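(* Let $d\ge 2$, $0<p,q\le\infty$ and $t\in\mathbb{R}$. Then the continuous embedding $$S^{t}_{p,q}B(\mathbb{R}^d)\hookrightarrow B^{t}_{p,q}(\mathbb{R}^d)$$ holds if and only if one of the following conditions is satisfied: (a) $t>0$; (b) $t=0$, $0<p<\infty$ and $0<q\le\min(p,2)$; (c) $t=0$, $p=\infty$ and $q\le 1$.
   Context: $\mathcal{S}'(\mathbb{R}^d)$ denotes the tempered distributions and $\mathcal{F}$, $\mathcal{F}^{-1}$ the Fourier transform and its inverse on $\mathcal{S}'(\mathbb{R}^d)$. Isotropic Besov spaces: let $\psi_0\in C_0^\infty(\mathbb{R}^d)$ with $\psi_0(x)=1$ if $\max_i|x_i|\le1$ and $\psi_0(x)=0$ if $\max_i|x_i|\ge 3/2$, and $\psi_j(x)=\psi_0(2^{-j}x)-\psi_0(2^{-j+1}x)$ for $j\in\mathbb{N}$. For $t\in\mathbb{R}$, $0<p,q\le\infty$, $B^t_{p,q}(\mathbb{R}^d)$ is the set of $f\in\mathcal{S}'(\mathbb{R}^d)$ with $\|f|B^t_{p,q}\|=\big(\sum_{j=0}^\infty 2^{jtq}\|\mathcal{F}^{-1}[\psi_j\mathcal{F}f]\|_{L_p(\mathbb{R}^d)}^q\big)^{1/q}<\infty$ (usual modification if $q=\infty$). Besov spaces of dominating mixed smoothness: let $\varphi_0\in C_0^\infty(\mathbb{R})$ with $\varphi_0=1$ on $[-1,1]$ and $\operatorname{supp}\varphi_0\subset[-3/2,3/2]$, $\varphi_j(s)=\varphi_0(2^{-j}s)-\varphi_0(2^{-j+1}s)$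 for $j\in\mathbb{N}$, and for $\bar k=(k_1,\dots,k_d)\in\mathbb{N}_0^d$ put $\varphi_{\bar k}(x)=\varphi_{k_1}(x_1)\cdots\varphi_{k_d}(x_d)$ and $|\bar k|=k_1+\dots+k_d$. Then $S^t_{p,q}B(\mathbb{R}^d)$ is the set of $f\in\mathcal{S}'(\mathbb{R}^d)$ with $\big(\sum_{\bar k\in\mathbb{N}_0^d}2^{|\bar k|tq}\|\mathcal{F}^{-1}[\varphi_{\bar k}\mathcal{F}f]\|_{L_p(\mathbb{R}^d)}^q\big)^{1/q}<\infty$ (usual modification if $q=\infty$). Both spaces are quasi-Banach spaces independent (up to equivalent quasi-norms) of the chosen generators. $X\hookrightarrow Y$ denotes a continuous embedding. *)

theory Defs
  imports "HOL-Analysis.Analysis"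
begin

text \<open>Iterated partial derivatives; a list of coordinate directions is a multi-index.\<close>
fun pderivs :: "'n::finite list \<Rightarrow> (real^'n \<Rightarrow> 'b::real_normed_vector) \<Rightarrow> (real^'n \<Rightarrow> 'b)" where
  "pderivs [] f = f"
| "pderivs (i # is) f = (\<lambda>x. frechet_derivative (pderivs is f) (at x) (axis i 1))"

definition smooth_fun :: "(real^'n::finite \<Rightarrow> 'b::real_normed_vector) \<Rightarrow> bool" where
  "smooth_fun f \<longleftrightarrow> (\<forall>is x. pderivs is f differentiable (at x))"

definition schwartz :: "(real^'n::finite \<Rightarrow> complex) set" where
  "schwartz = {\<phi>. smooth_fun \<phi> \<and>
     (\<forall>k::nat. \<forall>is. bdd_above (range (\<lambda>x. (1 + norm x) ^ k * norm (pderivs is \<phi> x))))}"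

definition schwartz_seminorm :: "nat \<Rightarrow> 'n::finite list \<Rightarrow> (real^'n \<Rightarrow> complex) \<Rightarrow> real" where
  "schwartz_seminorm k is \<phi> = (SUP x. (1 + norm x) ^ k * norm (pderivs is \<phi> x))"

text \<open>A tempered distribution is a linear functional on the Schwartz space, continuous
  w.r.t. the Schwartz seminorms (only its values on Schwartz functions matter).\<close>
definition tempered :: "((real^'n::finite \<Rightarrow> complex) \<Rightarrow> complex) \<Rightarrow> bool" where
  "tempered T \<longleftrightarrow>
     (\<forall>\<phi>\<in>schwartz. \<forall>\<psi>\<in>schwartz. T (\<lambda>x. \<phi> x + \<psi> x) = T \<phi> + T \<psi>) \<and>
     (\<forall>\<phi>\<in>schwartz. \<forall>c. T (\<lambda>x. c * \<phi> x) = c * T \<phi>) \<and>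
     (\<exists>C N. \<forall>\<phi>\<in>schwartz. norm (T \<phi>) \<le>
        C * (\<Sum>k\<le>N. \<Sum>is\<in>{is. length is \<le> N}. schwartz_seminorm k is \<phi>))"

definition FT :: "(real^'n::finite \<Rightarrow> complex) \<Rightarrow> (real^'n \<Rightarrow> complex)" where
  "FT \<phi> = (\<lambda>\<xi>. LINT x|lborel. cis (- (x \<bullet> \<xi>)) * \<phi> x)"

definition iFT :: "(real^'n::finite \<Rightarrow> complex) \<Rightarrow> (real^'n \<Rightarrow> complex)" where
  "iFT \<phi> = (\<lambda>x. complex_of_real (1 / (2 * pi) ^ CARD('n)) * (LINT \<xi>|lborel. cis (x \<bullet> \<xi>) * \<phi> \<xi>))"

text \<open>For a tempered distribution f and a multiplier m, the distribution
  F^{-1}[m F f] acts by  phi |-> f (F (m * F^{-1} phi)),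
  using  <F T, phi> = <T, F phi>,  <F^{-1} T, phi> = <T, F^{-1} phi>,  <m T, phi> = <T, m phi>.\<close>
definition fourier_mult :: "(real^'n::finite \<Rightarrow> real) \<Rightarrow> ((real^'n \<Rightarrow> complex) \<Rightarrow> complex)
     \<Rightarrow> ((real^'n \<Rightarrow> complex) \<Rightarrow> complex)" where
  "fourier_mult m f = (\<lambda>\<phi>. f (FT (\<lambda>\<xi>. complex_of_real (m \<xi>) * iFT \<phi> \<xi>)))"

definition epow :: "ennreal \<Rightarrow> real \<Rightarrow> ennreal" where
  "epow x r = (if x = \<infinity> then \<infinity> else ennreal (enn2real x powr r))"

definition Lp_qnorm :: "ennreal \<Rightarrow> (real^'n::finite \<Rightarrow> complex) \<Rightarrow> ennreal" where
  "Lp_qnorm p g = (if p = \<infinity> then Inf {C. AE x in lborel. ennreal (norm (g x)) \<le> C}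
     else epow (\<integral>\<^sup>+ x. ennreal (norm (g x) powr enn2real p) \<partial>lborel) (1 / enn2real p))"

definition represents :: "((real^'n::finite \<Rightarrow> complex) \<Rightarrow> complex) \<Rightarrow> (real^'n \<Rightarrow> complex) \<Rightarrow> bool" where
  "represents T g \<longleftrightarrow> g \<in> borel_measurable lborel \<and>
     (\<forall>\<phi>\<in>schwartz. integrable lborel (\<lambda>x. g x * \<phi> x) \<and> T \<phi> = (LINT x|lborel. g x * \<phi> x))"

text \<open>L_p quasi-norm of a distribution: the L_p quasi-norm of a representing function,
  and \<infinity> if the distribution is not a function.\<close>
definition dist_Lp :: "ennreal \<Rightarrow> ((real^'n::finite \<Rightarrow> complex) \<Rightarrow> complex) \<Rightarrow> ennreal" where
  "dist_Lp p T = (INF g\<in>{g. represents T g}. Lp_qnorm p g)"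

definition lq_qnorm :: "ennreal \<Rightarrow> ('i \<Rightarrow> ennreal) \<Rightarrow> ennreal" where
  "lq_qnorm q a = (if q = \<infinity> then (SUP k. a k)
     else epow (\<integral>\<^sup>+ k. epow (a k) (enn2real q) \<partial>count_space UNIV) (1 / enn2real q))"

definition iso_generator :: "(real^'n::finite \<Rightarrow> real) \<Rightarrow> bool" where
  "iso_generator \<psi>0 \<longleftrightarrow> smooth_fun \<psi>0 \<and>
     (\<forall>x. (\<forall>i. \<bar>x $ i\<bar> \<le> 1) \<longrightarrow> \<psi>0 x = 1) \<and>
     (\<forall>x. (\<exists>i. \<bar>x $ i\<bar> \<ge> 3/2) \<longrightarrow> \<psi>0 x = 0)"

definition iso_piece :: "(real^'n::finite \<Rightarrow> real) \<Rightarrow> nat \<Rightarrow> (real^'n \<Rightarrow> real)" where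
  "iso_piece \<psi>0 j = (if j = 0 then \<psi>0
     else (\<lambda>x. \<psi>0 ((1 / 2 ^ j) *\<^sub>R x) - \<psi>0 ((2 / 2 ^ j) *\<^sub>R x)))"

definition besov_qnorm :: "(real^'n::finite \<Rightarrow> real) \<Rightarrow> real \<Rightarrow> ennreal \<Rightarrow> ennreal
     \<Rightarrow> ((real^'n \<Rightarrow> complex) \<Rightarrow> complex) \<Rightarrow> ennreal" where
  "besov_qnorm \<psi>0 t p q f = lq_qnorm q
     (\<lambda>j::nat. ennreal (2 powr (real j * t)) * dist_Lp p (fourier_mult (iso_piece \<psi>0 j) f))"

definition besov_space :: "(real^'n::finite \<Rightarrow> real) \<Rightarrow> real \<Rightarrow> ennreal \<Rightarrow> ennreal
     \<Rightarrow> ((real^'n \<Rightarrow> complex) \<Rightarrow> complex) set" where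
  "besov_space \<psi>0 t p q = {f. tempered f \<and> besov_qnorm \<psi>0 t p q f < \<infinity>}"

definition mixed_generator :: "(real \<Rightarrow> real) \<Rightarrow> bool" where
  "mixed_generator \<phi>0 \<longleftrightarrow> (\<forall>k x. (deriv ^^ k) \<phi>0 differentiable (at x)) \<and>
     (\<forall>s. \<bar>s\<bar> \<le> 1 \<longrightarrow> \<phi>0 s = 1) \<and> (\<forall>s. \<bar>s\<bar> > 3/2 \<longrightarrow> \<phi>0 s = 0)"

definition mixed_piece1 :: "(real \<Rightarrow> real) \<Rightarrow> nat \<Rightarrow> (real \<Rightarrow> real)" where
  "mixed_piece1 \<phi>0 j = (if j = 0 then \<phi>0
     else (\<lambda>s. \<phi>0 (s / 2 ^ j) - \<phi>0 (2 * s / 2 ^ j)))"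

definition mixed_piece :: "(real \<Rightarrow> real) \<Rightarrow> ('n::finite \<Rightarrow> nat) \<Rightarrow> (real^'n \<Rightarrow> real)" where
  "mixed_piece \<phi>0 k = (\<lambda>x. \<Prod>i\<in>UNIV. mixed_piece1 \<phi>0 (k i) (x $ i))"

definition mixed_besov_qnorm :: "(real \<Rightarrow> real) \<Rightarrow> real \<Rightarrow> ennreal \<Rightarrow> ennreal
     \<Rightarrow> ((real^'n::finite \<Rightarrow> complex) \<Rightarrow> complex) \<Rightarrow> ennreal" where
  "mixed_besov_qnorm \<phi>0 t p q f = lq_qnorm q
     (\<lambda>k::'n \<Rightarrow> nat. ennreal (2 powr (real (\<Sum>i\<in>UNIV. k i) * t)) *
        dist_Lp p (fourier_mult (mixed_piece \<phi>0 k) f))"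

definition mixed_besov_space :: "(real \<Rightarrow> real) \<Rightarrow> real \<Rightarrow> ennreal \<Rightarrow> ennreal
     \<Rightarrow> ((real^'n::finite \<Rightarrow> complex) \<Rightarrow> complex) set" where
  "mixed_besov_space \<phi>0 t p q = {f. tempered f \<and> mixed_besov_qnorm \<phi>0 t p q f < \<infinity>}"

definition mixed_embeds :: "(real \<Rightarrow> real) \<Rightarrow> (real^'n::finite \<Rightarrow> real) \<Rightarrow> real \<Rightarrow> ennreal \<Rightarrow> ennreal \<Rightarrow> bool" where
  "mixed_embeds \<phi>0 \<psi>0 t p q \<longleftrightarrow>
     (mixed_besov_space \<phi>0 t p q :: ((real^'n \<Rightarrow> complex) \<Rightarrow> complex) set) \<subseteq> besov_space \<psi>0 t p q \<and>
     (\<exists>C::real. \<forall>f\<in>mixed_besov_space \<phi>0 t p q.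
        besov_qnorm \<psi>0 t p q f \<le> ennreal C * mixed_besov_qnorm \<phi>0 t p q f)"

end

theory Submission
  imports Defs "HOL-Probability.Probability"
begin

text \<open>
  Write \<open>g_k\<close> for the mixed pieces of \<open>f\<close>. The \<open>j\<close>-th isotropic piece of \<open>f\<close> is a finite sum of
  convolutions \<open>G_k\<close> of \<open>g_k\<close> with kernels adapted to the dyadic box of \<open>k\<close>, where \<open>max k\<close> is about \<open>j\<close>,
  and \<open>\<parallel>G_k\<parallel>_p \<le> C \<parallel>g_k\<parallel>_p\<close> uniformly (Young's inequality for \<open>p \<ge> 1\<close>, Nikolskii's inequality for
  \<open>p < 1\<close>). For \<open>t > 0\<close> the weights absorb the number of terms. For \<open>t = 0\<close> one needs
  \<open>\<parallel>\<Sum> G_k\<parallel>_p^r \<le> C \<Sum> \<parallel>G_k\<parallel>_p^r\<close>, with \<open>r = min p 2\<close> for \<open>p < \<infinity>\<close> and \<open>r = 1\<close> for \<open>p = \<infinity>\<close>. This is the triangle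
  inequality for \<open>p \<le> 1\<close> and \<open>p = \<infinity>\<close>. For \<open>1 < p < \<infinity>\<close> it is proved one coordinate at a time by telescoping
  \<open>|S_n|^p - |S_{n-1}|^p \<le> p Re (F(S_n) G_n)\<close> with \<open>F z = |z|^(p-2) cnj z\<close>: since \<open>G_n\<close> has no low frequencies,
  \<open>F(S_n)\<close> may be replaced by its oscillation at scale \<open>2^(-n)\<close>, which decays geometrically in the
  contributions of \<open>G_k\<close>, \<open>k < n\<close>.

  Conversely, the embedding is tested on sums of wave packets, each lying in a single mixed piece and
  all lying in the same isotropic piece. A single packet with \<open>k = (J,...,J)\<close> excludes \<open>t < 0\<close>. For \<open>t = 0\<close>
  the \<open>L_p\<close> norm of a sum of \<open>N\<close> packets is at most \<open>C N^(1/q)\<close>; far translates give \<open>N^(1/p)\<close>, random signs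
  give \<open>N^(1/2)\<close> for \<open>p \<ge> 2\<close>, and aligned phases give \<open>N\<close> for \<open>p = \<infinity>\<close>.
\<close>

section \<open>Fourier inversion\<close>

text \<open>Only upper bounds for sums of pieces are needed, not a two-sided square-function
  theorem; this is why convexity can replace singular integrals. The exponent is dictated by the
  smoothness of \<open>Fp p\<close>: for p <= 2 it is Hoelder of order p - 1 and the p-th powers
  obey a linear recursion; for p > 2 it is Lipschitz only with a weight of degree p - 2, and the
  recursion becomes linear in squares after comparison with the largest partial sum. As both sides
  carry the same exponent r, the one-coordinate estimates compose.

  For p < 1 a convolution bound fails for general functions. What saves it is that both factors of
  the integrand have spectrum in a box of volume comparable to \<open>vol k\<close>: the power of
  \<open>vol k\<close> lost by Nikolskii is regained from the kernel.

  L_p norms of distributions are infima over representing functions and become computable only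
  through uniqueness of these functions. That uniqueness rests on Fourier inversion, which is
  therefore proved for all integrable functions with integrable transform.\<close>

lemma norm_integral_le:
  fixes f :: "'a \<Rightarrow> 'b::{banach,second_countable_topology}"
  assumes g: "integrable M g" and le: "\<And>x. norm (f x) \<le> g x"
  shows "norm (integral\<^sup>L M f) \<le> integral\<^sup>L M g"
proof (cases "integrable M f")
  case True
  have "norm (integral\<^sup>L M f) \<le> (LINT x|M. norm (f x))" by (rule integral_norm_bound)
  also have "\<dots> \<le> integral\<^sup>L M g" using True g le by (intro integral_mono) auto
  finally show ?thesis .
next
  \<comment> \<open>\<open>f\<close> is not assumed measurable: a non-integrable \<open>f\<close>
    has integral 0 by convention, and the bound survives because \<open>g\<close> is
    nonnegative.\<close>
  case False
  have "0 \<le> integral\<^sup>L M g" using order_trans[OF norm_ge_zero le] by (intro integral_nonneg_AE) auto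
  then show ?thesis using False by (simp add: not_integrable_integral_eq)
qed

text \<open>Lebesgue measure is the image of a product measure under the coordinate map, so a
  separated integrand falls under Fubini for finite products.\<close>

lemma integral_lborel_prod:
  fixes f :: "'a::euclidean_space \<Rightarrow> real \<Rightarrow> 'b::{real_normed_field,banach,second_countable_topology}"
  assumes "\<And>b. b \<in> Basis \<Longrightarrow> integrable lborel (f b)"
  shows "integrable lborel (\<lambda>x::'a. \<Prod>b\<in>Basis. f b (x \<bullet> b))"
    and "(LINT x|lborel. (\<Prod>b\<in>Basis. f b (x \<bullet> b))) = (\<Prod>b\<in>Basis. LINT s|lborel. f b s)"
proof -
  interpret product_sigma_finite "\<lambda>_::'a. lborel :: real measure" ..
  let ?P = "\<Pi>\<^sub>M b\<in>Basis. (lborel::real measure)"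
  let ?T = "\<lambda>g::'a\<Rightarrow>real. \<Sum>b\<in>Basis. g b *\<^sub>R b"
  have [measurable]: "f b \<in> borel_measurable borel" if "b \<in> Basis" for b
    using assms[OF that] by (simp add: borel_measurable_integrable)
  have T: "?T \<in> measurable ?P borel" by measurable
  have m: "(\<lambda>x::'a. \<Prod>b\<in>Basis. f b (x \<bullet> b)) \<in> borel_measurable borel" by measurable
  have eq: "(\<Prod>b\<in>Basis. f b (?T g \<bullet> b)) = (\<Prod>b\<in>Basis. f b (g b))" for g
    by (intro prod.cong refl) (simp add: inner_sum_left inner_Basis if_distrib cong: if_cong)
  show "integrable lborel (\<lambda>x::'a. \<Prod>b\<in>Basis. f b (x \<bullet> b))"
    by (subst lborel_eq, subst integrable_distr_eq[OF T m])
       (simp add: eq, intro product_integrable_prod assms, auto)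
  show "(LINT x|lborel. (\<Prod>b\<in>Basis. f b (x \<bullet> b))) = (\<Prod>b\<in>Basis. LINT s|lborel. f b s)"
    by (subst lborel_eq, subst integral_distr[OF T m])
       (simp add: eq, intro product_integral_prod assms, auto)
qed

text \<open>This is the characteristic function of the standard normal law at \<open>t / e\<close>,
  rescaled by the substitution x -> e x.\<close>

lemma gauss_fourier_real:
  fixes t e :: real
  assumes "e > 0"
  shows "integrable lborel (\<lambda>x. cis (t * x) * of_real (exp (- (e\<^sup>2 * x\<^sup>2) / 2)))"
    and "(LINT x|lborel. cis (t * x) * of_real (exp (- (e\<^sup>2 * x\<^sup>2) / 2))) =
      complex_of_real (sqrt (2*pi) / e * exp (- t\<^sup>2 / (2 * e\<^sup>2)))"
proof -
  have 1: "(LINT x|lborel. std_normal_density x *\<^sub>R iexp (t/e * x)) = complex_of_real (exp (- ((t/e)^2) / 2))"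
  proof -
    have "(LINT x|lborel. std_normal_density x *\<^sub>R iexp (t/e * x)) = char std_normal_distribution (t/e)"
      unfolding char_def by (subst integral_density) auto
    then show ?thesis by (simp add: char_std_normal_distribution)
  qed
  have i: "integrable lborel (\<lambda>x. std_normal_density x *\<^sub>R iexp (t/e * x))"
  proof (rule Bochner_Integration.integrable_bound)
    show "integrable lborel std_normal_density" by simp
  qed auto
  have eq: "std_normal_density (e * x) *\<^sub>R iexp (t/e * (e * x)) =
     complex_of_real (1 / sqrt (2*pi)) * (cis (t * x) * of_real (exp (- (e\<^sup>2 * x\<^sup>2) / 2)))" for x
    using assms by (simp add: std_normal_density_def cis_conv_exp power_mult_distrib scaleR_conv_of_real mult_ac)
  have i2: "integrable lborel (\<lambda>x. std_normal_density (0 + e * x) *\<^sub>R iexp (t/e * (0 + e * x)))"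
    by (rule lborel_integrable_real_affine[OF i]) (use assms in auto)
  show "integrable lborel (\<lambda>x. cis (t * x) * of_real (exp (- (e\<^sup>2 * x\<^sup>2) / 2)))"
    using Bochner_Integration.integrable_mult_right[OF i2, of "complex_of_real (sqrt (2*pi))"]
    unfolding add_0 eq by simp
  have "(LINT x|lborel. std_normal_density x *\<^sub>R iexp (t/e * x)) =
     \<bar>e\<bar> *\<^sub>R (LINT x|lborel. std_normal_density (0 + e * x) *\<^sub>R iexp (t/e * (0 + e * x)))"
    by (rule lborel_integral_real_affine) (use assms in auto)
  then have "complex_of_real (exp (- ((t/e)^2) / 2)) = e *\<^sub>R (complex_of_real (1 / sqrt (2*pi)) * (LINT x|lborel. cis (t * x) * of_real (exp (- (e\<^sup>2 * x\<^sup>2) / 2))))"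
    unfolding add_0 eq 1 using assms by simp
  moreover have "exp (- ((t/e)^2) / 2) = exp (- t\<^sup>2 / (2 * e\<^sup>2))"
    by (simp add: power_divide)
  ultimately show "(LINT x|lborel. cis (t * x) * of_real (exp (- (e\<^sup>2 * x\<^sup>2) / 2))) =
      complex_of_real (sqrt (2*pi) / e * exp (- t\<^sup>2 / (2 * e\<^sup>2)))"
    using assms by (simp add: scaleR_conv_of_real field_simps)
qed

lemma norm_sq_Basis: "(norm (x::'a::euclidean_space))\<^sup>2 = (\<Sum>b\<in>Basis. (x \<bullet> b)\<^sup>2)"
  by (simp add: norm_eq_sqrt_inner euclidean_inner[of x x] power2_eq_square sum_nonneg)

lemma gauss_fourier:
  fixes z :: "'a::euclidean_space" and e :: real
  assumes "e > 0"
  shows "integrable lborel (\<lambda>x::'a. cis (z \<bullet> x) * of_real (exp (- (e\<^sup>2 * (norm x)\<^sup>2) / 2)))"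
    and "(LINT x|lborel. cis (z \<bullet> x) * of_real (exp (- (e\<^sup>2 * (norm x)\<^sup>2) / 2))) =
      complex_of_real ((sqrt (2*pi) / e) ^ DIM('a) * exp (- (norm z)\<^sup>2 / (2 * e\<^sup>2)))"
proof -
  have cis_sum: "cis (\<Sum>b\<in>A. g b) = (\<Prod>b\<in>A. cis (g b))" if "finite A" for g :: "'a \<Rightarrow> real" and A
    using that by (induction rule: finite_induct) (auto simp: cis_mult[symmetric])
  have eq: "cis (z \<bullet> x) * of_real (exp (- (e\<^sup>2 * (norm x)\<^sup>2) / 2)) =
    (\<Prod>b\<in>Basis. cis ((z \<bullet> b) * (x \<bullet> b)) * of_real (exp (- (e\<^sup>2 * (x \<bullet> b)\<^sup>2) / 2)))" for x :: 'a
  proof -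
    have "exp (- (e\<^sup>2 * (norm x)\<^sup>2) / 2) = (\<Prod>b\<in>Basis. exp (- (e\<^sup>2 * (x \<bullet> b)\<^sup>2) / 2))"
      by (subst exp_sum[symmetric]) (simp_all add: norm_sq_Basis sum_distrib_left sum_negf sum_divide_distrib)
    then show ?thesis
      by (simp add: euclidean_inner[of z x] cis_sum prod.distrib)
  qed
  have "(\<Prod>b\<in>Basis. exp (- (z \<bullet> b)\<^sup>2 / (2 * e\<^sup>2))) = exp (- (norm z)\<^sup>2 / (2 * e\<^sup>2))"
    by (subst exp_sum[symmetric]) (simp_all add: norm_sq_Basis sum_negf sum_divide_distrib)
  then have eq2: "complex_of_real ((sqrt (2*pi) / e) ^ DIM('a) * exp (- (norm z)\<^sup>2 / (2 * e\<^sup>2)))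
    = (\<Prod>b\<in>(Basis::'a set). complex_of_real (sqrt (2*pi) / e * exp (- (z \<bullet> b)\<^sup>2 / (2 * e\<^sup>2))))"
    by (simp only: prod.distrib of_real_mult of_real_prod[symmetric] of_real_power prod_constant)
  show "integrable lborel (\<lambda>x::'a. cis (z \<bullet> x) * of_real (exp (- (e\<^sup>2 * (norm x)\<^sup>2) / 2)))"
    unfolding eq by (rule integral_lborel_prod(1)) (rule gauss_fourier_real(1)[OF assms])
  show "(LINT x|lborel. cis (z \<bullet> x) * of_real (exp (- (e\<^sup>2 * (norm x)\<^sup>2) / 2))) =
      complex_of_real ((sqrt (2*pi) / e) ^ DIM('a) * exp (- (norm z)\<^sup>2 / (2 * e\<^sup>2)))"
    unfolding eq eq2
    by (subst integral_lborel_prod(2)[OF gauss_fourier_real(1)[OF assms]])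
       (simp only: gauss_fourier_real(2)[OF assms])
qed

lemma gauss_integral:
  fixes e :: real
  assumes "e > 0"
  shows "integrable lborel (\<lambda>x::'a::euclidean_space. exp (- (e\<^sup>2 * (norm x)\<^sup>2) / 2))"
    and "(LINT x::'a|lborel. exp (- (e\<^sup>2 * (norm x)\<^sup>2) / 2)) = (sqrt (2*pi) / e) ^ DIM('a)"
proof -
  have i: "integrable lborel (\<lambda>x::'a. complex_of_real (exp (- (e\<^sup>2 * (norm x)\<^sup>2) / 2)))"
    using gauss_fourier(1)[OF assms, of "0::'a"] by simp
  show "integrable lborel (\<lambda>x::'a. exp (- (e\<^sup>2 * (norm x)\<^sup>2) / 2))"
    using i by (simp only: complex_of_real_integrable_eq)
  have "complex_of_real (LINT x::'a|lborel. exp (- (e\<^sup>2 * (norm x)\<^sup>2) / 2)) = complex_of_real ((sqrt (2*pi) / e) ^ DIM('a))"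
    using gauss_fourier(2)[OF assms, of "0::'a"] unfolding integral_complex_of_real[symmetric] by simp
  then show "(LINT x::'a|lborel. exp (- (e\<^sup>2 * (norm x)\<^sup>2) / 2)) = (sqrt (2*pi) / e) ^ DIM('a)"
    using of_real_eq_iff by blast
qed

text \<open>The sets over which \<open>w\<close> integrates to 0 form a Dynkin system, and the
  closed sets are an intersection-stable generator of the Borel sets.\<close>

lemma AE_zero_if_closed_integrals_zero:
  fixes w :: "'a::euclidean_space \<Rightarrow> complex"
  assumes w: "integrable lborel w"
    and 0: "\<And>A. closed A \<Longrightarrow> (LINT x:A|lborel. w x) = 0"
  shows "AE x in lborel. w x = 0"
proof (rule sigma_finite_measure.density_zero[OF sigma_finite_lborel w])
  fix A :: "'a set" assume A: "A \<in> sets lborel"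
  have si: "set_integrable lborel B w" if "B \<in> sets borel" for B
    unfolding set_integrable_def using that w by (intro integrable_mult_indicator) auto
  have "Int_stable (Collect closed :: 'a set set)" by (auto simp: Int_stable_def)
  moreover have "Collect closed \<subseteq> Pow (UNIV :: 'a set)" by simp
  moreover have "A \<in> sigma_sets UNIV (Collect closed)"
    using A unfolding sets_lborel borel_eq_closed by (subst (asm) sets_measure_of) auto
  ultimately show "(LINT x:A|lborel. w x) = 0"
  proof (induction rule: sigma_sets_induct_disjoint[where \<Omega>=UNIV])
    case (basic A) then show ?case using 0 by auto
  next
    case empty show ?case by (simp add: set_lebesgue_integral_def)
  next
    case (compl A)
    have A: "A \<in> sets borel" using compl(1) unfolding borel_eq_closed by (subst sets_measure_of) auto
    have "(LINT x:UNIV|lborel. w x) = (LINT x:A|lborel. w x) + (LINT x:(UNIV-A)|lborel. w x)"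
      using A si by (subst set_integral_Un[symmetric]) auto
    with compl 0[of UNIV] show ?case by simp
  next
    case (union A)
    have A: "A i \<in> sets borel" for i using union(2) unfolding borel_eq_closed by (subst sets_measure_of) auto
    have "(LINT x:(\<Union>i. A i)|lborel. w x) = (\<Sum>i. (LINT x:A i|lborel. w x))"
      using A union(1) by (intro lebesgue_integral_countable_add si) (auto simp: disjoint_family_on_def)
    then show ?case using union by simp
  qed
qed

lemma integrable_cis_mult:
  fixes f :: "'a::euclidean_space \<Rightarrow> complex"
  assumes "integrable lborel f"
  shows "integrable lborel (\<lambda>x. cis (x \<bullet> \<xi>) * f x)" "integrable lborel (\<lambda>x. cis (\<xi> \<bullet> x) * f x)"
     "integrable lborel (\<lambda>x. cis (- (x \<bullet> \<xi>)) * f x)" "integrable lborel (\<lambda>x. cis (- (\<xi> \<bullet> x)) * f x)"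
  by (rule Bochner_Integration.integrable_bound[OF assms];
      use borel_measurable_integrable[OF assms] in \<open>auto simp: norm_mult cis_conv_exp intro!: borel_measurable_times\<close>)+

lemma cis_borel [measurable (raw)]:
  "f \<in> borel_measurable M \<Longrightarrow> (\<lambda>x. cis (f x)) \<in> borel_measurable M"
  unfolding cis_conv_exp by measurable

lemma integrable_pair_prod:
  fixes f :: "'a::euclidean_space \<Rightarrow> complex" and g :: "'b::euclidean_space \<Rightarrow> complex"
  assumes f: "integrable lborel f" and g: "integrable lborel g"
    and h: "h \<in> borel_measurable (lborel \<Otimes>\<^sub>M lborel)"
    and le: "\<And>x y. norm (h (x, y)) \<le> norm (f x) * norm (g y)"
  shows "integrable (lborel \<Otimes>\<^sub>M lborel) (h :: _ \<Rightarrow> complex)"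
proof -
  have [measurable]: "f \<in> borel_measurable lborel" "g \<in> borel_measurable lborel"
    using f g by (auto intro: borel_measurable_integrable)
  have "integrable (lborel \<Otimes>\<^sub>M lborel) (\<lambda>(x, y). f x * g y)"
    using f g
    by (intro lborel_pair.Fubini_integrable)
       (auto simp: norm_mult intro!: AE_I2 Bochner_Integration.integrable_mult_left Bochner_Integration.integrable_mult_right)
  then show ?thesis
    by (rule Bochner_Integration.integrable_bound) (use h le in \<open>auto simp: norm_mult\<close>)
qed

text \<open>Damping \<open>F\<close> by a Gaussian makes Fubini available and turns the inverse
  transform into a convolution of \<open>f\<close> with an approximate identity. Since
  \<open>f\<close> is merely integrable, its pointwise limit would require differentiation theorems;
  pairing with a continuous bounded \<open>v\<close> moves the approximate identity onto
  \<open>v\<close>, where pointwise convergence and domination are immediate.\<close>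

lemma fourier_inversion_tested:
  fixes f :: "'a::euclidean_space \<Rightarrow> complex" and v :: "'a \<Rightarrow> complex"
  defines "F \<equiv> \<lambda>\<xi>. LINT x|lborel. cis (- (x \<bullet> \<xi>)) * f x"
  assumes f: "integrable lborel f" and F: "integrable lborel F"
    and v: "integrable lborel v" and vc: "continuous_on UNIV v" and vb: "\<And>x. norm (v x) \<le> 1"
  shows "(2*pi)^DIM('a) * (LINT x|lborel. f x * v x) = (LINT x|lborel. v x * (LINT \<xi>|lborel. cis (x \<bullet> \<xi>) * F \<xi>))"
proof -
  let ?e = "\<lambda>m. inverse (real (Suc m))"
  let ?g = "\<lambda>m (\<xi>::'a). complex_of_real (exp (- ((?e m)\<^sup>2 * (norm \<xi>)\<^sup>2) / 2))"
  let ?c = "\<lambda>m. (sqrt (2*pi) / ?e m) ^ DIM('a)"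
  let ?E = "\<lambda>m (z::'a). complex_of_real (?c m * exp (- (norm z)\<^sup>2 / (2 * (?e m)\<^sup>2)))"
  have e0: "?e m > 0" for m by simp
  have [measurable]: "f \<in> borel_measurable borel" "v \<in> borel_measurable borel" "F \<in> borel_measurable borel"
    using f v F by (auto dest: borel_measurable_integrable)
  have gi: "integrable lborel (?g m)" for m
    using gauss_integral(1)[OF e0, of m, where 'a='a] by (simp only: complex_of_real_integrable_eq)
  have g1: "norm (?g m \<xi>) \<le> 1" for m \<xi> by simp
  have A: "(LINT \<xi>|lborel. cis (x \<bullet> \<xi>) * (F \<xi> * ?g m \<xi>)) = (LINT y|lborel. f y * ?E m (x - y))" for m x
  proof -
    have cxy: "cis ((x - y) \<bullet> \<xi>) = cis (x \<bullet> \<xi>) * cis (- (y \<bullet> \<xi>))" for y \<xi>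
      by (simp add: cis_mult inner_diff_left)
    have "(LINT \<xi>|lborel. cis (x \<bullet> \<xi>) * (F \<xi> * ?g m \<xi>)) =
      (LINT \<xi>|lborel. (LINT y|lborel. cis ((x - y) \<bullet> \<xi>) * ?g m \<xi> * f y))"
      unfolding F_def
      by (intro Bochner_Integration.integral_cong refl)
         (simp only: cxy, simp add: mult_ac flip: integral_mult_right_zero integral_mult_left_zero)
    also have "\<dots> = (LINT y|lborel. (LINT \<xi>|lborel. cis ((x - y) \<bullet> \<xi>) * ?g m \<xi> * f y))"
      by (rule lborel_pair.Fubini_integral)
         (auto intro!: integrable_pair_prod[OF f gi[of m]] simp: case_prod_beta norm_mult)
    also have "\<dots> = (LINT y|lborel. f y * ?E m (x - y))"
      by (intro Bochner_Integration.integral_cong refl)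
        (simp only: integral_mult_left_zero gauss_fourier(2)[OF e0], simp add: mult_ac)
    finally show ?thesis .
  qed
  \<comment> \<open>The substitution x = y + z / (m + 1) freezes the Gaussian, so that
    \<open>m\<close> survives only in the argument of \<open>v\<close>.\<close>
  have Esub: "(LINT x|lborel. v x * ?E m (x - y)) =
     (LINT z|lborel. v (y + ?e m *\<^sub>R z) * complex_of_real (sqrt (2*pi) ^ DIM('a) * exp (- (norm z)\<^sup>2 / 2)))" (is "?L = ?R") for m y
  proof -
    have "?L = (LINT x|density (distr lborel borel (\<lambda>x. y + ?e m *\<^sub>R x)) (\<lambda>_. ennreal (?e m ^ DIM('a))). v x * ?E m (x - y))"
      by (subst lborel_affine[of "?e m" y]) auto
    also have "\<dots> = (LINT x|lborel. (?e m ^ DIM('a)) *\<^sub>R (v (y + ?e m *\<^sub>R x) * ?E m (?e m *\<^sub>R x)))"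
      by (subst integral_density) (auto simp: integral_distr)
    also have "\<dots> = ?R"
      using of_nat_neq_0[of m, where 'a=complex]
      by (intro Bochner_Integration.integral_cong refl)
         (simp add: power_mult_distrib power_divide scaleR_conv_of_real mult_ac)
    finally show ?thesis .
  qed
  have step: "(LINT x|lborel. v x * (LINT \<xi>|lborel. cis (x \<bullet> \<xi>) * (F \<xi> * ?g m \<xi>))) =
     (LINT y|lborel. f y * (LINT z|lborel. v (y + ?e m *\<^sub>R z) * complex_of_real (sqrt (2*pi) ^ DIM('a) * exp (- (norm z)\<^sup>2 / 2))))" for m
  proof -
    have "(LINT x|lborel. v x * (LINT \<xi>|lborel. cis (x \<bullet> \<xi>) * (F \<xi> * ?g m \<xi>))) =
      (LINT x|lborel. (LINT y|lborel. v x * (f y * ?E m (x - y))))"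
      unfolding A by simp
    also have "\<dots> = (LINT y|lborel. (LINT x|lborel. v x * (f y * ?E m (x - y))))"
    proof (rule lborel_pair.Fubini_integral)
      have fc: "integrable lborel (\<lambda>x. complex_of_real (?c m) * f x)" using f by simp
      show "integrable (lborel \<Otimes>\<^sub>M lborel) (\<lambda>(y, x). v x * (f y * ?E m (x - y)))"
      proof (rule integrable_pair_prod[OF fc v])
        fix y x
        have c0: "?c m \<ge> 0" by simp
        have "norm (?E m (x - y)) = ?c m * exp (- (norm (x - y))\<^sup>2 / (2 * (?e m)\<^sup>2))"
          unfolding norm_of_real using c0 by (intro abs_of_nonneg mult_nonneg_nonneg) auto
        also have "\<dots> \<le> ?c m" using c0 by (rule mult_left_le[rotated]) simp
        also have "\<dots> = norm (complex_of_real (?c m))" unfolding norm_of_real using c0 by (rule abs_of_nonneg[symmetric])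
        finally have "norm (v x) * (norm (f y) * norm (?E m (x - y))) \<le> norm (v x) * (norm (f y) * norm (complex_of_real (?c m)))"
          by (intro mult_left_mono) auto
        then show "norm (case (y, x) of (y, x) \<Rightarrow> v x * (f y * ?E m (x - y))) \<le> norm (complex_of_real (?c m) * f y) * norm (v x)"
          unfolding case_prod_conv norm_mult[of "v x"] norm_mult[of "f y"] norm_mult[of "complex_of_real (?c m)"]
          by (simp only: mult_ac)
      qed measurable
    qed
    also have "\<dots> = (LINT y|lborel. f y * (LINT x|lborel. v x * ?E m (x - y)))"
      by (simp only: mult.left_commute[of _ "f _"] integral_mult_right_zero)
    finally show ?thesis unfolding Esub .
  qed
  have lim1: "(\<lambda>m. LINT \<xi>|lborel. cis (x \<bullet> \<xi>) * (F \<xi> * ?g m \<xi>)) \<longlonglongrightarrow> (LINT \<xi>|lborel. cis (x \<bullet> \<xi>) * F \<xi>)" for x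
  proof (rule integral_dominated_convergence[where w="\<lambda>\<xi>. norm (F \<xi>)"])
    show "integrable lborel (\<lambda>\<xi>. norm (F \<xi>))" using F by simp
    show "AE \<xi> in lborel. (\<lambda>m. cis (x \<bullet> \<xi>) * (F \<xi> * ?g m \<xi>)) \<longlonglongrightarrow> cis (x \<bullet> \<xi>) * F \<xi>"
    proof (rule AE_I2)
      fix \<xi> :: 'a
      have "(\<lambda>m. - ((?e m)\<^sup>2 * (norm \<xi>)\<^sup>2) / 2) \<longlonglongrightarrow> - (0\<^sup>2 * (norm \<xi>)\<^sup>2) / 2"
        by (intro tendsto_intros LIMSEQ_inverse_real_of_nat) auto
      then have "(\<lambda>m. ?g m \<xi>) \<longlonglongrightarrow> complex_of_real (exp (- (0\<^sup>2 * (norm \<xi>)\<^sup>2) / 2))"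
        by (intro tendsto_of_real tendsto_exp)
      then have "(\<lambda>m. cis (x \<bullet> \<xi>) * (F \<xi> * ?g m \<xi>)) \<longlonglongrightarrow> cis (x \<bullet> \<xi>) * (F \<xi> * 1)"
        by (intro tendsto_mult tendsto_const) simp
      then show "(\<lambda>m. cis (x \<bullet> \<xi>) * (F \<xi> * ?g m \<xi>)) \<longlonglongrightarrow> cis (x \<bullet> \<xi>) * F \<xi>" by simp
    qed
    show "AE \<xi> in lborel. norm (cis (x \<bullet> \<xi>) * (F \<xi> * ?g m \<xi>)) \<le> norm (F \<xi>)" for m
      using g1 by (auto simp: norm_mult mult_left_le)
  qed measurable
  have "(\<lambda>m. LINT x|lborel. v x * (LINT \<xi>|lborel. cis (x \<bullet> \<xi>) * (F \<xi> * ?g m \<xi>))) \<longlonglongrightarrow>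
     (LINT x|lborel. v x * (LINT \<xi>|lborel. cis (x \<bullet> \<xi>) * F \<xi>))"
  proof (rule integral_dominated_convergence[where w="\<lambda>x. norm (v x) * (LINT \<xi>|lborel. norm (F \<xi>))"])
    show "integrable lborel (\<lambda>x. norm (v x) * (LINT \<xi>|lborel. norm (F \<xi>)))" using v by simp
    show "AE x in lborel. (\<lambda>m. v x * (LINT \<xi>|lborel. cis (x \<bullet> \<xi>) * (F \<xi> * ?g m \<xi>))) \<longlonglongrightarrow>
      v x * (LINT \<xi>|lborel. cis (x \<bullet> \<xi>) * F \<xi>)"
      using lim1 by (intro AE_I2 tendsto_mult tendsto_const)
    have "norm (LINT \<xi>|lborel. cis (x \<bullet> \<xi>) * (F \<xi> * ?g m \<xi>)) \<le> (LINT \<xi>|lborel. norm (F \<xi>))" for m x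
      using F g1 by (intro norm_integral_le) (auto simp: norm_mult mult_left_le)
    then show "AE x in lborel. norm (v x * (LINT \<xi>|lborel. cis (x \<bullet> \<xi>) * (F \<xi> * ?g m \<xi>))) \<le> norm (v x) * (LINT \<xi>|lborel. norm (F \<xi>))" for m
      by (auto simp: norm_mult intro!: AE_I2 mult_left_mono)
  qed measurable
  moreover have "(\<lambda>m. LINT y|lborel. f y * (LINT z|lborel. v (y + ?e m *\<^sub>R z) * complex_of_real (sqrt (2*pi) ^ DIM('a) * exp (- (norm z)\<^sup>2 / 2))))
    \<longlonglongrightarrow> (LINT y|lborel. f y * (v y * (2*pi)^DIM('a)))"
  proof -
    let ?G = "\<lambda>z::'a. complex_of_real (sqrt (2*pi) ^ DIM('a) * exp (- (norm z)\<^sup>2 / 2))"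
    have Gi: "integrable lborel (\<lambda>z. sqrt (2*pi) ^ DIM('a) * exp (- (norm (z::'a))\<^sup>2 / 2))"
      using gauss_integral(1)[of 1, where 'a='a] by (intro Bochner_Integration.integrable_mult_right) simp
    have Gc: "integrable lborel ?G" using Gi by (simp only: complex_of_real_integrable_eq)
    have Gint: "(LINT z|lborel. ?G z) = (2*pi)^DIM('a)"
    proof -
      have "(LINT z|lborel. ?G z) = complex_of_real (sqrt (2*pi) ^ DIM('a) * (LINT z::'a|lborel. exp (- (norm z)\<^sup>2 / 2)))"
        unfolding integral_complex_of_real integral_mult_right_zero ..
      also have "(LINT z::'a|lborel. exp (- (norm z)\<^sup>2 / 2)) = sqrt (2*pi) ^ DIM('a)"
        using gauss_integral(2)[of 1, where 'a='a] by simp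
      also have "sqrt (2*pi) ^ DIM('a) * sqrt (2*pi) ^ DIM('a) = (2*pi)^DIM('a)"
        by (subst power_mult_distrib[symmetric]) simp
      finally show ?thesis .
    qed
    have nG: "norm (?G z) = sqrt (2*pi) ^ DIM('a) * exp (- (norm z)\<^sup>2 / 2)" for z
      by (simp add: norm_mult norm_power)
    have l: "(\<lambda>m. LINT z|lborel. v (y + ?e m *\<^sub>R z) * ?G z) \<longlonglongrightarrow> v y * (2*pi)^DIM('a)" for y
    proof -
      have "(\<lambda>m. LINT z|lborel. v (y + ?e m *\<^sub>R z) * ?G z) \<longlonglongrightarrow> (LINT z|lborel. v y * ?G z)"
      proof (rule integral_dominated_convergence[where w="\<lambda>z. norm (?G z)"])
        show "integrable lborel (\<lambda>z. norm (?G z))" using Gc by (rule integrable_norm)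
        show "AE z in lborel. (\<lambda>m. v (y + ?e m *\<^sub>R z) * ?G z) \<longlonglongrightarrow> v y * ?G z"
        proof (rule AE_I2)
          fix z :: 'a
          have "(\<lambda>m. y + ?e m *\<^sub>R z) \<longlonglongrightarrow> y + 0 *\<^sub>R z"
            by (intro tendsto_intros LIMSEQ_inverse_real_of_nat)
          then have "(\<lambda>m. v (y + ?e m *\<^sub>R z)) \<longlonglongrightarrow> v y"
            using vc by (intro continuous_on_tendsto_compose[OF vc]) auto
          then show "(\<lambda>m. v (y + ?e m *\<^sub>R z) * ?G z) \<longlonglongrightarrow> v y * ?G z"
            by (intro tendsto_mult tendsto_const)
        qed
        show "AE z in lborel. norm (v (y + ?e m *\<^sub>R z) * ?G z) \<le> norm (?G z)" for m
          unfolding norm_mult[of "v _"] using vb by (intro AE_I2 mult_left_le_one_le) auto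
      qed measurable
      then show ?thesis using Gint by simp
    qed
    show ?thesis
    proof (rule integral_dominated_convergence[where w="\<lambda>y. norm (f y) * (LINT z|lborel. norm (?G z))"])
      show "integrable lborel (\<lambda>y. norm (f y) * (LINT z|lborel. norm (?G z)))" using f by simp
      show "AE y in lborel. (\<lambda>m. f y * (LINT z|lborel. v (y + ?e m *\<^sub>R z) * ?G z)) \<longlonglongrightarrow> f y * (v y * (2*pi)^DIM('a))"
        by (intro AE_I2 tendsto_mult tendsto_const l)
      have "norm (LINT z|lborel. v (y + ?e m *\<^sub>R z) * ?G z) \<le> (LINT z|lborel. norm (?G z))" for m y
      proof (rule norm_integral_le)
        show "integrable lborel (\<lambda>z. norm (?G z))" using Gc by (rule integrable_norm)
      qed (use vb in \<open>unfold norm_mult[of "v _"], intro mult_left_le_one_le, auto\<close>)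
      then show "AE y in lborel. norm (f y * (LINT z|lborel. v (y + ?e m *\<^sub>R z) * ?G z)) \<le> norm (f y) * (LINT z|lborel. norm (?G z))" for m
        unfolding norm_mult[of "f _"] by (intro AE_I2 mult_left_mono) auto
    qed measurable
  qed
  ultimately have "(LINT x|lborel. v x * (LINT \<xi>|lborel. cis (x \<bullet> \<xi>) * F \<xi>)) = (LINT y|lborel. f y * (v y * (2*pi)^DIM('a)))"
    unfolding step by (rule LIMSEQ_unique)
  also have "\<dots> = (2*pi)^DIM('a) * (LINT x|lborel. f x * v x)"
    unfolding mult.assoc[symmetric] integral_mult_left_zero by (simp add: mult.commute)
  finally show ?thesis by simp
qed

text \<open>The difference \<open>?w\<close> of the two sides is only known to be locally
  integrable, because \<open>?H\<close> is bounded but perhaps not integrable. Hence its integrals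
  are first shown to vanish over compact sets, and vanishing almost everywhere is deduced on each
  ball separately.\<close>

theorem fourier_inversion_AE:
  fixes f :: "'a::euclidean_space \<Rightarrow> complex"
  defines "F \<equiv> \<lambda>\<xi>. LINT x|lborel. cis (- (x \<bullet> \<xi>)) * f x"
  assumes f: "integrable lborel f" and F: "integrable lborel F"
  shows "AE x in lborel. (2*pi)^DIM('a) * f x = (LINT \<xi>|lborel. cis (x \<bullet> \<xi>) * F \<xi>)"
proof -
  let ?H = "\<lambda>x. (LINT \<xi>|lborel. cis (x \<bullet> \<xi>) * F \<xi>)"
  let ?w = "\<lambda>x. (2*pi)^DIM('a) * f x - ?H x"
  have [measurable]: "f \<in> borel_measurable borel" "F \<in> borel_measurable borel"
    using f F by (auto dest: borel_measurable_integrable)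
  have [measurable]: "?H \<in> borel_measurable borel" by measurable
  have Hb: "norm (?H x) \<le> (LINT \<xi>|lborel. norm (F \<xi>))" for x
    using F by (intro norm_integral_le) (auto simp: norm_mult)
  have Hi: "integrable lborel (\<lambda>x. v x * ?H x)" if "integrable lborel v" for v :: "'a \<Rightarrow> complex"
  proof (rule Bochner_Integration.integrable_bound)
    show "integrable lborel (\<lambda>x. v x * of_real (LINT \<xi>|lborel. norm (F \<xi>)))" using that by simp
    show "AE x in lborel. norm (v x * ?H x) \<le> norm (v x * complex_of_real (LINT \<xi>|lborel. norm (F \<xi>)))"
      using Hb by (auto simp: norm_mult intro!: mult_left_mono AE_I2)
  qed (use that in measurable)
  have comp: "(LINT x:C|lborel. ?w x) = 0" if C: "compact C" for C :: "'a set"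
  proof (cases "C = {}")
    case True then show ?thesis by (simp add: set_lebesgue_integral_def)
  next
    case ne: False
    \<comment> \<open>Continuous, equal to 1 on \<open>C\<close> and 0 beyond distance 1 / (m + 1):
      these test functions decrease to the indicator of \<open>C\<close>.\<close>
    define v where "v m x = max 0 (1 - real (Suc m) * infdist x C)" for m x
    have [measurable]: "C \<in> sets borel" using C by (simp add: compact_imp_closed)
    obtain R where R: "C \<subseteq> cball 0 R"
      using compact_imp_bounded[OF C] unfolding bounded_iff by (auto simp: subset_iff)
    have vz: "v m x = 0" if "x \<notin> cball 0 (R + 1)" for m x
    proof -
      obtain y where y: "y \<in> C" "infdist x C = dist x y"
        using infdist_attains_inf[OF compact_imp_closed[OF C] ne] by blast
      have "norm y \<le> R" using y(1) R by auto
      then have "dist x y \<ge> 1" using that norm_triangle_ineq2[of x y] by (auto simp: dist_norm)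
      then have "real (Suc m) * infdist x C \<ge> 1 * 1" unfolding y(2) by (intro mult_mono) auto
      then show ?thesis by (simp add: v_def)
    qed
    have v01: "0 \<le> v m x" "v m x \<le> 1" for m x by (auto simp: v_def infdist_nonneg)
    have vc: "continuous_on UNIV (v m)" for m unfolding v_def by (intro continuous_intros)
    have [measurable]: "v m \<in> borel_measurable borel" for m by (rule borel_measurable_continuous_onI[OF vc])
    have vle: "v m x \<le> indicator (cball 0 (R+1)) x" for m x
      using vz[of x m] v01(2)[of m x] by (auto simp: indicator_def)
    have ib: "integrable lborel (indicator (cball 0 (R+1)) :: 'a \<Rightarrow> real)"
      by (rule integrable_real_indicator) (simp, rule emeasure_bounded_finite, simp)
    have vi: "integrable lborel (v m)" for m
      by (rule Bochner_Integration.integrable_bound[OF ib]) (use vle v01 in auto)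
    have vci: "integrable lborel (\<lambda>x. complex_of_real (v m x))" for m
      using vi by (simp only: complex_of_real_integrable_eq)
    have z: "(LINT x|lborel. complex_of_real (v m x) * ?w x) = 0" for m
    proof -
      have i1: "integrable lborel (\<lambda>x. f x * complex_of_real (v m x))"
        by (rule Bochner_Integration.integrable_bound[OF f]) (use v01 in \<open>auto simp: norm_mult mult_left_le\<close>)
      have "(LINT x|lborel. complex_of_real (v m x) * ?w x) =
        (LINT x|lborel. (2*pi)^DIM('a) * (f x * complex_of_real (v m x)) - complex_of_real (v m x) * ?H x)"
        by (simp add: algebra_simps)
      also have "\<dots> = (2*pi)^DIM('a) * (LINT x|lborel. f x * complex_of_real (v m x)) - (LINT x|lborel. complex_of_real (v m x) * ?H x)"
        using i1 Hi[OF vci] by (subst Bochner_Integration.integral_diff) auto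
      also have "\<dots> = 0"
        using fourier_inversion_tested[OF f F[unfolded F_def] vci, of m] v01 vc[of m]
        by (auto simp: F_def intro!: continuous_on_of_real)
      finally show ?thesis .
    qed
    have wi: "integrable lborel (\<lambda>x. indicator (cball 0 (R+1)) x *\<^sub>R ?w x)"
    proof -
      have "integrable lborel (\<lambda>x. indicator (cball 0 (R+1)) x *\<^sub>R ((2*pi)^DIM('a) * f x))"
        using f by (intro integrable_mult_indicator) auto
      moreover have "integrable lborel (\<lambda>x. complex_of_real (indicator (cball 0 (R+1)) x) * ?H x)"
        using ib by (intro Hi) (simp only: complex_of_real_integrable_eq)
      ultimately show ?thesis
        by (auto simp: scaleR_conv_of_real algebra_simps dest: Bochner_Integration.integrable_diff)
    qed
    have "(\<lambda>m. LINT x|lborel. complex_of_real (v m x) * ?w x) \<longlonglongrightarrow> (LINT x|lborel. indicator C x *\<^sub>R ?w x)"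
    proof (rule integral_dominated_convergence[where w="\<lambda>x. norm (indicator (cball 0 (R+1)) x *\<^sub>R ?w x)"])
      show "integrable lborel (\<lambda>x. norm (indicator (cball 0 (R+1)) x *\<^sub>R ?w x))" using wi by (rule integrable_norm)
      show "AE x in lborel. norm (complex_of_real (v m x) * ?w x) \<le> norm (indicator (cball 0 (R+1)) x *\<^sub>R ?w x)" for m
        using vle v01 by (auto simp: norm_mult intro!: AE_I2 mult_right_mono)
      show "AE x in lborel. (\<lambda>m. complex_of_real (v m x) * ?w x) \<longlonglongrightarrow> indicator C x *\<^sub>R ?w x"
      proof (rule AE_I2)
        fix x
        show "(\<lambda>m. complex_of_real (v m x) * ?w x) \<longlonglongrightarrow> indicator C x *\<^sub>R ?w x"
        proof (cases "x \<in> C")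
          case True then show ?thesis by (simp add: v_def)
        next
          case False
          then have pos: "infdist x C > 0" using ne compact_imp_closed[OF C] by (simp add: infdist_pos_not_in_closed)
          obtain N where N: "1 / infdist x C < real N" using reals_Archimedean2 by blast
          have "v m x = 0" if "m \<ge> N" for m
          proof -
            have "1 / infdist x C \<le> real (Suc m)" using N that by simp
            then have "1 \<le> real (Suc m) * infdist x C" using pos by (simp add: field_simps)
            then show ?thesis by (simp add: v_def)
          qed
          then have "\<forall>\<^sub>F m in sequentially. complex_of_real (v m x) * ?w x = indicator C x *\<^sub>R ?w x"
            using False by (auto simp: eventually_sequentially)
          then show ?thesis by (rule tendsto_eventually)
        qed
      qed
    qed measurable
    then show ?thesis unfolding z set_lebesgue_integral_def using LIMSEQ_unique tendsto_const by blast
  qed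
  have "AE x in lborel. indicator (cball 0 (real R)) x *\<^sub>R ?w x = 0" for R :: nat
  proof (rule AE_zero_if_closed_integrals_zero)
    have "integrable lborel (\<lambda>x. indicator (cball 0 (real R)) x *\<^sub>R ((2*pi)^DIM('a) * f x))"
      using f by (intro integrable_mult_indicator) auto
    moreover have "integrable lborel (indicator (cball 0 (real R)) :: 'a \<Rightarrow> real)"
      by (rule integrable_real_indicator) (simp, rule emeasure_bounded_finite, simp)
    then have "integrable lborel (\<lambda>x. complex_of_real (indicator (cball 0 (real R)) x) * ?H x)"
      by (intro Hi) (simp only: complex_of_real_integrable_eq)
    ultimately show "integrable lborel (\<lambda>x. indicator (cball 0 (real R)) x *\<^sub>R ?w x)"
      by (auto simp: scaleR_conv_of_real algebra_simps dest: Bochner_Integration.integrable_diff)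
    fix A :: "'a set" assume "closed A"
    then have "compact (A \<inter> cball 0 (real R))" by (simp add: closed_Int_compact)
    from comp[OF this] show "(LINT x:A|lborel. indicator (cball 0 (real R)) x *\<^sub>R ?w x) = 0"
      unfolding set_lebesgue_integral_def by (simp add: indicator_inter_arith)
  qed
  then have "AE x in lborel. \<forall>R::nat. indicator (cball 0 (real R)) x *\<^sub>R ?w x = 0" unfolding AE_all_countable by blast
  then show ?thesis
  proof (rule AE_mp, intro AE_I2 impI)
    fix x assume *: "\<forall>R::nat. indicator (cball 0 (real R)) x *\<^sub>R ?w x = 0"
    obtain R :: nat where "norm x \<le> real R" using real_arch_simple by blast
    then show "(2*pi)^DIM('a) * f x = ?H x" using spec[OF *, of R] by simp
  qed
qed

section \<open>Iterated partial derivatives\<close>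

lemma pderivs_append: "pderivs (is @ js) f = pderivs is (pderivs js f)"
  by (induction "is") auto

lemma partial_eq:
  assumes "(f has_derivative f') (at x)"
  shows "frechet_derivative f (at x) = f'"
  using frechet_derivative_at[OF assms] by simp

lemma smooth_fun_has_derivative:
  assumes "smooth_fun f"
  shows "(pderivs is f has_derivative frechet_derivative (pderivs is f) (at x)) (at x)"
  using assms unfolding smooth_fun_def by (simp flip: frechet_derivative_works)

lemma smooth_fun_pderivs: "smooth_fun f \<Longrightarrow> smooth_fun (pderivs js f)"
  unfolding smooth_fun_def by (simp flip: pderivs_append)

lemma smooth_fun_continuous:
  assumes "smooth_fun f" shows "continuous_on UNIV (pderivs is f)"
  using assms unfolding smooth_fun_def
  by (intro differentiable_imp_continuous_on) (auto simp: differentiable_on_def intro: differentiable_at_withinI)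

lemma smooth_fun_continuous0: "smooth_fun f \<Longrightarrow> continuous_on UNIV f"
  using smooth_fun_continuous[of f "[]"] by simp

lemma smooth_fun_borel:
  fixes f :: "real^'n::finite \<Rightarrow> 'b::real_normed_vector"
  shows "smooth_fun f \<Longrightarrow> f \<in> borel_measurable borel"
  by (rule borel_measurable_continuous_onI[OF smooth_fun_continuous0])

text \<open>Coinductive way to smoothness: a class of differentiable functions that is closed under
  partial derivatives consists of smooth functions. It spares an explicit formula for iterated
  derivatives, as for transforms of Schwartz functions.\<close>

lemma pderivs_coinduct:
  assumes "P f"
    and "\<And>f. P f \<Longrightarrow> (\<forall>x. f differentiable at x)"
    and "\<And>f i. P f \<Longrightarrow> P (\<lambda>x. frechet_derivative f (at x) (axis i 1))"
  shows "P (pderivs is f)" "smooth_fun f"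
proof -
  show *: "P (pderivs is f)" for "is" using assms(1,3) by (induction "is") auto
  show "smooth_fun f" unfolding smooth_fun_def using * assms(2) by blast
qed

lemma pderivs_linear:
  assumes L: "bounded_linear L" and f: "smooth_fun f"
  shows "pderivs is (\<lambda>x. L (f x)) = (\<lambda>x. L (pderivs is f x))" and "smooth_fun (\<lambda>x. L (f x))"
proof -
  have d: "((\<lambda>x. L (pderivs is f x)) has_derivative (\<lambda>h. L (frechet_derivative (pderivs is f) (at x) h))) (at x)" for x "is"
    by (rule bounded_linear.has_derivative[OF L smooth_fun_has_derivative[OF f]])
  show *: "pderivs is (\<lambda>x. L (f x)) = (\<lambda>x. L (pderivs is f x))" for "is"
    by (induction "is") (auto simp: partial_eq[OF d])
  show "smooth_fun (\<lambda>x. L (f x))" unfolding smooth_fun_def * using d differentiable_def by blast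
qed

lemma pderivs_add:
  assumes f: "smooth_fun f" and g: "smooth_fun g"
  shows "pderivs is (\<lambda>x. f x + g x) = (\<lambda>x. pderivs is f x + pderivs is g x)" and "smooth_fun (\<lambda>x. f x + g x)"
proof -
  have d: "((\<lambda>x. pderivs is f x + pderivs is g x) has_derivative (\<lambda>h. frechet_derivative (pderivs is f) (at x) h + frechet_derivative (pderivs is g) (at x) h)) (at x)" for x "is"
    by (intro has_derivative_add smooth_fun_has_derivative f g)
  show *: "pderivs is (\<lambda>x. f x + g x) = (\<lambda>x. pderivs is f x + pderivs is g x)" for "is"
    by (induction "is") (auto simp: partial_eq[OF d])
  show "smooth_fun (\<lambda>x. f x + g x)" unfolding smooth_fun_def * using d differentiable_def by blast
qed

text \<open>All ways to distribute the directions over two factors, one entry per subset of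
  positions: the index list of the Leibniz rule.\<close>

fun splits :: "'a list \<Rightarrow> ('a list \<times> 'a list) list" where
  "splits [] = [([], [])]"
| "splits (i # is) = concat (map (\<lambda>(a, b). [(i # a, b), (a, i # b)]) (splits is))"

lemma pderivs_mult:
  fixes f g :: "real^'n::finite \<Rightarrow> 'b::real_normed_algebra"
  assumes f: "smooth_fun f" and g: "smooth_fun g"
  shows "pderivs is (\<lambda>x. f x * g x) = (\<lambda>x. \<Sum>(a, b)\<leftarrow>splits is. pderivs a f x * pderivs b g x)"
    and "smooth_fun (\<lambda>x. f x * g x)"
proof -
  let ?d = "\<lambda>is x h. frechet_derivative (pderivs is f) (at x) h"
  let ?e = "\<lambda>is x h. frechet_derivative (pderivs is g) (at x) h"
  have 1: "((\<lambda>x. \<Sum>(a, b)\<leftarrow>xs. pderivs a f x * pderivs b g x) has_derivative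
     (\<lambda>h. \<Sum>(a, b)\<leftarrow>xs. pderivs a f x * ?e b x h + ?d a x h * pderivs b g x)) (at x)" for x xs
  proof (induction xs)
    case (Cons y xs)
    show ?case by (cases y) (auto intro!: has_derivative_add has_derivative_mult smooth_fun_has_derivative f g Cons)
  qed simp
  have 2: "(\<Sum>(a, b)\<leftarrow>concat (map (\<lambda>(a, b). [(i # a, b), (a, i # b)]) xs). pderivs a f x * pderivs b g x) =
    (\<Sum>(a, b)\<leftarrow>xs. pderivs a f x * ?e b x (axis i 1) + ?d a x (axis i 1) * pderivs b g x)" for xs i x
    by (induction xs) (auto simp: algebra_simps)
  show *: "pderivs is (\<lambda>x. f x * g x) = (\<lambda>x. \<Sum>(a, b)\<leftarrow>splits is. pderivs a f x * pderivs b g x)" for "is"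
    by (induction "is") (auto simp: partial_eq[OF 1] 2)
  show "smooth_fun (\<lambda>x. f x * g x)" unfolding smooth_fun_def * using 1 differentiable_def by blast
qed

lemma pderivs_const: "pderivs is (\<lambda>x. c) = (\<lambda>x. if is = [] then c else 0)"
proof (induction "is")
  case (Cons i "is") then show ?case by (cases "is") (auto simp: frechet_derivative_const)
qed simp

lemma smooth_fun_const: "smooth_fun (\<lambda>x. c)"
  unfolding smooth_fun_def pderivs_const by auto

lemma smooth_fun_prod:
  fixes f :: "'a \<Rightarrow> real^'n::finite \<Rightarrow> 'b::real_normed_field"
  assumes "finite A" "\<And>a. a \<in> A \<Longrightarrow> smooth_fun (f a)"
  shows "smooth_fun (\<lambda>x. \<Prod>a\<in>A. f a x)"
  using assms by (induction rule: finite_induct) (auto simp: smooth_fun_const pderivs_mult)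

lemma pderivs_minus:
  assumes f: "smooth_fun f" and g: "smooth_fun g"
  shows "smooth_fun (\<lambda>x. f x - g x)" "pderivs is (\<lambda>x. f x - g x) = (\<lambda>x. pderivs is f x - pderivs is g x)"
  using pderivs_add[OF f pderivs_linear(2)[OF bounded_linear_minus[OF bounded_linear_ident] g]]
    pderivs_linear(1)[OF bounded_linear_minus[OF bounded_linear_ident] g]
  by auto

text \<open>One family for translations, reflections and anisotropic dyadic dilations, so that a
  single chain rule and a single change of variables serve all of them.\<close>

definition diag_affine :: "real^'n \<Rightarrow> ('n \<Rightarrow> real) \<Rightarrow> real^'n::finite \<Rightarrow> real^'n" where
  "diag_affine b d x = b + (\<chi> i. d i * x $ i)"

lemma diag_affine_has_derivative:
  fixes b :: "real^'n::finite"
  shows "(diag_affine b d has_derivative diag_affine 0 d) (at x)"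
proof -
  have "bounded_linear (\<lambda>x::real^'n. (\<chi> i. d i * x $ i) :: real^'n)"
    by (rule linear_conv_bounded_linear[THEN iffD1], rule linearI) (auto simp: vec_eq_iff algebra_simps)
  from has_derivative_add[OF has_derivative_const bounded_linear_imp_has_derivative[OF this]]
  show ?thesis unfolding diag_affine_def[abs_def] by simp
qed

lemma diag_affine_borel [measurable]: "diag_affine b d \<in> borel_measurable borel"
  by (intro borel_measurable_continuous_onI continuous_at_imp_continuous_on ballI has_derivative_continuous[OF diag_affine_has_derivative])

lemma diag_affine_axis: "diag_affine 0 d (axis i 1) = d i *\<^sub>R axis i 1"
  by (auto simp: diag_affine_def vec_eq_iff axis_def)

lemma pderivs_diag_affine:
  assumes f: "smooth_fun f"
  shows "pderivs is (\<lambda>x. f (diag_affine b d x)) = (\<lambda>x. prod_list (map d is) *\<^sub>R pderivs is f (diag_affine b d x))"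
    and "smooth_fun (\<lambda>x. f (diag_affine b d x))"
proof -
  have D: "((\<lambda>x. prod_list (map d is) *\<^sub>R pderivs is f (diag_affine b d x)) has_derivative
     (\<lambda>h. prod_list (map d is) *\<^sub>R frechet_derivative (pderivs is f) (at (diag_affine b d x)) (diag_affine 0 d h))) (at x)" for x "is"
    by (intro has_derivative_scaleR_right has_derivative_compose[OF diag_affine_has_derivative] smooth_fun_has_derivative f)
  have lin: "linear (frechet_derivative (pderivs is f) (at y))" for y "is"
    using smooth_fun_has_derivative[OF f] by (rule has_derivative_linear)
  show *: "pderivs is (\<lambda>x. f (diag_affine b d x)) = (\<lambda>x. prod_list (map d is) *\<^sub>R pderivs is f (diag_affine b d x))" for "is"
    by (induction "is") (auto simp: partial_eq[OF D] diag_affine_axis linear_scale[OF lin])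
  show "smooth_fun (\<lambda>x. f (diag_affine b d x))"
    unfolding smooth_fun_def * using D differentiable_def by blast
qed

lemma smooth_fun_coord:
  fixes h :: "real \<Rightarrow> real"
  assumes h: "\<And>k x. (deriv ^^ k) h differentiable (at x)"
  shows "smooth_fun (\<lambda>x::real^'n::finite. h (x $ i))"
proof -
  have D: "((\<lambda>x::real^'n. (deriv ^^ k) h (x $ i)) has_derivative (\<lambda>v. (deriv ^^ Suc k) h (x $ i) * v $ i)) (at x)" for k x
  proof -
    have "((deriv ^^ k) h has_field_derivative deriv ((deriv ^^ k) h) (x $ i)) (at (x $ i))"
      using h[of k "x $ i"] by (metis DERIV_deriv_iff_real_differentiable)
    then have "((deriv ^^ k) h has_derivative (\<lambda>v. deriv ((deriv ^^ k) h) (x $ i) * v)) (at (x $ i))"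
      by (simp add: has_field_derivative_def)
    from has_derivative_compose[OF bounded_linear_imp_has_derivative[OF bounded_linear_vec_nth] this]
    show ?thesis by simp
  qed
  \<comment> \<open>A single derivative in a direction other than \<open>i\<close> annihilates the
    function for good.\<close>
  have "pderivs is (\<lambda>x::real^'n. h (x $ i)) = (\<lambda>x. if set is \<subseteq> {i} then (deriv ^^ length is) h (x $ i) else 0)" for "is"
  proof (induction "is")
    case (Cons j "is")
    show ?case
    proof (cases "set is \<subseteq> {i}")
      case True
      have "frechet_derivative (\<lambda>x::real^'n. (deriv ^^ length is) h (x $ i)) (at x) (axis j 1) =
         (deriv ^^ Suc (length is)) h (x $ i) * (axis j 1 :: real^'n) $ i" for x
        unfolding partial_eq[OF D] ..
      with True Cons show ?thesis by (auto simp: axis_def)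
    next
      case False
      then show ?thesis using Cons by (auto simp: frechet_derivative_const)
    qed
  qed simp
  note * = this
  show ?thesis unfolding smooth_fun_def
  proof (intro allI)
    fix "is" x
    show "pderivs is (\<lambda>x::real^'n. h (x $ i)) differentiable at x"
      unfolding * using differentiableI[OF D] by (cases "set is \<subseteq> {i}") auto
  qed
qed

lemma pderivs_zero_on_open:
  assumes U: "open U" and f: "\<And>x. x \<in> U \<Longrightarrow> f x = 0" and x: "x \<in> U"
  shows "pderivs is f x = 0"
  using x
proof (induction "is" arbitrary: x)
  case (Cons i "is")
  have "(pderivs is f has_derivative (\<lambda>_. 0)) (at x)"
    by (rule has_derivative_transform_within_open[OF has_derivative_const U Cons.prems, of 0]) (simp add: Cons.IH)
  then show ?case by (simp add: partial_eq)
qed (simp add: f)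

lemma pderivs_bounded:
  fixes f :: "real^'n::finite \<Rightarrow> 'b::real_normed_vector"
  assumes f: "smooth_fun f" and z: "\<And>x. norm x > R \<Longrightarrow> f x = 0"
  shows "\<exists>B\<ge>0. \<forall>x. norm (pderivs is f x) \<le> B"
proof -
  have "compact (pderivs is f ` cball 0 R)"
    by (intro compact_continuous_image continuous_on_subset[OF smooth_fun_continuous[OF f]]) auto
  from compact_imp_bounded[OF this] obtain B where B0: "\<forall>y\<in>pderivs is f ` cball 0 R. norm y \<le> B"
    unfolding bounded_iff by blast
  then have B: "\<And>x. x \<in> cball 0 R \<Longrightarrow> norm (pderivs is f x) \<le> B" by blast
  have "open {x::real^'n. norm x > R}" by (intro open_Collect_less continuous_intros)
  then have "pderivs is f x = 0" if "norm x > R" for x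
    using pderivs_zero_on_open[of "{x. norm x > R}" f x] z that by auto
  then have "norm (pderivs is f x) \<le> max B 0" for x
    using B[of x] by (cases "norm x > R") auto
  then show ?thesis by (intro exI[of _ "max B 0"]) auto
qed

section \<open>Schwartz functions\<close>

lemma schwartz_iff: "\<phi> \<in> schwartz \<longleftrightarrow> smooth_fun \<phi> \<and> (\<forall>k is. \<exists>C. \<forall>x. (1 + norm x) ^ k * norm (pderivs is \<phi> x) \<le> C)"
  unfolding schwartz_def bdd_above_def by (auto simp: image_iff)

lemma schwartz_smooth: "\<phi> \<in> schwartz \<Longrightarrow> smooth_fun \<phi>" by (simp add: schwartz_iff)

lemma schwartz_borel [measurable_dest]: "\<phi> \<in> schwartz \<Longrightarrow> \<phi> \<in> borel_measurable borel"
  by (simp add: smooth_fun_borel schwartz_smooth)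

lemma schwartz_bound:
  assumes "\<phi> \<in> schwartz" obtains C where "C \<ge> 0" "\<And>x. norm (pderivs is \<phi> x) \<le> C / (1 + norm x) ^ k"
proof -
  obtain C where C: "\<And>x. (1 + norm x) ^ k * norm (pderivs is \<phi> x) \<le> C" using assms unfolding schwartz_iff by blast
  have "norm (pderivs is \<phi> x) \<le> C / (1 + norm x) ^ k" for x
    using C[of x] by (simp add: field_simps add_pos_nonneg)
  moreover have "C \<ge> 0" using order_trans[OF _ C[of 0]] by simp
  ultimately show ?thesis using that by blast
qed

lemma schwartz_pderivs: "\<phi> \<in> schwartz \<Longrightarrow> pderivs js \<phi> \<in> schwartz"
  unfolding schwartz_iff by (auto simp: smooth_fun_pderivs simp flip: pderivs_append)

text \<open>The usual class of multipliers of the Schwartz space.\<close>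

definition slow :: "(real^'n::finite \<Rightarrow> complex) \<Rightarrow> bool" where
  "slow f \<longleftrightarrow> smooth_fun f \<and> (\<forall>is. \<exists>C N. \<forall>x. norm (pderivs is f x) \<le> C * (1 + norm x) ^ N)"

lemma slow_mult_schwartz:
  assumes f: "slow f" and g: "g \<in> schwartz"
  shows "(\<lambda>x. f x * g x) \<in> schwartz"
  unfolding schwartz_iff
proof (intro conjI allI)
  have sf: "smooth_fun f" and sg: "smooth_fun g" using f g by (auto simp: slow_def schwartz_smooth)
  show "smooth_fun (\<lambda>x. f x * g x)" by (rule pderivs_mult(2)[OF sf sg])
  fix k "is"
  have "\<exists>C. \<forall>x. (1 + norm x) ^ k * norm (\<Sum>(a, b)\<leftarrow>xs. pderivs a f x * pderivs b g x) \<le> C" for xs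
  proof (induction xs)
    case Nil show ?case by auto
  next
    case (Cons ab xs)
    obtain a b where ab: "ab = (a, b)" by (cases ab)
    obtain C where C: "\<And>x. (1 + norm x) ^ k * norm (\<Sum>(a, b)\<leftarrow>xs. pderivs a f x * pderivs b g x) \<le> C"
      using Cons by blast
    obtain D N where D: "\<And>x. norm (pderivs a f x) \<le> D * (1 + norm x) ^ N" using f unfolding slow_def by blast
    \<comment> \<open>The \<open>N\<close> extra powers of decay of \<open>g\<close> pay for the
      growth of the derivative of \<open>f\<close>.\<close>
    obtain E where E: "\<And>x. (1 + norm x) ^ (k + N) * norm (pderivs b g x) \<le> E" using g unfolding schwartz_iff by blast
    have D0: "D \<ge> 0" using order_trans[OF norm_ge_zero D[of 0]] by simp
    have "(1 + norm x) ^ k * norm (pderivs a f x * pderivs b g x) \<le> D * E" for x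
    proof -
      have "(1 + norm x) ^ k * norm (pderivs a f x * pderivs b g x) \<le> (1 + norm x) ^ k * (D * (1 + norm x) ^ N * norm (pderivs b g x))"
        using D[of x] by (auto simp: norm_mult intro!: mult_left_mono mult_right_mono)
      also have "\<dots> = D * ((1 + norm x) ^ (k + N) * norm (pderivs b g x))" by (simp add: power_add mult_ac)
      also have "\<dots> \<le> D * E" using E D0 by (intro mult_left_mono) auto
      finally show ?thesis .
    qed
    moreover have "(1 + norm x) ^ k * norm (u + w) \<le> (1 + norm x) ^ k * norm u + (1 + norm x) ^ k * norm w" for x :: "real^'n" and u w :: complex
      unfolding distrib_left[symmetric] by (intro mult_left_mono norm_triangle_ineq) auto
    ultimately have "(1 + norm x) ^ k * norm (\<Sum>(a, b)\<leftarrow>ab # xs. pderivs a f x * pderivs b g x) \<le> D * E + C" for x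
      using C[of x] unfolding ab list.map sum_list.Cons case_prod_conv by (meson add_mono order_trans)
    then show ?case by blast
  qed
  then show "\<exists>C. \<forall>x. (1 + norm x) ^ k * norm (pderivs is (\<lambda>x. f x * g x) x) \<le> C"
    unfolding pderivs_mult(1)[OF sf sg] .
qed

lemma schwartz_add: "f \<in> schwartz \<Longrightarrow> g \<in> schwartz \<Longrightarrow> (\<lambda>x. f x + g x) \<in> schwartz"
proof -
  assume f: "f \<in> schwartz" and g: "g \<in> schwartz"
  show ?thesis unfolding schwartz_iff
  proof (intro conjI allI)
    show "smooth_fun (\<lambda>x. f x + g x)" using f g by (simp add: pderivs_add schwartz_smooth)
    fix k "is"
    obtain C D where "\<And>x. (1 + norm x) ^ k * norm (pderivs is f x) \<le> C" "\<And>x. (1 + norm x) ^ k * norm (pderivs is g x) \<le> D"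
      using f g unfolding schwartz_iff by metis
    moreover have "(1 + norm x) ^ k * norm (u + w) \<le> (1 + norm x) ^ k * norm u + (1 + norm x) ^ k * norm w" for x :: "real^'a" and u w :: complex
      unfolding distrib_left[symmetric] by (intro mult_left_mono norm_triangle_ineq) auto
    ultimately show "\<exists>C. \<forall>x. (1 + norm x) ^ k * norm (pderivs is (\<lambda>x. f x + g x) x) \<le> C"
      unfolding pderivs_add(1)[OF schwartz_smooth[OF f] schwartz_smooth[OF g]] by (meson add_mono order_trans)
  qed
qed

lemma slow_bounded_derivs:
  assumes "smooth_fun f" "\<And>is. \<exists>B. \<forall>x. norm (pderivs is f x) \<le> B"
  shows "slow f"
  unfolding slow_def
proof (intro conjI assms allI)
  fix "is"
  obtain B where "\<And>x. norm (pderivs is f x) \<le> B" using assms(2) by blast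
  then show "\<exists>C N. \<forall>x. norm (pderivs is f x) \<le> C * (1 + norm x) ^ N"
    by (intro exI[of _ B] exI[of _ 0]) simp
qed

lemma slow_const: "slow (\<lambda>x. c)"
  by (rule slow_bounded_derivs[OF smooth_fun_const]) (auto simp: pderivs_const intro!: exI[of _ "norm c"])

lemma schwartz_cmult: "f \<in> schwartz \<Longrightarrow> (\<lambda>x. c * f x) \<in> schwartz"
  by (rule slow_mult_schwartz[OF slow_const])

lemma schwartz_zero: "(\<lambda>x. 0) \<in> schwartz"
  by (auto simp: schwartz_iff smooth_fun_const pderivs_const)

lemma schwartz_sum: "finite A \<Longrightarrow> (\<And>a. a \<in> A \<Longrightarrow> f a \<in> schwartz) \<Longrightarrow> (\<lambda>x. \<Sum>a\<in>A. f a x) \<in> schwartz"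
  by (induction rule: finite_induct) (auto simp: schwartz_zero schwartz_add)

lemma slow_compact:
  fixes f :: "real^'n::finite \<Rightarrow> complex"
  assumes "smooth_fun f" and "\<And>x. norm x > R \<Longrightarrow> f x = 0"
  shows "slow f"
  by (rule slow_bounded_derivs[OF assms(1)]) (use pderivs_bounded[OF assms] in blast)

lemma schwartz_compact:
  fixes f :: "real^'n::finite \<Rightarrow> complex"
  assumes f: "smooth_fun f" and z: "\<And>x. norm x > R \<Longrightarrow> f x = 0"
  shows "f \<in> schwartz"
  unfolding schwartz_iff
proof (intro conjI allI f)
  fix k "is"
  obtain B where B: "B \<ge> 0" "\<And>x. norm (pderivs is f x) \<le> B" using pderivs_bounded[OF assms] by blast
  have "open {x::real^'n. norm x > R}" by (intro open_Collect_less continuous_intros)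
  then have 0: "pderivs is f x = 0" if "norm x > R" for x
    using pderivs_zero_on_open[of "{x. norm x > R}" f x] z that by auto
  have "(1 + norm x) ^ k * norm (pderivs is f x) \<le> (1 + \<bar>R\<bar>) ^ k * B" for x
  proof (cases "norm x > R")
    case True then show ?thesis using 0 B by simp
  next
    case False then show ?thesis using B by (intro mult_mono power_mono) auto
  qed
  then show "\<exists>C. \<forall>x. (1 + norm x) ^ k * norm (pderivs is f x) \<le> C" by blast
qed

lemma
  fixes \<xi> :: "real^'n::finite"
  shows slow_cis: "slow (\<lambda>x. cis (x \<bullet> \<xi>))"
    and partial_cis: "frechet_derivative (\<lambda>x. cis (x \<bullet> \<xi>)) (at x) (axis i 1) = \<i> * (\<xi> $ i) * cis (x \<bullet> \<xi>)"
proof -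
  have D: "((\<lambda>x::real^'n. cis (x \<bullet> \<xi>)) has_derivative (\<lambda>h. (h \<bullet> \<xi>) *\<^sub>R (\<i> * cis (x \<bullet> \<xi>)))) (at x)" for x
  proof -
    have "(cis has_vector_derivative (\<i> * cis (x \<bullet> \<xi>))) (at (x \<bullet> \<xi>))"
      unfolding cis_conv_exp by (auto intro!: derivative_eq_intros has_vector_derivative_real_field)
    then have "(cis has_derivative (\<lambda>h. h *\<^sub>R (\<i> * cis (x \<bullet> \<xi>)))) (at (x \<bullet> \<xi>))"
      by (simp add: has_vector_derivative_def)
    from has_derivative_compose[OF bounded_linear_imp_has_derivative[OF bounded_linear_inner_left] this]
    show ?thesis by simp
  qed
  show p: "frechet_derivative (\<lambda>x. cis (x \<bullet> \<xi>)) (at x) (axis i 1) = \<i> * (\<xi> $ i) * cis (x \<bullet> \<xi>)" for x i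
    unfolding partial_eq[OF D] by (simp add: inner_axis' scaleR_conv_of_real mult_ac)
  have *: "pderivs is (\<lambda>x. cis (x \<bullet> \<xi>)) = (\<lambda>x. prod_list (map (\<lambda>i. \<i> * (\<xi> $ i)) is) * cis (x \<bullet> \<xi>))" for "is"
  proof (induction "is")
    case (Cons i "is")
    have "((\<lambda>x. prod_list (map (\<lambda>i. \<i> * (\<xi> $ i)) is) * cis (x \<bullet> \<xi>)) has_derivative
      (\<lambda>h. prod_list (map (\<lambda>i. \<i> * (\<xi> $ i)) is) * ((h \<bullet> \<xi>) *\<^sub>R (\<i> * cis (x \<bullet> \<xi>))))) (at x)" for x
      by (intro has_derivative_mult_right D)
    note D' = this
    show ?case unfolding pderivs.simps Cons partial_eq[OF D'] by (simp add: inner_axis' scaleR_conv_of_real mult_ac)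
  qed simp
  have sm: "smooth_fun (\<lambda>x. cis (x \<bullet> \<xi>))"
    unfolding smooth_fun_def * by (intro allI differentiable_mult) (auto simp: differentiable_def intro: D)
  show "slow (\<lambda>x. cis (x \<bullet> \<xi>))"
    by (rule slow_bounded_derivs[OF sm]) (auto simp: * norm_mult)
qed

lemma
  fixes i :: "'n::finite"
  shows slow_coord: "slow (\<lambda>x::real^'n. complex_of_real (x $ i))"
proof -
  have bl: "bounded_linear (\<lambda>x::real^'n. complex_of_real (x $ i))"
    by (intro bounded_linear_compose[OF bounded_linear_of_real bounded_linear_vec_nth, unfolded o_def])
  have 1: "pderivs [j] (\<lambda>x::real^'n. complex_of_real (x $ i)) = (\<lambda>x. complex_of_real ((axis j 1 :: real^'n) $ i))" for j
    by (simp add: partial_eq[OF bounded_linear_imp_has_derivative[OF bl]])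
  \<comment> \<open>The reverse induction exposes the derivative that acts first, after which only a
    constant remains.\<close>
  have *: "is = [] \<or> (\<exists>c. pderivs is (\<lambda>x::real^'n. complex_of_real (x $ i)) = (\<lambda>x. c))" for "is"
  proof (induction "is" rule: rev_induct)
    case (snoc j "is")
    show ?case unfolding pderivs_append 1 by (auto simp: pderivs_const)
  qed simp
  have sm: "smooth_fun (\<lambda>x::real^'n. complex_of_real (x $ i))" unfolding smooth_fun_def
  proof (intro allI)
    fix "is" x
    show "pderivs is (\<lambda>x::real^'n. complex_of_real (x $ i)) differentiable at x"
      using *[of "is"] bounded_linear_imp_differentiable[OF bl] by auto
  qed
  show ?thesis unfolding slow_def
  proof (intro conjI sm allI)
    fix "is"
    show "\<exists>C N. \<forall>x. norm (pderivs is (\<lambda>x::real^'n. complex_of_real (x $ i)) x) \<le> C * (1 + norm x) ^ N"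
      using *[of "is"]
    proof
      assume "is = []"
      then show ?thesis by (intro exI[of _ 1]) (auto intro!: order_trans[OF component_le_norm_cart])
    next
      assume "\<exists>c. pderivs is (\<lambda>x::real^'n. complex_of_real (x $ i)) = (\<lambda>x. c)"
      then obtain c where "pderivs is (\<lambda>x::real^'n. complex_of_real (x $ i)) = (\<lambda>x. c)" by blast
      then show ?thesis by (intro exI[of _ "norm c"] exI[of _ 0]) auto
    qed
  qed
qed

lemma schwartz_diag_affine:
  assumes f: "f \<in> schwartz" and d: "\<And>i. \<bar>d i\<bar> = 1"
  shows "(\<lambda>x. f (diag_affine b d x)) \<in> schwartz"
  unfolding schwartz_iff
proof (intro conjI allI)
  have sf: "smooth_fun f" using f by (rule schwartz_smooth)
  show "smooth_fun (\<lambda>x. f (diag_affine b d x))" by (rule pderivs_diag_affine(2)[OF sf])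
  fix k "is"
  obtain C where C: "\<And>x. (1 + norm x) ^ k * norm (pderivs is f x) \<le> C" using f unfolding schwartz_iff by blast
  have n: "norm (\<chi> i. d i * x $ i) = norm x" for x :: "real^'a"
    unfolding norm_vec_def using d by (simp add: abs_mult)
  have p: "\<bar>prod_list (map d is)\<bar> = 1" using d by (induction "is") (auto simp: abs_mult)
  have "(1 + norm x) ^ k * norm (pderivs is (\<lambda>x. f (diag_affine b d x)) x) \<le> (1 + norm b) ^ k * C" for x
  proof -
    let ?y = "diag_affine b d x"
    have "norm x \<le> norm ?y + norm b"
      using norm_triangle_ineq4[of ?y b] n[of x] by (simp add: diag_affine_def)
    \<comment> \<open>Peetre's inequality: shifting by \<open>b\<close> changes polynomial weights
      by a constant factor only.\<close>
    then have "1 + norm x \<le> (1 + norm b) * (1 + norm ?y)"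
      using mult_nonneg_nonneg[OF norm_ge_zero[of b] norm_ge_zero[of ?y]] unfolding distrib_left distrib_right by linarith
    then have "(1 + norm x) ^ k \<le> ((1 + norm b) * (1 + norm ?y)) ^ k" by (intro power_mono) auto
    then have "(1 + norm x) ^ k * norm (pderivs is f ?y) \<le> (1 + norm b) ^ k * ((1 + norm ?y) ^ k * norm (pderivs is f ?y))"
      unfolding power_mult_distrib mult.assoc[symmetric] by (intro mult_right_mono) auto
    also have "\<dots> \<le> (1 + norm b) ^ k * C" using C by (intro mult_left_mono) auto
    finally show ?thesis unfolding pderivs_diag_affine(1)[OF sf] by (simp add: p)
  qed
  then show "\<exists>C. \<forall>x. (1 + norm x) ^ k * norm (pderivs is (\<lambda>x. f (diag_affine b d x)) x) \<le> C" by blast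
qed

section \<open>Integration on Euclidean space\<close>

lemma lborel_shift:
  fixes f :: "'a::euclidean_space \<Rightarrow> 'b::{banach,second_countable_topology}" and b :: 'a
  assumes [measurable]: "f \<in> borel_measurable borel"
  shows "(LINT x|lborel. f (b + x)) = (LINT x|lborel. f x)" "(LINT x|lborel. f (b - x)) = (LINT x|lborel. f x)"
    "integrable lborel (\<lambda>x. f (b + x)) \<longleftrightarrow> integrable lborel f" "integrable lborel (\<lambda>x. f (b - x)) \<longleftrightarrow> integrable lborel f"
proof -
  have 1: "lborel = distr lborel borel (\<lambda>x::'a. b + x)" using lborel_affine[of 1 b] by (simp add: density_1)
  have 2: "lborel = distr lborel borel (\<lambda>x::'a. b - x)" using lborel_affine[of "-1" b] by (simp add: density_1)
  show "(LINT x|lborel. f (b + x)) = (LINT x|lborel. f x)" by (subst (2) 1, subst integral_distr) auto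
  show "(LINT x|lborel. f (b - x)) = (LINT x|lborel. f x)" by (subst (2) 2, subst integral_distr) auto
  show "integrable lborel (\<lambda>x. f (b + x)) \<longleftrightarrow> integrable lborel f" by (subst (2) 1, subst integrable_distr_eq) auto
  show "integrable lborel (\<lambda>x. f (b - x)) \<longleftrightarrow> integrable lborel f" by (subst (2) 2, subst integrable_distr_eq) auto
qed

lemma nn_integral_lborel_shift:
  fixes f :: "'a::euclidean_space \<Rightarrow> ennreal" and b :: 'a
  assumes [measurable]: "f \<in> borel_measurable borel"
  shows "(\<integral>\<^sup>+x. f (b + x) \<partial>lborel) = (\<integral>\<^sup>+x. f x \<partial>lborel)" "(\<integral>\<^sup>+x. f (b - x) \<partial>lborel) = (\<integral>\<^sup>+x. f x \<partial>lborel)"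
    "(\<integral>\<^sup>+x. f (x - b) \<partial>lborel) = (\<integral>\<^sup>+x. f x \<partial>lborel)"
proof -
  have 1: "lborel = distr lborel borel (\<lambda>x::'a. b + x)" for b using lborel_affine[of 1 b] by (simp add: density_1)
  have 2: "lborel = distr lborel borel (\<lambda>x::'a. b - x)" using lborel_affine[of "-1" b] by (simp add: density_1)
  show *: "(\<integral>\<^sup>+x. f (b + x) \<partial>lborel) = (\<integral>\<^sup>+x. f x \<partial>lborel)" for b by (subst (2) 1[of b], subst nn_integral_distr) auto
  show "(\<integral>\<^sup>+x. f (x - b) \<partial>lborel) = (\<integral>\<^sup>+x. f x \<partial>lborel)" using *[of "- b"] by simp
  show "(\<integral>\<^sup>+x. f (b - x) \<partial>lborel) = (\<integral>\<^sup>+x. f x \<partial>lborel)" by (subst (2) 2, subst nn_integral_distr) auto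
qed

lemma lborel_diag_affine:
  fixes b :: "real^'n::finite"
  assumes d: "\<And>i. d i \<noteq> 0"
  shows "lborel = density (distr lborel borel (diag_affine b d)) (\<lambda>_. ennreal (\<Prod>i\<in>UNIV. \<bar>d i\<bar>))"
proof -
  let ?c = "\<lambda>j::real^'n. (\<chi> i. d i) \<bullet> j"
  have inj: "inj (\<lambda>i::'n. axis i (1::real))" by (auto simp: inj_on_def axis_eq_axis)
  have B: "Basis = range (\<lambda>i::'n. axis i (1::real))" by (auto simp: Basis_vec_def)
  have "(\<Sum>j\<in>Basis. (?c j * (x \<bullet> j)) *\<^sub>R j) = (\<Sum>i\<in>UNIV. (d i * x $ i) *\<^sub>R axis i 1)" for x :: "real^'n"
    unfolding B by (subst sum.reindex[OF inj]) (simp add: inner_axis)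
  moreover have "(\<Sum>i\<in>UNIV. (d i * x $ i) *\<^sub>R axis i 1) = (\<chi> i. d i * x $ i)" for x :: "real^'n"
    by (auto simp: vec_eq_iff axis_def if_distrib cong: if_cong)
  moreover have "(\<Prod>j\<in>Basis. \<bar>?c j\<bar>) = (\<Prod>i\<in>UNIV. \<bar>d i\<bar>)"
    unfolding B by (subst prod.reindex[OF inj]) (simp add: inner_axis)
  moreover have "?c j \<noteq> 0" if "j \<in> Basis" for j using that d unfolding B by (auto simp: inner_axis)
  ultimately show ?thesis
    using lborel_affine_euclidean[of ?c b] unfolding diag_affine_def[abs_def] by simp
qed

lemma lborel_integral_diag_affine:
  fixes f :: "real^'n::finite \<Rightarrow> 'b::{banach,second_countable_topology}" and b
  assumes d: "\<And>i. d i \<noteq> 0" and [measurable]: "f \<in> borel_measurable borel"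
  shows "(LINT x|lborel. f x) = (\<Prod>i\<in>UNIV. \<bar>d i\<bar>) *\<^sub>R (LINT x|lborel. f (diag_affine b d x))"
  by (subst lborel_diag_affine[OF d, of b], subst integral_density)
     (auto simp: integral_distr prod_nonneg)

lemma nn_integral_diag_affine:
  fixes f :: "real^'n::finite \<Rightarrow> ennreal" and b
  assumes d: "\<And>i. d i \<noteq> 0" and [measurable]: "f \<in> borel_measurable borel"
  shows "(\<integral>\<^sup>+x. f x \<partial>lborel) = ennreal (\<Prod>i\<in>UNIV. \<bar>d i\<bar>) * (\<integral>\<^sup>+x. f (diag_affine b d x) \<partial>lborel)"
  by (subst lborel_diag_affine[OF d, of b], subst nn_integral_density)
     (auto simp: nn_integral_distr nn_integral_cmult)

lemma integrable_inverse_one_plus_square: "integrable lborel (\<lambda>s::real. 1 / (1 + s\<^sup>2))"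
proof -
  have "set_integrable lborel {0<..} (\<lambda>s::real. 1 / (1 + s\<^sup>2))"
    using integrable_I0i_1_div_plus_square
    by (simp add: interval_lebesgue_integrable_def einterval_def inverse_eq_divide greaterThan_def[symmetric])
  then have "integrable lborel (\<lambda>s::real. indicator {0..} s *\<^sub>R (1 / (1 + s\<^sup>2)))"
    unfolding set_integrable_def
  proof (rule integrable_cong_AE_imp)
    show "AE s::real in lborel. indicator {0<..} s *\<^sub>R (1 / (1 + s\<^sup>2)) = indicator {0..} s *\<^sub>R (1 / (1 + s\<^sup>2))"
      by (rule AE_mp[OF AE_lborel_singleton[of "0::real"]], rule AE_I2) (auto simp: indicator_def)
  qed measurable
  from has_bochner_integral_even_function[OF has_bochner_integral_integrable[OF this]]
  show ?thesis by (auto simp: has_bochner_integral_iff)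
qed

text \<open>Each coordinate satisfies 1 + x_b^2 <= (1 + |x|)^2, so the function lies below a product
  of one-dimensional Cauchy profiles. This is the origin of the exponent \<open>2 * DIM('a)\<close>
  that recurs below.\<close>

lemma integrable_norm_decay:
  "integrable lborel (\<lambda>x::'a::euclidean_space. 1 / (1 + norm x) ^ (2 * DIM('a)))"
proof (rule Bochner_Integration.integrable_bound)
  show "integrable lborel (\<lambda>x::'a. \<Prod>b\<in>Basis. 1 / (1 + (x \<bullet> b)\<^sup>2))"
    by (rule integral_lborel_prod(1)) (rule integrable_inverse_one_plus_square)
  show "AE x::'a in lborel. norm (1 / (1 + norm x) ^ (2 * DIM('a))) \<le> norm (\<Prod>b\<in>Basis. 1 / (1 + (x \<bullet> b)\<^sup>2))"
  proof (rule AE_I2)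
    fix x :: 'a
    have "(\<Prod>b\<in>(Basis::'a set). 1 / (1 + norm x)^2) \<le> (\<Prod>b\<in>Basis. 1 / (1 + (x \<bullet> b)\<^sup>2))"
    proof (rule prod_mono)
      fix b :: 'a assume b: "b \<in> Basis"
      have "(x \<bullet> b)\<^sup>2 \<le> (norm x)\<^sup>2" using Basis_le_norm[OF b, of x] by (metis abs_ge_zero power2_abs power_mono)
      then have "1 + (x \<bullet> b)\<^sup>2 \<le> (1 + norm x)\<^sup>2"
        using norm_ge_zero[of x] unfolding power2_sum power_one by linarith
      then have "1 / (1 + norm x)^2 \<le> 1 / (1 + (x \<bullet> b)\<^sup>2)"
        by (intro divide_left_mono mult_pos_pos zero_less_power) (auto simp: add_pos_nonneg)
      then show "0 \<le> 1 / (1 + norm x)^2 \<and> 1 / (1 + norm x)^2 \<le> 1 / (1 + (x \<bullet> b)\<^sup>2)" by simp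
    qed
    then show "norm (1 / (1 + norm x) ^ (2 * DIM('a))) \<le> norm (\<Prod>b\<in>Basis. 1 / (1 + (x \<bullet> b)\<^sup>2))"
      by (simp add: prod_nonneg power_mult power_divide)
  qed
qed measurable

text \<open>Mean value inequality that uses only the derivative in the direction \<open>h\<close>,
  on the segment itself. This keeps the pointwise decay of a single partial derivative
  usable.\<close>

lemma norm_diff_le_along:
  fixes \<psi> :: "'a::real_normed_vector \<Rightarrow> 'b::real_normed_vector"
  assumes D: "\<And>y. (\<psi> has_derivative \<psi>' y) (at y)"
    and B: "\<And>\<theta>. 0 \<le> \<theta> \<Longrightarrow> \<theta> \<le> 1 \<Longrightarrow> norm (\<psi>' (x + \<theta> *\<^sub>R h) h) \<le> B"
  shows "norm (\<psi> (x + h) - \<psi> x) \<le> B"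
proof -
  have d: "((\<lambda>\<theta>. \<psi> (x + \<theta> *\<^sub>R h)) has_derivative (\<lambda>s. \<psi>' (x + \<theta> *\<^sub>R h) (s *\<^sub>R h))) (at \<theta> within {0..1})" for \<theta> :: real
    by (rule has_derivative_compose[OF _ D]) (auto intro!: derivative_eq_intros)
  have "norm (\<psi> (x + 1 *\<^sub>R h) - \<psi> (x + 0 *\<^sub>R h)) \<le> B * norm (1 - 0 :: real)"
  proof (rule differentiable_bound[where S="{0..1}", OF _ d])
    fix \<theta> :: real assume t: "\<theta> \<in> {0..1}"
    have "linear (\<psi>' (x + \<theta> *\<^sub>R h))" using D by (rule has_derivative_linear)
    then have "norm (\<psi>' (x + \<theta> *\<^sub>R h) (s *\<^sub>R h)) \<le> B * norm s" for s
      using mult_left_mono[OF B[of \<theta>] abs_ge_zero[of s]] t by (simp add: linear_scale mult.commute)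
    then show "onorm (\<lambda>s. \<psi>' (x + \<theta> *\<^sub>R h) (s *\<^sub>R h)) \<le> B" by (rule onorm_le)
  qed auto
  then show ?thesis by simp
qed

section \<open>Fourier transform of Schwartz functions\<close>

lemma schwartz_norm_bound:
  assumes "\<phi> \<in> schwartz" obtains C where "C \<ge> 0" "\<And>x. norm x ^ k * norm (\<phi> x) \<le> C / (1 + norm (x::real^'n::finite)) ^ (2 * CARD('n))"
proof -
  obtain C where C: "C \<ge> 0" "\<And>x. norm (pderivs [] \<phi> x) \<le> C / (1 + norm x) ^ (k + 2 * CARD('n))" using schwartz_bound[OF assms] by metis
  have "norm x ^ k * norm (\<phi> x) \<le> C / (1 + norm x) ^ (2 * CARD('n))" for x
  proof -
    have "norm x ^ k * norm (\<phi> x) \<le> (1 + norm x) ^ k * (C / (1 + norm x) ^ (k + 2 * CARD('n)))"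
      using C(2)[of x] C(1) by (intro mult_mono power_mono) auto
    also have "\<dots> = C / (1 + norm x) ^ (2 * CARD('n))"
      using power_not_zero[of "1 + norm x" k] norm_ge_zero[of x] by (simp add: power_add)
    finally show ?thesis .
  qed
  then show ?thesis using that C by blast
qed

lemma schwartz_integrable_moment:
  fixes \<phi> :: "real^'n::finite \<Rightarrow> complex"
  assumes "\<phi> \<in> schwartz" shows "integrable lborel (\<lambda>x. norm x ^ k * norm (\<phi> x))"
proof -
  obtain C where C: "C \<ge> 0" "\<And>x. norm x ^ k * norm (\<phi> x) \<le> C / (1 + norm (x::real^'n)) ^ (2 * CARD('n))"
    using schwartz_norm_bound[OF assms] by metis
  have [measurable]: "\<phi> \<in> borel_measurable borel" using assms by (rule schwartz_borel)
  have "integrable lborel (\<lambda>x::real^'n. C * (1 / (1 + norm x) ^ (2 * DIM(real^'n))))"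
    by (intro Bochner_Integration.integrable_mult_right integrable_norm_decay)
  then show ?thesis
    by (rule Bochner_Integration.integrable_bound) (use C in \<open>auto simp: abs_mult\<close>)
qed

lemma schwartz_integrable: "\<phi> \<in> schwartz \<Longrightarrow> integrable lborel \<phi>"
  using schwartz_integrable_moment[of \<phi> 0] by (simp add: integrable_norm_iff schwartz_borel)

text \<open>Difference quotients have integral 0 by translation invariance, and the derivative is
  their dominated limit. The increments have length at most 1, so along them the weight 1 + |x|
  changes by a factor at most 2; hence \<open>2 ^ ?N\<close> in the majorant.\<close>

lemma integral_partial_schwartz:
  fixes \<psi> :: "real^'n::finite \<Rightarrow> complex"
  assumes \<psi>: "\<psi> \<in> schwartz"
  shows "(LINT x|lborel. frechet_derivative \<psi> (at x) (axis i 1)) = 0"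
proof -
  let ?e = "axis i 1 :: real^'n"
  let ?D = "\<lambda>x. frechet_derivative \<psi> (at x)"
  have D: "(\<psi> has_derivative ?D x) (at x)" for x
    using smooth_fun_has_derivative[OF schwartz_smooth[OF \<psi>], of "[]"] by simp
  have [measurable]: "\<psi> \<in> borel_measurable borel" using \<psi> by (rule schwartz_borel)
  have pd: "pderivs [i] \<psi> \<in> schwartz" using \<psi> by (rule schwartz_pderivs)
  have [measurable]: "(\<lambda>x. ?D x ?e) \<in> borel_measurable borel" using schwartz_borel[OF pd] by simp
  let ?N = "2 * CARD('n)"
  obtain C where C: "C \<ge> 0" "\<And>x. norm (?D x ?e) \<le> C / (1 + norm x) ^ ?N"
    using schwartz_bound[OF pd, of "[]" ?N] by auto
  let ?h = "\<lambda>m. inverse (real (Suc m))"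
  let ?q = "\<lambda>m x. (\<psi> (x + ?h m *\<^sub>R ?e) - \<psi> x) /\<^sub>R ?h m"
  have q0: "(LINT x|lborel. ?q m x) = 0" for m
  proof -
    have "(LINT x|lborel. \<psi> (x + ?h m *\<^sub>R ?e)) = (LINT x|lborel. \<psi> x)"
      using lborel_shift(1)[of \<psi> "?h m *\<^sub>R ?e"] by (simp add: add.commute)
    moreover have "integrable lborel (\<lambda>x. \<psi> (x + ?h m *\<^sub>R ?e))"
      using lborel_shift(3)[of \<psi> "?h m *\<^sub>R ?e"] schwartz_integrable[OF \<psi>] by (simp add: add.commute)
    ultimately show ?thesis using schwartz_integrable[OF \<psi>] by simp
  qed
  have "(\<lambda>m. LINT x|lborel. ?q m x) \<longlonglongrightarrow> (LINT x|lborel. ?D x ?e)"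
  proof (rule integral_dominated_convergence[where w="\<lambda>x. (C * 2 ^ ?N) * (1 / (1 + norm x) ^ ?N)"])
    show "integrable lborel (\<lambda>x::real^'n. (C * 2 ^ ?N) * (1 / (1 + norm x) ^ ?N))"
      using integrable_norm_decay[where 'a="real^'n"] by (intro Bochner_Integration.integrable_mult_right) simp
    show "AE x in lborel. (\<lambda>m. ?q m x) \<longlonglongrightarrow> ?D x ?e"
    proof (rule AE_I2)
      fix x
      have "((\<lambda>t. \<psi> (x + t *\<^sub>R ?e)) has_derivative (\<lambda>s. ?D (x + 0 *\<^sub>R ?e) (s *\<^sub>R ?e))) (at 0)"
        by (rule has_derivative_compose[OF _ D]) (auto intro!: derivative_eq_intros)
      moreover have "linear (?D x)" using D by (rule has_derivative_linear)
      ultimately have "((\<lambda>t. \<psi> (x + t *\<^sub>R ?e)) has_derivative (\<lambda>s. s *\<^sub>R ?D x ?e)) (at 0)"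
        by (simp add: linear_scale)
      then have "((\<lambda>t. norm (\<psi> (x + t *\<^sub>R ?e) - \<psi> x - t *\<^sub>R ?D x ?e) / norm t) \<longlongrightarrow> 0) (at 0)"
        by (simp add: has_derivative_iff_norm)
      moreover have "\<forall>\<^sub>F t in at 0. norm (\<psi> (x + t *\<^sub>R ?e) - \<psi> x - t *\<^sub>R ?D x ?e) / norm t = norm ((\<psi> (x + t *\<^sub>R ?e) - \<psi> x) /\<^sub>R t - ?D x ?e)"
        unfolding eventually_at_filter
      proof (rule always_eventually, intro allI impI)
        fix t :: real assume "t \<noteq> 0"
        then have "(\<psi> (x + t *\<^sub>R ?e) - \<psi> x) /\<^sub>R t - ?D x ?e = (\<psi> (x + t *\<^sub>R ?e) - \<psi> x - t *\<^sub>R ?D x ?e) /\<^sub>R t"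
          by (simp add: scaleR_diff_right)
        then show "norm (\<psi> (x + t *\<^sub>R ?e) - \<psi> x - t *\<^sub>R ?D x ?e) / norm t = norm ((\<psi> (x + t *\<^sub>R ?e) - \<psi> x) /\<^sub>R t - ?D x ?e)"
          by (simp add: divide_inverse mult.commute)
      qed
      ultimately have "((\<lambda>t. norm ((\<psi> (x + t *\<^sub>R ?e) - \<psi> x) /\<^sub>R t - ?D x ?e)) \<longlongrightarrow> 0) (at 0)"
        by (rule Lim_transform_eventually)
      then have lim: "((\<lambda>t. (\<psi> (x + t *\<^sub>R ?e) - \<psi> x) /\<^sub>R t) \<longlongrightarrow> ?D x ?e) (at 0)"
        by (rule LIM_zero_cancel[OF tendsto_norm_zero_cancel])
      have "filterlim ?h (at 0) sequentially"
        using LIMSEQ_inverse_real_of_nat by (auto simp: filterlim_at)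
      from filterlim_compose[OF lim this] show "(\<lambda>m. ?q m x) \<longlonglongrightarrow> ?D x ?e" .
    qed
    show "AE x in lborel. norm (?q m x) \<le> (C * 2 ^ ?N) * (1 / (1 + norm x) ^ ?N)" for m
    proof (rule AE_I2)
      fix x :: "real^'n"
      have aux: "a \<le> b + 1 \<Longrightarrow> 0 \<le> b \<Longrightarrow> 1 + a \<le> 2 * (1 + b)" for a b :: real by simp
      have h01: "?h m > 0" "?h m \<le> 1" by (auto simp: inverse_le_1_iff)
      have "norm (\<psi> (x + ?h m *\<^sub>R ?e) - \<psi> x) \<le> ?h m * ((C * 2 ^ ?N) * (1 / (1 + norm x) ^ ?N))"
      proof (rule norm_diff_le_along[OF D])
        fix \<theta> :: real assume t: "0 \<le> \<theta>" "\<theta> \<le> 1"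
        let ?y = "x + \<theta> *\<^sub>R (?h m *\<^sub>R ?e)"
        have "norm (\<theta> *\<^sub>R (?h m *\<^sub>R ?e)) \<le> 1" using t h01 by (simp add: mult_le_one)
        then have "norm x \<le> norm ?y + 1" using norm_triangle_ineq4[of ?y "\<theta> *\<^sub>R (?h m *\<^sub>R ?e)"] by simp
        then have le: "1 + norm x \<le> 2 * (1 + norm ?y)"
          using norm_ge_zero[of ?y] by (rule aux)
        have "(1 + norm x) ^ ?N \<le> 2 ^ ?N * (1 + norm ?y) ^ ?N"
          unfolding power_mult_distrib[symmetric] using le by (intro power_mono) auto
        then have le2: "C / (1 + norm ?y) ^ ?N \<le> (C * 2 ^ ?N) * (1 / (1 + norm x) ^ ?N)"
          using C(1) by (simp add: field_simps add_pos_nonneg mult_left_mono)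
        have eq: "?D ?y (?h m *\<^sub>R ?e) = ?h m *\<^sub>R ?D ?y ?e"
          using has_derivative_linear[OF D] by (simp add: linear_scale)
        show "norm (?D ?y (?h m *\<^sub>R ?e)) \<le> ?h m * ((C * 2 ^ ?N) * (1 / (1 + norm x) ^ ?N))"
          unfolding eq norm_scaleR abs_of_pos[OF h01(1)]
          by (intro mult_left_mono order_trans[OF C(2) le2] less_imp_le[OF h01(1)])
      qed
      moreover have "h > 0 \<Longrightarrow> norm v \<le> h * B \<Longrightarrow> norm (v /\<^sub>R h) \<le> B" for h B :: real and v :: complex
        by (simp add: field_simps)
      ultimately show "norm (?q m x) \<le> (C * 2 ^ ?N) * (1 / (1 + norm x) ^ ?N)" using h01(1) by blast
    qed
  qed measurable
  from LIMSEQ_unique[OF tendsto_const this[unfolded q0]] show ?thesis by simp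
qed

text \<open>Integration by parts: the derivative of the product of \<open>\<phi>\<close> with the
  character has integral 0.\<close>

lemma FT_partial:
  fixes \<phi> :: "real^'n::finite \<Rightarrow> complex"
  assumes \<phi>: "\<phi> \<in> schwartz"
  shows "FT (\<lambda>x. frechet_derivative \<phi> (at x) (axis i 1)) \<xi> = \<i> * (\<xi> $ i) * FT \<phi> \<xi>"
proof -
  let ?e = "axis i 1 :: real^'n"
  have s: "slow (\<lambda>x. cis (x \<bullet> (- \<xi>)))" by (rule slow_cis)
  have p: "(\<lambda>x. cis (x \<bullet> (- \<xi>)) * \<phi> x) \<in> schwartz" using slow_mult_schwartz[OF s \<phi>] .
  have sm: "smooth_fun (\<lambda>x. cis (x \<bullet> (- \<xi>)))" using s by (simp add: slow_def)
  have "frechet_derivative (\<lambda>x. cis (x \<bullet> (- \<xi>)) * \<phi> x) (at x) ?e =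
     cis (- (x \<bullet> \<xi>)) * frechet_derivative \<phi> (at x) ?e - \<i> * (\<xi> $ i) * (cis (- (x \<bullet> \<xi>)) * \<phi> x)" for x
    using fun_cong[OF pderivs_mult(1)[OF sm schwartz_smooth[OF \<phi>], of "[i]"], of x] partial_cis[of "- \<xi>" x i]
    by (simp add: algebra_simps)
  moreover have "integrable lborel (\<lambda>x. cis (- (x \<bullet> \<xi>)) * frechet_derivative \<phi> (at x) ?e)"
    using schwartz_integrable[OF schwartz_pderivs[OF \<phi>, of "[i]"]] by (intro integrable_cis_mult) simp
  moreover have "integrable lborel (\<lambda>x. \<i> * (\<xi> $ i) * (cis (- (x \<bullet> \<xi>)) * \<phi> x))"
    by (intro Bochner_Integration.integrable_mult_right integrable_cis_mult schwartz_integrable \<phi>)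
  ultimately have "0 = FT (\<lambda>x. frechet_derivative \<phi> (at x) ?e) \<xi> - \<i> * (\<xi> $ i) * FT \<phi> \<xi>"
    using integral_partial_schwartz[OF p, of i] unfolding FT_def by simp
  then show ?thesis by simp
qed

lemma FT_norm_le:
  assumes "integrable lborel \<phi>" shows "norm (FT \<phi> \<xi>) \<le> (LINT x|lborel. norm (\<phi> x))"
  unfolding FT_def using assms by (intro norm_integral_le) (auto simp: norm_mult)

text \<open>The Taylor remainder of the character is at most (x . h)^2, so the second absolute
  moment of \<open>\<phi>\<close> controls the error quadratically in h.\<close>

lemma FT_has_derivative:
  fixes \<phi> :: "real^'n::finite \<Rightarrow> complex"
  assumes \<phi>: "\<phi> \<in> schwartz"
  shows "(FT \<phi> has_derivative (\<lambda>h. LINT x|lborel. (x \<bullet> h) *\<^sub>R (- \<i> * cis (- (x \<bullet> \<xi>)) * \<phi> x))) (at \<xi>)"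
proof -
  let ?G = "\<lambda>x. - \<i> * cis (- (x \<bullet> \<xi>)) * \<phi> x"
  let ?F = "\<lambda>h. LINT x|lborel. (x \<bullet> h) *\<^sub>R ?G x"
  have [measurable]: "\<phi> \<in> borel_measurable borel" using \<phi> by (rule schwartz_borel)
  have i1: "integrable lborel (\<lambda>x. norm x * norm (\<phi> x))" using schwartz_integrable_moment[OF \<phi>, of 1] by simp
  have i2: "integrable lborel (\<lambda>x. norm x ^ 2 * norm (\<phi> x))" using schwartz_integrable_moment[OF \<phi>, of 2] .
  have le1: "norm ((x \<bullet> h) *\<^sub>R ?G x) \<le> (norm x * norm (\<phi> x)) * norm h" for x h
    using mult_right_mono[OF Cauchy_Schwarz_ineq2[of x h] norm_ge_zero[of "\<phi> x"]] by (simp add: norm_mult mult_ac)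
  have iG: "integrable lborel (\<lambda>x. (x \<bullet> h) *\<^sub>R ?G x)" for h
    by (rule Bochner_Integration.integrable_bound[OF integrable_mult_left[OF i1, of "norm h"]])
       (use le1[of _ h] in \<open>auto simp: abs_mult intro: order_trans\<close>)
  have bl: "bounded_linear ?F"
  proof (rule bounded_linear_intro[where K="LINT x|lborel. norm x * norm (\<phi> x)"])
    show "?F (x + y) = ?F x + ?F y" for x y
      unfolding inner_add_right scaleR_add_left by (rule Bochner_Integration.integral_add[OF iG iG])
    show "?F (r *\<^sub>R x) = r *\<^sub>R ?F x" for r x
      unfolding inner_scaleR_right scaleR_scaleR[symmetric] by (rule integral_scaleR_right)
    show "norm (?F h) \<le> norm h * (LINT x|lborel. norm x * norm (\<phi> x))" for h
    proof -
      have "norm (?F h) \<le> (LINT x|lborel. (norm x * norm (\<phi> x)) * norm h)"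
        by (rule norm_integral_le[OF _ le1]) (rule integrable_mult_left[OF i1])
      then show ?thesis by (simp add: mult.commute)
    qed
  qed
  show ?thesis
  proof (rule has_derivativeI_sandwich[where e=1 and H="\<lambda>y. (LINT x|lborel. norm x ^ 2 * norm (\<phi> x)) * norm (y - \<xi>)", OF _ bl])
    have "((\<lambda>y. (LINT x|lborel. norm x ^ 2 * norm (\<phi> x)) * norm (y - \<xi>)) \<longlongrightarrow> (LINT x|lborel. norm x ^ 2 * norm (\<phi> x)) * norm (\<xi> - \<xi>)) (at \<xi>)"
      by (intro tendsto_intros)
    then show "((\<lambda>y. (LINT x|lborel. norm x ^ 2 * norm (\<phi> x)) * norm (y - \<xi>)) \<longlongrightarrow> 0) (at \<xi>)" by simp
    fix y :: "real^'n" assume y: "y \<noteq> \<xi>"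
    let ?h = "y - \<xi>"
    have r: "norm (cis (- b) - 1 + \<i> * b) \<le> b ^ 2" for b :: real
    proof -
      have eq: "cis (- b) - 1 + \<i> * b = iexp (- b) - (\<Sum>k\<le>1. (\<i> * complex_of_real (- b)) ^ k / fact k)"
        by (simp add: cis_conv_exp)
      have "norm (cis (- b) - 1 + \<i> * b) \<le> \<bar>- b\<bar> ^ Suc 1 / fact (Suc 1)"
        unfolding eq by (rule iexp_approx1)
      also have "\<dots> = b\<^sup>2 / 2" by (simp add: numeral_2_eq_2[symmetric])
      finally show ?thesis using zero_le_power2[of b] by linarith
    qed
    have "FT \<phi> y - FT \<phi> \<xi> - ?F ?h = (LINT x|lborel. (cis (- (x \<bullet> y)) * \<phi> x - cis (- (x \<bullet> \<xi>)) * \<phi> x) - (x \<bullet> ?h) *\<^sub>R ?G x)"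
      unfolding FT_def
      by (subst Bochner_Integration.integral_diff[OF _ iG], simp add: integrable_cis_mult schwartz_integrable[OF \<phi>])
         (simp add: integrable_cis_mult schwartz_integrable[OF \<phi>])
    also have "norm \<dots> \<le> (LINT x|lborel. (norm x ^ 2 * norm (\<phi> x)) * (norm ?h)^2)"
    proof (rule norm_integral_le)
      show "integrable lborel (\<lambda>x. (norm x ^ 2 * norm (\<phi> x)) * (norm ?h)^2)" by (rule integrable_mult_left[OF i2])
      fix x :: "real^'n"
      have "(cis (- (x \<bullet> y)) * \<phi> x - cis (- (x \<bullet> \<xi>)) * \<phi> x) - (x \<bullet> ?h) *\<^sub>R ?G x
        = (cis (- (x \<bullet> ?h)) - 1 + \<i> * (x \<bullet> ?h)) * (cis (- (x \<bullet> \<xi>)) * \<phi> x)"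
      proof -
        have "cis (- (x \<bullet> y)) = cis (- (x \<bullet> ?h)) * cis (- (x \<bullet> \<xi>))" by (simp add: cis_mult inner_diff_right)
        then show ?thesis by (simp add: algebra_simps scaleR_conv_of_real)
      qed
      also have "norm \<dots> \<le> (x \<bullet> ?h)^2 * norm (\<phi> x)"
        unfolding norm_mult norm_cis using r by (simp add: mult_right_mono)
      also have "\<dots> \<le> (norm x * norm ?h)^2 * norm (\<phi> x)"
        using Cauchy_Schwarz_ineq2[of x ?h] by (intro mult_right_mono) (auto simp: abs_le_square_iff[symmetric] abs_mult)
      finally show "norm ((cis (- (x \<bullet> y)) * \<phi> x - cis (- (x \<bullet> \<xi>)) * \<phi> x) - (x \<bullet> ?h) *\<^sub>R ?G x) \<le> (norm x ^ 2 * norm (\<phi> x)) * (norm ?h)^2"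
        by (simp add: power_mult_distrib mult_ac)
    qed
    finally have "norm (FT \<phi> y - FT \<phi> \<xi> - ?F ?h) \<le> (LINT x|lborel. norm x ^ 2 * norm (\<phi> x)) * (norm ?h)^2" by simp
    then show "norm (FT \<phi> y - FT \<phi> \<xi> - ?F ?h) / norm ?h \<le> (LINT x|lborel. norm x ^ 2 * norm (\<phi> x)) * norm ?h"
      using y by (simp add: divide_le_eq power2_eq_square mult_ac)
  qed simp
qed

text \<open>Smoothness: transforms of Schwartz functions are closed under partial derivatives, which
  become multiplication by -i x_i before the transform. Decay: each factor 1 + |xi| is bounded by 1
  plus the sum of the |xi_i|, and every xi_i is traded for a derivative of the function
  transformed.\<close>

lemma FT_schwartz:
  fixes \<phi> :: "real^'n::finite \<Rightarrow> complex"
  assumes \<phi>: "\<phi> \<in> schwartz"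
  shows "FT \<phi> \<in> schwartz"
  unfolding schwartz_iff
proof (intro conjI allI)
  let ?P = "\<lambda>f :: real^'n \<Rightarrow> complex. \<exists>\<phi>\<in>schwartz. f = FT \<phi>"
  have P0: "?P (FT \<phi>)" using \<phi> by blast
  have P1: "\<forall>x. f differentiable at x" if "?P f" for f using that differentiableI[OF FT_has_derivative] by auto
  have P2: "?P (\<lambda>x. frechet_derivative f (at x) (axis i 1))" if Pf: "?P f" for f i
  proof -
    obtain \<phi> where f: "f = FT \<phi>" and \<phi>: "\<phi> \<in> schwartz" using Pf by blast
    have "(\<lambda>x. frechet_derivative f (at x) (axis i 1)) = FT (\<lambda>x. (- \<i>) * (complex_of_real (x $ i) * \<phi> x))"
      unfolding f partial_eq[OF FT_has_derivative[OF \<phi>]] by (simp add: FT_def) (simp add: inner_axis scaleR_conv_of_real mult_ac)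
    moreover have "(\<lambda>x. (- \<i>) * (complex_of_real (x $ i) * \<phi> x)) \<in> schwartz"
      by (intro schwartz_cmult slow_mult_schwartz slow_coord \<phi>)
    ultimately show ?thesis by blast
  qed
  show "smooth_fun (FT \<phi>)" by (rule pderivs_coinduct(2)[of ?P, OF P0 P1 P2])
  fix k "is"
  obtain \<psi> where \<psi>: "\<psi> \<in> schwartz" "pderivs is (FT \<phi>) = FT \<psi>"
    using pderivs_coinduct(1)[of ?P, OF P0 P1 P2] by blast
  have "\<exists>C. \<forall>\<xi>. (1 + norm \<xi>) ^ k * norm (FT \<psi> \<xi>) \<le> C" using \<psi>(1)
  proof (induction k arbitrary: \<psi>)
    case 0
    then show ?case using FT_norm_le[OF schwartz_integrable] by auto
  next
    case (Suc k)
    let ?\<psi> = "\<lambda>i x. frechet_derivative \<psi> (at x) (axis i 1)"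
    have "?\<psi> i \<in> schwartz" for i using schwartz_pderivs[OF Suc.prems, of "[i]"] by simp
    from Suc.IH[OF this] obtain C where C: "\<And>i \<xi>. (1 + norm \<xi>) ^ k * norm (FT (?\<psi> i) \<xi>) \<le> C i" by metis
    from Suc.IH[OF Suc.prems] obtain C0 where C0: "\<And>\<xi>. (1 + norm \<xi>) ^ k * norm (FT \<psi> \<xi>) \<le> C0" by blast
    have "(1 + norm \<xi>) ^ Suc k * norm (FT \<psi> \<xi>) \<le> C0 + (\<Sum>i\<in>UNIV. C i)" for \<xi>
    proof -
      have "(1 + norm \<xi>) ^ Suc k * norm (FT \<psi> \<xi>) \<le> (1 + (\<Sum>i\<in>UNIV. \<bar>\<xi> $ i\<bar>)) * ((1 + norm \<xi>) ^ k * norm (FT \<psi> \<xi>))"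
        using norm_le_l1_cart[of \<xi>] unfolding power_Suc mult.assoc by (intro mult_right_mono) auto
      also have "\<dots> = (1 + norm \<xi>) ^ k * norm (FT \<psi> \<xi>) + (\<Sum>i\<in>UNIV. (1 + norm \<xi>) ^ k * norm (FT (?\<psi> i) \<xi>))"
        unfolding FT_partial[OF Suc.prems] by (simp add: norm_mult ring_distribs sum_distrib_left sum_distrib_right mult_ac)
      also have "\<dots> \<le> C0 + (\<Sum>i\<in>UNIV. C i)" using C C0 by (intro add_mono sum_mono) auto
      finally show ?thesis .
    qed
    then show ?case by blast
  qed
  then show "\<exists>C. \<forall>x. (1 + norm x) ^ k * norm (pderivs is (FT \<phi>) x) \<le> C" unfolding \<psi>(2) .
qed

lemma iFT_eq_FT: "iFT \<phi> x = complex_of_real (1 / (2 * pi) ^ CARD('n)) * FT \<phi> (- (x::real^'n::finite))"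
  unfolding iFT_def FT_def by (simp add: inner_commute)

lemma iFT_schwartz:
  fixes \<phi> :: "real^'n::finite \<Rightarrow> complex"
  assumes \<phi>: "\<phi> \<in> schwartz" shows "iFT \<phi> \<in> schwartz"
proof -
  have "(\<lambda>x. FT \<phi> (diag_affine 0 (\<lambda>_. -1) x)) \<in> schwartz"
    by (intro schwartz_diag_affine FT_schwartz \<phi>) auto
  moreover have "diag_affine 0 (\<lambda>_. -1) x = - x" for x :: "real^'n" by (auto simp: diag_affine_def vec_eq_iff)
  ultimately show ?thesis unfolding iFT_eq_FT[abs_def] by (intro schwartz_cmult) simp
qed

lemma AE_eq_continuous:
  fixes f g :: "'a::euclidean_space \<Rightarrow> complex"
  assumes f: "continuous_on UNIV f" and g: "continuous_on UNIV g" and ae: "AE x in lborel. f x = g x"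
  shows "f = g"
proof
  fix x
  have "closed {x. f x = g x}" using f g by (intro closed_Collect_eq)
  moreover have "AE x\<in>UNIV in lebesgue. x \<in> {x. f x = g x}"
    using ae by (intro AE_completion) auto
  ultimately have "x \<in> {x. f x = g x}" using mem_closed_if_AE_lebesgue_open[of UNIV "{x. f x = g x}" x] by auto
  then show "f x = g x" by simp
qed

text \<open>Both sides are continuous, which upgrades inversion from almost everywhere to
  everywhere.\<close>

lemma iFT_FT:
  fixes \<phi> :: "real^'n::finite \<Rightarrow> complex"
  assumes \<phi>: "\<phi> \<in> schwartz" shows "iFT (FT \<phi>) = \<phi>"
proof (rule AE_eq_continuous)
  show "continuous_on UNIV (iFT (FT \<phi>))" "continuous_on UNIV \<phi>"
    using \<phi> by (auto intro!: smooth_fun_continuous0 schwartz_smooth iFT_schwartz FT_schwartz)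
  have "AE x in lborel. (2*pi)^DIM(real^'n) * \<phi> x = (LINT \<xi>|lborel. cis (x \<bullet> \<xi>) * FT \<phi> \<xi>)"
    using fourier_inversion_AE[OF schwartz_integrable[OF \<phi>]] schwartz_integrable[OF FT_schwartz[OF \<phi>]]
    unfolding FT_def by blast
  then show "AE x in lborel. iFT (FT \<phi>) x = \<phi> x"
    by (rule AE_mp) (auto intro!: AE_I2 simp: iFT_def field_simps)
qed

lemma FT_iFT:
  fixes \<phi> :: "real^'n::finite \<Rightarrow> complex"
  assumes \<phi>: "\<phi> \<in> schwartz" shows "FT (iFT \<phi>) = \<phi>"
proof
  fix \<xi>
  have "FT (iFT \<phi>) \<xi> = complex_of_real (1 / (2 * pi) ^ CARD('n)) * (LINT x|lborel. cis (- (x \<bullet> \<xi>)) * FT \<phi> (- x))"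
    unfolding FT_def[of "iFT \<phi>"] iFT_eq_FT by (simp add: mult_ac flip: integral_mult_right_zero)
  also have "(LINT x|lborel. cis (- (x \<bullet> \<xi>)) * FT \<phi> (- x)) = (LINT x|lborel. cis (\<xi> \<bullet> x) * FT \<phi> x)"
    using lborel_shift(2)[of "\<lambda>x. cis (\<xi> \<bullet> x) * FT \<phi> x" 0] schwartz_borel[OF FT_schwartz[OF \<phi>]]
    by (simp add: inner_commute)
  finally show "FT (iFT \<phi>) \<xi> = \<phi> \<xi>"
    using fun_cong[OF iFT_FT[OF \<phi>], of \<xi>] by (simp add: iFT_def)
qed

section \<open>Inequalities for p-th powers\<close>

text \<open>At x = 0 both sides are 0 whatever the exponents, since \<open>0 powr a = 0\<close> even
  for a = 0; this removes many case distinctions.\<close>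

lemma powr_mult_self: "(x::real) \<ge> 0 \<Longrightarrow> x powr a * x = x powr (a + 1)"
  by (cases "x = 0") (auto simp: powr_add)

text \<open>The graph of a -> a^p lies above its tangent at \<open>c\<close>. The Jensen-type bounds
  below come from averaging this inequality at a suitable \<open>c\<close>.\<close>

lemma powr_tangent:
  fixes a c p :: real
  assumes "p \<ge> 1" "a \<ge> 0" "c \<ge> 0"
  shows "p * c powr (p - 1) * a \<le> a powr p + (p - 1) * c powr p"
proof (cases "p = 1")
  case True
  then show ?thesis using assms by (cases "c = 0") auto
next
  case False
  then have p: "p > 1" using assms by simp
  have "a * c powr (p - 1) \<le> a powr p / p + (c powr (p - 1)) powr (p / (p - 1)) / (p / (p - 1))"
    using p assms by (intro Youngs_inequality) (auto simp: field_simps)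
  also have "(c powr (p - 1)) powr (p / (p - 1)) = c powr p" using p by (simp add: powr_powr)
  finally show ?thesis using p by (simp add: field_simps)
qed

text \<open>Jensen's inequality for the quotients \<open>d k / w k\<close> with weights
  \<open>w k\<close>, obtained from the tangent at their mean \<open>?c\<close>.\<close>

lemma sum_powr_le:
  fixes d w :: "'k \<Rightarrow> real" and p :: real
  assumes K: "finite K" and p: "p \<ge> 1" and d: "\<And>k. k \<in> K \<Longrightarrow> d k \<ge> 0" and w: "\<And>k. k \<in> K \<Longrightarrow> w k > 0"
  shows "(\<Sum>k\<in>K. d k) powr p \<le> (\<Sum>k\<in>K. w k) powr (p - 1) * (\<Sum>k\<in>K. w k powr (1 - p) * d k powr p)"
proof (cases "K = {}")
  case False
  let ?W = "\<Sum>k\<in>K. w k" let ?D = "\<Sum>k\<in>K. d k" let ?c = "?D / ?W"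
  have W: "?W > 0" using K False w by (intro sum_pos) auto
  have D: "?D \<ge> 0" using d by (intro sum_nonneg) auto
  have c: "?c \<ge> 0" using W D by simp
  have 1: "p * ?c powr (p - 1) * d k \<le> w k powr (1 - p) * d k powr p + (p - 1) * ?c powr p * w k" if k: "k \<in> K" for k
  proof -
    have "w k * (p * ?c powr (p - 1) * (d k / w k)) \<le> w k * ((d k / w k) powr p + (p - 1) * ?c powr p)"
      using powr_tangent[OF p _ c, of "d k / w k"] d[OF k] w[OF k] by (intro mult_left_mono) auto
    moreover have "w k * (d k / w k) powr p = w k powr (1 - p) * d k powr p"
      using d[OF k] w[OF k] by (simp add: powr_divide powr_diff)
    ultimately show ?thesis using w[OF k] by (simp add: algebra_simps)
  qed
  have "(\<Sum>k\<in>K. p * ?c powr (p - 1) * d k) \<le> (\<Sum>k\<in>K. w k powr (1 - p) * d k powr p + (p - 1) * ?c powr p * w k)"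
    by (intro sum_mono 1)
  then have "p * ?c powr (p - 1) * ?D \<le> (\<Sum>k\<in>K. w k powr (1 - p) * d k powr p) + (p - 1) * ?c powr p * ?W"
    by (simp add: sum.distrib sum_distrib_left)
  moreover have "?c powr (p - 1) * ?D = ?c powr p * ?W"
    using powr_mult_self[OF c, of "p - 1"] W by (simp add: field_simps)
  ultimately have "p * (?c powr p * ?W) \<le> (\<Sum>k\<in>K. w k powr (1 - p) * d k powr p) + (p - 1) * (?c powr p * ?W)"
    by (simp add: mult.assoc)
  then have "?c powr p * ?W \<le> (\<Sum>k\<in>K. w k powr (1 - p) * d k powr p)" by (simp add: algebra_simps)
  then have "?W powr (p - 1) * (?c powr p * ?W) \<le> ?W powr (p - 1) * (\<Sum>k\<in>K. w k powr (1 - p) * d k powr p)"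
    by (intro mult_left_mono) auto
  moreover have "?W powr (p - 1) * (?c powr p * ?W) = ?D powr p"
  proof -
    have "?W powr (p - 1) * (?c powr p * ?W) = ?c powr p * (?W powr (p - 1) * ?W)" by (simp only: mult_ac)
    also have "\<dots> = ?c powr p * ?W powr p" using W powr_mult_self[of ?W "p - 1"] by simp
    also have "\<dots> = (?c * ?W) powr p" using W c by (subst powr_mult) auto
    finally show ?thesis using W by simp
  qed
  ultimately show ?thesis by simp
qed simp

lemma powr_add_le:
  fixes a b p :: real assumes "a \<ge> 0" "b \<ge> 0" "p > 0"
  shows "(a + b) powr p \<le> 2 powr p * (a powr p + b powr p)"
proof -
  have "(a + b) powr p \<le> (2 * max a b) powr p" using assms by (intro powr_mono2) auto
  also have "\<dots> = 2 powr p * max a b powr p" using assms by (subst powr_mult) auto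
  also have "max a b powr p \<le> a powr p + b powr p" by (auto simp: max_def)
  finally show ?thesis by simp
qed

lemma powr_sum_le_subadd:
  fixes d :: "'k \<Rightarrow> real"
  assumes "finite K" "0 < p" "p \<le> 1" "\<And>k. k \<in> K \<Longrightarrow> d k \<ge> 0"
  shows "(\<Sum>k\<in>K. d k) powr p \<le> (\<Sum>k\<in>K. d k powr p)"
  using assms
proof (induction rule: finite_induct)
  case (insert k K)
  have sub: "(a + b) powr p \<le> a powr p + b powr p" if "a \<ge> 0" "b \<ge> 0" for a b :: real
  proof (cases "a + b = 0")
    case False
    then have s: "a + b > 0" using that by simp
    \<comment> \<open>After normalisation both ratios lie in [0,1], where x <= x^p.\<close>
    have "a / (a + b) \<le> (a / (a + b)) powr p" "b / (a + b) \<le> (b / (a + b)) powr p"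
      using powr_mono'[of p 1 "a / (a + b)"] powr_mono'[of p 1 "b / (a + b)"] assms that s by auto
    then have "1 \<le> (a / (a + b)) powr p + (b / (a + b)) powr p"
      using s add_divide_distrib[of a b "a + b"] by simp
    also have "\<dots> = (a powr p + b powr p) / (a + b) powr p" using that s by (simp add: powr_divide add_divide_distrib)
    finally show ?thesis using s by (simp add: field_simps)
  qed (use that assms in auto)
  have "(\<Sum>k\<in>insert k K. d k) powr p \<le> d k powr p + (\<Sum>k\<in>K. d k) powr p"
    using insert sub[of "d k" "\<Sum>k\<in>K. d k"] by (simp add: sum_nonneg)
  also have "\<dots> \<le> d k powr p + (\<Sum>k\<in>K. d k powr p)" using insert by simp
  finally show ?case using insert by simp
qed simp

text \<open>Up to the factor \<open>p\<close>, the (conjugate) gradient of \<open>z \<mapsto> |z|^p\<close>.\<close>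
definition Fp :: "real \<Rightarrow> complex \<Rightarrow> complex" where
  "Fp p z = complex_of_real (norm z powr (p - 2)) * cnj z"

lemma norm_Fp: "p > 1 \<Longrightarrow> norm (Fp p z) = norm z powr (p - 1)"
  using powr_mult_self[of "norm z" "p - 2"] by (simp add: Fp_def norm_mult)

lemma Fp_borel [measurable]: "Fp p \<in> borel_measurable borel"
proof -
  have [measurable]: "cnj \<in> borel_measurable borel" by (intro borel_measurable_continuous_onI continuous_intros)
  show ?thesis unfolding Fp_def[abs_def] by measurable
qed

text \<open>Tangent inequality for |z|^p at the point \<open>c\<close>, evaluated at
  \<open>c - g\<close>. The tangent sits at \<open>c\<close> because in the telescoping
  \<open>c\<close> is the newest partial sum and \<open>g\<close> its last summand.\<close>

lemma powr_norm_convex: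
  fixes c g :: complex
  assumes p: "p > 1"
  shows "norm c powr p \<le> norm (c - g) powr p + p * Re (Fp p c * g)"
proof -
  have "Re (Fp p c * (c - g)) \<le> norm (Fp p c) * norm (c - g)"
    using complex_Re_le_cmod[of "Fp p c * (c - g)"] by (simp add: norm_mult)
  then have "p * Re (Fp p c * (c - g)) \<le> p * (norm c powr (p - 1) * norm (c - g))"
    using p by (simp add: norm_Fp)
  also have "\<dots> \<le> norm (c - g) powr p + (p - 1) * norm c powr p"
    using powr_tangent[of p "norm (c - g)" "norm c"] p by simp
  finally have 1: "p * Re (Fp p c * (c - g)) \<le> norm (c - g) powr p + (p - 1) * norm c powr p" .
  have "Fp p c * c = complex_of_real (norm c powr (p - 2)) * complex_of_real ((norm c)\<^sup>2)"
    unfolding Fp_def using complex_norm_square[of c] by (simp add: mult_ac)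
  moreover have "norm c powr (p - 2) * (norm c)\<^sup>2 = norm c powr p"
    using powr_mult_self[of "norm c" "p - 2"] powr_mult_self[of "norm c" "p - 1"] by (simp add: power2_eq_square mult.assoc[symmetric])
  ultimately have "Fp p c * c = complex_of_real (norm c powr p)" by (metis of_real_mult)
  then have "Re (Fp p c * (c - g)) = norm c powr p - Re (Fp p c * g)" by (simp add: right_diff_distrib)
  then show ?thesis using 1 by (simp add: algebra_simps)
qed

lemma powr_mvt:
  fixes x y \<alpha> :: real
  assumes "0 < y" "y < x"
  obtains z where "y < z" "z < x" "x powr \<alpha> - y powr \<alpha> = (x - y) * (\<alpha> * z powr (\<alpha> - 1))"
proof -
  have "\<exists>z. y < z \<and> z < x \<and> x powr \<alpha> - y powr \<alpha> = (x - y) * (\<alpha> * z powr (\<alpha> - 1))"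
    using assms by (intro MVT2) (auto intro!: derivative_eq_intros simp: powr_diff)
  then show ?thesis using that by blast
qed

lemma Fp_diff_eq: "Fp p a - Fp p b = complex_of_real (norm a powr (p - 2)) * cnj (a - b) + complex_of_real (norm a powr (p - 2) - norm b powr (p - 2)) * cnj b"
  by (simp add: Fp_def algebra_simps)

lemma Fp_diff_norm_le:
  "norm (Fp p a - Fp p b) \<le> norm a powr (p - 2) * norm (a - b) + \<bar>norm a powr (p - 2) - norm b powr (p - 2)\<bar> * norm b"
proof -
  have "norm (Fp p a - Fp p b) \<le> norm (complex_of_real (norm a powr (p - 2)) * cnj (a - b)) + norm (complex_of_real (norm a powr (p - 2) - norm b powr (p - 2)) * cnj b)"
    unfolding Fp_diff_eq by (rule norm_triangle_ineq)
  then show ?thesis by (simp only: norm_mult norm_of_real complex_mod_cnj) simp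
qed

text \<open>By symmetry |b| <= |a|. The difference splits into a change of direction and a change of
  modulus; the mean value theorem for the modulus produces the exponent p - 3, possibly negative,
  and the spare factor |b| raises it to p - 2.\<close>

lemma Fp_lipschitz:
  assumes p: "p > 2"
  shows "norm (Fp p a - Fp p b) \<le> (p - 1) * (norm (a - b) * (norm a + norm b) powr (p - 2))"
proof -
  have main: "norm (Fp p a - Fp p b) \<le> (p - 1) * (norm (a - b) * norm a powr (p - 2))" if le: "norm b \<le> norm a" for a b
  proof -
    have "\<bar>norm a powr (p - 2) - norm b powr (p - 2)\<bar> * norm b \<le> (p - 2) * norm a powr (p - 2) * norm (a - b)"
    proof (cases "norm b = 0 \<or> norm b = norm a")
      case True then show ?thesis using p by auto
    next
      case False
      then have b: "0 < norm b" "norm b < norm a" using le by auto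
      obtain z where z: "norm b < z" "z < norm a" "norm a powr (p - 2) - norm b powr (p - 2) = (norm a - norm b) * ((p - 2) * z powr (p - 2 - 1))"
        using powr_mvt[OF b] by metis
      have z0: "z > 0" using z(1) b(1) by linarith
      have "z powr (p - 2 - 1) * norm b \<le> z powr (p - 2 - 1) * z" using z by (intro mult_left_mono) auto
      also have "\<dots> = z powr (p - 2)" using powr_mult_self[of z "p - 2 - 1"] z0 by simp
      also have "\<dots> \<le> norm a powr (p - 2)" using z z0 p by (intro powr_mono2) auto
      finally have 1: "z powr (p - 2 - 1) * norm b \<le> norm a powr (p - 2)" .
      have "\<bar>norm a powr (p - 2) - norm b powr (p - 2)\<bar> * norm b = (norm a - norm b) * ((p - 2) * (z powr (p - 2 - 1) * norm b))"
        unfolding z(3) using b p by (simp add: abs_mult)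
      also have "\<dots> \<le> norm (a - b) * ((p - 2) * norm a powr (p - 2))"
        using 1 p b norm_triangle_ineq2[of a b] by (intro mult_mono) auto
      finally show ?thesis by (simp add: mult_ac)
    qed
    with Fp_diff_norm_le[of p a b] show ?thesis by (simp add: algebra_simps)
  qed
  have mono: "norm a powr (p - 2) \<le> (norm a + norm b) powr (p - 2)" "norm b powr (p - 2) \<le> (norm a + norm b) powr (p - 2)"
    using p by (auto intro!: powr_mono2)
  show ?thesis
  proof (cases "norm b \<le> norm a")
    case True
    have "(p - 1) * (norm (a - b) * norm a powr (p - 2)) \<le> (p - 1) * (norm (a - b) * (norm a + norm b) powr (p - 2))"
      using mono p by (intro mult_left_mono) auto
    with main[OF True] show ?thesis by linarith
  next
    case False
    have "(p - 1) * (norm (a - b) * norm b powr (p - 2)) \<le> (p - 1) * (norm (a - b) * (norm a + norm b) powr (p - 2))"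
      using mono p by (intro mult_left_mono) auto
    with main[of a b] False show ?thesis by (simp add: norm_minus_commute)
  qed
qed

text \<open>If |a| is at most 2 |a - b|, the triangle inequality suffices. Otherwise |a|, |b| and
  all moduli between them exceed |a - b|, and since p - 2 <= 0 their powers of exponent p - 2 are at
  most that of |a - b|.\<close>

lemma Fp_holder:
  assumes p: "1 < p" "p \<le> 2"
  shows "norm (Fp p a - Fp p b) \<le> 4 * norm (a - b) powr (p - 1)"
proof -
  have main: "norm (Fp p a - Fp p b) \<le> 4 * norm (a - b) powr (p - 1)" if le: "norm b \<le> norm a" for a b
  proof (cases "norm a \<le> 2 * norm (a - b)")
    case True
    have "norm (Fp p a - Fp p b) \<le> norm a powr (p - 1) + norm b powr (p - 1)"
      using norm_triangle_ineq4[of "Fp p a" "Fp p b"] p by (simp add: norm_Fp)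
    also have "\<dots> \<le> 2 * norm a powr (p - 1)" using le p powr_mono2[of "p - 1" "norm b" "norm a"] by simp
    also have "norm a powr (p - 1) \<le> (2 * norm (a - b)) powr (p - 1)" using True p by (intro powr_mono2) auto
    also have "\<dots> = 2 powr (p - 1) * norm (a - b) powr (p - 1)" by (simp add: powr_mult)
    also have "2 powr (p - 1) \<le> (2::real) powr 1" using p by (intro powr_mono) auto
    finally show ?thesis by (simp add: mult_right_mono)
  next
    case False
    show ?thesis
    proof (cases "a = b")
      case ab: False
      have d: "norm (a - b) > 0" "norm (a - b) < norm b" using ab False norm_triangle_ineq2[of a b] by auto
      have neg: "x powr (p - 2) \<le> norm (a - b) powr (p - 2)" if "x \<ge> norm (a - b)" for x
        using that d p by (intro powr_mono2') auto
      have dd: "norm (a - b) powr (p - 2) * norm (a - b) = norm (a - b) powr (p - 1)"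
        using powr_mult_self[of "norm (a - b)" "p - 2"] by simp
      have 1: "norm a powr (p - 2) * norm (a - b) \<le> norm (a - b) powr (p - 1)"
        using mult_right_mono[OF neg, of "norm a" "norm (a - b)"] le d dd by simp
      have 2: "\<bar>norm a powr (p - 2) - norm b powr (p - 2)\<bar> * norm b \<le> norm (a - b) powr (p - 1)"
      proof (cases "norm a = norm b")
        case True then show ?thesis by simp
      next
        case False
        then have b: "0 < norm b" "norm b < norm a" using d le by auto
        obtain z where z: "norm b < z" "z < norm a" "norm a powr (p - 2) - norm b powr (p - 2) = (norm a - norm b) * ((p - 2) * z powr (p - 2 - 1))"
          using powr_mvt[OF b] by metis
        have z0: "z > 0" using z(1) b(1) by linarith
        have "z powr (p - 2 - 1) * norm b \<le> z powr (p - 2 - 1) * z" using z by (intro mult_left_mono) auto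
        also have "\<dots> = z powr (p - 2)" using powr_mult_self[of z "p - 2 - 1"] z0 by simp
        also have "\<dots> \<le> norm (a - b) powr (p - 2)" using z d by (intro neg) auto
        finally have 1: "z powr (p - 2 - 1) * norm b \<le> norm (a - b) powr (p - 2)" .
        have "\<bar>norm a powr (p - 2) - norm b powr (p - 2)\<bar> * norm b = (norm a - norm b) * ((2 - p) * (z powr (p - 2 - 1) * norm b))"
          unfolding z(3) using b p by (simp add: abs_mult)
        also have "\<dots> \<le> norm (a - b) * (1 * norm (a - b) powr (p - 2))"
          using 1 p b norm_triangle_ineq2[of a b] by (intro mult_mono) auto
        finally show ?thesis using dd by (simp add: mult.commute)
      qed
      have "0 \<le> norm (a - b) powr (p - 1)" by simp
      then show ?thesis using 1 2 Fp_diff_norm_le[of p a b] by linarith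
    qed simp
  qed
  show ?thesis
  proof (cases "norm b \<le> norm a")
    case True then show ?thesis by (rule main)
  next
    case False then show ?thesis using main[of a b] by (simp add: norm_minus_commute)
  qed
qed

section \<open>Integral inequalities\<close>

text \<open>Jensen for a kernel of mass at most \<open>W\<close>, from the tangent at c = b / W. The
  mean enters only through the finite lower bound \<open>b\<close>, so the integrals may be
  infinite: the term cancelled at the end is finite.\<close>

lemma nn_jensen_powr:
  fixes w a :: "'c \<Rightarrow> real" and p b W :: real
  assumes [measurable]: "w \<in> borel_measurable M" "a \<in> borel_measurable M"
    and w: "\<And>s. w s \<ge> 0" and a: "\<And>s. a s \<ge> 0" and p: "p \<ge> 1" and W: "W \<ge> 0" "(\<integral>\<^sup>+s. w s \<partial>M) \<le> ennreal W"
    and b: "b \<ge> 0" "ennreal b \<le> (\<integral>\<^sup>+s. ennreal (w s * a s) \<partial>M)"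
  shows "ennreal (b powr p) \<le> ennreal (W powr (p - 1)) * (\<integral>\<^sup>+s. ennreal (w s * a s powr p) \<partial>M)"
proof (cases "b = 0")
  case True then show ?thesis by simp
next
  case False
  then have b0: "b > 0" using b by simp
  have W0: "W > 0"
  proof (rule ccontr)
    assume "\<not> W > 0"
    then have "(\<integral>\<^sup>+s. w s \<partial>M) = 0" using W by simp
    then have "AE s in M. ennreal (w s) = 0" by (subst (asm) nn_integral_0_iff_AE) auto
    then have "AE s in M. ennreal (w s * a s) = 0" by (rule AE_mp) (auto simp: ennreal_eq_0_iff a mult_nonneg_nonpos2)
    then have "(\<integral>\<^sup>+s. ennreal (w s * a s) \<partial>M) = 0" by (subst nn_integral_0_iff_AE) auto
    then show False using b(2) b0 by (simp add: ennreal_eq_0_iff)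
  qed
  define c where "c = b / W"
  have c: "c > 0" using b0 W0 by (simp add: c_def)
  let ?I = "\<integral>\<^sup>+s. ennreal (w s * a s powr p) \<partial>M"
  have "ennreal (p * c powr (p - 1)) * (\<integral>\<^sup>+s. ennreal (w s * a s) \<partial>M) = (\<integral>\<^sup>+s. ennreal (w s * (p * c powr (p - 1) * a s)) \<partial>M)"
    using p w a by (subst nn_integral_cmult[symmetric]) (auto simp: ennreal_mult'[symmetric] mult_ac)
  also have "\<dots> \<le> (\<integral>\<^sup>+s. ennreal (w s * a s powr p) + ennreal ((p - 1) * c powr p) * ennreal (w s) \<partial>M)"
  proof (rule nn_integral_mono)
    fix s
    have "w s * (p * c powr (p - 1) * a s) \<le> w s * (a s powr p + (p - 1) * c powr p)"
      using powr_tangent[OF p a, of c s] c w by (intro mult_left_mono) auto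
    then have "w s * (p * c powr (p - 1) * a s) \<le> w s * a s powr p + (p - 1) * c powr p * w s" by (simp add: algebra_simps)
    then show "ennreal (w s * (p * c powr (p - 1) * a s)) \<le> ennreal (w s * a s powr p) + ennreal ((p - 1) * c powr p) * ennreal (w s)"
      using p w by (simp add: ennreal_mult'[symmetric] ennreal_plus[symmetric] del: ennreal_plus)
  qed
  also have "\<dots> = ?I + ennreal ((p - 1) * c powr p) * (\<integral>\<^sup>+s. w s \<partial>M)"
    by (subst nn_integral_add) (auto simp: nn_integral_cmult)
  also have "\<dots> \<le> ?I + ennreal ((p - 1) * c powr p) * ennreal W"
    using W by (intro add_left_mono mult_left_mono) auto
  finally have 1: "ennreal (p * c powr (p - 1)) * (\<integral>\<^sup>+s. ennreal (w s * a s) \<partial>M) \<le> ?I + ennreal ((p - 1) * c powr p * W)"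
    using W0 p by (simp add: ennreal_mult')
  have "ennreal (p * c powr (p - 1)) * ennreal b \<le> ennreal (p * c powr (p - 1)) * (\<integral>\<^sup>+s. ennreal (w s * a s) \<partial>M)"
    using b by (intro mult_left_mono) auto
  then have 2: "ennreal (p * c powr (p - 1) * b) \<le> ?I + ennreal ((p - 1) * c powr p * W)"
    using order_trans[OF _ 1] b by (simp add: ennreal_mult'')
  have "p * c powr (p - 1) * b = c powr p * W + (p - 1) * c powr p * W"
    using powr_mult_self[of c "p - 1"] c W0 by (simp add: c_def field_simps)
  then have 3: "ennreal (c powr p * W) + ennreal ((p - 1) * c powr p * W) \<le> ?I + ennreal ((p - 1) * c powr p * W)"
    using 2 p W0 by (simp add: ennreal_plus[symmetric] del: ennreal_plus)
  have "ennreal (c powr p * W) \<le> ?I"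
    using 3 unfolding add.commute[of _ "ennreal ((p - 1) * c powr p * W)"] by (simp add: ennreal_add_left_cancel_le)
  then have "ennreal (W powr (p - 1)) * ennreal (c powr p * W) \<le> ennreal (W powr (p - 1)) * ?I"
    by (intro mult_left_mono) auto
  moreover have "W powr (p - 1) * (c powr p * W) = b powr p"
  proof -
    have "W powr (p - 1) * (c powr p * W) = c powr p * (W powr (p - 1) * W)" by (simp only: mult_ac)
    also have "\<dots> = c powr p * W powr p" using W0 powr_mult_self[of W "p - 1"] by simp
    also have "\<dots> = (c * W) powr p" using W0 c by (subst powr_mult) auto
    finally show ?thesis using W0 by (simp add: c_def)
  qed
  ultimately show ?thesis using W0 by (simp add: ennreal_mult''[symmetric])
qed

text \<open>Young's inequality for a kernel of mass at most \<open>W\<close>: Jensen inside, then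
  Tonelli and translation invariance. The map \<open>\<tau>\<close> lets the kernel live on another
  space, so that convolution along a line and on the whole space are covered together.\<close>

lemma convolution_powr_le:
  fixes \<kappa> :: "'c::euclidean_space \<Rightarrow> real" and \<tau> :: "'c \<Rightarrow> 'a::euclidean_space" and G H :: "'a \<Rightarrow> complex"
  assumes [measurable]: "\<kappa> \<in> borel_measurable borel" "\<tau> \<in> borel_measurable borel" "G \<in> borel_measurable borel"
    and \<kappa>: "\<And>s. \<kappa> s \<ge> 0" and p: "p \<ge> 1" and W: "W \<ge> 0" "(\<integral>\<^sup>+s. \<kappa> s \<partial>lborel) \<le> ennreal W"
    and H: "\<And>x. ennreal (norm (H x)) \<le> (\<integral>\<^sup>+s. ennreal (\<kappa> s * norm (G (x - \<tau> s))) \<partial>lborel)"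
  shows "(\<integral>\<^sup>+x. ennreal (norm (H x) powr p) \<partial>lborel) \<le> ennreal (W powr p) * (\<integral>\<^sup>+x. ennreal (norm (G x) powr p) \<partial>lborel)"
proof -
  let ?N = "\<integral>\<^sup>+x. ennreal (norm (G x) powr p) \<partial>lborel"
  have "(\<integral>\<^sup>+x. ennreal (norm (H x) powr p) \<partial>lborel) \<le>
    (\<integral>\<^sup>+x. ennreal (W powr (p - 1)) * (\<integral>\<^sup>+s. ennreal (\<kappa> s * norm (G (x - \<tau> s)) powr p) \<partial>lborel) \<partial>lborel)"
    using \<kappa> p W H by (intro nn_integral_mono nn_jensen_powr) auto
  also have "\<dots> = ennreal (W powr (p - 1)) * (\<integral>\<^sup>+x. (\<integral>\<^sup>+s. ennreal (\<kappa> s * norm (G (x - \<tau> s)) powr p) \<partial>lborel) \<partial>lborel)"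
    by (rule nn_integral_cmult) measurable
  also have "(\<integral>\<^sup>+x. (\<integral>\<^sup>+s. ennreal (\<kappa> s * norm (G (x - \<tau> s)) powr p) \<partial>lborel) \<partial>lborel) =
    (\<integral>\<^sup>+s. (\<integral>\<^sup>+x. ennreal (\<kappa> s * norm (G (x - \<tau> s)) powr p) \<partial>lborel) \<partial>lborel)"
    by (rule lborel_pair.Fubini') measurable
  also have "\<dots> = (\<integral>\<^sup>+s. ennreal (\<kappa> s) * ?N \<partial>lborel)"
  proof (rule nn_integral_cong)
    fix s
    have "(\<integral>\<^sup>+x. ennreal (\<kappa> s * norm (G (x - \<tau> s)) powr p) \<partial>lborel) = ennreal (\<kappa> s) * (\<integral>\<^sup>+x. ennreal (norm (G (x - \<tau> s)) powr p) \<partial>lborel)"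
      using \<kappa> by (subst nn_integral_cmult[symmetric]) (auto simp: ennreal_mult')
    then show "(\<integral>\<^sup>+x. ennreal (\<kappa> s * norm (G (x - \<tau> s)) powr p) \<partial>lborel) = ennreal (\<kappa> s) * ?N"
      by (subst (asm) nn_integral_lborel_shift(3)[of "\<lambda>x. ennreal (norm (G x) powr p)"]) auto
  qed
  also have "\<dots> = (\<integral>\<^sup>+s. ennreal (\<kappa> s) \<partial>lborel) * ?N" by (rule nn_integral_multc) measurable
  also have "ennreal (W powr (p - 1)) * \<dots> \<le> ennreal (W powr (p - 1)) * (ennreal W * ?N)"
    using W by (intro mult_left_mono mult_right_mono) auto
  also have "\<dots> = ennreal (W powr p) * ?N"
    using W powr_mult_self[of W "p - 1"] by (simp add: mult.assoc[symmetric] ennreal_mult'[symmetric])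
  finally show ?thesis .
qed

text \<open>Hoelder with exponents p/2 and p/(p - 2), by Young's inequality for
  \<open>u x / U\<close> and \<open>v x / V\<close>.\<close>

lemma nn_holder_square:
  fixes u v :: "'c \<Rightarrow> real" and U V p :: real
  assumes [measurable]: "u \<in> borel_measurable M" "v \<in> borel_measurable M"
    and u: "\<And>x. u x \<ge> 0" and v: "\<And>x. v x \<ge> 0" and p: "p > 2" and UV: "U \<ge> 0" "V > 0"
    and U: "(\<integral>\<^sup>+x. ennreal (u x powr p) \<partial>M) \<le> ennreal (U powr p)" and V: "(\<integral>\<^sup>+x. ennreal (v x powr p) \<partial>M) \<le> ennreal (V powr p)"
  shows "(\<integral>\<^sup>+x. ennreal ((u x)\<^sup>2 * v x powr (p - 2)) \<partial>M) \<le> ennreal (U\<^sup>2 * V powr (p - 2))"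
proof (cases "U = 0")
  case True
  then have "(\<integral>\<^sup>+x. ennreal (u x powr p) \<partial>M) = 0" using U p by simp
  then have "AE x in M. ennreal (u x powr p) = 0" by (subst (asm) nn_integral_0_iff_AE) auto
  then have "AE x in M. ennreal ((u x)\<^sup>2 * v x powr (p - 2)) = 0" by (rule AE_mp) (auto simp: ennreal_eq_0_iff)
  then have "(\<integral>\<^sup>+x. ennreal ((u x)\<^sup>2 * v x powr (p - 2)) \<partial>M) = 0" by (subst nn_integral_0_iff_AE) auto
  then show ?thesis by simp
next
  case False
  then have U0: "U > 0" using UV by simp
  have y: "s\<^sup>2 * t powr (p - 2) \<le> 2 / p * s powr p + (p - 2) / p * t powr p" if "s \<ge> 0" "t \<ge> 0" for s t :: real
  proof (cases "s = 0 \<or> t = 0")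
    case True then show ?thesis using p by auto
  next
    case False
    then have st: "s > 0" "t > 0" using that by auto
    have "(s powr p) powr (2 / p) * (t powr p) powr ((p - 2) / p) \<le> 2 / p * s powr p + (p - 2) / p * t powr p"
      using p st by (intro Youngs_inequality_0) (auto simp: field_simps)
    moreover have "(s powr p) powr (2 / p) = s\<^sup>2" "(t powr p) powr ((p - 2) / p) = t powr (p - 2)"
      using p st by (auto simp: powr_powr powr_numeral)
    ultimately show ?thesis by simp
  qed
  let ?k = "U\<^sup>2 * V powr (p - 2)"
  have le: "(u x)\<^sup>2 * v x powr (p - 2) \<le> ?k * (2 / p) / U powr p * u x powr p + ?k * ((p - 2) / p) / V powr p * v x powr p" for x
  proof -
    have "(u x)\<^sup>2 * v x powr (p - 2) = ?k * ((u x / U)\<^sup>2 * (v x / V) powr (p - 2))"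
      using U0 UV v u by (simp add: power_divide powr_divide)
    also have "\<dots> \<le> ?k * (2 / p * (u x / U) powr p + (p - 2) / p * (v x / V) powr p)"
      using y[of "u x / U" "v x / V"] U0 UV u v by (intro mult_left_mono) auto
    also have "\<dots> = ?k * (2 / p) / U powr p * u x powr p + ?k * ((p - 2) / p) / V powr p * v x powr p"
      using U0 UV u v by (simp add: powr_divide algebra_simps)
    finally show ?thesis .
  qed
  define A where "A = ?k * (2 / p) / U powr p"
  define B where "B = ?k * ((p - 2) / p) / V powr p"
  have ab: "A \<ge> 0" "B \<ge> 0" using p by (auto simp: A_def B_def)
  note le = le[folded A_def B_def]
  have "(\<integral>\<^sup>+x. ennreal ((u x)\<^sup>2 * v x powr (p - 2)) \<partial>M) \<le> (\<integral>\<^sup>+x. ennreal A * ennreal (u x powr p) + ennreal B * ennreal (v x powr p) \<partial>M)"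
    using le ab by (intro nn_integral_mono) (auto simp: ennreal_mult'[symmetric] ennreal_plus[symmetric] simp del: ennreal_plus)
  also have "\<dots> = ennreal A * (\<integral>\<^sup>+x. ennreal (u x powr p) \<partial>M) + ennreal B * (\<integral>\<^sup>+x. ennreal (v x powr p) \<partial>M)"
    by (simp add: nn_integral_add nn_integral_cmult)
  also have "\<dots> \<le> ennreal A * ennreal (U powr p) + ennreal B * ennreal (V powr p)"
    using U V by (intro add_mono mult_left_mono) auto
  also have "\<dots> = ennreal (A * U powr p + B * V powr p)" using ab by (simp add: ennreal_mult'[symmetric] ennreal_plus[symmetric] del: ennreal_plus)
  also have "A * U powr p + B * V powr p = ?k" using U0 UV p by (simp add: A_def B_def field_simps)
  finally show ?thesis .
qed

section \<open>A Littlewood--Paley inequality in one direction\<close>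

lemma norm_diff_mult: "norm (a * g - b * g) = norm (a - b) * norm (g::complex)"
  by (metis left_diff_distrib norm_mult)

definition Lpow :: "real \<Rightarrow> ('a::euclidean_space \<Rightarrow> complex) \<Rightarrow> ennreal" where
  "Lpow p G = (\<integral>\<^sup>+x. ennreal (norm (G x) powr p) \<partial>lborel)"

lemma integrable_powr_iff:
  assumes [measurable]: "G \<in> borel_measurable borel"
  shows "integrable lborel (\<lambda>x. norm (G x) powr p) \<longleftrightarrow> Lpow p G < \<infinity>"
  unfolding integrable_iff_bounded Lpow_def by (auto simp del: infinity_ennreal_def)

lemma Lpow_shift:
  assumes [measurable]: "G \<in> borel_measurable borel"
  shows "Lpow p (\<lambda>x. G (x + h)) = Lpow p G" "Lpow p (\<lambda>x. G (x - h)) = Lpow p G"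
  using nn_integral_lborel_shift(1)[of "\<lambda>x. ennreal (norm (G x) powr p)" h] nn_integral_lborel_shift(3)[of "\<lambda>x. ennreal (norm (G x) powr p)" h]
  unfolding Lpow_def add.commute[of h] by simp_all

lemma Fp_mult_le:
  assumes p: "p > 1"
  shows "norm (Fp p a * g) \<le> norm a powr p + norm g powr p"
proof -
  have "norm a powr (p - 1) * norm g \<le> norm a powr p + norm g powr p"
  proof (cases "norm g \<le> norm a")
    case True
    then have "norm a powr (p - 1) * norm g \<le> norm a powr (p - 1) * norm a" by (intro mult_left_mono) auto
    then show ?thesis using powr_mult_self[of "norm a" "p - 1"] by (simp add: add_increasing add_increasing2)
  next
    case False
    then have "norm a powr (p - 1) * norm g \<le> norm g powr (p - 1) * norm g" using p by (intro mult_right_mono powr_mono2) auto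
    then show ?thesis using powr_mult_self[of "norm g" "p - 1"] by (simp add: add_increasing add_increasing2)
  qed
  then show ?thesis using p by (simp add: norm_mult norm_Fp)
qed

lemma integrable_Fp_mult:
  fixes S G :: "'a::euclidean_space \<Rightarrow> complex"
  assumes p: "p > 1" and [measurable]: "S \<in> borel_measurable borel" "G \<in> borel_measurable borel"
    and "Lpow p S < \<infinity>" "Lpow p G < \<infinity>"
  shows "integrable lborel (\<lambda>x. Fp p (S x) * G x)"
proof (rule Bochner_Integration.integrable_bound)
  show "integrable lborel (\<lambda>x. norm (S x) powr p + norm (G x) powr p)"
    using assms by (intro Bochner_Integration.integrable_add) (auto simp: integrable_powr_iff)
  show "AE x in lborel. norm (Fp p (S x) * G x) \<le> norm (norm (S x) powr p + norm (G x) powr p)"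
    by (intro AE_I2 order_trans[OF Fp_mult_le[OF p]]) simp
qed measurable

text \<open>What the one-directional estimate asks of the kernel: mass 1, finite moments and an L_1
  Lipschitz bound under translation. The instance will be the inverse Fourier transform of
  \<open>\<phi>0\<close>, for which convolution with \<open>dil \<rho>\<close> keeps frequencies up
  to \<rho> and removes those beyond 3/2 \<rho>.\<close>

locale smoothing_kernel =
  fixes lam :: "real \<Rightarrow> complex" and \<Lambda> :: "nat \<Rightarrow> real" and A :: real
  assumes lam_borel [measurable]: "lam \<in> borel_measurable borel"
    and lam_integral: "integrable lborel lam" "(LINT s|lborel. lam s) = 1"
    and lam_moment: "\<And>k. \<Lambda> k \<ge> 0" "\<And>k. (\<integral>\<^sup>+s. ennreal (norm (lam s) * (1 + \<bar>s\<bar>) ^ k) \<partial>lborel) \<le> ennreal (\<Lambda> k)"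
    and lam_diff: "A \<ge> 0" "\<And>h. (\<integral>\<^sup>+s. ennreal (norm (lam (s - h) - lam s)) \<partial>lborel) \<le> ennreal (A * \<bar>h\<bar>)"
begin

definition dil :: "real \<Rightarrow> real \<Rightarrow> complex" where
  "dil \<rho> s = complex_of_real \<rho> * lam (\<rho> * s)"

lemma dil_borel [measurable]: "dil \<rho> \<in> borel_measurable borel"
  unfolding dil_def[abs_def] by measurable

lemma dil_integral:
  assumes "\<rho> > 0"
  shows "integrable lborel (dil \<rho>)" "(LINT s|lborel. dil \<rho> s) = 1"
proof -
  have "integrable lborel (\<lambda>s. lam (0 + \<rho> * s))"
    by (rule lborel_integrable_real_affine) (use lam_integral assms in auto)
  then show "integrable lborel (dil \<rho>)" unfolding dil_def[abs_def] by simp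
  have "(LINT s|lborel. lam s) = \<bar>\<rho>\<bar> *\<^sub>R (LINT s|lborel. lam (0 + \<rho> * s))"
    by (rule lborel_integral_real_affine) (use assms in auto)
  then show "(LINT s|lborel. dil \<rho> s) = 1" using assms lam_integral by (simp add: dil_def scaleR_conv_of_real)
qed

lemma dil_moment:
  assumes "\<rho> > 0"
  shows "(\<integral>\<^sup>+s. ennreal (norm (dil \<rho> s) * (1 + \<rho> * \<bar>s\<bar>) ^ k) \<partial>lborel) \<le> ennreal (\<Lambda> k)"
proof -
  have "(\<integral>\<^sup>+s. ennreal (norm (lam s) * (1 + \<bar>s\<bar>) ^ k) \<partial>lborel) = ennreal \<bar>\<rho>\<bar> * (\<integral>\<^sup>+s. ennreal (norm (lam (0 + \<rho> * s)) * (1 + \<bar>0 + \<rho> * s\<bar>) ^ k) \<partial>lborel)"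
    by (rule nn_integral_real_affine) (use assms in auto)
  also have "\<dots> = (\<integral>\<^sup>+s. ennreal (norm (dil \<rho> s) * (1 + \<rho> * \<bar>s\<bar>) ^ k) \<partial>lborel)"
    using assms by (subst nn_integral_cmult[symmetric]) (auto simp: dil_def norm_mult abs_mult ennreal_mult'[symmetric] mult_ac intro!: nn_integral_cong)
  finally show ?thesis using lam_moment(2)[of k] by simp
qed

lemma dil_norm_integral: "\<rho> > 0 \<Longrightarrow> (\<integral>\<^sup>+s. ennreal (norm (dil \<rho> s)) \<partial>lborel) \<le> ennreal (\<Lambda> 0)"
  using dil_moment[of \<rho> 0] by simp

lemma dil_diff:
  assumes "\<rho> > 0"
  shows "(\<integral>\<^sup>+s. ennreal (norm (dil \<rho> (s - h) - dil \<rho> s)) \<partial>lborel) \<le> ennreal (A * (\<rho> * \<bar>h\<bar>))"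
proof -
  have "(\<integral>\<^sup>+s. ennreal (norm (lam (s - \<rho> * h) - lam s)) \<partial>lborel) = ennreal \<bar>\<rho>\<bar> * (\<integral>\<^sup>+s. ennreal (norm (lam (0 + \<rho> * s - \<rho> * h) - lam (0 + \<rho> * s))) \<partial>lborel)"
    by (rule nn_integral_real_affine) (use assms in auto)
  also have "\<dots> = (\<integral>\<^sup>+s. ennreal (norm (dil \<rho> (s - h) - dil \<rho> s)) \<partial>lborel)"
    using assms by (subst nn_integral_cmult[symmetric])
      (auto simp: dil_def norm_mult right_diff_distrib[symmetric] ennreal_mult'[symmetric] intro!: nn_integral_cong simp flip: mult.assoc)
  finally show ?thesis using lam_diff(2)[of "\<rho> * h"] assms by (simp add: abs_mult)
qed

text \<open>Spectral localisation of \<open>G\<close> in the direction \<open>e\<close> to frequencies of size about \<open>2^n\<close>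
  (at most about \<open>1\<close> for \<open>n = 0\<close>).\<close>
definition band :: "'a::euclidean_space \<Rightarrow> nat \<Rightarrow> ('a \<Rightarrow> complex) \<Rightarrow> bool" where
  "band e n G \<longleftrightarrow> G \<in> borel_measurable borel \<and>
     (\<forall>x. integrable lborel (\<lambda>s. dil (4 * 2 ^ n) s * G (x - s *\<^sub>R e)) \<and> (LINT s|lborel. dil (4 * 2 ^ n) s * G (x - s *\<^sub>R e)) = G x) \<and>
     (n \<ge> 1 \<longrightarrow> (\<forall>x. integrable lborel (\<lambda>s. dil (2 ^ n / 8) s * G (x - s *\<^sub>R e)) \<and> (LINT s|lborel. dil (2 ^ n / 8) s * G (x - s *\<^sub>R e)) = 0))"

lemma band_sum:
  assumes "finite K" "\<And>k. k \<in> K \<Longrightarrow> band e n (G k)"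
  shows "band e n (\<lambda>x. \<Sum>k\<in>K. G k x)"
proof -
  have G: "k \<in> K \<Longrightarrow> G k \<in> borel_measurable borel"
    and a: "k \<in> K \<Longrightarrow> integrable lborel (\<lambda>s. dil (4 * 2 ^ n) s * G k (x - s *\<^sub>R e))" "k \<in> K \<Longrightarrow> (LINT s|lborel. dil (4 * 2 ^ n) s * G k (x - s *\<^sub>R e)) = G k x"
    and b: "n \<ge> 1 \<Longrightarrow> k \<in> K \<Longrightarrow> integrable lborel (\<lambda>s. dil (2 ^ n / 8) s * G k (x - s *\<^sub>R e))" "n \<ge> 1 \<Longrightarrow> k \<in> K \<Longrightarrow> (LINT s|lborel. dil (2 ^ n / 8) s * G k (x - s *\<^sub>R e)) = 0" for k x
    using assms(2) unfolding band_def by blast+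
  show ?thesis unfolding band_def sum_distrib_left
  proof (intro conjI allI impI)
    show "(\<lambda>x. \<Sum>k\<in>K. G k x) \<in> borel_measurable borel" using G by (intro borel_measurable_sum) auto
    fix x
    show "integrable lborel (\<lambda>s. \<Sum>k\<in>K. dil (4 * 2 ^ n) s * G k (x - s *\<^sub>R e))"
      by (intro Bochner_Integration.integrable_sum a)
    show "(LINT s|lborel. (\<Sum>k\<in>K. dil (4 * 2 ^ n) s * G k (x - s *\<^sub>R e))) = (\<Sum>k\<in>K. G k x)"
      by (subst Bochner_Integration.integral_sum[OF a(1)]) (auto intro!: sum.cong a(2))
    assume n: "n \<ge> 1"
    show "integrable lborel (\<lambda>s. \<Sum>k\<in>K. dil (2 ^ n / 8) s * G k (x - s *\<^sub>R e))"
      by (intro Bochner_Integration.integrable_sum b n)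
    show "(LINT s|lborel. (\<Sum>k\<in>K. dil (2 ^ n / 8) s * G k (x - s *\<^sub>R e))) = 0"
      by (subst Bochner_Integration.integral_sum[OF b(1)[OF n]]) (auto intro!: sum.neutral b(2) n)
  qed
qed

text \<open>Bernstein's inequality in difference form: \<open>G\<close> reproduces itself under the
  kernel at scale 4 * 2^n, so a shift of \<open>G\<close> can be moved to the kernel.\<close>

lemma band_translate:
  fixes G :: "'a::euclidean_space \<Rightarrow> complex"
  assumes b: "band e n G" and p: "p \<ge> 1"
  shows "(\<integral>\<^sup>+x. ennreal (norm (G (x + h *\<^sub>R e) - G x) powr p) \<partial>lborel) \<le> ennreal ((A * (4 * 2 ^ n * \<bar>h\<bar>)) powr p) * Lpow p G"
  unfolding Lpow_def
proof (rule convolution_powr_le[where \<kappa>="\<lambda>s. norm (dil (4 * 2 ^ n) (s + h) - dil (4 * 2 ^ n) s)" and \<tau>="\<lambda>s. s *\<^sub>R e"])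
  let ?d = "dil (4 * 2 ^ n)"
  show [measurable]: "G \<in> borel_measurable borel" using b by (simp add: band_def)
  show "(\<integral>\<^sup>+s. ennreal (norm (?d (s + h) - ?d s)) \<partial>lborel) \<le> ennreal (A * (4 * 2 ^ n * \<bar>h\<bar>))"
    using dil_diff[of "4 * 2 ^ n" "- h"] by simp
  fix x
  let ?f = "\<lambda>s. ?d s * G (x + h *\<^sub>R e - s *\<^sub>R e)"
  have i0: "integrable lborel (\<lambda>s. ?d s * G (x - s *\<^sub>R e))" and e0: "(LINT s|lborel. ?d s * G (x - s *\<^sub>R e)) = G x" for x
    using b by (auto simp: band_def)
  have sh: "?f (h + s) = ?d (s + h) * G (x - s *\<^sub>R e)" for s by (simp add: algebra_simps)
  have i1: "integrable lborel (\<lambda>s. ?d (s + h) * G (x - s *\<^sub>R e))"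
    using lborel_shift(3)[of ?f h] i0[of "x + h *\<^sub>R e"] unfolding sh by simp
  have e1: "(LINT s|lborel. ?d (s + h) * G (x - s *\<^sub>R e)) = G (x + h *\<^sub>R e)"
    using lborel_shift(1)[of ?f h] e0[of "x + h *\<^sub>R e"] unfolding sh by simp
  have eq: "G (x + h *\<^sub>R e) - G x = (LINT s|lborel. ?d (s + h) * G (x - s *\<^sub>R e) - ?d s * G (x - s *\<^sub>R e))"
    using i0 i1 e0 e1 by simp
  have "ennreal (norm (LINT s|lborel. ?d (s + h) * G (x - s *\<^sub>R e) - ?d s * G (x - s *\<^sub>R e))) \<le>
      (\<integral>\<^sup>+s. ennreal (norm (?d (s + h) * G (x - s *\<^sub>R e) - ?d s * G (x - s *\<^sub>R e))) \<partial>lborel)"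
    by (intro integral_norm_bound_ennreal Bochner_Integration.integrable_diff i0 i1)
  then show "ennreal (norm (G (x + h *\<^sub>R e) - G x)) \<le> (\<integral>\<^sup>+s. ennreal (norm (?d (s + h) - ?d s) * norm (G (x - s *\<^sub>R e))) \<partial>lborel)"
    unfolding eq norm_diff_mult .
  show "0 \<le> A * (4 * 2 ^ n * \<bar>h\<bar>)" using lam_diff(1) by simp
  show "p \<ge> 1" by (rule p)
  show "0 \<le> norm (?d (s + h) - ?d s)" for s by simp
  show "(\<lambda>s. norm (?d (s + h) - ?d s)) \<in> borel_measurable borel" "(\<lambda>s. s *\<^sub>R e) \<in> borel_measurable borel" by measurable
qed

text \<open>The gain over the plain convexity inequality comes from the vanishing mean of \<open>G\<close> against
  the kernel at the lower scale: \<open>G\<close> only sees the oscillation of \<open>Fp p \<circ> S\<close> at that scale.\<close>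
lemma band_telescope:
  fixes S G :: "'a::euclidean_space \<Rightarrow> complex"
  assumes p: "p > 1" and n: "n \<ge> 1" and b: "band e n G" and [measurable]: "S \<in> borel_measurable borel"
    and S: "Lpow p S < \<infinity>" and G: "Lpow p G < \<infinity>"
  shows "Lpow p S \<le> Lpow p (\<lambda>x. S x - G x) + ennreal p *
    (\<integral>\<^sup>+s. ennreal (norm (dil (2 ^ n / 8) s)) * (\<integral>\<^sup>+x. ennreal (norm (Fp p (S x) - Fp p (S (x + s *\<^sub>R e))) * norm (G x)) \<partial>lborel) \<partial>lborel)"
proof -
  let ?d = "dil (2 ^ n / 8)"
  have Gm [measurable]: "G \<in> borel_measurable borel" using b by (simp add: band_def)
  define I where "I = (LINT x|lborel. Fp p (S x) * G x)"
  define J where "J s = (LINT x|lborel. Fp p (S (x + s *\<^sub>R e)) * G x)" for s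
  have Jm [measurable]: "J \<in> borel_measurable borel" unfolding J_def by measurable
  have iS: "integrable lborel (\<lambda>x. norm (S x) powr p)" "integrable lborel (\<lambda>x. norm (G x) powr p)" using S G by (auto simp: integrable_powr_iff)
  have iI: "integrable lborel (\<lambda>x. Fp p (S x) * G x)" by (rule integrable_Fp_mult[OF p _ _ S G]) measurable
  have iJ: "integrable lborel (\<lambda>x. Fp p (S (x + s *\<^sub>R e)) * G x)" for s
    using S by (intro integrable_Fp_mult[OF p _ _ _ G]) (auto simp: Lpow_shift)
  have iD: "integrable lborel (\<lambda>x. norm (S x - G x) powr p)"
  proof (rule Bochner_Integration.integrable_bound)
    show "integrable lborel (\<lambda>x. 2 powr p * (norm (S x) powr p + norm (G x) powr p))" using iS by auto
    have "norm (S x - G x) powr p \<le> 2 powr p * (norm (S x) powr p + norm (G x) powr p)" for x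
      using powr_add_le[of "norm (S x)" "norm (G x)" p] p powr_mono2[OF _ _ norm_triangle_ineq4[of "S x" "G x"], of p] by auto
    then show "AE x in lborel. norm (norm (S x - G x) powr p) \<le> norm (2 powr p * (norm (S x) powr p + norm (G x) powr p))"
      by (auto intro: order_trans)
  qed measurable
  have 1: "(LINT x|lborel. norm (S x) powr p) \<le> (LINT x|lborel. norm (S x - G x) powr p) + p * Re I"
  proof -
    have "(LINT x|lborel. norm (S x) powr p) \<le> (LINT x|lborel. norm (S x - G x) powr p + p * Re (Fp p (S x) * G x))"
      by (intro integral_mono iS Bochner_Integration.integrable_add iD Bochner_Integration.integrable_mult_right integrable_Re iI powr_norm_convex p)
    also have "\<dots> = (LINT x|lborel. norm (S x - G x) powr p) + p * Re I"
      unfolding I_def integral_Re[OF iI, symmetric] integral_mult_right_zero[symmetric]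
      by (intro Bochner_Integration.integral_add iD Bochner_Integration.integrable_mult_right integrable_Re iI)
    finally show ?thesis .
  qed
  have di: "integrable lborel ?d" "(LINT s|lborel. ?d s) = 1" by (auto intro: dil_integral)
  \<comment> \<open>The exchange of integrals below needs absolute integrability, which
    \<open>Fp_mult_le\<close> reduces to the two finite p-th powers.\<close>
  have pair: "integrable (lborel \<Otimes>\<^sub>M lborel) (\<lambda>(x, s). ?d s * (Fp p (S x) * G (x - s *\<^sub>R e)))"
    unfolding integrable_iff_bounded
  proof (intro conjI)
    have "(\<integral>\<^sup>+z. ennreal (norm (case z of (x, s) \<Rightarrow> ?d s * (Fp p (S x) * G (x - s *\<^sub>R e)))) \<partial>(lborel \<Otimes>\<^sub>M lborel)) =
      (\<integral>\<^sup>+s. (\<integral>\<^sup>+x. ennreal (norm (?d s * (Fp p (S x) * G (x - s *\<^sub>R e)))) \<partial>lborel) \<partial>lborel)"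
      by (subst lborel_pair.nn_integral_snd[symmetric]) auto
    also have "\<dots> \<le> (\<integral>\<^sup>+s. ennreal (norm (?d s)) * (Lpow p S + Lpow p G) \<partial>lborel)"
    proof (rule nn_integral_mono)
      fix s
      have "(\<integral>\<^sup>+x. ennreal (norm (?d s * (Fp p (S x) * G (x - s *\<^sub>R e)))) \<partial>lborel) = ennreal (norm (?d s)) * (\<integral>\<^sup>+x. ennreal (norm (Fp p (S x) * G (x - s *\<^sub>R e))) \<partial>lborel)"
        by (subst nn_integral_cmult[symmetric]) (auto simp: norm_mult ennreal_mult')
      also have "(\<integral>\<^sup>+x. ennreal (norm (Fp p (S x) * G (x - s *\<^sub>R e))) \<partial>lborel) \<le> (\<integral>\<^sup>+x. ennreal (norm (S x) powr p) + ennreal (norm (G (x - s *\<^sub>R e)) powr p) \<partial>lborel)"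
        using Fp_mult_le[OF p] by (intro nn_integral_mono) (auto simp flip: ennreal_plus)
      also have "\<dots> = Lpow p S + Lpow p G"
        using Lpow_shift(2)[OF Gm, of p "s *\<^sub>R e"] unfolding Lpow_def by (subst nn_integral_add) auto
      finally show "(\<integral>\<^sup>+x. ennreal (norm (?d s * (Fp p (S x) * G (x - s *\<^sub>R e)))) \<partial>lborel) \<le> ennreal (norm (?d s)) * (Lpow p S + Lpow p G)"
        by (simp add: mult_left_mono)
    qed
    also have "\<dots> = (\<integral>\<^sup>+s. ennreal (norm (?d s)) \<partial>lborel) * (Lpow p S + Lpow p G)" by (rule nn_integral_multc) measurable
    also have "\<dots> \<le> ennreal (\<Lambda> 0) * (Lpow p S + Lpow p G)" by (intro mult_right_mono dil_norm_integral) auto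
    also have "\<dots> < \<infinity>" using S G by (auto simp: ennreal_mult_less_top)
    finally show "(\<integral>\<^sup>+z. ennreal (norm (case z of (x, s) \<Rightarrow> ?d s * (Fp p (S x) * G (x - s *\<^sub>R e)))) \<partial>(lborel \<Otimes>\<^sub>M lborel)) < \<infinity>" .
  qed measurable
  have Jeq: "J s = (LINT x|lborel. Fp p (S x) * G (x - s *\<^sub>R e))" for s
    using lborel_shift(1)[of "\<lambda>x. Fp p (S x) * G (x - s *\<^sub>R e)" "s *\<^sub>R e"] unfolding J_def by (simp add: add.commute)
  \<comment> \<open>After the substitution the shift acts on \<open>G\<close>, and the integral over
    \<open>s\<close> vanishes because \<open>G\<close> has no frequencies below this scale.\<close>
  have J0: "(LINT s|lborel. ?d s * J s) = 0"
  proof -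
    have "(LINT s|lborel. ?d s * J s) = (LINT s|lborel. (LINT x|lborel. ?d s * (Fp p (S x) * G (x - s *\<^sub>R e))))" unfolding Jeq by simp
    also have "\<dots> = (LINT x|lborel. (LINT s|lborel. ?d s * (Fp p (S x) * G (x - s *\<^sub>R e))))"
      by (rule lborel_pair.Fubini_integral[OF pair])
    also have "\<dots> = (LINT x|lborel. Fp p (S x) * (LINT s|lborel. ?d s * G (x - s *\<^sub>R e)))"
      by (simp only: mult.left_commute[of _ "Fp p _"] integral_mult_right_zero)
    also have "\<dots> = 0" using b n by (simp add: band_def)
    finally show ?thesis .
  qed
  have iJd: "integrable lborel (\<lambda>s. ?d s * J s)"
    using lborel_pair.integrable_snd[OF pair] unfolding Jeq by simp
  \<comment> \<open>Mass 1 of the kernel writes \<open>I\<close> as an average of itself, from which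
    the vanishing average of \<open>J\<close> may be subtracted. This is where the oscillation of
    \<open>Fp p\<close> along \<open>e\<close> appears.\<close>
  have "I = (LINT s|lborel. ?d s * I) - (LINT s|lborel. ?d s * J s)" using di J0 by simp
  also have "\<dots> = (LINT s|lborel. ?d s * I - ?d s * J s)" using di iJd by (subst Bochner_Integration.integral_diff) auto
  finally have "I = (LINT s|lborel. ?d s * I - ?d s * J s)" .
  then have "ennreal (norm I) \<le> (\<integral>\<^sup>+s. ennreal (norm (?d s * I - ?d s * J s)) \<partial>lborel)"
    using integral_norm_bound_ennreal[of lborel "\<lambda>s. ?d s * I - ?d s * J s"] di iJd by simp
  also have "\<dots> \<le> (\<integral>\<^sup>+s. ennreal (norm (?d s)) * (\<integral>\<^sup>+x. ennreal (norm (Fp p (S x) - Fp p (S (x + s *\<^sub>R e))) * norm (G x)) \<partial>lborel) \<partial>lborel)"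
  proof (rule nn_integral_mono)
    fix s
    have "I - J s = (LINT x|lborel. Fp p (S x) * G x - Fp p (S (x + s *\<^sub>R e)) * G x)"
      unfolding I_def J_def using iI iJ by simp
    then have "ennreal (norm (I - J s)) \<le> (\<integral>\<^sup>+x. ennreal (norm (Fp p (S x) * G x - Fp p (S (x + s *\<^sub>R e)) * G x)) \<partial>lborel)"
      using integral_norm_bound_ennreal[of lborel "\<lambda>x. Fp p (S x) * G x - Fp p (S (x + s *\<^sub>R e)) * G x"] iI iJ by simp
    then have "ennreal (norm (I - J s)) \<le> (\<integral>\<^sup>+x. ennreal (norm (Fp p (S x) - Fp p (S (x + s *\<^sub>R e))) * norm (G x)) \<partial>lborel)"
      unfolding norm_diff_mult .
    then show "ennreal (norm (?d s * I - ?d s * J s)) \<le> ennreal (norm (?d s)) * (\<integral>\<^sup>+x. ennreal (norm (Fp p (S x) - Fp p (S (x + s *\<^sub>R e))) * norm (G x)) \<partial>lborel)"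
      by (simp add: right_diff_distrib[symmetric] norm_mult ennreal_mult' mult_left_mono)
  qed
  finally have 2: "ennreal (norm I) \<le> (\<integral>\<^sup>+s. ennreal (norm (?d s)) * (\<integral>\<^sup>+x. ennreal (norm (Fp p (S x) - Fp p (S (x + s *\<^sub>R e))) * norm (G x)) \<partial>lborel) \<partial>lborel)" .
  have "Lpow p S = ennreal (LINT x|lborel. norm (S x) powr p)" unfolding Lpow_def using iS by (intro nn_integral_eq_integral) auto
  also have "\<dots> \<le> ennreal ((LINT x|lborel. norm (S x - G x) powr p) + p * norm I)"
    using 1 p mult_left_mono[OF complex_Re_le_cmod[of I], of p] by (intro ennreal_leI) linarith
  also have "\<dots> = ennreal (LINT x|lborel. norm (S x - G x) powr p) + ennreal p * ennreal (norm I)"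
    using p by (simp add: ennreal_plus ennreal_mult' integral_nonneg_AE)
  also have "ennreal (LINT x|lborel. norm (S x - G x) powr p) = Lpow p (\<lambda>x. S x - G x)"
    unfolding Lpow_def using iD by (intro nn_integral_eq_integral[symmetric]) auto
  finally show ?thesis using 2 by (meson add_left_mono mult_left_mono order_trans zero_le)
qed

end

text \<open>The geometric averages obey X (n+1) = X n / 2 + y (n+1), so \<open>s n + c * X n\<close>
  is a potential that grows by at most 2 c y (n+1) per step.\<close>

lemma geometric_recursion:
  fixes s y :: "nat \<Rightarrow> real"
  assumes c: "c \<ge> 0" and y: "\<And>n. y n \<ge> 0"
    and rec: "\<And>n. n < N \<Longrightarrow> s (Suc n) \<le> s n + c * (\<Sum>k\<le>Suc n. (1/2) ^ (Suc n - k) * y k)"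
  shows "s N \<le> s 0 + 2 * c * (\<Sum>k\<le>N. y k)"
proof -
  define X where "X n = (\<Sum>k\<le>n. (1/2) ^ (n - k) * y k)" for n
  have X: "X (Suc n) = X n / 2 + y (Suc n)" for n
  proof -
    have "(\<Sum>k\<le>n. (1/2) ^ (Suc n - k) * y k) = (\<Sum>k\<le>n. (1/2) ^ (n - k) * y k) / 2"
      unfolding sum_divide_distrib by (intro sum.cong) (auto simp: Suc_diff_le)
    then show ?thesis by (simp add: X_def)
  qed
  have "n \<le> N \<Longrightarrow> s n + c * X n \<le> s 0 + 2 * c * (\<Sum>k\<le>n. y k)" for n
  proof (induction n)
    case 0 show ?case using c y[of 0] by (simp add: X_def)
  next
    case (Suc n)
    have "s (Suc n) + c * X (Suc n) \<le> s n + 2 * (c * X (Suc n))" using rec[of n] Suc by (simp add: X_def)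
    also have "\<dots> = s n + c * X n + 2 * c * y (Suc n)" by (simp add: X algebra_simps)
    finally show ?case using Suc by (simp add: algebra_simps)
  qed
  from this[of N] have "s N + c * X N \<le> s 0 + 2 * c * (\<Sum>k\<le>N. y k)" by simp
  moreover have "X N \<ge> 0" unfolding X_def using y by (intro sum_nonneg) auto
  ultimately show ?thesis using c by (smt (verit) mult_nonneg_nonneg)
qed

lemma sum_half_powers_le: "(\<Sum>k\<le>n. (1/2::real) ^ (n - k)) \<le> 2"
proof -
  have "(\<Sum>k\<le>n. (1/2::real) ^ (n - k)) = 2 - (1/2) ^ n"
  proof (induction n)
    case (Suc n)
    have "(\<Sum>k\<le>n. (1/2::real) ^ (Suc n - k)) = (\<Sum>k\<le>n. (1/2) ^ (n - k)) / 2"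
      unfolding sum_divide_distrib by (intro sum.cong) (auto simp: Suc_diff_le)
    then show ?case using Suc by simp
  qed simp
  then show ?thesis by simp
qed

lemma Lpow_sum_finite:
  fixes G :: "'k \<Rightarrow> 'a::euclidean_space \<Rightarrow> complex"
  assumes K: "finite K" and p: "p > 0" and [measurable]: "\<And>k. k \<in> K \<Longrightarrow> G k \<in> borel_measurable borel"
    and G: "\<And>k. k \<in> K \<Longrightarrow> Lpow p (G k) < \<infinity>"
  shows "Lpow p (\<lambda>x. \<Sum>k\<in>K. G k x) < \<infinity>"
  using K assms(3,4)
proof (induction rule: finite_induct)
  case empty then show ?case using p by (simp add: Lpow_def)
next
  case (insert k K)
  have [measurable]: "G k \<in> borel_measurable borel" "(\<lambda>x. \<Sum>k\<in>K. G k x) \<in> borel_measurable borel" using insert by auto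
  have "Lpow p (\<lambda>x. \<Sum>k\<in>insert k K. G k x) \<le> (\<integral>\<^sup>+x. ennreal (2 powr p) * (ennreal (norm (G k x) powr p) + ennreal (norm (\<Sum>k\<in>K. G k x) powr p)) \<partial>lborel)"
    unfolding Lpow_def
  proof (rule nn_integral_mono)
    fix x
    have "norm (G k x + (\<Sum>k\<in>K. G k x)) powr p \<le> (norm (G k x) + norm (\<Sum>k\<in>K. G k x)) powr p"
      using p by (intro powr_mono2 norm_triangle_ineq) auto
    also have "\<dots> \<le> 2 powr p * (norm (G k x) powr p + norm (\<Sum>k\<in>K. G k x) powr p)" using p by (intro powr_add_le) auto
    finally show "ennreal (norm (\<Sum>k\<in>insert k K. G k x) powr p) \<le> ennreal (2 powr p) * (ennreal (norm (G k x) powr p) + ennreal (norm (\<Sum>k\<in>K. G k x) powr p))"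
      using insert(1,2) by (simp add: ennreal_mult'[symmetric] ennreal_plus[symmetric] del: ennreal_plus)
  qed
  also have "\<dots> = ennreal (2 powr p) * (Lpow p (G k) + Lpow p (\<lambda>x. \<Sum>k\<in>K. G k x))"
    unfolding Lpow_def by (simp add: nn_integral_cmult nn_integral_add)
  also have "\<dots> < \<infinity>" using insert by (auto simp: ennreal_mult_less_top)
  finally show ?case .
qed

lemma sum_square_weighted:
  fixes d w :: "'k \<Rightarrow> real"
  assumes "finite K" "\<And>k. k \<in> K \<Longrightarrow> d k \<ge> 0" "\<And>k. k \<in> K \<Longrightarrow> w k > 0"
  shows "(\<Sum>k\<in>K. d k)\<^sup>2 \<le> (\<Sum>k\<in>K. w k) * (\<Sum>k\<in>K. (d k)\<^sup>2 / w k)"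
proof -
  have "(\<Sum>k\<in>K. sqrt (w k) * (d k / sqrt (w k)))\<^sup>2 \<le> (\<Sum>k\<in>K. (sqrt (w k))\<^sup>2) * (\<Sum>k\<in>K. (d k / sqrt (w k))\<^sup>2)"
    by (rule Cauchy_Schwarz_ineq_sum)
  moreover have "(\<Sum>k\<in>K. sqrt (w k) * (d k / sqrt (w k))) = (\<Sum>k\<in>K. d k)"
  proof (intro sum.cong refl)
    fix k assume "k \<in> K" then show "sqrt (w k) * (d k / sqrt (w k)) = d k" using assms(3)[of k] by simp
  qed
  moreover have "(\<Sum>k\<in>K. (sqrt (w k))\<^sup>2) = (\<Sum>k\<in>K. w k)" "(\<Sum>k\<in>K. (d k / sqrt (w k))\<^sup>2) = (\<Sum>k\<in>K. (d k)\<^sup>2 / w k)"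
    using assms(3) by (auto intro!: sum.cong simp: power_divide less_imp_le)
  ultimately show ?thesis by simp
qed

section \<open>Oscillation estimates and summation over the frequencies of one direction\<close>

context smoothing_kernel
begin

text \<open>The oscillation estimates grow at most quadratically in
  \<open>\<rho> * \<bar>s\<bar>\<close>, so the second moment of the kernel integrates them
  out.\<close>

lemma outer_bound:
  assumes "\<rho> > 0" "\<alpha> \<ge> 0" "\<beta> \<ge> 0" and f: "\<And>s. f s \<le> ennreal (\<alpha> * (1 + \<rho> * \<bar>s\<bar>)\<^sup>2 + \<beta>)"
  shows "(\<integral>\<^sup>+s. ennreal (norm (dil \<rho> s)) * f s \<partial>lborel) \<le> ennreal (\<alpha> * \<Lambda> 2 + \<beta> * \<Lambda> 0)"
proof -
  have "(\<integral>\<^sup>+s. ennreal (norm (dil \<rho> s)) * f s \<partial>lborel) \<le>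
    (\<integral>\<^sup>+s. ennreal \<alpha> * ennreal (norm (dil \<rho> s) * (1 + \<rho> * \<bar>s\<bar>)\<^sup>2) + ennreal \<beta> * ennreal (norm (dil \<rho> s)) \<partial>lborel)"
  proof (rule nn_integral_mono)
    fix s
    have "ennreal (norm (dil \<rho> s)) * f s \<le> ennreal (norm (dil \<rho> s)) * ennreal (\<alpha> * (1 + \<rho> * \<bar>s\<bar>)\<^sup>2 + \<beta>)"
      by (intro mult_left_mono f) auto
    also have "\<dots> = ennreal (\<alpha> * (norm (dil \<rho> s) * (1 + \<rho> * \<bar>s\<bar>)\<^sup>2) + \<beta> * norm (dil \<rho> s))"
      using assms by (subst ennreal_mult'[symmetric]) (auto simp: algebra_simps)
    finally show "ennreal (norm (dil \<rho> s)) * f s \<le> ennreal \<alpha> * ennreal (norm (dil \<rho> s) * (1 + \<rho> * \<bar>s\<bar>)\<^sup>2) + ennreal \<beta> * ennreal (norm (dil \<rho> s))"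
      using assms by (simp add: ennreal_mult' ennreal_plus)
  qed
  also have "\<dots> = ennreal \<alpha> * (\<integral>\<^sup>+s. ennreal (norm (dil \<rho> s) * (1 + \<rho> * \<bar>s\<bar>)\<^sup>2) \<partial>lborel) + ennreal \<beta> * (\<integral>\<^sup>+s. ennreal (norm (dil \<rho> s)) \<partial>lborel)"
    by (simp add: nn_integral_add nn_integral_cmult)
  also have "\<dots> \<le> ennreal \<alpha> * ennreal (\<Lambda> 2) + ennreal \<beta> * ennreal (\<Lambda> 0)"
    by (intro add_mono mult_left_mono dil_moment dil_norm_integral assms) auto
  also have "\<dots> = ennreal (\<alpha> * \<Lambda> 2 + \<beta> * \<Lambda> 0)"
    using assms lam_moment(1) by (simp add: ennreal_mult' ennreal_plus)
  finally show ?thesis .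
qed

text \<open>Hoelder continuity reduces the claim to |S(x) - S(x + s e)|^p and |G n|^p. Shifting
  \<open>G k\<close> costs (2^k |s|)^p, that is \<open>?w k powr p\<close> relative to the scale 2^n
  of the kernel; weighted Jensen contributes \<open>?w k powr (1 - p)\<close>, and exactly one
  geometric factor \<open>?w k\<close> is left.\<close>

lemma oscillation_low:
  fixes G :: "nat \<Rightarrow> 'a::euclidean_space \<Rightarrow> complex"
  assumes p: "1 < p" "p \<le> 2" and n: "n \<ge> 1"
    and b: "\<And>k. k \<le> n \<Longrightarrow> band e k (G k)" and g: "\<And>k. k \<le> n \<Longrightarrow> g k \<ge> 0" "\<And>k. k \<le> n \<Longrightarrow> Lpow p (G k) = ennreal (g k)"
  defines "S \<equiv> \<lambda>x. \<Sum>k\<le>n. G k x"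
  shows "(\<integral>\<^sup>+s. ennreal (norm (dil (2 ^ n / 8) s)) * (\<integral>\<^sup>+x. ennreal (norm (Fp p (S x) - Fp p (S (x + s *\<^sub>R e))) * norm (G n x)) \<partial>lborel) \<partial>lborel)
    \<le> ennreal ((8 * (32 * A) powr p * \<Lambda> 2 + 4 * \<Lambda> 0) * (\<Sum>k\<le>n. (1/2) ^ (n - k) * g k))"
proof -
  let ?w = "\<lambda>k. (1/2::real) ^ (n - k)" and ?\<rho> = "2 ^ n / 8 :: real"
  let ?X = "\<Sum>k\<le>n. ?w k * g k"
  have Gm [measurable]: "G k \<in> borel_measurable borel" if "k \<le> n" for k using b[OF that] by (simp add: band_def)
  have [measurable]: "S \<in> borel_measurable borel" unfolding S_def by measurable
  have X0: "?X \<ge> 0" using g by (intro sum_nonneg) auto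
  have gX: "g n \<le> ?X" using member_le_sum[of n "{..n}" "\<lambda>k. ?w k * g k"] g by auto
  have inner: "(\<integral>\<^sup>+x. ennreal (norm (Fp p (S x) - Fp p (S (x + s *\<^sub>R e))) * norm (G n x)) \<partial>lborel) \<le>
     ennreal ((8 * (32 * A) powr p * ?X) * (1 + ?\<rho> * \<bar>s\<bar>)\<^sup>2 + 4 * ?X)" for s
  proof -
    have pt: "norm (Fp p (S x) - Fp p (S (x + s *\<^sub>R e))) * norm (G n x) \<le>
      8 * (\<Sum>k\<le>n. ?w k powr (1 - p) * norm (G k (x + s *\<^sub>R e) - G k x) powr p) + 4 * norm (G n x) powr p" for x
    proof -
      let ?D = "norm (S x - S (x + s *\<^sub>R e))" and ?g = "norm (G n x)"
      have "norm (Fp p (S x) - Fp p (S (x + s *\<^sub>R e))) * ?g \<le> 4 * (?D powr (p - 1) * ?g)"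
        unfolding mult.assoc[symmetric] by (intro mult_right_mono Fp_holder p) auto
      also have "?D powr (p - 1) * ?g \<le> ?D powr p + ?g powr p"
        using Fp_mult_le[of p "S x - S (x + s *\<^sub>R e)" "G n x"] p by (simp add: norm_mult norm_Fp)
      finally have 1: "norm (Fp p (S x) - Fp p (S (x + s *\<^sub>R e))) * ?g \<le> 4 * (?D powr p + ?g powr p)" by (simp add: mult.assoc)
      have "?D \<le> (\<Sum>k\<le>n. norm (G k (x + s *\<^sub>R e) - G k x))"
        unfolding S_def sum_subtractf[symmetric] norm_minus_commute[of "G _ (x + s *\<^sub>R e)"] by (rule norm_sum)
      then have "?D powr p \<le> (\<Sum>k\<le>n. norm (G k (x + s *\<^sub>R e) - G k x)) powr p" using p by (intro powr_mono2) auto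
      also have "\<dots> \<le> (\<Sum>k\<le>n. ?w k) powr (p - 1) * (\<Sum>k\<le>n. ?w k powr (1 - p) * norm (G k (x + s *\<^sub>R e) - G k x) powr p)"
        using p by (intro sum_powr_le) auto
      also have "\<dots> \<le> 2 * (\<Sum>k\<le>n. ?w k powr (1 - p) * norm (G k (x + s *\<^sub>R e) - G k x) powr p)"
      proof (rule mult_right_mono)
        have "(\<Sum>k\<le>n. ?w k) powr (p - 1) \<le> 2 powr (p - 1)" using p sum_half_powers_le[of n] by (intro powr_mono2 sum_nonneg) auto
        also have "\<dots> \<le> 2 powr 1" using p by (intro powr_mono) auto
        finally show "(\<Sum>k\<le>n. ?w k) powr (p - 1) \<le> 2" by simp
      qed (auto intro!: sum_nonneg)
      finally show ?thesis using 1 by (simp add: algebra_simps)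
    qed
    have "(\<integral>\<^sup>+x. ennreal (norm (Fp p (S x) - Fp p (S (x + s *\<^sub>R e))) * norm (G n x)) \<partial>lborel) \<le>
      (\<integral>\<^sup>+x. ennreal 8 * (\<Sum>k\<le>n. ennreal (?w k powr (1 - p)) * ennreal (norm (G k (x + s *\<^sub>R e) - G k x) powr p)) + ennreal 4 * ennreal (norm (G n x) powr p) \<partial>lborel)"
    proof (rule nn_integral_mono)
      fix x
      have "ennreal (norm (Fp p (S x) - Fp p (S (x + s *\<^sub>R e))) * norm (G n x)) \<le> ennreal (8 * (\<Sum>k\<le>n. ?w k powr (1 - p) * norm (G k (x + s *\<^sub>R e) - G k x) powr p) + 4 * norm (G n x) powr p)"
        using pt by (rule ennreal_leI)
      also have "\<dots> = ennreal 8 * ennreal (\<Sum>k\<le>n. ?w k powr (1 - p) * norm (G k (x + s *\<^sub>R e) - G k x) powr p) + ennreal 4 * ennreal (norm (G n x) powr p)"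
        by (subst ennreal_plus) (auto simp: ennreal_mult' intro!: mult_nonneg_nonneg sum_nonneg)
      also have "ennreal (\<Sum>k\<le>n. ?w k powr (1 - p) * norm (G k (x + s *\<^sub>R e) - G k x) powr p) = (\<Sum>k\<le>n. ennreal (?w k powr (1 - p)) * ennreal (norm (G k (x + s *\<^sub>R e) - G k x) powr p))"
        by (subst sum_ennreal[symmetric]) (auto simp: ennreal_mult'[symmetric])
      finally show "ennreal (norm (Fp p (S x) - Fp p (S (x + s *\<^sub>R e))) * norm (G n x)) \<le> ennreal 8 * (\<Sum>k\<le>n. ennreal (?w k powr (1 - p)) * ennreal (norm (G k (x + s *\<^sub>R e) - G k x) powr p)) + ennreal 4 * ennreal (norm (G n x) powr p)" .
    qed
    also have "\<dots> = ennreal 8 * (\<Sum>k\<le>n. ennreal (?w k powr (1 - p)) * (\<integral>\<^sup>+x. ennreal (norm (G k (x + s *\<^sub>R e) - G k x) powr p) \<partial>lborel)) + ennreal 4 * Lpow p (G n)"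
    proof -
      have "(\<integral>\<^sup>+x. (\<Sum>k\<le>n. ennreal (?w k powr (1 - p)) * ennreal (norm (G k (x + s *\<^sub>R e) - G k x) powr p)) \<partial>lborel) = (\<Sum>k\<le>n. ennreal (?w k powr (1 - p)) * (\<integral>\<^sup>+x. ennreal (norm (G k (x + s *\<^sub>R e) - G k x) powr p) \<partial>lborel))"
        by (subst nn_integral_sum) (auto intro!: sum.cong nn_integral_cmult)
      then show ?thesis unfolding Lpow_def by (subst nn_integral_add) (auto simp: nn_integral_cmult)
    qed
    also have "\<dots> \<le> ennreal 8 * (\<Sum>k\<le>n. ennreal (?w k powr (1 - p)) * (ennreal ((A * (4 * 2 ^ k * \<bar>s\<bar>)) powr p) * Lpow p (G k))) + ennreal 4 * Lpow p (G n)"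
      using p b by (intro add_right_mono mult_left_mono sum_mono band_translate) auto
    also have "\<dots> = ennreal (8 * (\<Sum>k\<le>n. ?w k powr (1 - p) * ((A * (4 * 2 ^ k * \<bar>s\<bar>)) powr p * g k)) + 4 * g n)"
    proof -
      have "(\<Sum>k\<le>n. ennreal (?w k powr (1 - p)) * (ennreal ((A * (4 * 2 ^ k * \<bar>s\<bar>)) powr p) * Lpow p (G k))) = (\<Sum>k\<le>n. ennreal (?w k powr (1 - p) * ((A * (4 * 2 ^ k * \<bar>s\<bar>)) powr p * g k)))"
        using g by (intro sum.cong refl) (simp add: ennreal_mult')
      also have "\<dots> = ennreal (\<Sum>k\<le>n. ?w k powr (1 - p) * ((A * (4 * 2 ^ k * \<bar>s\<bar>)) powr p * g k))"
        using g by (intro sum_ennreal) auto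
      finally show ?thesis using g by (subst ennreal_plus) (auto simp: ennreal_mult' intro!: mult_nonneg_nonneg sum_nonneg)
    qed
    also have "\<dots> \<le> ennreal ((8 * (32 * A) powr p * ?X) * (1 + ?\<rho> * \<bar>s\<bar>)\<^sup>2 + 4 * ?X)"
    proof (rule ennreal_leI)
      have "(\<Sum>k\<le>n. ?w k powr (1 - p) * ((A * (4 * 2 ^ k * \<bar>s\<bar>)) powr p * g k)) = (\<Sum>k\<le>n. (32 * A) powr p * (?\<rho> * \<bar>s\<bar>) powr p * (?w k * g k))"
      proof (intro sum.cong refl)
        fix k assume "k \<in> {..n}"
        then have k: "k \<le> n" by simp
        have "?w k * 2 ^ n = 2 ^ k" using k by (simp add: power_divide power_diff field_simps)
        \<comment> \<open>32 = 4 * 8: reproducing scale 4 * 2^k over kernel scale 2^n / 8.\<close>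
        then have e: "A * (4 * 2 ^ k * \<bar>s\<bar>) = ?w k * ((32 * A) * (?\<rho> * \<bar>s\<bar>))" by (simp add: algebra_simps)
        have "?w k powr (1 - p) * (A * (4 * 2 ^ k * \<bar>s\<bar>)) powr p = ?w k powr (1 - p) * ?w k powr p * ((32 * A) powr p * (?\<rho> * \<bar>s\<bar>) powr p)"
        proof -
          have "(?w k * ((32 * A) * (?\<rho> * \<bar>s\<bar>))) powr p = ?w k powr p * ((32 * A) powr p * (?\<rho> * \<bar>s\<bar>) powr p)"
            unfolding powr_mult[of "?w k"] powr_mult[of "32 * A"] ..
          then show ?thesis unfolding e by (simp only: mult.assoc)
        qed
        also have "?w k powr (1 - p) * ?w k powr p = ?w k" by (simp add: powr_add[symmetric])
        finally show "?w k powr (1 - p) * ((A * (4 * 2 ^ k * \<bar>s\<bar>)) powr p * g k) = (32 * A) powr p * (?\<rho> * \<bar>s\<bar>) powr p * (?w k * g k)" by (simp add: mult_ac)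
      qed
      also have "\<dots> = (32 * A) powr p * (?\<rho> * \<bar>s\<bar>) powr p * ?X" by (rule sum_distrib_left[symmetric])
      also have "\<dots> \<le> (32 * A) powr p * (1 + ?\<rho> * \<bar>s\<bar>)\<^sup>2 * ?X"
      proof (intro mult_right_mono mult_left_mono X0)
        have "(?\<rho> * \<bar>s\<bar>) powr p \<le> (1 + ?\<rho> * \<bar>s\<bar>) powr p" using p by (intro powr_mono2) auto
        also have "\<dots> \<le> (1 + ?\<rho> * \<bar>s\<bar>) powr 2" using p by (intro powr_mono) auto
        also have "\<dots> = (1 + ?\<rho> * \<bar>s\<bar>)\<^sup>2" by (simp add: powr_numeral add_pos_nonneg)
        finally show "(?\<rho> * \<bar>s\<bar>) powr p \<le> (1 + ?\<rho> * \<bar>s\<bar>)\<^sup>2" .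
      qed auto
      finally show "8 * (\<Sum>k\<le>n. ?w k powr (1 - p) * ((A * (4 * 2 ^ k * \<bar>s\<bar>)) powr p * g k)) + 4 * g n \<le> (8 * (32 * A) powr p * ?X) * (1 + ?\<rho> * \<bar>s\<bar>)\<^sup>2 + 4 * ?X"
        using gX by (simp add: algebra_simps)
    qed
    finally show ?thesis .
  qed
  have "(\<integral>\<^sup>+s. ennreal (norm (dil ?\<rho> s)) * (\<integral>\<^sup>+x. ennreal (norm (Fp p (S x) - Fp p (S (x + s *\<^sub>R e))) * norm (G n x)) \<partial>lborel) \<partial>lborel) \<le> ennreal ((8 * (32 * A) powr p * ?X) * \<Lambda> 2 + (4 * ?X) * \<Lambda> 0)"
    by (rule outer_bound[OF _ _ _ inner]) (use X0 in auto)
  then show ?thesis by (simp add: algebra_simps)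
qed

text \<open>The Lipschitz bound leaves D |G n| W^(p-2), where D is the increment of \<open>S\<close>
  and W adds the moduli of \<open>S\<close> at both points. Splitting D |G n| into squares lets
  Hoelder separate W^(p-2), which the a priori bound \<open>R\<close> on \<open>S\<close> controls;
  the squares then gain a geometric factor as for p <= 2.\<close>

lemma oscillation_high:
  fixes G :: "nat \<Rightarrow> 'a::euclidean_space \<Rightarrow> complex"
  assumes p: "p > 2" and n: "n \<ge> 1" and R: "R > 0"
    and b: "\<And>k. k \<le> n \<Longrightarrow> band e k (G k)" and a: "\<And>k. k \<le> n \<Longrightarrow> a k \<ge> 0" "\<And>k. k \<le> n \<Longrightarrow> Lpow p (G k) = ennreal (a k powr p)"
  defines "S \<equiv> \<lambda>x. \<Sum>k\<le>n. G k x"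
  assumes S: "Lpow p S \<le> ennreal (R powr p)"
  shows "(\<integral>\<^sup>+s. ennreal (norm (dil (2 ^ n / 8) s)) * (\<integral>\<^sup>+x. ennreal (norm (Fp p (S x) - Fp p (S (x + s *\<^sub>R e))) * norm (G n x)) \<partial>lborel) \<partial>lborel)
    \<le> ennreal ((p - 1) * (2048 * A\<^sup>2 * \<Lambda> 2 + \<Lambda> 0) * (4 * R) powr (p - 2) * (\<Sum>k\<le>n. (1/2) ^ (n - k) * (a k)\<^sup>2))"
proof -
  let ?w = "\<lambda>k. (1/2::real) ^ (n - k)" and ?\<rho> = "2 ^ n / 8 :: real"
  let ?X = "\<Sum>k\<le>n. ?w k * (a k)\<^sup>2" and ?V = "(4 * R) powr (p - 2)"
  have Gm [measurable]: "G k \<in> borel_measurable borel" if "k \<le> n" for k using b[OF that] by (simp add: band_def)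
  have Sm [measurable]: "S \<in> borel_measurable borel" unfolding S_def by measurable
  have X0: "?X \<ge> 0" by (intro sum_nonneg) auto
  have gX: "(a n)\<^sup>2 \<le> ?X" using member_le_sum[of n "{..n}" "\<lambda>k. ?w k * (a k)\<^sup>2"] by auto
  have inner: "(\<integral>\<^sup>+x. ennreal (norm (Fp p (S x) - Fp p (S (x + s *\<^sub>R e))) * norm (G n x)) \<partial>lborel) \<le>
     ennreal (((p - 1) * 2048 * A\<^sup>2 * ?V * ?X) * (1 + ?\<rho> * \<bar>s\<bar>)\<^sup>2 + (p - 1) * ?V * ?X)" for s
  proof -
    let ?W = "\<lambda>x. norm (S x) + norm (S (x + s *\<^sub>R e))"
    let ?d = "\<lambda>k x. norm (G k (x + s *\<^sub>R e) - G k x)"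
    have W: "(\<integral>\<^sup>+x. ennreal (?W x powr p) \<partial>lborel) \<le> ennreal ((4 * R) powr p)"
    proof -
      have "(\<integral>\<^sup>+x. ennreal (?W x powr p) \<partial>lborel) \<le> (\<integral>\<^sup>+x. ennreal (2 powr p) * (ennreal (norm (S x) powr p) + ennreal (norm (S (x + s *\<^sub>R e)) powr p)) \<partial>lborel)"
        using p powr_add_le[of "norm (S _)" "norm (S (_ + s *\<^sub>R e))" p]
        by (intro nn_integral_mono) (auto simp: ennreal_mult'[symmetric] ennreal_plus[symmetric] simp del: ennreal_plus)
      also have "\<dots> = ennreal (2 powr p) * (Lpow p S + Lpow p S)"
        using Lpow_shift(1)[OF Sm, of p "s *\<^sub>R e"] unfolding Lpow_def by (simp add: nn_integral_cmult nn_integral_add)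
      also have "\<dots> \<le> ennreal (2 powr p) * (ennreal (R powr p) + ennreal (R powr p))" using S by (intro mult_left_mono add_mono) auto
      also have "\<dots> = ennreal (2 powr p * 2 * R powr p)" by (simp add: ennreal_mult'[symmetric] ennreal_plus[symmetric] del: ennreal_plus)
      also have "\<dots> \<le> ennreal (2 powr p * 2 powr p * R powr p)"
        using p powr_mono[of 1 p 2] by (intro ennreal_leI mult_right_mono mult_left_mono) auto
      also have "2 powr p * 2 powr p * R powr p = (4 * R) powr p" using R by (simp flip: powr_mult)
      finally show ?thesis .
    qed
    have hd: "(\<integral>\<^sup>+x. ennreal ((?d k x)\<^sup>2 * ?W x powr (p - 2)) \<partial>lborel) \<le> ennreal ((A * (4 * 2 ^ k * \<bar>s\<bar>) * a k)\<^sup>2 * ?V)" if k: "k \<le> n" for k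
    proof (rule nn_holder_square[OF _ _ _ _ p _ _ _ W])
      have "(\<integral>\<^sup>+x. ennreal (?d k x powr p) \<partial>lborel) \<le> ennreal ((A * (4 * 2 ^ k * \<bar>s\<bar>)) powr p) * Lpow p (G k)"
        using p by (intro band_translate b k) auto
      also have "\<dots> = ennreal ((A * (4 * 2 ^ k * \<bar>s\<bar>) * a k) powr p)" using a[OF k] lam_diff(1) by (simp add: powr_mult ennreal_mult')
      finally show "(\<integral>\<^sup>+x. ennreal (?d k x powr p) \<partial>lborel) \<le> ennreal ((A * (4 * 2 ^ k * \<bar>s\<bar>) * a k) powr p)" .
    qed (use k a[OF k] R lam_diff(1) in auto)
    have hg: "(\<integral>\<^sup>+x. ennreal ((norm (G n x))\<^sup>2 * ?W x powr (p - 2)) \<partial>lborel) \<le> ennreal ((a n)\<^sup>2 * ?V)"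
      by (rule nn_holder_square[OF _ _ _ _ p _ _ _ W]) (use a[of n] R in \<open>auto simp: Lpow_def\<close>)
    have pt: "norm (Fp p (S x) - Fp p (S (x + s *\<^sub>R e))) * norm (G n x) \<le>
      (p - 1) * (\<Sum>k\<le>n. (2 / ?w k) * ((?d k x)\<^sup>2 * ?W x powr (p - 2))) + (p - 1) * ((norm (G n x))\<^sup>2 * ?W x powr (p - 2))" for x
    proof -
      let ?D = "norm (S x - S (x + s *\<^sub>R e))" and ?g = "norm (G n x)"
      have "norm (Fp p (S x) - Fp p (S (x + s *\<^sub>R e))) * ?g \<le> (p - 1) * (?D * ?W x powr (p - 2)) * ?g"
        by (intro mult_right_mono Fp_lipschitz p) auto
      also have "\<dots> = (p - 1) * ((?D * ?g) * ?W x powr (p - 2))" by (simp add: mult_ac)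
      also have "\<dots> \<le> (p - 1) * ((?D\<^sup>2 + ?g\<^sup>2) * ?W x powr (p - 2))"
      proof (intro mult_left_mono mult_right_mono)
        have "2 * (?D * ?g) \<le> ?D\<^sup>2 + ?g\<^sup>2" using sum_squares_bound[of ?D ?g] by (simp add: mult.assoc)
        then show "?D * ?g \<le> ?D\<^sup>2 + ?g\<^sup>2" using zero_le_power2[of ?D] zero_le_power2[of ?g] by linarith
      qed (use p in auto)
      finally have 1: "norm (Fp p (S x) - Fp p (S (x + s *\<^sub>R e))) * ?g \<le> (p - 1) * ((?D\<^sup>2 + ?g\<^sup>2) * ?W x powr (p - 2))" .
      have "?D \<le> (\<Sum>k\<le>n. ?d k x)"
        unfolding S_def sum_subtractf[symmetric] norm_minus_commute[of "G _ (x + s *\<^sub>R e)"] by (rule norm_sum)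
      then have "?D\<^sup>2 \<le> (\<Sum>k\<le>n. ?d k x)\<^sup>2" by (intro power_mono) auto
      also have "\<dots> \<le> (\<Sum>k\<le>n. ?w k) * (\<Sum>k\<le>n. (?d k x)\<^sup>2 / ?w k)" by (rule sum_square_weighted) auto
      also have "\<dots> \<le> 2 * (\<Sum>k\<le>n. (?d k x)\<^sup>2 / ?w k)" by (intro mult_right_mono sum_half_powers_le sum_nonneg) auto
      finally have 2: "?D\<^sup>2 \<le> (\<Sum>k\<le>n. (2 / ?w k) * (?d k x)\<^sup>2)" by (simp add: sum_distrib_left mult_ac)
      have "(?D\<^sup>2 + ?g\<^sup>2) * ?W x powr (p - 2) \<le> ((\<Sum>k\<le>n. (2 / ?w k) * (?d k x)\<^sup>2) + ?g\<^sup>2) * ?W x powr (p - 2)"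
        using 2 by (intro mult_right_mono add_right_mono) auto
      also have "\<dots> = (\<Sum>k\<le>n. (2 / ?w k) * ((?d k x)\<^sup>2 * ?W x powr (p - 2))) + ?g\<^sup>2 * ?W x powr (p - 2)"
        by (simp only: distrib_right sum_distrib_right mult.assoc)
      finally show ?thesis using mult_left_mono[of _ _ "p - 1"] p 1 by (smt (verit) distrib_left)
    qed
    have "(\<integral>\<^sup>+x. ennreal (norm (Fp p (S x) - Fp p (S (x + s *\<^sub>R e))) * norm (G n x)) \<partial>lborel) \<le>
      (\<integral>\<^sup>+x. ennreal (p - 1) * (\<Sum>k\<le>n. ennreal (2 / ?w k) * ennreal ((?d k x)\<^sup>2 * ?W x powr (p - 2))) + ennreal (p - 1) * ennreal ((norm (G n x))\<^sup>2 * ?W x powr (p - 2)) \<partial>lborel)"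
    proof (rule nn_integral_mono)
      fix x
      have "ennreal (norm (Fp p (S x) - Fp p (S (x + s *\<^sub>R e))) * norm (G n x)) \<le> ennreal ((p - 1) * (\<Sum>k\<le>n. (2 / ?w k) * ((?d k x)\<^sup>2 * ?W x powr (p - 2))) + (p - 1) * ((norm (G n x))\<^sup>2 * ?W x powr (p - 2)))"
        using pt by (rule ennreal_leI)
      also have "\<dots> = ennreal (p - 1) * ennreal (\<Sum>k\<le>n. (2 / ?w k) * ((?d k x)\<^sup>2 * ?W x powr (p - 2))) + ennreal (p - 1) * ennreal ((norm (G n x))\<^sup>2 * ?W x powr (p - 2))"
        using p by (subst ennreal_plus) (auto simp: ennreal_mult' intro!: mult_nonneg_nonneg sum_nonneg)
      also have "ennreal (\<Sum>k\<le>n. (2 / ?w k) * ((?d k x)\<^sup>2 * ?W x powr (p - 2))) = (\<Sum>k\<le>n. ennreal (2 / ?w k) * ennreal ((?d k x)\<^sup>2 * ?W x powr (p - 2)))"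
        by (subst sum_ennreal[symmetric]) (auto simp: ennreal_mult'[symmetric])
      finally show "ennreal (norm (Fp p (S x) - Fp p (S (x + s *\<^sub>R e))) * norm (G n x)) \<le> ennreal (p - 1) * (\<Sum>k\<le>n. ennreal (2 / ?w k) * ennreal ((?d k x)\<^sup>2 * ?W x powr (p - 2))) + ennreal (p - 1) * ennreal ((norm (G n x))\<^sup>2 * ?W x powr (p - 2))" .
    qed
    also have "\<dots> = ennreal (p - 1) * (\<Sum>k\<le>n. ennreal (2 / ?w k) * (\<integral>\<^sup>+x. ennreal ((?d k x)\<^sup>2 * ?W x powr (p - 2)) \<partial>lborel)) + ennreal (p - 1) * (\<integral>\<^sup>+x. ennreal ((norm (G n x))\<^sup>2 * ?W x powr (p - 2)) \<partial>lborel)"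
    proof -
      have "(\<integral>\<^sup>+x. (\<Sum>k\<le>n. ennreal (2 / ?w k) * ennreal ((?d k x)\<^sup>2 * ?W x powr (p - 2))) \<partial>lborel) = (\<Sum>k\<le>n. ennreal (2 / ?w k) * (\<integral>\<^sup>+x. ennreal ((?d k x)\<^sup>2 * ?W x powr (p - 2)) \<partial>lborel))"
        by (subst nn_integral_sum) (auto intro!: sum.cong nn_integral_cmult)
      then show ?thesis by (subst nn_integral_add) (auto simp: nn_integral_cmult)
    qed
    also have "\<dots> \<le> ennreal (p - 1) * (\<Sum>k\<le>n. ennreal (2 / ?w k) * ennreal ((A * (4 * 2 ^ k * \<bar>s\<bar>) * a k)\<^sup>2 * ?V)) + ennreal (p - 1) * ennreal ((a n)\<^sup>2 * ?V)"
      using hd hg by (intro add_mono mult_left_mono sum_mono) auto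
    also have "\<dots> = ennreal ((p - 1) * (\<Sum>k\<le>n. (2 / ?w k) * ((A * (4 * 2 ^ k * \<bar>s\<bar>) * a k)\<^sup>2 * ?V)) + (p - 1) * ((a n)\<^sup>2 * ?V))"
    proof -
      have "(\<Sum>k\<le>n. ennreal (2 / ?w k) * ennreal ((A * (4 * 2 ^ k * \<bar>s\<bar>) * a k)\<^sup>2 * ?V)) = ennreal (\<Sum>k\<le>n. (2 / ?w k) * ((A * (4 * 2 ^ k * \<bar>s\<bar>) * a k)\<^sup>2 * ?V))"
        by (subst sum_ennreal[symmetric]) (auto simp: ennreal_mult'[symmetric])
      then show ?thesis
        using p by (subst ennreal_plus) (auto simp: ennreal_mult' intro!: mult_nonneg_nonneg sum_nonneg)
    qed
    also have "\<dots> \<le> ennreal (((p - 1) * 2048 * A\<^sup>2 * ?V * ?X) * (1 + ?\<rho> * \<bar>s\<bar>)\<^sup>2 + (p - 1) * ?V * ?X)"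
    proof (rule ennreal_leI)
      have "(\<Sum>k\<le>n. (2 / ?w k) * ((A * (4 * 2 ^ k * \<bar>s\<bar>) * a k)\<^sup>2 * ?V)) = (\<Sum>k\<le>n. (2048 * A\<^sup>2 * ?V * (?\<rho> * \<bar>s\<bar>)\<^sup>2) * (?w k * (a k)\<^sup>2))"
      proof (intro sum.cong refl)
        fix k assume "k \<in> {..n}"
        then have k: "k \<le> n" by simp
        have "?w k * 2 ^ n = 2 ^ k" using k by (simp add: power_divide power_diff field_simps)
        \<comment> \<open>Again 32 = 4 * 8; its square times the 2 of \<open>2 / ?w k\<close> gives
          2048.\<close>
        then have e: "A * (4 * 2 ^ k * \<bar>s\<bar>) * a k = ?w k * ((32 * A) * (?\<rho> * \<bar>s\<bar>) * a k)" by (simp add: algebra_simps)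
        have w0: "?w k \<noteq> 0" by simp
        show "(2 / ?w k) * ((A * (4 * 2 ^ k * \<bar>s\<bar>) * a k)\<^sup>2 * ?V) = (2048 * A\<^sup>2 * ?V * (?\<rho> * \<bar>s\<bar>)\<^sup>2) * (?w k * (a k)\<^sup>2)"
          unfolding e power_mult_distrib power2_eq_square[of "?w k"] using w0 by (simp del: power_divide add: field_simps)
      qed
      also have "\<dots> = (2048 * A\<^sup>2 * ?V * (?\<rho> * \<bar>s\<bar>)\<^sup>2) * ?X" by (rule sum_distrib_left[symmetric])
      also have "\<dots> \<le> (2048 * A\<^sup>2 * ?V * (1 + ?\<rho> * \<bar>s\<bar>)\<^sup>2) * ?X"
        by (intro mult_right_mono mult_left_mono power_mono X0) auto
      finally have 1: "(p - 1) * (\<Sum>k\<le>n. (2 / ?w k) * ((A * (4 * 2 ^ k * \<bar>s\<bar>) * a k)\<^sup>2 * ?V)) \<le> (p - 1) * ((2048 * A\<^sup>2 * ?V * (1 + ?\<rho> * \<bar>s\<bar>)\<^sup>2) * ?X)"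
        using p by (intro mult_left_mono) auto
      have 2: "(p - 1) * ((a n)\<^sup>2 * ?V) \<le> (p - 1) * (?X * ?V)" using p gX by (intro mult_left_mono mult_right_mono) auto
      show "(p - 1) * (\<Sum>k\<le>n. (2 / ?w k) * ((A * (4 * 2 ^ k * \<bar>s\<bar>) * a k)\<^sup>2 * ?V)) + (p - 1) * ((a n)\<^sup>2 * ?V) \<le> ((p - 1) * 2048 * A\<^sup>2 * ?V * ?X) * (1 + ?\<rho> * \<bar>s\<bar>)\<^sup>2 + (p - 1) * ?V * ?X"
        using add_mono[OF 1 2] by (simp only: mult_ac)
    qed
    finally show ?thesis .
  qed
  have "(\<integral>\<^sup>+s. ennreal (norm (dil ?\<rho> s)) * (\<integral>\<^sup>+x. ennreal (norm (Fp p (S x) - Fp p (S (x + s *\<^sub>R e))) * norm (G n x)) \<partial>lborel) \<partial>lborel) \<le> ennreal (((p - 1) * 2048 * A\<^sup>2 * ?V * ?X) * \<Lambda> 2 + ((p - 1) * ?V * ?X) * \<Lambda> 0)"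
    by (rule outer_bound[OF _ _ _ inner]) (use X0 p in auto)
  then show ?thesis by (simp add: algebra_simps)
qed

text \<open>For p <= 2 the telescoped inequality is a linear recursion for \<open>Lpow\<close>. For
  p > 2 each increment carries R^(p-2); taking for R the norm of the largest partial sum and
  dividing by R^(p-2) bounds R^2 by the sum of squares. The exponent min p 2 / p of
  \<open>Lpow\<close> is the exponent min p 2 of the norm.\<close>

lemma littlewood_paley:
  assumes p: "p > 1"
  shows "\<exists>C\<ge>0. \<forall>(e::'a::euclidean_space) N G g. (\<forall>n\<le>N. band e n (G n) \<and> g n \<ge> 0 \<and> Lpow p (G n) = ennreal (g n)) \<longrightarrow>
    (\<exists>s\<ge>0. Lpow p (\<lambda>x. \<Sum>n\<le>N. G n x) = ennreal s \<and> s powr (min p 2 / p) \<le> C * (\<Sum>n\<le>N. g n powr (min p 2 / p)))"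
proof -
  have psums: "\<exists>\<sigma>. (\<forall>n\<le>N. \<sigma> n \<ge> 0 \<and> Lpow p (\<lambda>x. \<Sum>k\<le>n. G k x) = ennreal (\<sigma> n)) \<and> \<sigma> 0 = g 0"
    if h: "\<forall>n\<le>N. band e n (G n) \<and> g n \<ge> 0 \<and> Lpow p (G n) = ennreal (g n)" for e :: 'a and N G g
  proof -
    have "\<exists>s\<ge>0. Lpow p (\<lambda>x. \<Sum>k\<le>n. G k x) = ennreal s" if n: "n \<le> N" for n
    proof -
      have "Lpow p (\<lambda>x. \<Sum>k\<le>n. G k x) < \<infinity>"
        using h n p by (intro Lpow_sum_finite) (auto simp: band_def)
      then show ?thesis by (metis ennreal_cases infinity_ennreal_def less_irrefl)
    qed
    then obtain \<sigma> where s: "\<And>n. n \<le> N \<Longrightarrow> \<sigma> n \<ge> 0 \<and> Lpow p (\<lambda>x. \<Sum>k\<le>n. G k x) = ennreal (\<sigma> n)" by metis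
    moreover have "\<sigma> 0 = g 0" using s[of 0] h by (auto simp: ennreal_inj)
    ultimately show ?thesis by blast
  qed
  have tele: "Lpow p (\<lambda>x. \<Sum>k\<le>Suc n. G k x) \<le> Lpow p (\<lambda>x. \<Sum>k\<le>n. G k x) + ennreal p *
    (\<integral>\<^sup>+s. ennreal (norm (dil (2 ^ Suc n / 8) s)) * (\<integral>\<^sup>+x. ennreal (norm (Fp p (\<Sum>k\<le>Suc n. G k x) - Fp p (\<Sum>k\<le>Suc n. G k (x + s *\<^sub>R e))) * norm (G (Suc n) x)) \<partial>lborel) \<partial>lborel)"
    if h: "\<forall>n\<le>N. band e n (G n) \<and> g n \<ge> 0 \<and> Lpow p (G n) = ennreal (g n)" and n: "Suc n \<le> N" for e :: 'a and N G g n
  proof -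
    have m: "(\<lambda>x. \<Sum>k\<le>Suc n. G k x) \<in> borel_measurable borel"
      using h n by (intro borel_measurable_sum) (auto simp: band_def)
    have f: "Lpow p (\<lambda>x. \<Sum>k\<le>Suc n. G k x) < \<infinity>"
      using h n p by (intro Lpow_sum_finite) (auto simp: band_def)
    have eq: "(\<lambda>x. (\<Sum>k\<le>Suc n. G k x) - G (Suc n) x) = (\<lambda>x. \<Sum>k\<le>n. G k x)" by simp
    show ?thesis
      using band_telescope[OF p, of "Suc n" e "G (Suc n)" "\<lambda>x. \<Sum>k\<le>Suc n. G k x", unfolded eq, OF _ _ m f] h n by auto
  qed
  show ?thesis
  proof (cases "p \<le> 2")
    case True
    let ?c = "p * (8 * (32 * A) powr p * \<Lambda> 2 + 4 * \<Lambda> 0)"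
    have c0: "?c \<ge> 0" using p lam_moment(1) by simp
    have mp: "min p 2 / p = 1" using True p by simp
    show ?thesis unfolding mp
    proof (rule exI[of _ "1 + 2 * ?c"], intro conjI allI impI)
      show "1 + 2 * ?c \<ge> 0" using c0 by simp
      fix e :: 'a and N G g assume h: "\<forall>n\<le>N. band e n (G n) \<and> g n \<ge> 0 \<and> Lpow p (G n) = ennreal (g n)"
      obtain \<sigma> where s: "\<forall>n\<le>N. \<sigma> n \<ge> 0 \<and> Lpow p (\<lambda>x. \<Sum>k\<le>n. G k x) = ennreal (\<sigma> n)" "\<sigma> 0 = g 0" using psums[OF h] by blast
      \<comment> \<open>Extension by 0, since the recursion lemma asks for nonnegativity at every
        index.\<close>
      define y where "y k = (if k \<le> N then g k else 0)" for k
      have y0: "y k \<ge> 0" for k using h by (simp add: y_def)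
      have "\<sigma> N \<le> \<sigma> 0 + 2 * ?c * (\<Sum>k\<le>N. y k)"
      proof (rule geometric_recursion[OF c0 y0])
        fix n assume n: "n < N"
        let ?X = "\<Sum>k\<le>Suc n. (1/2) ^ (Suc n - k) * g k"
        have X0: "?X \<ge> 0" using h n by (intro sum_nonneg) auto
        have sn: "ennreal (\<sigma> (Suc n)) = Lpow p (\<lambda>x. \<Sum>k\<le>Suc n. G k x)" "Lpow p (\<lambda>x. \<Sum>k\<le>n. G k x) = ennreal (\<sigma> n)"
          using s(1) n by (auto simp del: sum.atMost_Suc)
        have "ennreal (\<sigma> (Suc n)) \<le> ennreal (\<sigma> n) + ennreal p * ennreal ((8 * (32 * A) powr p * \<Lambda> 2 + 4 * \<Lambda> 0) * ?X)"
          unfolding sn(1) sn(2)[symmetric]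
          by (rule order_trans[OF tele[OF h]], use n in simp, intro add_left_mono mult_left_mono oscillation_low[OF p True])
             (use h n in auto)
        also have "\<dots> = ennreal (\<sigma> n + ?c * ?X)"
          using c0 X0 s(1) n p lam_moment(1) by (subst ennreal_plus) (auto simp: ennreal_mult'[symmetric] mult.assoc)
        finally have "\<sigma> (Suc n) \<le> \<sigma> n + ?c * ?X"
          using s(1) n c0 X0 mult_nonneg_nonneg[OF c0 X0] by (subst (asm) ennreal_le_iff) (auto intro!: add_nonneg_nonneg)
        also have "?X = (\<Sum>k\<le>Suc n. (1/2) ^ (Suc n - k) * y k)" using n by (intro sum.cong) (auto simp: y_def)
        finally show "\<sigma> (Suc n) \<le> \<sigma> n + ?c * (\<Sum>k\<le>Suc n. (1/2) ^ (Suc n - k) * y k)" .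
      qed
      also have "(\<Sum>k\<le>N. y k) = (\<Sum>k\<le>N. g k)" by (intro sum.cong) (auto simp: y_def)
      also have "\<sigma> 0 \<le> (\<Sum>k\<le>N. g k)" unfolding s(2) using h by (intro member_le_sum) auto
      finally have "\<sigma> N \<le> (1 + 2 * ?c) * (\<Sum>k\<le>N. g k)" by (simp add: algebra_simps)
      moreover have "(\<Sum>n\<le>N. g n powr 1) = (\<Sum>k\<le>N. g k)" using h by (intro sum.cong) auto
      ultimately show "\<exists>s\<ge>0. Lpow p (\<lambda>x. \<Sum>n\<le>N. G n x) = ennreal s \<and> s powr 1 \<le> (1 + 2 * ?c) * (\<Sum>n\<le>N. g n powr 1)"
        using s(1) by (intro exI[of _ "\<sigma> N"]) auto
    qed
  next
    case False
    then have p2: "p > 2" by simp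
    let ?d = "p * ((p - 1) * (2048 * A\<^sup>2 * \<Lambda> 2 + \<Lambda> 0) * 4 powr (p - 2))"
    have d0: "?d \<ge> 0" using p lam_moment(1) by simp
    have mp: "min p 2 / p = 2 / p" using p2 by simp
    show ?thesis unfolding mp
    proof (rule exI[of _ "1 + 2 * ?d"], intro conjI allI impI)
      show "1 + 2 * ?d \<ge> 0" using d0 by simp
      fix e :: 'a and N G g assume h: "\<forall>n\<le>N. band e n (G n) \<and> g n \<ge> 0 \<and> Lpow p (G n) = ennreal (g n)"
      obtain \<sigma> where s: "\<forall>n\<le>N. \<sigma> n \<ge> 0 \<and> Lpow p (\<lambda>x. \<Sum>k\<le>n. G k x) = ennreal (\<sigma> n)" "\<sigma> 0 = g 0" using psums[OF h] by blast
      define a where "a k = (if k \<le> N then g k powr (1 / p) else 0)" for k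
      have a0: "a k \<ge> 0" for k by (simp add: a_def)
      have ag: "a k powr p = g k" if "k \<le> N" for k using that h p by (simp add: a_def powr_powr)
      have a2: "(a k)\<^sup>2 = g k powr (2 / p)" if "k \<le> N" for k
        using that by (simp add: a_def power2_eq_square powr_add[symmetric] add_divide_distrib[symmetric])
      \<comment> \<open>The recursion is run only up to the index of the largest partial sum; the
        last partial sum is then compared with it.\<close>
      obtain m where m: "m \<le> N" "\<And>n. n \<le> N \<Longrightarrow> \<sigma> n \<le> \<sigma> m"
      proof -
        have "Max (\<sigma> ` {..N}) \<in> \<sigma> ` {..N}" by (rule Max_in) auto
        then obtain m where "m \<le> N" "Max (\<sigma> ` {..N}) = \<sigma> m" unfolding image_iff by auto
        moreover have "\<sigma> n \<le> Max (\<sigma> ` {..N})" if "n \<le> N" for n using that by simp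
        ultimately show ?thesis using that[of m] by simp
      qed
      have B0: "(\<Sum>k\<le>N. (a k)\<^sup>2) \<ge> 0" by (intro sum_nonneg) auto
      have f1: "\<sigma> m powr (2 / p) \<le> (1 + 2 * ?d) * (\<Sum>k\<le>N. (a k)\<^sup>2)"
      proof (cases "\<sigma> m = 0")
        case True then show ?thesis using d0 B0 by simp
      next
        case sm: False
        define R where "R = \<sigma> m powr (1 / p)"
        have sm0: "\<sigma> m > 0" using sm s(1) m(1) by (metis order_le_less)
        have R: "R > 0" "R powr p = \<sigma> m" "R\<^sup>2 = \<sigma> m powr (2 / p)"
          using sm0 p by (auto simp: R_def powr_powr power2_eq_square powr_add[symmetric] add_divide_distrib[symmetric])
        let ?c = "?d * R powr (p - 2)"
        have c0: "?c \<ge> 0" using d0 by simp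
        have "\<sigma> m \<le> \<sigma> 0 + 2 * ?c * (\<Sum>k\<le>m. (a k)\<^sup>2)"
        proof (rule geometric_recursion[OF c0])
          fix n assume n: "n < m"
          let ?X = "\<Sum>k\<le>Suc n. (1/2) ^ (Suc n - k) * (a k)\<^sup>2"
          have X0: "?X \<ge> 0" by (intro sum_nonneg) auto
          have SR: "Lpow p (\<lambda>x. \<Sum>k\<le>Suc n. G k x) \<le> ennreal (R powr p)"
            using s(1) n m unfolding R(2) by (auto intro: ennreal_leI simp del: sum.atMost_Suc)
          have sn: "ennreal (\<sigma> (Suc n)) = Lpow p (\<lambda>x. \<Sum>k\<le>Suc n. G k x)" "Lpow p (\<lambda>x. \<Sum>k\<le>n. G k x) = ennreal (\<sigma> n)"
            using s(1) n m by (auto simp del: sum.atMost_Suc)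
          have "ennreal (\<sigma> (Suc n)) \<le> ennreal (\<sigma> n) + ennreal p * ennreal ((p - 1) * (2048 * A\<^sup>2 * \<Lambda> 2 + \<Lambda> 0) * (4 * R) powr (p - 2) * ?X)"
            unfolding sn(1) sn(2)[symmetric]
            by (rule order_trans[OF tele[OF h]], use n m in simp, intro add_left_mono mult_left_mono oscillation_high[OF p2 _ R(1) _ _ _ SR])
               (use h n m a0 ag in auto)
          also have "\<dots> = ennreal (\<sigma> n + ?c * ?X)"
          proof -
            have "p * ((p - 1) * (2048 * A\<^sup>2 * \<Lambda> 2 + \<Lambda> 0) * (4 * R) powr (p - 2) * ?X) = ?c * ?X"
              using R(1) by (simp add: powr_mult mult_ac)
            moreover have "\<sigma> n \<ge> 0" using s(1) n m by auto
            ultimately show ?thesis using p mult_nonneg_nonneg[OF c0 X0] by (subst ennreal_mult'[symmetric]) (auto simp: ennreal_plus)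
          qed
          finally show "\<sigma> (Suc n) \<le> \<sigma> n + ?c * ?X"
            using s(1) n m c0 X0 mult_nonneg_nonneg[OF c0 X0] by (subst (asm) ennreal_le_iff) (auto intro!: add_nonneg_nonneg)
        qed simp
        also have "\<dots> \<le> \<sigma> 0 + 2 * ?c * (\<Sum>k\<le>N. (a k)\<^sup>2)"
          using m(1) c0 by (intro add_left_mono mult_left_mono sum_mono2) auto
        \<comment> \<open>The initial term must show the same homogeneity as the increments before
          R^(p-2) can be divided out.\<close>
        also have "\<sigma> 0 \<le> R powr (p - 2) * (\<Sum>k\<le>N. (a k)\<^sup>2)"
        proof -
          have "a 0 \<le> R" unfolding R_def a_def using m(2)[of 0] s h p by (auto intro!: powr_mono2)
          then have "a 0 powr (p - 2) \<le> R powr (p - 2)" using p2 a0 by (intro powr_mono2) auto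
          moreover have "\<sigma> 0 = a 0 powr (p - 2) * (a 0)\<^sup>2"
            using ag[of 0] s(2) powr_mult_self[OF a0[of 0], of "p - 2"] powr_mult_self[OF a0[of 0], of "p - 1"] by (simp add: power2_eq_square mult.assoc[symmetric])
          moreover have "(a 0)\<^sup>2 \<le> (\<Sum>k\<le>N. (a k)\<^sup>2)" by (rule member_le_sum) auto
          ultimately show ?thesis by (auto intro!: mult_mono)
        qed
        finally have "R powr p \<le> R powr (p - 2) * ((1 + 2 * ?d) * (\<Sum>k\<le>N. (a k)\<^sup>2))"
          unfolding R(2) by (simp add: algebra_simps)
        moreover have "R powr p = R powr (p - 2) * R\<^sup>2" using R(1) by (simp add: powr_diff powr_numeral)
        ultimately have "R\<^sup>2 \<le> (1 + 2 * ?d) * (\<Sum>k\<le>N. (a k)\<^sup>2)" using R(1) by simp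
        then show ?thesis using R(3) by simp
      qed
      have f2: "\<sigma> N powr (2 / p) \<le> \<sigma> m powr (2 / p)" using s(1) m p by (intro powr_mono2) auto
      have f3: "(\<Sum>k\<le>N. (a k)\<^sup>2) = (\<Sum>n\<le>N. g n powr (2 / p))" using a2 by (intro sum.cong) auto
      have "\<sigma> N powr (2 / p) \<le> (1 + 2 * ?d) * (\<Sum>n\<le>N. g n powr (2 / p))"
        using order_trans[OF f2 f1] unfolding f3 .
      then show "\<exists>s\<ge>0. Lpow p (\<lambda>x. \<Sum>n\<le>N. G n x) = ennreal s \<and> s powr (2 / p) \<le> (1 + 2 * ?d) * (\<Sum>n\<le>N. g n powr (2 / p))"
        using s(1) by (intro exI[of _ "\<sigma> N"]) auto
    qed
  qed
qed

end

section \<open>The generators and their kernels\<close>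

text \<open>The kernel along a coordinate lives on \<open>real\<close>, the Schwartz theory on
  \<open>real^'n\<close>; \<open>real^1\<close> connects them.\<close>

lemma lborel_vec1: "distr lborel borel (\<lambda>s::real. vec s :: real^1) = lborel"
proof (rule lborel_eqI[symmetric])
  have m [measurable]: "(\<lambda>s::real. vec s :: real^1) \<in> borel_measurable borel"
    by (intro borel_measurable_continuous_onI) (auto intro!: continuous_on_vec_lambda simp: vec_def)
  fix l u :: "real^1" assume le: "\<And>b. b \<in> Basis \<Longrightarrow> l \<bullet> b \<le> u \<bullet> b"
  have B: "Basis = {axis 1 1 :: real^1}" by (auto simp: Basis_vec_def num1_eq1)
  have "l $ 1 \<le> u $ 1" using le[of "axis 1 1"] by (simp add: B inner_axis)
  moreover have "(\<lambda>s::real. vec s :: real^1) -` box l u = {l $ 1 <..< u $ 1}"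
    by (auto simp: mem_box B inner_axis)
  ultimately show "emeasure (distr lborel borel (\<lambda>s::real. vec s :: real^1)) (box l u) = (\<Prod>b\<in>Basis. (u - l) \<bullet> b)"
    by (subst emeasure_distr) (auto simp: B inner_axis)
qed simp

lemma integral_vec1:
  fixes f :: "real^1 \<Rightarrow> 'b::{banach,second_countable_topology}"
  assumes [measurable]: "f \<in> borel_measurable borel"
  shows "(LINT s|lborel. f (vec s)) = (LINT x|lborel. f x)" "integrable lborel (\<lambda>s. f (vec s)) \<longleftrightarrow> integrable lborel f"
proof -
  have m [measurable]: "(\<lambda>s::real. vec s :: real^1) \<in> borel_measurable borel"
    by (intro borel_measurable_continuous_onI) (auto intro!: continuous_on_vec_lambda simp: vec_def)
  show "(LINT s|lborel. f (vec s)) = (LINT x|lborel. f x)"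
    by (subst lborel_vec1[symmetric], subst integral_distr) auto
  show "integrable lborel (\<lambda>s. f (vec s)) \<longleftrightarrow> integrable lborel f"
    by (subst lborel_vec1[symmetric], subst integrable_distr_eq) auto
qed

lemma norm_vec1: "norm (vec s :: real^1) = \<bar>s\<bar>"
  by (simp add: norm_vec_def)

lemma nn_integral_decay_bound:
  fixes f :: "real \<Rightarrow> real"
  assumes [measurable]: "f \<in> borel_measurable borel" and f: "\<And>s. f s \<le> C / (1 + s\<^sup>2)" and C: "C \<ge> 0"
  shows "(\<integral>\<^sup>+s. ennreal (f s) \<partial>lborel) \<le> ennreal (C * (LINT s|lborel. 1 / (1 + s\<^sup>2)))"
proof -
  have "(\<integral>\<^sup>+s. ennreal (f s) \<partial>lborel) \<le> (\<integral>\<^sup>+s. ennreal (C * (1 / (1 + s\<^sup>2))) \<partial>lborel)"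
    using f by (intro nn_integral_mono ennreal_leI) simp
  also have "\<dots> = ennreal (LINT s|lborel. C * (1 / (1 + s\<^sup>2)))"
    using C integrable_inverse_one_plus_square by (intro nn_integral_eq_integral Bochner_Integration.integrable_mult_right AE_I2 mult_nonneg_nonneg) auto
  finally show ?thesis by (simp only: integral_mult_right_zero)
qed

lemma one_plus_square_le: "1 + (s::real)\<^sup>2 \<le> (1 + \<bar>s\<bar>)\<^sup>2"
  using abs_ge_zero[of s] by (simp add: power2_sum)

locale mixed_gen =
  fixes \<phi>0 :: "real \<Rightarrow> real"
  assumes gen: "mixed_generator \<phi>0"
begin

lemma phi_smooth: "(deriv ^^ k) \<phi>0 differentiable (at x)" using gen by (simp add: mixed_generator_def)
lemma phi_one: "\<bar>s\<bar> \<le> 1 \<Longrightarrow> \<phi>0 s = 1" using gen by (simp add: mixed_generator_def)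
lemma phi_zero: "\<bar>s\<bar> > 3/2 \<Longrightarrow> \<phi>0 s = 0" using gen by (simp add: mixed_generator_def)

definition low1 :: "real^1 \<Rightarrow> complex" where "low1 \<xi> = complex_of_real (\<phi>0 (\<xi> $ 1))"

lemma low1_schwartz: "low1 \<in> schwartz"
proof (rule schwartz_compact)
  show "smooth_fun low1" unfolding low1_def[abs_def]
    by (intro pderivs_linear(2)[OF bounded_linear_of_real] smooth_fun_coord phi_smooth)
  show "low1 x = 0" if "norm x > 3/2" for x
  proof -
    have "x = vec (x $ 1)" by (auto simp: vec_eq_iff num1_eq1)
    then have "norm x = \<bar>x $ 1\<bar>" by (metis norm_vec1)
    then show ?thesis using phi_zero that by (simp add: low1_def)
  qed
qed

definition lam :: "real \<Rightarrow> complex" where "lam s = iFT low1 (vec s)"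

lemma lam_schw: "iFT low1 \<in> schwartz" by (intro iFT_schwartz low1_schwartz)

lemma lam_decay: "\<exists>C\<ge>0. \<forall>s. norm (lam s) \<le> C / (1 + \<bar>s\<bar>) ^ k"
proof -
  obtain C where "C \<ge> 0" "\<And>x. norm (pderivs [] (iFT low1) x) \<le> C / (1 + norm x) ^ k" using schwartz_bound[OF lam_schw, of "[]" k] by blast
  then show ?thesis by (intro exI[of _ C]) (auto simp: lam_def norm_vec1[symmetric] simp del: norm_vec1)
qed

lemma lam_derivative: "\<exists>l' C. C \<ge> 0 \<and> (\<forall>s. (lam has_vector_derivative l' s) (at s)) \<and> (\<forall>s. norm (l' s) \<le> C / (1 + \<bar>s\<bar>)\<^sup>2)"
proof -
  let ?K = "iFT low1"
  obtain C where C: "C \<ge> 0" "\<And>x. norm (pderivs [1] ?K x) \<le> C / (1 + norm x) ^ 2" using schwartz_bound[OF lam_schw, of "[1]" 2] by blast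
  have "(lam has_vector_derivative pderivs [1] ?K (vec s)) (at s)" for s
  proof -
    have K: "(?K has_derivative frechet_derivative ?K (at (vec s))) (at (vec s))"
      using smooth_fun_has_derivative[OF schwartz_smooth[OF lam_schw], of "[]"] by simp
    have v: "((\<lambda>s::real. vec s :: real^1) has_derivative vec) (at s)"
    proof -
      have "bounded_linear (vec :: real \<Rightarrow> real^1)" by (rule linear_conv_bounded_linear[THEN iffD1], rule linearI) (auto simp: vec_eq_iff)
      then show ?thesis by (rule bounded_linear_imp_has_derivative)
    qed
    have lin: "linear (frechet_derivative ?K (at y))" for y
      using smooth_fun_has_derivative[OF schwartz_smooth[OF lam_schw], of "[]" y] by (intro has_derivative_linear[of ?K]) simp
    have e: "vec h = h *\<^sub>R (axis 1 1 :: real^1)" for h :: real by (auto simp: vec_eq_iff axis_def num1_eq1)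
    have "(\<lambda>h. frechet_derivative ?K (at (vec s)) (vec h)) = (\<lambda>h. h *\<^sub>R frechet_derivative ?K (at (vec s)) (axis 1 1))"
      unfolding e[of "_::real"] using linear_scale[OF lin] by (simp add: e)
    then show ?thesis
      using has_derivative_compose[OF v K] by (simp add: lam_def[abs_def] has_vector_derivative_def)
  qed
  then show ?thesis using C by (intro exI[of _ "\<lambda>s. pderivs [1] ?K (vec s)"] exI[of _ C]) (auto simp: norm_vec1[symmetric] simp del: norm_vec1)
qed

lemma lam_continuous: "continuous_on UNIV lam"
proof -
  obtain l' where "\<And>s. (lam has_vector_derivative l' s) (at s)" using lam_derivative by blast
  then show ?thesis by (intro continuous_at_imp_continuous_on ballI has_vector_derivative_continuous)
qed

lemma lam_integrable: "integrable lborel lam"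
  unfolding lam_def[abs_def] using integral_vec1(2)[OF schwartz_borel[OF lam_schw]] schwartz_integrable[OF lam_schw] by simp

lemma lam_fourier: "(LINT s|lborel. lam s * cis (- (s * \<xi>))) = complex_of_real (\<phi>0 \<xi>)"
proof -
  have [measurable]: "iFT low1 \<in> borel_measurable borel" by (rule schwartz_borel[OF lam_schw])
  have "(LINT s|lborel. lam s * cis (- (s * \<xi>))) = (LINT s|lborel. cis (- ((vec s :: real^1) \<bullet> vec \<xi>)) * iFT low1 (vec s))"
    by (simp add: lam_def inner_vec_def mult_ac)
  also have "\<dots> = FT (iFT low1) (vec \<xi>)"
    unfolding FT_def by (rule integral_vec1(1)[of "\<lambda>x. cis (- (x \<bullet> vec \<xi>)) * iFT low1 x"]) measurable
  also have "\<dots> = complex_of_real (\<phi>0 \<xi>)" by (simp add: FT_iFT[OF low1_schwartz] low1_def)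
  finally show ?thesis .
qed

text \<open>Translation bound: for |h| <= 1 by the mean value inequality and the decay of the
  derivative, for |h| > 1 by the triangle inequality, as |h| then absorbs the constant. Mass 1 is
  \<open>\<phi>0 0 = 1\<close>.\<close>

lemma lam_kernel: "\<exists>\<Lambda> A. smoothing_kernel lam \<Lambda> A"
proof -
  let ?I = "LINT s|lborel. 1 / (1 + (s::real)\<^sup>2)"
  have I0: "?I \<ge> 0" by (intro integral_nonneg_AE) auto
  have [measurable]: "lam \<in> borel_measurable borel" by (rule borel_measurable_continuous_onI[OF lam_continuous])
  have mom: "\<exists>L\<ge>0. (\<integral>\<^sup>+s. ennreal (norm (lam s) * (1 + \<bar>s\<bar>) ^ k) \<partial>lborel) \<le> ennreal L" for k
  proof -
    obtain C where C: "C \<ge> 0" "\<And>s. norm (lam s) \<le> C / (1 + \<bar>s\<bar>) ^ (k + 2)" using lam_decay by blast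
    have "norm (lam s) * (1 + \<bar>s\<bar>) ^ k \<le> C / (1 + s\<^sup>2)" for s
    proof -
      have "norm (lam s) * (1 + \<bar>s\<bar>) ^ k \<le> C / (1 + \<bar>s\<bar>) ^ (k + 2) * (1 + \<bar>s\<bar>) ^ k" using C by (intro mult_right_mono) auto
      also have "\<dots> = C / (1 + \<bar>s\<bar>)\<^sup>2" by (simp add: power_add power2_eq_square)
      also have "\<dots> \<le> C / (1 + s\<^sup>2)" using C one_plus_square_le[of s] by (intro divide_left_mono mult_pos_pos zero_less_power) (auto simp: add_pos_nonneg)
      finally show ?thesis .
    qed
    from nn_integral_decay_bound[OF _ this C(1)] show ?thesis using C(1) I0 by (intro exI[of _ "C * ?I"]) auto
  qed
  then obtain \<Lambda> where L: "\<And>k. \<Lambda> k \<ge> 0" "\<And>k. (\<integral>\<^sup>+s. ennreal (norm (lam s) * (1 + \<bar>s\<bar>) ^ k) \<partial>lborel) \<le> ennreal (\<Lambda> k)" by metis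
  obtain l' C where C: "C \<ge> 0" "\<And>s. (lam has_vector_derivative l' s) (at s)" "\<And>s. norm (l' s) \<le> C / (1 + \<bar>s\<bar>)\<^sup>2" using lam_derivative by blast
  let ?A = "4 * C * ?I + 2 * \<Lambda> 0"
  have "(\<integral>\<^sup>+s. ennreal (norm (lam (s - h) - lam s)) \<partial>lborel) \<le> ennreal (?A * \<bar>h\<bar>)" for h
  proof (cases "\<bar>h\<bar> \<le> 1")
    case True
    have le: "norm (lam (s - h) - lam s) \<le> (4 * C * \<bar>h\<bar>) / (1 + s\<^sup>2)" for s
    proof -
      have "norm (lam (s + (- h)) - lam s) \<le> (4 * C * \<bar>h\<bar>) / (1 + s\<^sup>2)"
      proof (rule norm_diff_le_along[of lam "\<lambda>y v. v *\<^sub>R l' y"])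
        show "(lam has_derivative (\<lambda>v. v *\<^sub>R l' y)) (at y)" for y using C(2)[of y] by (simp add: has_vector_derivative_def)
        fix \<theta> :: real assume t: "0 \<le> \<theta>" "\<theta> \<le> 1"
        let ?y = "s + \<theta> *\<^sub>R (- h)"
        have "\<bar>\<theta> * h\<bar> \<le> 1" using t True by (simp add: abs_mult mult_le_one)
        \<comment> \<open>Along a segment of length at most 1 the weight loses at most a factor 2,
          its square the factor 4 of \<open>?A\<close>.\<close>
        then have "1 + \<bar>s\<bar> \<le> 2 * (1 + \<bar>?y\<bar>)" by (simp add: abs_if split: if_splits)
        then have "(1 + \<bar>s\<bar>)\<^sup>2 \<le> (2 * (1 + \<bar>?y\<bar>))\<^sup>2" by (intro power_mono) auto
        then have "1 + s\<^sup>2 \<le> 4 * (1 + \<bar>?y\<bar>)\<^sup>2"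
          using one_plus_square_le[of s] unfolding power_mult_distrib by simp
        then have "C / (1 + \<bar>?y\<bar>)\<^sup>2 \<le> 4 * C / (1 + s\<^sup>2)"
          using C(1) mult_left_mono[of "1 + s\<^sup>2" "4 * (1 + \<bar>?y\<bar>)\<^sup>2" C] by (simp add: field_simps add_pos_nonneg)
        then have "\<bar>h\<bar> * norm (l' ?y) \<le> \<bar>h\<bar> * (4 * C / (1 + s\<^sup>2))" using C(3)[of ?y] by (intro mult_left_mono) auto
        then show "norm ((- h) *\<^sub>R l' ?y) \<le> (4 * C * \<bar>h\<bar>) / (1 + s\<^sup>2)" by (simp add: mult_ac)
      qed
      then show ?thesis by simp
    qed
    have "(\<integral>\<^sup>+s. ennreal (norm (lam (s - h) - lam s)) \<partial>lborel) \<le> ennreal ((4 * C * \<bar>h\<bar>) * ?I)"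
      by (rule nn_integral_decay_bound[OF _ le]) (use C(1) in auto)
    also have "\<dots> \<le> ennreal (?A * \<bar>h\<bar>)" using L(1)[of 0] by (intro ennreal_leI) (simp add: algebra_simps)
    finally show ?thesis .
  next
    case False
    have "(\<integral>\<^sup>+s. ennreal (norm (lam (s - h) - lam s)) \<partial>lborel) \<le> (\<integral>\<^sup>+s. ennreal (norm (lam (s - h))) + ennreal (norm (lam s)) \<partial>lborel)"
      by (intro nn_integral_mono) (auto simp: norm_triangle_ineq4 simp flip: ennreal_plus)
    also have "\<dots> = (\<integral>\<^sup>+s. ennreal (norm (lam s)) \<partial>lborel) + (\<integral>\<^sup>+s. ennreal (norm (lam s)) \<partial>lborel)"
      using nn_integral_lborel_shift(3)[of "\<lambda>s. ennreal (norm (lam s))" h] by (subst nn_integral_add) auto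
    also have "\<dots> \<le> ennreal (\<Lambda> 0) + ennreal (\<Lambda> 0)" using L(2)[of 0] by (intro add_mono) auto
    also have "\<dots> = ennreal (2 * \<Lambda> 0 * 1)" using L(1)[of 0] by (simp flip: ennreal_plus)
    also have "\<dots> \<le> ennreal (?A * \<bar>h\<bar>)" using False L(1)[of 0] C(1) I0 by (intro ennreal_leI mult_mono) auto
    finally show ?thesis .
  qed
  moreover have "(LINT s|lborel. lam s) = 1" using lam_fourier[of 0] phi_one[of 0] by simp
  ultimately have "smoothing_kernel lam \<Lambda> ?A"
    using L lam_integrable C(1) I0 by unfold_locales (auto simp: add_nonneg_nonneg)
  then show ?thesis by blast
qed

text \<open>\<open>\<phi>0 (s / 2)\<close> is 1 up to |s| = 2 and \<open>\<phi>0 (4 * s)\<close>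
  vanishes beyond 3/8, so the value is 1 on the rescaled support of a mixed piece: 1/2 <= |s| <= 3/2
  if \<open>b\<close>, and |s| <= 3/2 otherwise. It is 0 beyond 3 and, if \<open>b\<close>, also for
  |s| <= 1/4.\<close>

definition al :: "bool \<Rightarrow> real \<Rightarrow> real" where
  "al b s = \<phi>0 (s / 2) - (if b then \<phi>0 (4 * s) else 0)"

text \<open>Equal to 1 on the support of the mixed piece with the same index, so multiplying by it is harmless;
  it makes the multiplier of an isotropic piece adapted to a single dyadic box.\<close>
definition fat_piece :: "('n::finite \<Rightarrow> nat) \<Rightarrow> real^'n \<Rightarrow> real" where
  "fat_piece k \<xi> = (\<Prod>i\<in>UNIV. al (k i \<ge> 1) (\<xi> $ i / 2 ^ k i))"

lemma al_zero: "\<bar>s\<bar> > 3 \<Longrightarrow> al b s = 0"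
  using phi_zero[of "s / 2"] phi_zero[of "4 * s"] by (auto simp: al_def)

lemma al_true_zero: "\<bar>s\<bar> \<le> 1/4 \<Longrightarrow> al True s = 0"
  using phi_one[of "s / 2"] phi_one[of "4 * s"] by (auto simp: al_def)

lemma al_one:
  assumes "mixed_piece1 \<phi>0 j s \<noteq> 0"
  shows "al (j \<ge> 1) (s / 2 ^ j) = 1"
proof -
  define t where "t = s / 2 ^ j"
  have t32: "\<bar>t\<bar> \<le> 3/2"
  proof (rule ccontr)
    assume "\<not> \<bar>t\<bar> \<le> 3/2"
    then have "\<phi>0 t = 0" "\<phi>0 (2 * t) = 0" using phi_zero[of t] phi_zero[of "2 * t"] by auto
    then show False using assms by (auto simp: mixed_piece1_def t_def split: if_splits)
  qed
  have 1: "\<phi>0 (t / 2) = 1" using t32 by (intro phi_one) auto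
  show ?thesis
  proof (cases "j = 0")
    case False
    have "\<bar>t\<bar> \<ge> 1/2"
    proof (rule ccontr)
      assume "\<not> \<bar>t\<bar> \<ge> 1/2"
      then have "\<phi>0 t = 1" "\<phi>0 (2 * t) = 1" using phi_one[of t] phi_one[of "2 * t"] by auto
      then show False using assms False by (auto simp: mixed_piece1_def t_def)
    qed
    then have "\<phi>0 (4 * t) = 0" by (intro phi_zero) auto
    then show ?thesis using 1 False by (simp add: al_def t_def)
  qed (use 1 in \<open>simp add: al_def t_def\<close>)
qed

lemma fat_piece_one:
  assumes "mixed_piece \<phi>0 k \<xi> \<noteq> 0"
  shows "fat_piece k \<xi> = 1"
  unfolding fat_piece_def by (rule prod.neutral, intro ballI, rule al_one) (use assms in \<open>auto simp: mixed_piece_def\<close>)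

lemma fat_piece_support:
  assumes "fat_piece k \<xi> \<noteq> 0"
  shows "\<bar>\<xi> $ i\<bar> \<le> 3 * 2 ^ k i"
proof -
  have "al (k i \<ge> 1) (\<xi> $ i / 2 ^ k i) \<noteq> 0" using assms by (auto simp: fat_piece_def)
  then have "\<not> \<bar>\<xi> $ i / 2 ^ k i\<bar> > 3" using al_zero by blast
  then show ?thesis by (simp add: abs_divide field_simps)
qed

lemma fat_piece_gap:
  assumes "fat_piece k \<xi> \<noteq> 0" "k i \<ge> 1"
  shows "\<bar>\<xi> $ i\<bar> > 2 ^ k i / 4"
proof -
  have "al (k i \<ge> 1) (\<xi> $ i / 2 ^ k i) \<noteq> 0" using assms(1) unfolding fat_piece_def prod_zero_iff[OF finite] by blast
  moreover have "(k i \<ge> 1) = True" using assms(2) by simp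
  ultimately have "\<not> \<bar>\<xi> $ i / 2 ^ k i\<bar> \<le> 1/4" using al_true_zero by metis
  then show ?thesis by (simp add: abs_divide field_simps)
qed

lemma smooth_phi_coord: "smooth_fun (\<lambda>x::real^'n::finite. \<phi>0 (c * x $ i))"
proof -
  have "smooth_fun (\<lambda>x::real^'n. (\<lambda>x. \<phi>0 (x $ i)) (diag_affine 0 (\<lambda>_. c) x))"
    by (intro pderivs_diag_affine(2) smooth_fun_coord phi_smooth)
  then show ?thesis by (simp add: diag_affine_def)
qed

lemma smooth_al_coord: "smooth_fun (\<lambda>x::real^'n::finite. al b (c * x $ i))"
  using pderivs_minus(1)[OF smooth_phi_coord[of "c / 2" i] smooth_phi_coord[of "4 * c" i]] smooth_phi_coord[of "c / 2" i]
  by (cases b) (simp_all add: al_def mult_ac)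

lemma smooth_fat_piece: "smooth_fun (fat_piece k)"
  unfolding fat_piece_def[abs_def] using smooth_al_coord[of _ "1 / 2 ^ k _"] by (intro smooth_fun_prod) auto

lemma smooth_mixed_piece1: "smooth_fun (\<lambda>x::real^'n::finite. mixed_piece1 \<phi>0 j (x $ i))"
  using smooth_phi_coord[of 1 i] pderivs_minus(1)[OF smooth_phi_coord[of "1 / 2 ^ j" i] smooth_phi_coord[of "2 / 2 ^ j" i]]
  by (cases "j = 0") (simp_all add: mixed_piece1_def)

lemma smooth_mixed_piece: "smooth_fun (mixed_piece \<phi>0 k)"
  unfolding mixed_piece_def[abs_def] by (intro smooth_fun_prod smooth_mixed_piece1) auto

lemma mixed_piece1_support: "mixed_piece1 \<phi>0 j s \<noteq> 0 \<Longrightarrow> \<bar>s\<bar> \<le> 3/2 * 2 ^ j"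
  using phi_zero[of "s / 2 ^ j"] phi_zero[of "2 * s / 2 ^ j"] unfolding mixed_piece1_def
  by (force simp: field_simps abs_mult split: if_splits)

lemma mixed_piece_support: "mixed_piece \<phi>0 k \<xi> \<noteq> 0 \<Longrightarrow> \<bar>\<xi> $ i\<bar> \<le> 3/2 * 2 ^ k i"
  using mixed_piece1_support[of "k i" "\<xi> $ i"] unfolding mixed_piece_def by force

end

lemma norm_le_coord_bound:
  fixes x :: "real^'n::finite"
  assumes "\<And>i. \<bar>x $ i\<bar> \<le> B i" shows "norm x \<le> (\<Sum>i\<in>UNIV. B i)"
  using norm_le_l1_cart[of x] sum_mono[of UNIV "\<lambda>i. \<bar>x $ i\<bar>" B] assms by force

section \<open>Uniform decay of kernels\<close>

text \<open>\<open>B\<close> is an argument so that one bound can serve a whole family of functions;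
  uniformity in j and k is expressed this way.\<close>

definition bounded_derivs :: "('n list \<Rightarrow> real) \<Rightarrow> (real^'n::finite \<Rightarrow> 'b::real_normed_vector) \<Rightarrow> bool" where
  "bounded_derivs B f \<longleftrightarrow> smooth_fun f \<and> (\<forall>is x. norm (pderivs is f x) \<le> B is)"

lemma bounded_derivs_mult:
  fixes f g :: "real^'n::finite \<Rightarrow> 'b::real_normed_algebra"
  assumes "bounded_derivs A f" "bounded_derivs B g"
  shows "bounded_derivs (\<lambda>is. \<Sum>(a, b)\<leftarrow>splits is. A a * B b) (\<lambda>x. f x * g x)"
proof -
  have sf: "smooth_fun f" and sg: "smooth_fun g" using assms by (auto simp: bounded_derivs_def)
  have "norm (\<Sum>(a, b)\<leftarrow>xs. pderivs a f x * pderivs b g x) \<le> (\<Sum>(a, b)\<leftarrow>xs. A a * B b)" for xs x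
  proof (induction xs)
    case (Cons ab xs)
    obtain a b where ab: "ab = (a, b)" by (cases ab)
    have "norm (pderivs a f x * pderivs b g x) \<le> A a * B b"
      using assms by (intro order_trans[OF norm_mult_ineq] mult_mono) (auto simp: bounded_derivs_def intro: order_trans[OF norm_ge_zero])
    then show ?case using Cons ab by (auto intro!: order_trans[OF norm_triangle_ineq] add_mono)
  qed simp
  then show ?thesis unfolding bounded_derivs_def using pderivs_mult[OF sf sg] by auto
qed

lemma bounded_derivs_diag:
  assumes f: "bounded_derivs B f" and d: "\<And>i. \<bar>d i\<bar> \<le> c"
  shows "bounded_derivs (\<lambda>is. c ^ length is * B is) (\<lambda>x. f (diag_affine b d x))"
proof -
  have sf: "smooth_fun f" using f by (simp add: bounded_derivs_def)
  have c: "c \<ge> 0" using d order_trans[OF abs_ge_zero] by blast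
  have p: "\<bar>prod_list (map d is)\<bar> \<le> c ^ length is" for "is"
    using d c by (induction "is") (auto simp: abs_mult intro!: mult_mono)
  show ?thesis unfolding bounded_derivs_def pderivs_diag_affine(1)[OF sf]
    using pderivs_diag_affine(2)[OF sf] p f c by (auto simp: bounded_derivs_def intro!: mult_mono)
qed

lemma bounded_derivs_compact:
  fixes f :: "real^'n::finite \<Rightarrow> 'b::real_normed_vector"
  assumes "smooth_fun f" "\<And>x. norm x > R \<Longrightarrow> f x = 0"
  shows "\<exists>B. bounded_derivs B f \<and> (\<forall>is. B is \<ge> 0)"
proof -
  have "\<forall>is. \<exists>B\<ge>0. \<forall>x. norm (pderivs is f x) \<le> B" using pderivs_bounded[OF assms] by blast
  then obtain B where "\<forall>is. B is \<ge> 0 \<and> (\<forall>x. norm (pderivs is f x) \<le> B is)" by metis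
  then show ?thesis using assms by (auto simp: bounded_derivs_def)
qed

text \<open>The constant depends on \<open>B\<close> and the support radius but not on
  \<open>m\<close>. Each power of decay costs one derivative, and it is the one applied first; hence
  the bound \<open>\<lambda>is. B (is @ [i])\<close> for the derivative.\<close>

lemma FT_uniform_decay:
  fixes B :: "'n::finite list \<Rightarrow> real"
  shows "\<exists>C\<ge>0. \<forall>m::real^'n \<Rightarrow> complex. bounded_derivs B m \<and> (\<forall>x. norm x > R \<longrightarrow> m x = 0) \<longrightarrow> (\<forall>z. (1 + norm z) ^ k * norm (FT m z) \<le> C)"
proof (induction k arbitrary: B)
  case 0
  let ?C = "LINT x::real^'n|lborel. indicator (cball 0 R) x * \<bar>B []\<bar>"
  have i: "integrable lborel (\<lambda>x::real^'n. indicator (cball 0 R) x * \<bar>B []\<bar>)"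
    by (intro integrable_mult_left integrable_real_indicator) (simp, rule emeasure_bounded_finite, simp)
  have "norm (FT m z) \<le> ?C" if "bounded_derivs B m \<and> (\<forall>x. norm x > R \<longrightarrow> m x = 0)" for m z
  proof -
    have "norm (m x) \<le> B []" for x using that unfolding bounded_derivs_def by (metis pderivs.simps(1))
    then have "norm (cis (- (x \<bullet> z)) * m x) \<le> indicator (cball 0 R) x * \<bar>B []\<bar>" for x
      using that by (auto simp: norm_mult indicator_def intro: order_trans[OF _ abs_ge_self])
    then show ?thesis unfolding FT_def by (intro norm_integral_le i)
  qed
  moreover have "?C \<ge> 0" by (intro integral_nonneg_AE) auto
  ultimately show ?case by (intro exI[of _ ?C]) auto
next
  case (Suc k)
  obtain C0 where C0: "C0 \<ge> 0" "\<And>m z. bounded_derivs B m \<and> (\<forall>x. norm x > R \<longrightarrow> m x = 0) \<Longrightarrow> (1 + norm z) ^ k * norm (FT m z) \<le> C0"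
    using Suc[of B] by blast
  have "\<forall>i. \<exists>C\<ge>0. \<forall>m z. bounded_derivs (\<lambda>is. B (is @ [i])) m \<and> (\<forall>x. norm x > R \<longrightarrow> m x = 0) \<longrightarrow> (1 + norm z) ^ k * norm (FT m z) \<le> C"
    using Suc by blast
  then obtain C where C: "\<And>i. C i \<ge> 0" "\<And>i m z. bounded_derivs (\<lambda>is. B (is @ [i])) m \<and> (\<forall>x. norm x > R \<longrightarrow> m x = 0) \<Longrightarrow> (1 + norm z) ^ k * norm (FT m z) \<le> C i"
    by metis
  have "(1 + norm z) ^ Suc k * norm (FT m z) \<le> C0 + (\<Sum>i\<in>UNIV. C i)" if h: "bounded_derivs B m \<and> (\<forall>x. norm x > R \<longrightarrow> m x = 0)" for m z
  proof -
    have m: "m \<in> schwartz" using h by (intro schwartz_compact[of _ R]) (auto simp: bounded_derivs_def)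
    let ?m = "\<lambda>i x. frechet_derivative m (at x) (axis i 1)"
    have op: "open {x::real^'n. norm x > R}" by (intro open_Collect_less continuous_intros)
    have "bounded_derivs (\<lambda>is. B (is @ [i])) (?m i) \<and> (\<forall>x. norm x > R \<longrightarrow> ?m i x = 0)" for i
      using h smooth_fun_pderivs[of m "[i]"] pderivs_zero_on_open[OF op, of m _ "[i]"] pderivs_append[of _ "[i]" m]
      unfolding bounded_derivs_def by (auto simp: fun_eq_iff) (metis pderivs_append pderivs.simps)+
    then have Ci: "(1 + norm z) ^ k * norm (FT (?m i) z) \<le> C i" for i using C(2) by blast
    have "(1 + norm z) ^ Suc k * norm (FT m z) \<le> (1 + (\<Sum>i\<in>UNIV. \<bar>z $ i\<bar>)) * ((1 + norm z) ^ k * norm (FT m z))"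
      using norm_le_l1_cart[of z] unfolding power_Suc mult.assoc by (intro mult_right_mono) auto
    also have "\<dots> = (1 + norm z) ^ k * norm (FT m z) + (\<Sum>i\<in>UNIV. (1 + norm z) ^ k * norm (FT (?m i) z))"
      unfolding FT_partial[OF m] by (simp add: norm_mult ring_distribs sum_distrib_left sum_distrib_right mult_ac)
    also have "\<dots> \<le> C0 + (\<Sum>i\<in>UNIV. C i)" using Ci C0(2)[OF h] by (intro add_mono sum_mono) auto
    finally show ?thesis .
  qed
  moreover have "C0 + (\<Sum>i\<in>UNIV. C i) \<ge> 0" using C0 C by (intro add_nonneg_nonneg sum_nonneg) auto
  ultimately show ?case by blast
qed

section \<open>Convolution kernels adapted to dyadic boxes\<close>

locale gens = mixed_gen \<phi>0 for \<phi>0 +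
  fixes \<psi>0 :: "real^'n::finite \<Rightarrow> real"
  assumes iso_gen: "iso_generator \<psi>0"
begin

lemma psi_smooth: "smooth_fun \<psi>0" using iso_gen by (simp add: iso_generator_def)
lemma psi_one: "(\<And>i. \<bar>x $ i\<bar> \<le> 1) \<Longrightarrow> \<psi>0 x = 1" using iso_gen by (simp add: iso_generator_def)
lemma psi_zero: "\<bar>x $ i\<bar> \<ge> 3/2 \<Longrightarrow> \<psi>0 x = 0" using iso_gen unfolding iso_generator_def by blast

lemma psi_compact: "norm x > (\<Sum>i\<in>(UNIV::'n set). 3/2) \<Longrightarrow> \<psi>0 x = 0"
  using norm_le_coord_bound[of x "\<lambda>_. 3/2"] psi_zero[of x] by (metis linorder_not_le nle_le)

lemma smooth_iso_piece: "smooth_fun (iso_piece \<psi>0 j)"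
proof -
  have eq: "diag_affine 0 (\<lambda>_. c) x = c *\<^sub>R x" for c and x :: "real^'n" by (auto simp: diag_affine_def vec_eq_iff)
  have "smooth_fun (\<lambda>x. \<psi>0 (c *\<^sub>R x))" for c
    using pderivs_diag_affine(2)[OF psi_smooth, of 0 "\<lambda>_. c"] by (simp add: eq)
  then show ?thesis unfolding iso_piece_def using psi_smooth by (auto intro!: pderivs_minus(1))
qed

text \<open>The multiplier that turns the \<open>k\<close>-th mixed piece into its share of the
  \<open>j\<close>-th isotropic piece.\<close>

definition mc :: "nat \<Rightarrow> ('n \<Rightarrow> nat) \<Rightarrow> real^'n \<Rightarrow> complex" where
  "mc j k \<xi> = complex_of_real (fat_piece k \<xi> * iso_piece \<psi>0 j \<xi>)"

definition ker :: "nat \<Rightarrow> ('n \<Rightarrow> nat) \<Rightarrow> real^'n \<Rightarrow> complex" where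
  "ker j k = iFT (mc j k)"

definition vol :: "('n \<Rightarrow> nat) \<Rightarrow> real" where "vol k = (\<Prod>i\<in>UNIV. 2 ^ k i)"

abbreviation dl :: "('n \<Rightarrow> nat) \<Rightarrow> real^'n \<Rightarrow> real^'n" where "dl k \<equiv> diag_affine 0 (\<lambda>i. 2 ^ k i)"

lemma vol_pos: "vol k > 0" unfolding vol_def by (intro prod_pos) auto

lemma mc_support: "mc j k \<xi> \<noteq> 0 \<Longrightarrow> \<bar>\<xi> $ i\<bar> \<le> 3 * 2 ^ k i"
  using fat_piece_support[of k \<xi> i] by (auto simp: mc_def)

lemma mc_gap: "mc j k \<xi> \<noteq> 0 \<Longrightarrow> k i \<ge> 1 \<Longrightarrow> \<bar>\<xi> $ i\<bar> > 2 ^ k i / 4"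
  using fat_piece_gap[of k \<xi> i] by (auto simp: mc_def)

lemma mc_schwartz: "mc j k \<in> schwartz"
proof (rule schwartz_compact)
  show "smooth_fun (mc j k)" unfolding mc_def[abs_def]
    by (intro pderivs_linear(2)[OF bounded_linear_of_real] pderivs_mult(2) smooth_fat_piece smooth_iso_piece)
  show "mc j k x = 0" if "norm x > (\<Sum>i\<in>UNIV. 3 * 2 ^ k i)" for x
    using norm_le_coord_bound[of x "\<lambda>i. 3 * 2 ^ k i"] mc_support[of j k x] that by (metis linorder_not_le)
qed

lemma ker_schwartz: "ker j k \<in> schwartz" unfolding ker_def by (intro iFT_schwartz mc_schwartz)

lemma ker_borel [measurable]: "ker j k \<in> borel_measurable borel" by (rule schwartz_borel[OF ker_schwartz])

text \<open>In coordinates rescaled to the box of \<open>k\<close>, the fat piece has one of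
  finitely many forms, one for each set of coordinates with k_i >= 1. The isotropic factor is
  stretched by at most 2 * 2^(k_i) / 2^j <= 4 since k_i <= j + 1, so at the scale of the box its
  derivatives stay bounded.\<close>

lemma mc_uniform: "\<exists>B. \<forall>j k. (\<forall>i. k i \<le> Suc j) \<longrightarrow> bounded_derivs B (\<lambda>\<eta>. mc j k (dl k \<eta>))"
proof -
  let ?a = "\<lambda>b (\<eta>::real^'n). \<Prod>i\<in>UNIV. al (b i) (\<eta> $ i)"
  have "\<forall>b. \<exists>B. bounded_derivs B (?a b) \<and> (\<forall>is. B is \<ge> 0)"
  proof
    fix b :: "'n \<Rightarrow> bool"
    show "\<exists>B. bounded_derivs B (?a b) \<and> (\<forall>is. B is \<ge> 0)"
    proof (rule bounded_derivs_compact[where R="\<Sum>i\<in>(UNIV::'n set). 3"])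
      show "smooth_fun (?a b)" using smooth_al_coord[of _ 1] by (intro smooth_fun_prod) auto
      show "?a b x = 0" if x: "norm x > (\<Sum>i\<in>(UNIV::'n set). 3)" for x
      proof -
        obtain i where "\<bar>x $ i\<bar> > 3" using norm_le_coord_bound[of x "\<lambda>_. 3"] x by (metis linorder_not_le)
        then show ?thesis using al_zero by (intro prod_zero) auto
      qed
    qed
  qed
  then obtain Ba where Ba: "\<And>b. bounded_derivs (Ba b) (?a b)" "\<And>b is. Ba b is \<ge> 0" by metis
  define B1 where "B1 is = (\<Sum>b\<in>UNIV. Ba b is)" for "is"
  have B1: "bounded_derivs B1 (?a b)" for b
    unfolding bounded_derivs_def
  proof (intro conjI allI)
    show "smooth_fun (?a b)" using Ba(1) by (simp add: bounded_derivs_def)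
    fix "is" x
    have "norm (pderivs is (?a b) x) \<le> Ba b is" using Ba(1) by (simp add: bounded_derivs_def)
    also have "\<dots> \<le> B1 is" unfolding B1_def using Ba(2) by (intro member_le_sum) auto
    finally show "norm (pderivs is (?a b) x) \<le> B1 is" .
  qed
  obtain Bp where Bp: "bounded_derivs Bp \<psi>0" "\<And>is. Bp is \<ge> 0" using bounded_derivs_compact[OF psi_smooth psi_compact] by blast
  define B2 where "B2 is = 4 ^ length is * Bp is + 4 ^ length is * Bp is" for "is"
  have B2: "bounded_derivs B2 (\<lambda>\<eta>. iso_piece \<psi>0 j (dl k \<eta>))" if k: "\<forall>i. k i \<le> Suc j" for j k
  proof -
    have pw: "(2::real) ^ k i \<le> 2 * 2 ^ j" for i using power_increasing[of "k i" "Suc j" "2::real"] k by simp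
    show ?thesis
    proof (cases "j = 0")
      case True
      have "bounded_derivs (\<lambda>is. 4 ^ length is * Bp is) (\<lambda>\<eta>. \<psi>0 (dl k \<eta>))"
      proof (rule bounded_derivs_diag[OF Bp(1)])
        show "\<bar>2 ^ k i\<bar> \<le> (4::real)" for i using pw[of i] True by simp
      qed
      moreover have "4 ^ length is * Bp is \<le> B2 is" for "is" unfolding B2_def using Bp(2) by simp
      ultimately show ?thesis unfolding iso_piece_def bounded_derivs_def using True by (simp, meson order_trans)
    next
      case False
      have e: "c *\<^sub>R dl k \<eta> = diag_affine 0 (\<lambda>i. c * 2 ^ k i) \<eta>" for c \<eta> by (auto simp: diag_affine_def vec_eq_iff)
      have 1: "bounded_derivs (\<lambda>is. 4 ^ length is * Bp is) (\<lambda>\<eta>. \<psi>0 ((1 / 2 ^ j) *\<^sub>R dl k \<eta>))"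
        unfolding e
      proof (rule bounded_derivs_diag[OF Bp(1)])
        have "(2::real) ^ k i \<le> 4 * 2 ^ j" for i using pw[of i] zero_less_power[of "2::real" j] by linarith
        then show "\<bar>1 / 2 ^ j * 2 ^ k i\<bar> \<le> (4::real)" for i by (simp add: field_simps)
      qed
      have 2: "bounded_derivs (\<lambda>is. 4 ^ length is * Bp is) (\<lambda>\<eta>. \<psi>0 ((2 / 2 ^ j) *\<^sub>R dl k \<eta>))"
        unfolding e
      proof (rule bounded_derivs_diag[OF Bp(1)])
        show "\<bar>2 / 2 ^ j * 2 ^ k i\<bar> \<le> (4::real)" for i using pw[of i] zero_less_power[of "2::real" j] by (simp add: field_simps)
      qed
      have s: "smooth_fun (\<lambda>\<eta>. \<psi>0 ((1 / 2 ^ j) *\<^sub>R dl k \<eta>))" "smooth_fun (\<lambda>\<eta>. \<psi>0 ((2 / 2 ^ j) *\<^sub>R dl k \<eta>))"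
        using 1 2 by (auto simp: bounded_derivs_def)
      have "norm (pderivs is (\<lambda>\<eta>. \<psi>0 ((1 / 2 ^ j) *\<^sub>R dl k \<eta>)) x - pderivs is (\<lambda>\<eta>. \<psi>0 ((2 / 2 ^ j) *\<^sub>R dl k \<eta>)) x) \<le> B2 is" for "is" x
        unfolding B2_def using 1 2 by (intro order_trans[OF norm_triangle_ineq4] add_mono) (auto simp: bounded_derivs_def)
      then show ?thesis unfolding iso_piece_def bounded_derivs_def using False pderivs_minus[OF s] by simp
    qed
  qed
  let ?B = "\<lambda>is. \<Sum>(a, b)\<leftarrow>splits is. B1 a * B2 b"
  have "bounded_derivs ?B (\<lambda>\<eta>. mc j k (dl k \<eta>))" if k: "\<forall>i. k i \<le> Suc j" for j k
  proof -
    have f: "fat_piece k (dl k \<eta>) = ?a (\<lambda>i. k i \<ge> 1) \<eta>" for \<eta> by (simp add: fat_piece_def diag_affine_def)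
    have b: "bounded_derivs ?B (\<lambda>\<eta>. fat_piece k (dl k \<eta>) * iso_piece \<psi>0 j (dl k \<eta>))"
      unfolding f by (rule bounded_derivs_mult[OF B1 B2[OF k]])
    then have s: "smooth_fun (\<lambda>\<eta>. fat_piece k (dl k \<eta>) * iso_piece \<psi>0 j (dl k \<eta>))" by (simp add: bounded_derivs_def)
    show ?thesis using b unfolding mc_def bounded_derivs_def pderivs_linear(1)[OF bounded_linear_of_real s]
      using pderivs_linear(2)[OF bounded_linear_of_real s] by (simp only: norm_of_real) simp
  qed
  then show ?thesis by (intro exI[of _ ?B]) auto
qed

lemma FT_mc_scale: "FT (mc j k) z = complex_of_real (vol k) * FT (\<lambda>\<eta>. mc j k (dl k \<eta>)) (dl k z)"
proof -
  have [measurable]: "mc j k \<in> borel_measurable borel" by (rule schwartz_borel[OF mc_schwartz])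
  have i: "dl k x \<bullet> z = x \<bullet> dl k z" for x by (simp add: diag_affine_def inner_vec_def mult_ac)
  have "FT (mc j k) z = (\<Prod>i\<in>UNIV. \<bar>2 ^ k i\<bar>) *\<^sub>R (LINT x|lborel. cis (- (dl k x \<bullet> z)) * mc j k (dl k x))"
    unfolding FT_def by (rule lborel_integral_diag_affine) auto
  then show ?thesis unfolding i FT_def by (simp add: vol_def scaleR_conv_of_real)
qed

lemma ker_decay: "\<exists>C\<ge>0. \<forall>j k x. (\<forall>i. k i \<le> Suc j) \<longrightarrow> norm (ker j k x) \<le> C * vol k / (1 + norm (dl k x)) ^ L"
proof -
  obtain B where B: "\<And>j k. (\<forall>i. k i \<le> Suc j) \<Longrightarrow> bounded_derivs B (\<lambda>\<eta>. mc j k (dl k \<eta>))" using mc_uniform by blast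
  let ?R = "\<Sum>i\<in>(UNIV::'n set). 3::real"
  obtain C where C: "C \<ge> 0" "\<And>m z. bounded_derivs B m \<Longrightarrow> (\<forall>x. norm x > ?R \<longrightarrow> m x = 0) \<Longrightarrow> (1 + norm z) ^ L * norm (FT m z) \<le> C"
    using FT_uniform_decay[of B ?R L] by blast
  have "norm (ker j k x) \<le> C * vol k / (1 + norm (dl k x)) ^ L" if k: "\<forall>i. k i \<le> Suc j" for j k x
  proof -
    have z: "\<forall>x. norm x > ?R \<longrightarrow> mc j k (dl k x) = 0"
    proof (intro allI impI)
      fix x :: "real^'n" assume x: "norm x > ?R"
      then obtain i where "\<bar>x $ i\<bar> > 3" using norm_le_coord_bound[of x "\<lambda>_. 3"] by (metis linorder_not_le)
      then have "\<bar>dl k x $ i\<bar> > 3 * 2 ^ k i" by (simp add: diag_affine_def abs_mult)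
      then show "mc j k (dl k x) = 0" using mc_support[of j k "dl k x" i] by force
    qed
    have n: "norm (dl k (- x)) = norm (dl k x)"
    proof -
      have "dl k (- x) = - dl k x" by (simp add: diag_affine_def vec_eq_iff)
      then show ?thesis by simp
    qed
    have le: "norm (FT (\<lambda>\<eta>. mc j k (dl k \<eta>)) (dl k (- x))) \<le> C / (1 + norm (dl k x)) ^ L"
      using C(2)[OF B[OF k] z, of "dl k (- x)"] unfolding n by (simp add: field_simps add_pos_nonneg)
    have pi1: "(1::real) / (2 * pi) ^ CARD('n) \<le> 1"
    proof -
      have "1 \<le> (2 * pi) ^ CARD('n)" using pi_ge_two by (intro one_le_power) linarith
      moreover have "1 / x \<le> 1" if "1 \<le> x" for x :: real using that by simp
      ultimately show ?thesis by blast
    qed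
    have "norm (ker j k x) = 1 / (2 * pi) ^ CARD('n) * (vol k * norm (FT (\<lambda>\<eta>. mc j k (dl k \<eta>)) (dl k (- x))))"
      unfolding ker_def iFT_eq_FT FT_mc_scale using vol_pos[of k] by (simp add: norm_mult norm_divide norm_power)
    also have "\<dots> \<le> 1 * (vol k * (C / (1 + norm (dl k x)) ^ L))"
      using pi1 le vol_pos[of k] by (intro mult_mono) (auto intro: less_imp_le)
    finally show ?thesis by (simp add: mult_ac)
  qed
  then show ?thesis using C(1) by blast
qed

text \<open>The kernel has height about \<open>vol k\<close> on a set of volume about 1 /
  \<open>vol k\<close>, hence the power p - 1. The order of decay \<open>L\<close> is taken so large
  that the p-th power is still integrable.\<close>

lemma ker_Lpow:
  assumes p: "p > 0"
  shows "\<exists>C\<ge>0. \<forall>j k. (\<forall>i. k i \<le> Suc j) \<longrightarrow> Lpow p (ker j k) \<le> ennreal (C * vol k powr (p - 1))"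
proof -
  obtain L :: nat where L: "real L \<ge> 2 * CARD('n) / p" using real_arch_simple by blast
  then have Lp: "real L * p \<ge> real (2 * CARD('n))" using p by (simp add: field_simps)
  obtain C where C: "C \<ge> 0" "\<And>j k x. (\<forall>i. k i \<le> Suc j) \<Longrightarrow> norm (ker j k x) \<le> C * vol k / (1 + norm (dl k x)) ^ L" using ker_decay[of L] by blast
  define h where "h x = 1 / (1 + norm x) ^ (2 * CARD('n))" for x :: "real^'n"
  have hi: "integrable lborel h" unfolding h_def using integrable_norm_decay[where 'a="real^'n"] by simp
  have [measurable]: "h \<in> borel_measurable borel" unfolding h_def by measurable
  let ?I = "LINT x|lborel. h x"
  have h0: "h x \<ge> 0" for x by (simp add: h_def)
  have I: "(\<integral>\<^sup>+x. ennreal (h x) \<partial>lborel) = ennreal ?I" by (rule nn_integral_eq_integral[OF hi]) (auto simp: h0)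
  have "Lpow p (ker j k) \<le> ennreal ((C powr p * ?I) * vol k powr (p - 1))" if k: "\<forall>i. k i \<le> Suc j" for j k
  proof -
    let ?c = "C powr p * vol k powr (p - 1)"
    have pt: "norm (ker j k x) powr p \<le> ?c * (vol k * h (dl k x))" for x
    proof -
      let ?N = "1 + norm (dl k x)"
      have N: "?N \<ge> 1" by simp
      have "norm (ker j k x) powr p \<le> (C * vol k / ?N ^ L) powr p" using C(2)[OF k] p by (intro powr_mono2) auto
      also have "\<dots> = C powr p * vol k powr p * (1 / ?N powr (real L * p))"
      proof -
        have "(?N ^ L) powr p = ?N powr (real L * p)"
          using powr_realpow[of ?N L, OF less_le_trans[OF zero_less_one N]] by (simp add: powr_powr[symmetric])
        then show ?thesis by (simp add: powr_divide powr_mult)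
      qed
      also have "\<dots> \<le> C powr p * vol k powr p * h (dl k x)"
      proof (rule mult_left_mono)
        have "?N powr real (2 * CARD('n)) \<le> ?N powr (real L * p)" using N Lp by (intro powr_mono) auto
        then have "?N ^ (2 * CARD('n)) \<le> ?N powr (real L * p)" using N by (subst (asm) powr_realpow[OF less_le_trans[OF zero_less_one N]]) auto
        then show "1 / ?N powr (real L * p) \<le> h (dl k x)" unfolding h_def using less_le_trans[OF zero_less_one N] by (intro divide_left_mono) auto
      qed (use C vol_pos in auto)
      also have "vol k powr p = vol k powr (p - 1) * vol k" using powr_mult_self[of "vol k" "p - 1"] vol_pos[of k] by simp
      finally show ?thesis by (simp add: mult_ac)
    qed
    have "Lpow p (ker j k) \<le> (\<integral>\<^sup>+x. ennreal ?c * (ennreal (vol k) * ennreal (h (dl k x))) \<partial>lborel)"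
      unfolding Lpow_def using pt vol_pos[of k] h0 by (intro nn_integral_mono) (simp add: ennreal_mult'[symmetric] ennreal_leI)
    also have "\<dots> = ennreal ?c * (ennreal (vol k) * (\<integral>\<^sup>+x. ennreal (h (dl k x)) \<partial>lborel))"
      by (simp add: nn_integral_cmult)
    also have "ennreal (vol k) * (\<integral>\<^sup>+x. ennreal (h (dl k x)) \<partial>lborel) = ennreal ?I"
      using nn_integral_diag_affine[of "\<lambda>i. 2 ^ k i" "\<lambda>x. ennreal (h x)" 0] unfolding I by (simp add: vol_def)
    also have "ennreal ?c * ennreal ?I = ennreal ((C powr p * ?I) * vol k powr (p - 1))"
      using h0 by (simp add: ennreal_mult'[symmetric] mult_ac)
    finally show ?thesis .
  qed
  moreover have "C powr p * ?I \<ge> 0" using h0 by (intro mult_nonneg_nonneg integral_nonneg_AE) auto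
  ultimately show ?thesis by blast
qed

lemma ker_bounded: "\<exists>B\<ge>0. \<forall>x. norm (ker j k x) \<le> B"
proof -
  obtain C where "C \<ge> 0" "\<And>x. norm (pderivs [] (ker j k) x) \<le> C / (1 + norm x) ^ 0" using schwartz_bound[OF ker_schwartz] by blast
  then show ?thesis by auto
qed

section \<open>Convolution with the kernels\<close>

definition cv :: "nat \<Rightarrow> ('n \<Rightarrow> nat) \<Rightarrow> (real^'n \<Rightarrow> complex) \<Rightarrow> real^'n \<Rightarrow> complex" where
  "cv j k g y = (LINT x|lborel. ker j k (y - x) * g x)"

text \<open>The integral of absolute values: where it is finite, \<open>cv\<close> is a genuine
  integral and not the default value 0 of a divergent one.\<close>

definition cva :: "nat \<Rightarrow> ('n \<Rightarrow> nat) \<Rightarrow> (real^'n \<Rightarrow> complex) \<Rightarrow> real^'n \<Rightarrow> ennreal" where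
  "cva j k g y = (\<integral>\<^sup>+x. ennreal (norm (ker j k (y - x)) * norm (g x)) \<partial>lborel)"

lemma cv_borel [measurable]:
  assumes [measurable]: "g \<in> borel_measurable borel"
  shows "cv j k g \<in> borel_measurable borel"
  unfolding cv_def[abs_def] by measurable

lemma cv_integrable:
  assumes [measurable]: "g \<in> borel_measurable borel" and "cva j k g y < \<infinity>"
  shows "integrable lborel (\<lambda>x. ker j k (y - x) * g x)"
  using assms(2) unfolding integrable_iff_bounded cva_def by (simp add: norm_mult)

lemma cv_le_cva:
  assumes "g \<in> borel_measurable borel" "cva j k g y < \<infinity>"
  shows "ennreal (norm (cv j k g y)) \<le> cva j k g y"
  unfolding cv_def cva_def using integral_norm_bound_ennreal[OF cv_integrable[OF assms]] by (simp add: norm_mult)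

lemma cva_eq: "g \<in> borel_measurable borel \<Longrightarrow> cva j k g y = (\<integral>\<^sup>+s. ennreal (norm (ker j k s) * norm (g (y - s))) \<partial>lborel)"
  using nn_integral_lborel_shift(2)[of "\<lambda>x. ennreal (norm (ker j k (y - x)) * norm (g x))" y] unfolding cva_def by simp

lemma ker_L1: "\<exists>W\<ge>0. \<forall>j k. (\<forall>i. k i \<le> Suc j) \<longrightarrow> (\<integral>\<^sup>+x. ennreal (norm (ker j k x)) \<partial>lborel) \<le> ennreal W"
proof -
  obtain C where C: "C \<ge> 0" "\<And>j k. (\<forall>i. k i \<le> Suc j) \<Longrightarrow> Lpow 1 (ker j k) \<le> ennreal (C * vol k powr (1 - 1))" using ker_Lpow[of 1] by auto
  have "(\<integral>\<^sup>+x. ennreal (norm (ker j k x)) \<partial>lborel) \<le> ennreal C" if "\<forall>i. k i \<le> Suc j" for j k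
    using C(2)[OF that] vol_pos[of k] by (simp add: Lpow_def)
  then show ?thesis using C(1) by blast
qed

lemma cva_bounded_ge1:
  assumes [measurable]: "g \<in> borel_measurable borel" and p: "p \<ge> 1" and g: "Lpow p g < \<infinity>"
  shows "\<exists>B. \<forall>y. cva j k g y \<le> ennreal B"
proof -
  obtain K where K: "K \<ge> 0" "\<And>x. norm (ker j k x) \<le> K" using ker_bounded by blast
  have pt: "norm (ker j k (y - x)) * norm (g x) \<le> norm (ker j k (y - x)) + K * norm (g x) powr p" for x y
  proof -
    \<comment> \<open>A crude substitute for Hoelder: only finiteness is wanted here, so the bound
      may depend on \<open>j\<close>, \<open>k\<close> and \<open>g\<close>.\<close>
    have "norm (g x) \<le> 1 + norm (g x) powr p"
    proof (cases "norm (g x) \<le> 1")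
      case False
      then have "norm (g x) powr 1 \<le> norm (g x) powr p" using p by (intro powr_mono) auto
      then show ?thesis using False by simp
    qed (auto intro: add_increasing2)
    then have "norm (ker j k (y - x)) * norm (g x) \<le> norm (ker j k (y - x)) * (1 + norm (g x) powr p)" by (intro mult_left_mono) auto
    also have "\<dots> \<le> norm (ker j k (y - x)) + K * norm (g x) powr p" using K by (simp add: distrib_left mult_right_mono)
    finally show ?thesis .
  qed
  let ?B = "(\<integral>\<^sup>+x. ennreal (norm (ker j k x)) \<partial>lborel) + ennreal K * Lpow p g"
  have "cva j k g y \<le> ?B" for y
  proof -
    have "cva j k g y \<le> (\<integral>\<^sup>+x. ennreal (norm (ker j k (y - x))) + ennreal K * ennreal (norm (g x) powr p) \<partial>lborel)"
      unfolding cva_def using pt K(1) by (intro nn_integral_mono) (auto simp: ennreal_mult'[symmetric] simp flip: ennreal_plus)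
    also have "\<dots> = ?B"
      unfolding Lpow_def using nn_integral_lborel_shift(2)[of "\<lambda>x. ennreal (norm (ker j k x))" y] by (simp add: nn_integral_add nn_integral_cmult)
    finally show ?thesis .
  qed
  moreover have "?B < \<infinity>"
    using g schwartz_integrable[OF ker_schwartz, of j k] by (auto simp: integrable_iff_bounded ennreal_mult_less_top)
  then obtain b where "?B = ennreal b" by (metis ennreal_cases infinity_ennreal_def less_irrefl)
  ultimately show ?thesis by metis
qed

lemma cv_Lpow_ge1:
  assumes p: "p \<ge> 1"
  shows "\<exists>C\<ge>0. \<forall>j k g. (\<forall>i. k i \<le> Suc j) \<longrightarrow> g \<in> borel_measurable borel \<longrightarrow> Lpow p g < \<infinity> \<longrightarrow> Lpow p (cv j k g) \<le> ennreal C * Lpow p g"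
proof -
  obtain W where W: "W \<ge> 0" "\<And>j k. (\<forall>i. k i \<le> Suc j) \<Longrightarrow> (\<integral>\<^sup>+x. ennreal (norm (ker j k x)) \<partial>lborel) \<le> ennreal W" using ker_L1 by blast
  have "Lpow p (cv j k g) \<le> ennreal (W powr p) * Lpow p g"
    if k: "\<forall>i. k i \<le> Suc j" and g [measurable]: "g \<in> borel_measurable borel" and gp: "Lpow p g < \<infinity>" for j k g
    unfolding Lpow_def
  proof (rule convolution_powr_le[where \<kappa>="\<lambda>s. norm (ker j k s)" and \<tau>="\<lambda>s. s"])
    obtain B where "\<And>y. cva j k g y \<le> ennreal B" using cva_bounded_ge1[OF g p gp] by blast
    then have "cva j k g y < \<infinity>" for y by (metis ennreal_less_top infinity_ennreal_def order_le_less_trans)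
    then show "ennreal (norm (cv j k g x)) \<le> (\<integral>\<^sup>+s. ennreal (norm (ker j k s) * norm (g (x - s))) \<partial>lborel)" for x
      using cv_le_cva[OF g] cva_eq[OF g] by metis
  qed (use p W k in auto)
  then show ?thesis by (intro exI[of _ "W powr p"]) auto
qed

end

section \<open>Band-limited integrands and the case p < 1\<close>

lemma tempered_zero: "tempered f \<Longrightarrow> f (\<lambda>x. 0) = 0"
proof -
  assume "tempered f"
  then have "\<forall>\<phi>\<in>schwartz. \<forall>c. f (\<lambda>x. c * \<phi> x) = c * f \<phi>" by (simp add: tempered_def)
  from this[rule_format, OF schwartz_zero, of 0] show ?thesis by simp
qed

lemma tempered_sum:
  assumes f: "tempered f" and "finite A" "\<And>a. a \<in> A \<Longrightarrow> h a \<in> schwartz"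
  shows "f (\<lambda>x. \<Sum>a\<in>A. h a x) = (\<Sum>a\<in>A. f (h a))"
  using assms(2,3)
proof (induction rule: finite_induct)
  case empty then show ?case using tempered_zero[OF f] by simp
next
  case (insert a A)
  have "f (\<lambda>x. h a x + (\<Sum>a\<in>A. h a x)) = f (h a) + f (\<lambda>x. \<Sum>a\<in>A. h a x)"
    using f insert schwartz_sum[of A h] unfolding tempered_def by auto
  then show ?case using insert by simp
qed

lemma FT_zero: "FT (\<lambda>x. 0) = (\<lambda>x. 0)" unfolding FT_def by simp

lemma FT_sum:
  assumes "\<And>a. a \<in> A \<Longrightarrow> h a \<in> schwartz"
  shows "FT (\<lambda>x. \<Sum>a\<in>A. h a x) = (\<lambda>\<xi>. \<Sum>a\<in>A. FT (h a) \<xi>)"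
  unfolding FT_def sum_distrib_left
  using assms by (intro ext Bochner_Integration.integral_sum integrable_cis_mult schwartz_integrable)

lemma schwartz_reflect: "\<phi> \<in> schwartz \<Longrightarrow> (\<lambda>x. \<phi> (y - x)) \<in> schwartz"
proof -
  assume "\<phi> \<in> schwartz"
  then have "(\<lambda>x. \<phi> (diag_affine y (\<lambda>_. -1) x)) \<in> schwartz" by (rule schwartz_diag_affine) simp
  moreover have "diag_affine y (\<lambda>_. -1) x = y - x" for x by (simp add: diag_affine_def vec_eq_iff)
  ultimately show ?thesis by simp
qed

lemma represents_borel: "represents T g \<Longrightarrow> g \<in> borel_measurable borel"
  by (simp add: represents_def)

context gens
begin

lemma ker_eq: "ker j k z = complex_of_real (1 / (2 * pi) ^ CARD('n)) * (LINT \<xi>|lborel. cis (z \<bullet> \<xi>) * mc j k \<xi>)"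
  unfolding ker_def iFT_def ..

lemma mixed_schwartz_mult:
  fixes k :: "'n \<Rightarrow> nat"
  assumes "\<phi> \<in> schwartz" shows "(\<lambda>\<xi>. complex_of_real (mixed_piece \<phi>0 k \<xi>) * \<phi> \<xi>) \<in> schwartz"
proof (rule slow_mult_schwartz[OF _ assms], rule slow_compact)
  show "smooth_fun (\<lambda>\<xi>::real^'n. complex_of_real (mixed_piece \<phi>0 k \<xi>))"
    by (intro pderivs_linear(2)[OF bounded_linear_of_real] smooth_mixed_piece)
  show "complex_of_real (mixed_piece \<phi>0 k x) = 0" if "norm x > (\<Sum>i\<in>UNIV. 3/2 * 2 ^ k i)" for x :: "real^'n"
    using norm_le_coord_bound[of x "\<lambda>i. 3/2 * 2 ^ k i"] mixed_piece_support[of k x] that by (metis linorder_not_le of_real_0)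
qed

text \<open>The spectrum of a product lies in the sum of the spectra: 3/2 from the mixed piece and 3
  from the kernel give 9/2. As \<open>g\<close> is tied to \<open>f\<close> only through test
  functions, the transform is written as \<open>f\<close> evaluated at a function that vanishes
  identically.\<close>

lemma cv_fourier_zero:
  assumes f: "tempered f" and g: "represents (fourier_mult (mixed_piece \<phi>0 k) f) g" and \<xi>: "\<bar>\<xi> $ i\<bar> > 9/2 * 2 ^ k i"
  shows "(LINT x|lborel. cis (- (x \<bullet> \<xi>)) * (ker j k (y - x) * g x)) = 0"
proof -
  let ?c = "complex_of_real (1 / (2 * pi) ^ CARD('n))"
  \<comment> \<open>The inverse transform of the test function that multiplies \<open>g\<close>:
    \<open>mc j k\<close> moved by \<open>\<xi>\<close> and modulated by \<open>y\<close>.\<close>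
  define w where "w \<zeta> = ?c * (cis (- (y \<bullet> \<xi>)) * (cis (\<zeta> \<bullet> y) * mc j k (\<zeta> - \<xi>)))" for \<zeta>
  have [measurable]: "mc j k \<in> borel_measurable borel" by (rule schwartz_borel[OF mc_schwartz])
  have ms: "(\<lambda>\<zeta>. mc j k (\<zeta> - \<xi>)) \<in> schwartz"
    using schwartz_diag_affine[OF mc_schwartz[of j k], of "\<lambda>_. 1" "- \<xi>"] by (simp add: diag_affine_def)
  have ws: "w \<in> schwartz" unfolding w_def[abs_def]
    by (intro schwartz_cmult slow_mult_schwartz[OF slow_cis] ms)
  have FTw: "FT w x = cis (- (x \<bullet> \<xi>)) * ker j k (y - x)" for x
  proof -
    have "FT w x = (LINT \<zeta>|lborel. cis (- ((\<xi> + \<zeta>) \<bullet> x)) * w (\<xi> + \<zeta>))"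
      unfolding FT_def by (rule lborel_shift(1)[symmetric]) (use schwartz_borel[OF ws] in measurable)
    also have "\<dots> = (LINT \<zeta>|lborel. (?c * cis (- (x \<bullet> \<xi>))) * (cis ((y - x) \<bullet> \<zeta>) * mc j k \<zeta>))"
    proof (rule Bochner_Integration.integral_cong[OF refl])
      fix \<zeta>
      have "cis (- ((\<xi> + \<zeta>) \<bullet> x)) * (cis (- (y \<bullet> \<xi>)) * cis ((\<xi> + \<zeta>) \<bullet> y)) = cis (- (x \<bullet> \<xi>)) * cis ((y - x) \<bullet> \<zeta>)"
        unfolding cis_mult by (simp add: inner_add_left inner_diff_left inner_commute algebra_simps)
      then have "?c * ((cis (- ((\<xi> + \<zeta>) \<bullet> x)) * (cis (- (y \<bullet> \<xi>)) * cis ((\<xi> + \<zeta>) \<bullet> y))) * mc j k \<zeta>) = ?c * ((cis (- (x \<bullet> \<xi>)) * cis ((y - x) \<bullet> \<zeta>)) * mc j k \<zeta>)" by simp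
      then show "cis (- ((\<xi> + \<zeta>) \<bullet> x)) * w (\<xi> + \<zeta>) = (?c * cis (- (x \<bullet> \<xi>))) * (cis ((y - x) \<bullet> \<zeta>) * mc j k \<zeta>)"
        unfolding w_def by (simp only: add_diff_cancel_left' mult_ac)
    qed
    also have "\<dots> = cis (- (x \<bullet> \<xi>)) * ker j k (y - x)" unfolding ker_eq integral_mult_right_zero by (simp only: mult_ac)
    finally show ?thesis .
  qed
  have z: "complex_of_real (mixed_piece \<phi>0 k \<zeta>) * w \<zeta> = 0" for \<zeta>
  proof (rule ccontr)
    assume "complex_of_real (mixed_piece \<phi>0 k \<zeta>) * w \<zeta> \<noteq> 0"
    then have "mixed_piece \<phi>0 k \<zeta> \<noteq> 0" "mc j k (\<zeta> - \<xi>) \<noteq> 0" by (auto simp: w_def)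
    then have "\<bar>\<zeta> $ i\<bar> \<le> 3/2 * 2 ^ k i" "\<bar>\<zeta> $ i - \<xi> $ i\<bar> \<le> 3 * 2 ^ k i" using mixed_piece_support[of k \<zeta> i] mc_support[of j k "\<zeta> - \<xi>" i] by auto
    then have "\<bar>\<xi> $ i\<bar> \<le> 9/2 * 2 ^ k i" by linarith
    then show False using \<xi> by simp
  qed
  have "(LINT x|lborel. cis (- (x \<bullet> \<xi>)) * (ker j k (y - x) * g x)) = (LINT x|lborel. g x * FT w x)"
    unfolding FTw by (simp add: mult_ac)
  also have "\<dots> = fourier_mult (mixed_piece \<phi>0 k) f (FT w)"
    using g FT_schwartz[OF ws] by (simp add: represents_def)
  also have "\<dots> = f (FT (\<lambda>\<zeta>. complex_of_real (mixed_piece \<phi>0 k \<zeta>) * w \<zeta>))"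
    unfolding fourier_mult_def iFT_FT[OF ws] ..
  also have "\<dots> = 0" unfolding z FT_zero by (rule tempered_zero[OF f])
  finally show ?thesis .
qed

lemma cv_h_integrable:
  assumes g: "represents T g"
  shows "integrable lborel (\<lambda>x. ker j k (y - x) * g x)"
proof -
  have "integrable lborel (\<lambda>x. g x * ker j k (y - x))"
    using bspec[OF conjunct2[OF g[unfolded represents_def]] schwartz_reflect[OF ker_schwartz[of j k], of y]] by (rule conjunct1)
  then show ?thesis by (simp only: mult.commute)
qed

text \<open>The supremum is bounded by the L_1 norm: the transform is at most that norm and lives on
  a box of volume 9^d \<open>vol k\<close>. The factor (2 pi)^d of inversion is at least 1 and is
  dropped. Inversion holds almost everywhere, hence the form of the conclusion.\<close>

lemma cv_h_bound:
  assumes f: "tempered f" and g: "represents (fourier_mult (mixed_piece \<phi>0 k) f) g"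
  shows "AE x in lborel. norm (ker j k (y - x) * g x) \<le> 9 ^ CARD('n) * vol k * (LINT x|lborel. norm (ker j k (y - x) * g x))"
proof -
  let ?h = "\<lambda>x. ker j k (y - x) * g x" and ?Q = "cbox (- (\<chi> i. 9/2 * 2 ^ k i)) (\<chi> i. 9/2 * 2 ^ k i) :: (real^'n) set"
  let ?H = "LINT x|lborel. norm (?h x)"
  let ?F = "\<lambda>\<xi>. LINT x|lborel. cis (- (x \<bullet> \<xi>)) * ?h x"
  have hi: "integrable lborel ?h" by (rule cv_h_integrable[OF g])
  have [measurable]: "g \<in> borel_measurable borel" using g by (rule represents_borel)
  have H0: "?H \<ge> 0" by (intro integral_nonneg_AE) auto
  have F1: "norm (?F \<xi>) \<le> ?H" for \<xi>
    by (rule norm_integral_le[OF integrable_norm[OF hi]]) (simp add: norm_mult)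
  have F2: "norm (?F \<xi>) \<le> indicator ?Q \<xi> * ?H" for \<xi>
  proof (cases "\<xi> \<in> ?Q")
    case True then show ?thesis using F1 by simp
  next
    case False
    then obtain i where "\<not> (- (9/2 * 2 ^ k i) \<le> \<xi> $ i \<and> \<xi> $ i \<le> 9/2 * 2 ^ k i)" by (auto simp: mem_box_cart)
    then have "\<bar>\<xi> $ i\<bar> > 9/2 * 2 ^ k i" by linarith
    then have "?F \<xi> = 0" by (rule cv_fourier_zero[OF f g])
    then show ?thesis using H0 by simp
  qed
  have mQ: "measure lborel ?Q = 9 ^ CARD('n) * vol k"
  proof -
    have "0 \<in> ?Q" by (simp add: mem_box_cart)
    then have "measure lborel ?Q = (\<Prod>i\<in>UNIV. 9 * 2 ^ k i)"
      by (subst content_cbox_cart) auto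
    then show ?thesis by (simp add: prod.distrib vol_def)
  qed
  have Qi: "integrable lborel (\<lambda>\<xi>. indicator ?Q \<xi> * ?H)"
    by (intro integrable_mult_left integrable_real_indicator) (simp, rule emeasure_bounded_finite, simp)
  have Fi: "integrable lborel ?F"
    by (rule Bochner_Integration.integrable_bound[OF Qi]) (use F2 H0 in \<open>auto simp: abs_mult intro!: AE_I2\<close>)
  have "AE x in lborel. (2 * pi) ^ DIM(real^'n) * ?h x = (LINT \<xi>|lborel. cis (x \<bullet> \<xi>) * ?F \<xi>)"
    by (rule fourier_inversion_AE[OF hi Fi])
  then show ?thesis
  proof (rule AE_mp, intro AE_I2 impI)
    fix x assume e: "(2 * pi) ^ DIM(real^'n) * ?h x = (LINT \<xi>|lborel. cis (x \<bullet> \<xi>) * ?F \<xi>)"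
    have "norm (LINT \<xi>|lborel. cis (x \<bullet> \<xi>) * ?F \<xi>) \<le> (LINT \<xi>|lborel. indicator ?Q \<xi> * ?H)"
      using F2 by (intro norm_integral_le Qi) (auto simp: norm_mult)
    also have "\<dots> = 9 ^ CARD('n) * vol k * ?H" using mQ by simp
    finally have 1: "norm (complex_of_real ((2 * pi) ^ DIM(real^'n)) * ?h x) \<le> 9 ^ CARD('n) * vol k * ?H" unfolding e[symmetric] by simp
    have p1: "1 \<le> (2 * pi) ^ DIM(real^'n)" using pi_ge_two by (intro one_le_power) linarith
    have "norm (?h x) \<le> (2 * pi) ^ DIM(real^'n) * norm (?h x)" using mult_right_mono[OF p1 norm_ge_zero[of "?h x"]] by simp
    also have "\<dots> = norm (complex_of_real ((2 * pi) ^ DIM(real^'n)) * ?h x)" using p1 unfolding norm_mult norm_of_real by simp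
    finally show "norm (?h x) \<le> 9 ^ CARD('n) * vol k * ?H" using 1 by simp
  qed
qed

text \<open>Nikolskii's inequality for the band-limited integrand replaces Young's inequality when \<open>p < 1\<close>.\<close>
lemma cva_lt1:
  assumes f: "tempered f" and g: "represents (fourier_mult (mixed_piece \<phi>0 k) f) g" and p: "0 < p" "p < 1"
  shows "\<exists>H\<ge>0. cva j k g y = ennreal H \<and>
    ennreal (H powr p) \<le> ennreal ((9 ^ CARD('n) * vol k) powr (1 - p)) * (\<integral>\<^sup>+x. ennreal (norm (ker j k (y - x)) powr p * norm (g x) powr p) \<partial>lborel)"
proof -
  let ?h = "\<lambda>x. ker j k (y - x) * g x" and ?V = "9 ^ CARD('n) * vol k"
  define H where "H = (LINT x|lborel. norm (?h x))"
  let ?I = "\<integral>\<^sup>+x. ennreal (norm (ker j k (y - x)) powr p * norm (g x) powr p) \<partial>lborel"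
  have [measurable]: "g \<in> borel_measurable borel" using g by (rule represents_borel)
  have hi: "integrable lborel ?h" by (rule cv_h_integrable[OF g])
  have H0: "H \<ge> 0" unfolding H_def by (intro integral_nonneg_AE) auto
  have V: "?V > 0" using vol_pos[of k] by simp
  have c: "cva j k g y = ennreal H"
    unfolding cva_def norm_mult[symmetric] H_def using hi by (intro nn_integral_eq_integral) auto
  have "ennreal (H powr p) \<le> ennreal (?V powr (1 - p)) * ?I"
  proof (cases "H = 0")
    case True then show ?thesis using p by simp
  next
    case False
    then have Hp: "H > 0" using H0 by simp
    have "ennreal H = (\<integral>\<^sup>+x. ennreal (norm (?h x)) \<partial>lborel)" unfolding H_def using hi by (intro nn_integral_eq_integral[symmetric]) auto
    also have "\<dots> \<le> (\<integral>\<^sup>+x. ennreal ((?V * H) powr (1 - p)) * ennreal (norm (ker j k (y - x)) powr p * norm (g x) powr p) \<partial>lborel)"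
    proof (rule nn_integral_mono_AE, rule AE_mp[OF cv_h_bound[OF f g, of j y, folded H_def]], intro AE_I2 impI)
      fix x assume le: "norm (?h x) \<le> ?V * H"
      \<comment> \<open>The p-th power is kept, and the remaining power 1 - p is estimated by the
        supremum bound.\<close>
      have "norm (?h x) = norm (?h x) powr (1 - p) * norm (?h x) powr p"
        by (cases "?h x = 0") (auto simp: powr_add[symmetric])
      also have "\<dots> \<le> (?V * H) powr (1 - p) * norm (?h x) powr p" using le p by (intro mult_right_mono powr_mono2) auto
      finally show "ennreal (norm (?h x)) \<le> ennreal ((?V * H) powr (1 - p)) * ennreal (norm (ker j k (y - x)) powr p * norm (g x) powr p)"
        by (simp add: ennreal_mult'[symmetric] norm_mult powr_mult ennreal_leI)
    qed
    also have "\<dots> = ennreal ((?V * H) powr (1 - p)) * ?I" by (rule nn_integral_cmult) measurable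
    \<comment> \<open>\<open>H\<close> occurs on both sides. Dividing by H^(1-p) is legitimate
      because \<open>H\<close> is finite, \<open>g\<close> being integrable against Schwartz
      functions.\<close>
    finally have "ennreal (H powr (p - 1)) * ennreal H \<le> ennreal (H powr (p - 1)) * (ennreal ((?V * H) powr (1 - p)) * ?I)"
      by (intro mult_left_mono) auto
    moreover have "H powr (p - 1) * H = H powr p" using powr_mult_self[of H "p - 1"] Hp by simp
    moreover have "H powr (p - 1) * (?V * H) powr (1 - p) = ?V powr (1 - p)"
      using Hp V by (simp add: powr_mult powr_add[symmetric] mult.left_commute)
    ultimately show ?thesis using H0 by (simp add: ennreal_mult'[symmetric] mult.assoc[symmetric])
  qed
  then show ?thesis using c H0 by blast
qed

lemma cva_bounded_lt1:
  assumes f: "tempered f" and g: "represents (fourier_mult (mixed_piece \<phi>0 k) f) g" and p: "0 < p" "p < 1" and gp: "Lpow p g < \<infinity>"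
  shows "\<exists>B. \<forall>y. cva j k g y \<le> ennreal B"
proof -
  obtain K where K: "K \<ge> 0" "\<And>x. norm (ker j k x) \<le> K" using ker_bounded by blast
  have [measurable]: "g \<in> borel_measurable borel" using g by (rule represents_borel)
  let ?V = "(9 ^ CARD('n) * vol k) powr (1 - p)"
  obtain b where b: "b \<ge> 0" "ennreal ?V * (ennreal (K powr p) * Lpow p g) = ennreal b"
  proof -
    have "ennreal ?V * (ennreal (K powr p) * Lpow p g) < \<infinity>" using gp by (auto simp: ennreal_mult_less_top)
    then show ?thesis using that by (metis ennreal_cases infinity_ennreal_def less_irrefl)
  qed
  have "cva j k g y \<le> ennreal (b powr (1 / p))" for y
  proof -
    obtain H where H: "H \<ge> 0" "cva j k g y = ennreal H" "ennreal (H powr p) \<le> ennreal ?V * (\<integral>\<^sup>+x. ennreal (norm (ker j k (y - x)) powr p * norm (g x) powr p) \<partial>lborel)"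
      using cva_lt1[OF f g p] by blast
    note H(3)
    also have "(\<integral>\<^sup>+x. ennreal (norm (ker j k (y - x)) powr p * norm (g x) powr p) \<partial>lborel) \<le> (\<integral>\<^sup>+x. ennreal (K powr p) * ennreal (norm (g x) powr p) \<partial>lborel)"
      using K p by (intro nn_integral_mono) (auto simp: ennreal_mult'[symmetric] intro!: ennreal_leI mult_right_mono powr_mono2)
    also have "\<dots> = ennreal (K powr p) * Lpow p g" unfolding Lpow_def by (rule nn_integral_cmult) measurable
    finally have "ennreal (H powr p) \<le> ennreal b" unfolding b(2)[symmetric] by (simp add: mult_left_mono)
    then have "H powr p \<le> b" using b(1) by simp
    then have "(H powr p) powr (1 / p) \<le> b powr (1 / p)" using p by (intro powr_mono2) auto
    then show ?thesis using H p by (simp add: powr_powr ennreal_leI)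
  qed
  then show ?thesis by blast
qed

text \<open>The powers of \<open>vol k\<close> cancel, 1 - p from Nikolskii against p - 1 from the
  kernel, which makes the constant uniform in j and k.\<close>

lemma cv_Lpow_lt1:
  assumes p: "0 < p" "p < 1"
  shows "\<exists>C\<ge>0. \<forall>j k f g. (\<forall>i. k i \<le> Suc j) \<longrightarrow> tempered f \<longrightarrow> represents (fourier_mult (mixed_piece \<phi>0 k) f) g \<longrightarrow> Lpow p g < \<infinity> \<longrightarrow> Lpow p (cv j k g) \<le> ennreal C * Lpow p g"
proof -
  obtain C where C: "C \<ge> 0" "\<And>j k. (\<forall>i. k i \<le> Suc j) \<Longrightarrow> Lpow p (ker j k) \<le> ennreal (C * vol k powr (p - 1))" using ker_Lpow[OF p(1)] by blast
  let ?D = "(9 ^ CARD('n)) powr (1 - p) * C"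
  have "Lpow p (cv j k g) \<le> ennreal ?D * Lpow p g"
    if k: "\<forall>i. k i \<le> Suc j" and f: "tempered f" and g: "represents (fourier_mult (mixed_piece \<phi>0 k) f) g" and gp: "Lpow p g < \<infinity>" for j k f g
  proof -
    have gm [measurable]: "g \<in> borel_measurable borel" using g by (rule represents_borel)
    let ?V = "(9 ^ CARD('n) * vol k) powr (1 - p)"
    have pt: "ennreal (norm (cv j k g y) powr p) \<le> ennreal ?V * (\<integral>\<^sup>+x. ennreal (norm (ker j k (y - x)) powr p * norm (g x) powr p) \<partial>lborel)" for y
    proof -
      obtain H where H: "H \<ge> 0" "cva j k g y = ennreal H" "ennreal (H powr p) \<le> ennreal ?V * (\<integral>\<^sup>+x. ennreal (norm (ker j k (y - x)) powr p * norm (g x) powr p) \<partial>lborel)"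
        using cva_lt1[OF f g p] by blast
      have "ennreal (norm (cv j k g y)) \<le> ennreal H" using cv_le_cva[OF gm, of j k y] H by simp
      then have "norm (cv j k g y) powr p \<le> H powr p" using H(1) p by (intro powr_mono2) auto
      then show ?thesis using H(3) by (meson ennreal_leI order_trans)
    qed
    have "Lpow p (cv j k g) \<le> (\<integral>\<^sup>+y. ennreal ?V * (\<integral>\<^sup>+x. ennreal (norm (ker j k (y - x)) powr p * norm (g x) powr p) \<partial>lborel) \<partial>lborel)"
      unfolding Lpow_def by (intro nn_integral_mono pt)
    also have "\<dots> = ennreal ?V * (\<integral>\<^sup>+y. (\<integral>\<^sup>+x. ennreal (norm (ker j k (y - x)) powr p * norm (g x) powr p) \<partial>lborel) \<partial>lborel)"
      by (rule nn_integral_cmult) measurable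
    also have "(\<integral>\<^sup>+y. (\<integral>\<^sup>+x. ennreal (norm (ker j k (y - x)) powr p * norm (g x) powr p) \<partial>lborel) \<partial>lborel) =
      (\<integral>\<^sup>+x. (\<integral>\<^sup>+y. ennreal (norm (ker j k (y - x)) powr p * norm (g x) powr p) \<partial>lborel) \<partial>lborel)"
      by (rule lborel_pair.Fubini') measurable
    also have "\<dots> = (\<integral>\<^sup>+x. Lpow p (ker j k) * ennreal (norm (g x) powr p) \<partial>lborel)"
    proof (rule nn_integral_cong)
      fix x
      have "(\<integral>\<^sup>+y. ennreal (norm (ker j k (y - x)) powr p * norm (g x) powr p) \<partial>lborel) = (\<integral>\<^sup>+y. ennreal (norm (ker j k (y - x)) powr p) \<partial>lborel) * ennreal (norm (g x) powr p)"
        by (subst nn_integral_multc[symmetric]) (auto simp: ennreal_mult')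
      then show "(\<integral>\<^sup>+y. ennreal (norm (ker j k (y - x)) powr p * norm (g x) powr p) \<partial>lborel) = Lpow p (ker j k) * ennreal (norm (g x) powr p)"
        using nn_integral_lborel_shift(3)[of "\<lambda>y. ennreal (norm (ker j k y) powr p)" x] by (simp add: Lpow_def)
    qed
    also have "\<dots> = Lpow p (ker j k) * Lpow p g" unfolding Lpow_def[of p g] by (rule nn_integral_cmult) measurable
    also have "ennreal ?V * \<dots> \<le> ennreal ?V * (ennreal (C * vol k powr (p - 1)) * Lpow p g)"
      using C(2)[OF k] by (intro mult_left_mono mult_right_mono) auto
    also have "\<dots> = ennreal (?V * (C * vol k powr (p - 1))) * Lpow p g" by (simp add: ennreal_mult' mult.assoc)
    also have "?V * (C * vol k powr (p - 1)) = ?D"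
      using vol_pos[of k] powr_add[of "vol k" "1 - p" "p - 1"] by (simp add: powr_mult mult_ac)
    finally show ?thesis .
  qed
  moreover have "?D \<ge> 0" using C by simp
  ultimately show ?thesis by blast
qed

end

section \<open>Uniqueness of representing functions\<close>

lemma vec_nth_borel [measurable (raw)]:
  assumes "f \<in> borel_measurable M"
  shows "(\<lambda>x. (f x :: real^'n::finite) $ i) \<in> borel_measurable M"
  by (rule measurable_compose[OF assms]) (intro borel_measurable_continuous_onI continuous_intros)

lemma coord_gt_if_norm_gt:
  fixes x :: "real^'n::finite"
  assumes "norm x > (\<Sum>i\<in>UNIV. B i)" shows "\<exists>i. \<bar>x $ i\<bar> > B i"
proof (rule ccontr)
  assume "\<nexists>i. \<bar>x $ i\<bar> > B i"
  then have "norm x \<le> (\<Sum>i\<in>UNIV. B i)" by (intro norm_le_coord_bound) (simp add: not_less)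
  then show False using assms by simp
qed

lemma schwartz_slow:
  assumes "\<phi> \<in> schwartz" shows "slow \<phi>"
proof (rule slow_bounded_derivs[OF schwartz_smooth[OF assms]])
  fix "is"
  obtain C where "C \<ge> 0" "\<And>x. norm (pderivs is \<phi> x) \<le> C / (1 + norm x) ^ 0" using schwartz_bound[OF assms] by blast
  then show "\<exists>B. \<forall>x. norm (pderivs is \<phi> x) \<le> B" by auto
qed

lemma Lp_qnorm_cong_AE:
  assumes "AE x in lborel. g x = h x"
  shows "Lp_qnorm p g = Lp_qnorm p h"
proof -
  have "(AE x in lborel. ennreal (norm (g x)) \<le> C) \<longleftrightarrow> (AE x in lborel. ennreal (norm (h x)) \<le> C)" for C
  proof
    assume a: "AE x in lborel. ennreal (norm (g x)) \<le> C"
    show "AE x in lborel. ennreal (norm (h x)) \<le> C" by (rule AE_mp[OF a], rule AE_mp[OF assms]) auto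
  next
    assume a: "AE x in lborel. ennreal (norm (h x)) \<le> C"
    show "AE x in lborel. ennreal (norm (g x)) \<le> C" by (rule AE_mp[OF a], rule AE_mp[OF assms]) auto
  qed
  moreover have "(\<integral>\<^sup>+ x. ennreal (norm (g x) powr enn2real p) \<partial>lborel) = (\<integral>\<^sup>+ x. ennreal (norm (h x) powr enn2real p) \<partial>lborel)"
    by (rule nn_integral_cong_AE) (rule AE_mp[OF assms], auto)
  ultimately show ?thesis by (simp add: Lp_qnorm_def)
qed

context mixed_gen
begin

text \<open>Test functions of the form cut-off times character show that \<open>u\<close> times a
  cut-off has vanishing Fourier transform, so inversion gives 0; the cut-offs exhaust the
  space.\<close>

lemma AE_zero_if_orthogonal:
  fixes u :: "real^'n::finite \<Rightarrow> complex"
  assumes [measurable]: "u \<in> borel_measurable borel" and i: "\<And>\<phi>. \<phi> \<in> schwartz \<Longrightarrow> integrable lborel (\<lambda>x. u x * \<phi> x)"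
    and z: "\<And>\<phi>. \<phi> \<in> schwartz \<Longrightarrow> (LINT x|lborel. u x * \<phi> x) = 0"
  shows "AE x in lborel. u x = 0"
proof -
  define \<gamma> where "\<gamma> R x = complex_of_real (\<Prod>i\<in>UNIV. \<phi>0 (1 / real (Suc R) * x $ i))" for R and x :: "real^'n"
  have gs: "\<gamma> R \<in> schwartz" for R
  proof (rule schwartz_compact)
    show "smooth_fun (\<gamma> R)" unfolding \<gamma>_def[abs_def]
      by (intro pderivs_linear(2)[OF bounded_linear_of_real] smooth_fun_prod smooth_phi_coord) auto
    show "\<gamma> R x = 0" if nx: "norm x > (\<Sum>i\<in>(UNIV::'n set). 3/2 * real (Suc R))" for x
    proof -
      obtain i where "\<bar>x $ i\<bar> > 3/2 * real (Suc R)" using coord_gt_if_norm_gt[OF nx] by blast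
      moreover have "r > 0 \<Longrightarrow> \<bar>t\<bar> > 3/2 * r \<Longrightarrow> \<bar>1 / r * t\<bar> > 3/2" for r t :: real by (simp add: abs_mult field_simps)
      ultimately have "\<bar>1 / real (Suc R) * x $ i\<bar> > 3/2" by (metis of_nat_0_less_iff zero_less_Suc)
      then have "\<phi>0 (1 / real (Suc R) * x $ i) = 0" by (rule phi_zero)
      then have "(\<Prod>i\<in>UNIV. \<phi>0 (1 / real (Suc R) * x $ i)) = 0" by (intro prod_zero) auto
      then show ?thesis by (simp add: \<gamma>_def)
    qed
  qed
  have "AE x in lborel. u x * \<gamma> R x = 0" for R
  proof -
    have F0: "(LINT x|lborel. cis (- (x \<bullet> \<xi>)) * (u x * \<gamma> R x)) = 0" for \<xi>
    proof -
      have "(\<lambda>x. cis (x \<bullet> (- \<xi>)) * \<gamma> R x) \<in> schwartz" by (rule slow_mult_schwartz[OF slow_cis gs])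
      from z[OF this] show ?thesis by (simp add: mult.left_commute)
    qed
    have "AE x in lborel. (2*pi)^DIM(real^'n) * (u x * \<gamma> R x) = (LINT \<xi>|lborel. cis (x \<bullet> \<xi>) * (LINT x|lborel. cis (- (x \<bullet> \<xi>)) * (u x * \<gamma> R x)))"
      by (rule fourier_inversion_AE[OF i[OF gs]]) (simp add: F0)
    then show ?thesis by (rule AE_mp) (auto intro!: AE_I2 simp: F0)
  qed
  then have "AE x in lborel. \<forall>R. u x * \<gamma> R x = 0" unfolding AE_all_countable by blast
  then show ?thesis
  proof (rule AE_mp, intro AE_I2 impI)
    fix x assume *: "\<forall>R. u x * \<gamma> R x = 0"
    obtain R :: nat where R: "norm x \<le> real R" using real_arch_simple by blast
    have "\<phi>0 (1 / real (Suc R) * x $ i) = 1" for i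
    proof (rule phi_one)
      have "\<bar>x $ i\<bar> \<le> real (Suc R)" using component_le_norm_cart[of x i] R by simp
      moreover have "r > 0 \<Longrightarrow> \<bar>t\<bar> \<le> r \<Longrightarrow> \<bar>1 / r * t\<bar> \<le> 1" for r t :: real by (simp add: abs_mult field_simps)
      ultimately show "\<bar>1 / real (Suc R) * x $ i\<bar> \<le> 1" by (metis of_nat_0_less_iff zero_less_Suc)
    qed
    then have "\<gamma> R x = 1" by (simp add: \<gamma>_def)
    with spec[OF *, of R] show "u x = 0" by simp
  qed
qed

lemma represents_unique:
  assumes g: "represents T g" and h: "represents T h"
  shows "AE x in lborel. g x = h x"
proof -
  have [measurable]: "g \<in> borel_measurable borel" "h \<in> borel_measurable borel" using g h by (auto simp: represents_def)
  have gi: "integrable lborel (\<lambda>x. g x * \<phi> x)" "T \<phi> = (LINT x|lborel. g x * \<phi> x)" if "\<phi> \<in> schwartz" for \<phi> using g that by (auto simp: represents_def)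
  have hi: "integrable lborel (\<lambda>x. h x * \<phi> x)" "T \<phi> = (LINT x|lborel. h x * \<phi> x)" if "\<phi> \<in> schwartz" for \<phi> using h that by (auto simp: represents_def)
  have "AE x in lborel. g x - h x = 0"
    by (rule AE_zero_if_orthogonal) (auto simp: left_diff_distrib gi(1) hi(1) Bochner_Integration.integral_diff gi(2)[symmetric] hi(2)[symmetric])
  then show ?thesis by (rule AE_mp) auto
qed

text \<open>All representing functions agree almost everywhere, so the infimum is taken over a
  single value.\<close>

lemma dist_Lp_eq:
  assumes "represents T g" shows "dist_Lp p T = Lp_qnorm p g"
proof -
  have e: "Lp_qnorm p h = Lp_qnorm p g" if "represents T h" for h
    using Lp_qnorm_cong_AE[OF represents_unique[OF that assms]] .
  show ?thesis unfolding dist_Lp_def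
  proof (rule antisym)
    show "(INF h\<in>{h. represents T h}. Lp_qnorm p h) \<le> Lp_qnorm p g" by (rule INF_lower) (simp add: assms)
    show "Lp_qnorm p g \<le> (INF h\<in>{h. represents T h}. Lp_qnorm p h)" by (rule INF_greatest) (simp add: e)
  qed
qed

end

section \<open>Representation and spectral localisation of the convolved pieces\<close>

context gens
begin

lemma cv_bounded:
  assumes g: "g \<in> borel_measurable borel" and B: "\<And>y. cva j k g y \<le> ennreal B"
  shows "norm (cv j k g y) \<le> \<bar>B\<bar>"
proof -
  have "cva j k g y < \<infinity>" using B[of y] by (metis ennreal_less_top infinity_ennreal_def order_le_less_trans)
  then have "ennreal (norm (cv j k g y)) \<le> ennreal B" using cv_le_cva[OF g] B order_trans by blast
  also have "\<dots> \<le> ennreal \<bar>B\<bar>" by (intro ennreal_leI) simp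
  finally show ?thesis by simp
qed

lemma FT_mc_iFT:
  assumes \<phi>: "\<phi> \<in> schwartz"
  shows "FT (\<lambda>\<xi>. mc j k \<xi> * iFT \<phi> \<xi>) x = (LINT y|lborel. \<phi> y * ker j k (y - x))"
proof -
  let ?c = "complex_of_real (1 / (2 * pi) ^ CARD('n))"
  have [measurable]: "mc j k \<in> borel_measurable borel" "\<phi> \<in> borel_measurable borel" using schwartz_borel[OF mc_schwartz] schwartz_borel[OF \<phi>] by auto
  have "FT (\<lambda>\<xi>. mc j k \<xi> * iFT \<phi> \<xi>) x = (LINT \<xi>|lborel. (LINT y|lborel. ?c * (\<phi> y * (cis ((y - x) \<bullet> \<xi>) * mc j k \<xi>))))"
    unfolding FT_def iFT_def
  proof (rule Bochner_Integration.integral_cong[OF refl])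
    fix \<xi>
    have e: "cis ((y - x) \<bullet> \<xi>) = cis (- (\<xi> \<bullet> x)) * cis (\<xi> \<bullet> y)" for y by (simp add: cis_mult inner_diff_left inner_diff_right inner_commute)
    have "?c * (\<phi> y * (cis ((y - x) \<bullet> \<xi>) * mc j k \<xi>)) = (cis (- (\<xi> \<bullet> x)) * (mc j k \<xi> * ?c)) * (cis (\<xi> \<bullet> y) * \<phi> y)" for y
      unfolding e by (simp only: mult_ac)
    then show "cis (- (\<xi> \<bullet> x)) * (mc j k \<xi> * (?c * (LINT y|lborel. cis (\<xi> \<bullet> y) * \<phi> y))) = (LINT y|lborel. ?c * (\<phi> y * (cis ((y - x) \<bullet> \<xi>) * mc j k \<xi>)))"
      by (simp only: integral_mult_right_zero mult.assoc)
  qed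
  also have "\<dots> = (LINT y|lborel. (LINT \<xi>|lborel. ?c * (\<phi> y * (cis ((y - x) \<bullet> \<xi>) * mc j k \<xi>))))"
  proof (rule lborel_pair.Fubini_integral)
    have ci: "integrable lborel (\<lambda>y. ?c * \<phi> y)" using schwartz_integrable[OF \<phi>] by simp
    show "integrable (lborel \<Otimes>\<^sub>M lborel) (\<lambda>(y, \<xi>). ?c * (\<phi> y * (cis ((y - x) \<bullet> \<xi>) * mc j k \<xi>)))"
      by (rule integrable_pair_prod[OF ci schwartz_integrable[OF mc_schwartz[of j k]]])
         (measurable, simp add: norm_mult norm_divide mult_ac)
  qed
  also have "\<dots> = (LINT y|lborel. \<phi> y * ker j k (y - x))"
    unfolding ker_eq by (simp only: integral_mult_right_zero mult.left_commute[of "\<phi> _" "complex_of_real (1 / (2 * pi) ^ CARD('n))"])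
  finally show ?thesis .
qed

lemma mixed_mc: "complex_of_real (mixed_piece \<phi>0 k \<xi>) * mc j k \<xi> = complex_of_real (mixed_piece \<phi>0 k \<xi>) * complex_of_real (iso_piece \<psi>0 j \<xi>)"
  using fat_piece_one[of k \<xi>] by (cases "mixed_piece \<phi>0 k \<xi> = 0") (auto simp: mc_def)

text \<open>By duality the multiplier is moved to the test function, where it acts as convolution
  with the reflected kernel; the bound \<open>B\<close> makes the resulting double integral
  absolutely convergent. The mixed and the isotropic multiplier stay together under \<open>f\<close>
  so that the pieces can later be summed by \<open>iso_resolution\<close>.\<close>

lemma cv_represents:
  assumes f: "tempered f" and g: "represents (fourier_mult (mixed_piece \<phi>0 k) f) g"
    and B: "\<And>y. cva j k g y \<le> ennreal B" and \<phi>: "\<phi> \<in> schwartz"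
  shows "integrable lborel (\<lambda>y. cv j k g y * \<phi> y)"
    and "f (FT (\<lambda>\<xi>. complex_of_real (mixed_piece \<phi>0 k \<xi>) * (complex_of_real (iso_piece \<psi>0 j \<xi>) * iFT \<phi> \<xi>))) = (LINT y|lborel. cv j k g y * \<phi> y)"
proof -
  have gm [measurable]: "g \<in> borel_measurable borel" using g by (rule represents_borel)
  have [measurable]: "\<phi> \<in> borel_measurable borel" using \<phi> by (rule schwartz_borel)
  have \<phi>i: "integrable lborel \<phi>" using \<phi> by (rule schwartz_integrable)
  show "integrable lborel (\<lambda>y. cv j k g y * \<phi> y)"
  proof (rule Bochner_Integration.integrable_bound)
    show "integrable lborel (\<lambda>y. \<bar>B\<bar> * norm (\<phi> y))" using \<phi>i by simp
    show "AE y in lborel. norm (cv j k g y * \<phi> y) \<le> norm (\<bar>B\<bar> * norm (\<phi> y))"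
      using cv_bounded[OF gm B] by (auto simp: norm_mult intro!: AE_I2 mult_right_mono)
  qed measurable
  let ?w = "\<lambda>\<xi>. mc j k \<xi> * iFT \<phi> \<xi>"
  have ws: "?w \<in> schwartz" by (intro slow_mult_schwartz schwartz_slow mc_schwartz iFT_schwartz \<phi>)
  have "f (FT (\<lambda>\<xi>. complex_of_real (mixed_piece \<phi>0 k \<xi>) * (complex_of_real (iso_piece \<psi>0 j \<xi>) * iFT \<phi> \<xi>))) = fourier_mult (mixed_piece \<phi>0 k) f (FT ?w)"
    unfolding fourier_mult_def iFT_FT[OF ws] mult.assoc[symmetric] mixed_mc ..
  also have "\<dots> = (LINT x|lborel. g x * FT ?w x)" using g FT_schwartz[OF ws] by (simp add: represents_def)
  also have "\<dots> = (LINT x|lborel. (LINT y|lborel. g x * (\<phi> y * ker j k (y - x))))" unfolding FT_mc_iFT[OF \<phi>] by simp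
  also have "\<dots> = (LINT y|lborel. (LINT x|lborel. g x * (\<phi> y * ker j k (y - x))))"
  proof (rule lborel_pair.Fubini_integral)
    show "integrable (lborel \<Otimes>\<^sub>M lborel) (\<lambda>(y, x). g x * (\<phi> y * ker j k (y - x)))"
      unfolding integrable_iff_bounded
    proof (intro conjI)
      have "(\<integral>\<^sup>+z. ennreal (norm (case z of (y, x) \<Rightarrow> g x * (\<phi> y * ker j k (y - x)))) \<partial>(lborel \<Otimes>\<^sub>M lborel)) = (\<integral>\<^sup>+y. (\<integral>\<^sup>+x. ennreal (norm (g x * (\<phi> y * ker j k (y - x)))) \<partial>lborel) \<partial>lborel)"
        by (subst lborel.nn_integral_fst[symmetric]) auto
      also have "\<dots> = (\<integral>\<^sup>+y. ennreal (norm (\<phi> y)) * cva j k g y \<partial>lborel)"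
        unfolding cva_def by (intro nn_integral_cong, subst nn_integral_cmult[symmetric]) (auto simp: norm_mult ennreal_mult'[symmetric] mult_ac)
      also have "\<dots> \<le> (\<integral>\<^sup>+y. ennreal (norm (\<phi> y)) * ennreal B \<partial>lborel)" using B by (intro nn_integral_mono mult_left_mono) auto
      also have "\<dots> = (\<integral>\<^sup>+y. ennreal (norm (\<phi> y)) \<partial>lborel) * ennreal B" by (rule nn_integral_multc) measurable
      also have "\<dots> < \<infinity>" using \<phi>i by (auto simp: integrable_iff_bounded ennreal_mult_less_top)
      finally show "(\<integral>\<^sup>+z. ennreal (norm (case z of (y, x) \<Rightarrow> g x * (\<phi> y * ker j k (y - x)))) \<partial>(lborel \<Otimes>\<^sub>M lborel)) < \<infinity>" .
    qed measurable
  qed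
  also have "\<dots> = (LINT y|lborel. cv j k g y * \<phi> y)"
  proof (rule Bochner_Integration.integral_cong[OF refl])
    fix y
    have "g x * (\<phi> y * ker j k (y - x)) = \<phi> y * (ker j k (y - x) * g x)" for x by (simp only: mult_ac)
    then show "(LINT x|lborel. g x * (\<phi> y * ker j k (y - x))) = cv j k g y * \<phi> y"
      unfolding cv_def by (simp only: integral_mult_right_zero mult.commute)
  qed
  finally show "f (FT (\<lambda>\<xi>. complex_of_real (mixed_piece \<phi>0 k \<xi>) * (complex_of_real (iso_piece \<psi>0 j \<xi>) * iFT \<phi> \<xi>))) = (LINT y|lborel. cv j k g y * \<phi> y)" .
qed

text \<open>By \<open>lam_fourier\<close> and scaling, the kernel along an axis becomes a low-pass
  factor under the integral, whose values can then be read off on the support of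
  \<open>mc j k\<close>.\<close>

lemma ker_partial_conv:
  assumes sk: "smoothing_kernel lam \<Lambda> A" and r: "\<rho> > 0"
  shows "(LINT s|lborel. smoothing_kernel.dil lam \<rho> s * ker j k (z - s *\<^sub>R axis i 1)) =
    complex_of_real (1 / (2 * pi) ^ CARD('n)) * (LINT \<xi>|lborel. cis (z \<bullet> \<xi>) * (complex_of_real (\<phi>0 (\<xi> $ i / \<rho>)) * mc j k \<xi>))"
proof -
  interpret smoothing_kernel lam \<Lambda> A by (rule sk)
  let ?c = "complex_of_real (1 / (2 * pi) ^ CARD('n))" and ?e = "axis i 1 :: real^'n"
  have [measurable]: "mc j k \<in> borel_measurable borel" using schwartz_borel[OF mc_schwartz] .
  have F: "(LINT s|lborel. dil \<rho> s * cis (- (s * t))) = complex_of_real (\<phi>0 (t / \<rho>))" for t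
  proof -
    have "complex_of_real (\<phi>0 (t / \<rho>)) = (LINT s|lborel. lam s * cis (- (s * (t / \<rho>))))" by (rule lam_fourier[symmetric])
    also have "\<dots> = \<bar>\<rho>\<bar> *\<^sub>R (LINT s|lborel. lam (0 + \<rho> * s) * cis (- ((0 + \<rho> * s) * (t / \<rho>))))"
      by (rule lborel_integral_real_affine) (use r in simp)
    also have "\<dots> = (LINT s|lborel. dil \<rho> s * cis (- (s * t)))"
    proof -
      have "dil \<rho> s * cis (- (s * t)) = complex_of_real \<rho> * (lam (0 + \<rho> * s) * cis (- ((0 + \<rho> * s) * (t / \<rho>))))" for s
        using r by (simp add: dil_def mult.assoc)
      then show ?thesis using r by (simp only: integral_mult_right_zero scaleR_conv_of_real abs_of_pos)
    qed
    finally show ?thesis by simp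
  qed
  have "(LINT s|lborel. dil \<rho> s * ker j k (z - s *\<^sub>R ?e)) = (LINT s|lborel. (LINT \<xi>|lborel. ?c * (cis (z \<bullet> \<xi>) * ((dil \<rho> s * cis (- (s * \<xi> $ i))) * mc j k \<xi>))))"
  proof (rule Bochner_Integration.integral_cong[OF refl])
    fix s
    have e: "cis ((z - s *\<^sub>R ?e) \<bullet> \<xi>) = cis (z \<bullet> \<xi>) * cis (- (s * \<xi> $ i))" for \<xi>
      by (simp add: cis_mult inner_diff_left inner_axis')
    have "?c * (cis (z \<bullet> \<xi>) * ((dil \<rho> s * cis (- (s * \<xi> $ i))) * mc j k \<xi>)) = (dil \<rho> s * ?c) * (cis ((z - s *\<^sub>R ?e) \<bullet> \<xi>) * mc j k \<xi>)" for \<xi>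
      unfolding e by (simp only: mult_ac)
    then show "dil \<rho> s * ker j k (z - s *\<^sub>R ?e) = (LINT \<xi>|lborel. ?c * (cis (z \<bullet> \<xi>) * ((dil \<rho> s * cis (- (s * \<xi> $ i))) * mc j k \<xi>)))"
      unfolding ker_eq by (simp only: integral_mult_right_zero mult.assoc)
  qed
  also have "\<dots> = (LINT \<xi>|lborel. (LINT s|lborel. ?c * (cis (z \<bullet> \<xi>) * ((dil \<rho> s * cis (- (s * \<xi> $ i))) * mc j k \<xi>))))"
  proof (rule lborel_pair.Fubini_integral)
    have ci: "integrable lborel (\<lambda>\<xi>. ?c * mc j k \<xi>)" using schwartz_integrable[OF mc_schwartz[of j k]] by simp
    show "integrable (lborel \<Otimes>\<^sub>M lborel) (\<lambda>(\<xi>, s). ?c * (cis (z \<bullet> \<xi>) * ((dil \<rho> s * cis (- (s * \<xi> $ i))) * mc j k \<xi>)))"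
      by (rule integrable_pair_prod[OF ci dil_integral(1)[OF r]]) (measurable, simp add: norm_mult norm_divide mult_ac)
  qed
  also have "\<dots> = (LINT \<xi>|lborel. ?c * (cis (z \<bullet> \<xi>) * (complex_of_real (\<phi>0 (\<xi> $ i / \<rho>)) * mc j k \<xi>)))"
    unfolding integral_mult_right_zero integral_mult_left_zero F ..
  finally show ?thesis by simp
qed

lemma cv_band:
  assumes sk: "smoothing_kernel lam \<Lambda> A" and g [measurable]: "g \<in> borel_measurable borel" and B: "\<And>y. cva j k g y \<le> ennreal B"
  shows "smoothing_kernel.band lam (axis i 1) (k i) (cv j k g)"
proof -
  interpret smoothing_kernel lam \<Lambda> A by (rule sk)
  let ?e = "axis i 1 :: real^'n"
  have di: "integrable lborel (\<lambda>s. dil \<rho> s * cv j k g (x - s *\<^sub>R ?e))" if r: "\<rho> > 0" for \<rho> x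
  proof (rule Bochner_Integration.integrable_bound)
    show "integrable lborel (\<lambda>s. norm (dil \<rho> s) * \<bar>B\<bar>)" using dil_integral(1)[OF r] by simp
    show "AE s in lborel. norm (dil \<rho> s * cv j k g (x - s *\<^sub>R ?e)) \<le> norm (norm (dil \<rho> s) * \<bar>B\<bar>)"
      using cv_bounded[OF g B] by (auto simp: norm_mult abs_mult intro!: AE_I2 mult_left_mono)
  qed measurable
  have conv: "(LINT s|lborel. dil \<rho> s * cv j k g (x - s *\<^sub>R ?e)) = (LINT y|lborel. (LINT s|lborel. dil \<rho> s * ker j k (x - y - s *\<^sub>R ?e)) * g y)" if r: "\<rho> > 0" for \<rho> x
  proof -
    have "(LINT s|lborel. dil \<rho> s * cv j k g (x - s *\<^sub>R ?e)) = (LINT s|lborel. (LINT y|lborel. dil \<rho> s * (ker j k (x - s *\<^sub>R ?e - y) * g y)))"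
      unfolding cv_def by simp
    also have "\<dots> = (LINT y|lborel. (LINT s|lborel. dil \<rho> s * (ker j k (x - s *\<^sub>R ?e - y) * g y)))"
    proof (rule lborel_pair.Fubini_integral)
      show "integrable (lborel \<Otimes>\<^sub>M lborel) (\<lambda>(y, s). dil \<rho> s * (ker j k (x - s *\<^sub>R ?e - y) * g y))"
        unfolding integrable_iff_bounded
      proof (intro conjI)
        have "(\<integral>\<^sup>+z. ennreal (norm (case z of (y, s) \<Rightarrow> dil \<rho> s * (ker j k (x - s *\<^sub>R ?e - y) * g y))) \<partial>(lborel \<Otimes>\<^sub>M lborel)) =
          (\<integral>\<^sup>+s. (\<integral>\<^sup>+y. ennreal (norm (dil \<rho> s * (ker j k (x - s *\<^sub>R ?e - y) * g y))) \<partial>lborel) \<partial>lborel)"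
          by (subst lborel_pair.nn_integral_snd[symmetric]) auto
        also have "\<dots> = (\<integral>\<^sup>+s. ennreal (norm (dil \<rho> s)) * cva j k g (x - s *\<^sub>R ?e) \<partial>lborel)"
          unfolding cva_def by (intro nn_integral_cong, subst nn_integral_cmult[symmetric]) (auto simp: norm_mult ennreal_mult'[symmetric] mult_ac)
        also have "\<dots> \<le> (\<integral>\<^sup>+s. ennreal (norm (dil \<rho> s)) * ennreal B \<partial>lborel)" using B by (intro nn_integral_mono mult_left_mono) auto
        also have "\<dots> = (\<integral>\<^sup>+s. ennreal (norm (dil \<rho> s)) \<partial>lborel) * ennreal B" by (rule nn_integral_multc) measurable
        also have "\<dots> < \<infinity>" using dil_integral(1)[OF r] by (auto simp: integrable_iff_bounded ennreal_mult_less_top)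
        finally show "(\<integral>\<^sup>+z. ennreal (norm (case z of (y, s) \<Rightarrow> dil \<rho> s * (ker j k (x - s *\<^sub>R ?e - y) * g y))) \<partial>(lborel \<Otimes>\<^sub>M lborel)) < \<infinity>" .
      qed measurable
    qed
    also have "\<dots> = (LINT y|lborel. (LINT s|lborel. dil \<rho> s * ker j k (x - y - s *\<^sub>R ?e)) * g y)"
      unfolding mult.assoc[symmetric] integral_mult_left_zero by (simp add: diff_diff_eq add.commute)
    finally show ?thesis .
  qed
  have a: "(LINT s|lborel. dil (4 * 2 ^ k i) s * ker j k (z - s *\<^sub>R ?e)) = ker j k z" for z
  proof -
    have "complex_of_real (\<phi>0 (\<xi> $ i / (4 * 2 ^ k i))) * mc j k \<xi> = mc j k \<xi>" for \<xi>
    proof (cases "mc j k \<xi> = 0")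
      case False
      \<comment> \<open>The support reaches only 3 * 2^(k i), so the low-pass filter at 4 * 2^(k i)
        equals 1 on it.\<close>
      have "\<bar>\<xi> $ i\<bar> \<le> 4 * 2 ^ k i" using mc_support[OF False, of i] zero_less_power[of "2::real" "k i"] by linarith
      then have "\<phi>0 (\<xi> $ i / (4 * 2 ^ k i)) = 1" by (intro phi_one) (simp add: abs_divide abs_mult)
      then show ?thesis by simp
    qed simp
    note e = this
    have r: "(0::real) < 4 * 2 ^ k i" by simp
    show ?thesis unfolding ker_partial_conv[OF sk r] e by (rule ker_eq[symmetric])
  qed
  have b: "(LINT s|lborel. dil (2 ^ k i / 8) s * ker j k (z - s *\<^sub>R ?e)) = 0" if ki: "k i \<ge> 1" for z
  proof -
    have "complex_of_real (\<phi>0 (\<xi> $ i / (2 ^ k i / 8))) * mc j k \<xi> = 0" for \<xi>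
    proof (cases "mc j k \<xi> = 0")
      case False
      \<comment> \<open>The filter at 2^(k i) / 8 ends at 3/16 * 2^(k i), inside the gap of the fat
        piece.\<close>
      have "\<bar>\<xi> $ i\<bar> > 2 ^ k i / 4" by (rule mc_gap[OF False ki])
      then have "\<phi>0 (\<xi> $ i / (2 ^ k i / 8)) = 0" by (intro phi_zero) (simp add: abs_divide abs_mult field_simps)
      then show ?thesis by simp
    qed simp
    note e = this
    have r: "(0::real) < 2 ^ k i / 8" by simp
    show ?thesis unfolding ker_partial_conv[OF sk r] e by simp
  qed
  show ?thesis unfolding band_def
  proof (intro conjI allI impI)
    show "cv j k g \<in> borel_measurable borel" by measurable
    fix x
    show "integrable lborel (\<lambda>s. dil (4 * 2 ^ k i) s * cv j k g (x - s *\<^sub>R ?e))" by (rule di) simp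
    show "(LINT s|lborel. dil (4 * 2 ^ k i) s * cv j k g (x - s *\<^sub>R ?e)) = cv j k g x"
      by (subst conv) (simp_all add: a cv_def)
    show "integrable lborel (\<lambda>s. dil (2 ^ k i / 8) s * cv j k g (x - s *\<^sub>R ?e))" by (rule di) simp
    assume "1 \<le> k i"
    then show "(LINT s|lborel. dil (2 ^ k i / 8) s * cv j k g (x - s *\<^sub>R ?e)) = 0"
      by (subst conv) (simp_all add: b)
  qed
qed

end

text \<open>Induction over the set \<open>I\<close> of directions in which the indices of
  \<open>K\<close> may still differ: the fibres of constant i-th index are summed by the induction
  hypothesis and then added along direction i. The estimate has the same exponent on both sides, so
  every direction just costs a factor \<open>C0\<close>.\<close>

lemma (in smoothing_kernel) littlewood_paley_all_directions:
  assumes p: "p > 1"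
  shows "\<exists>C\<ge>0. \<forall>(K::('n::finite \<Rightarrow> nat) set) N (G::('n \<Rightarrow> nat) \<Rightarrow> real^'n \<Rightarrow> complex) \<gamma>.
    finite K \<and> (\<forall>k\<in>K. \<forall>i. k i \<le> N \<and> band (axis i 1) (k i) (G k)) \<and> (\<forall>k\<in>K. \<gamma> k \<ge> 0 \<and> Lpow p (G k) = ennreal (\<gamma> k)) \<longrightarrow>
    (\<exists>s\<ge>0. Lpow p (\<lambda>x. \<Sum>k\<in>K. G k x) = ennreal s \<and> s powr (min p 2 / p) \<le> C * (\<Sum>k\<in>K. \<gamma> k powr (min p 2 / p)))"
proof -
  obtain C0 where C0: "C0 \<ge> 0" and LP: "\<And>(e::real^'n) N G g. (\<forall>n\<le>N. band e n (G n) \<and> g n \<ge> 0 \<and> Lpow p (G n) = ennreal (g n)) \<Longrightarrow>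
    (\<exists>s\<ge>0. Lpow p (\<lambda>x. \<Sum>n\<le>N. G n x) = ennreal s \<and> s powr (min p 2 / p) \<le> C0 * (\<Sum>n\<le>N. g n powr (min p 2 / p)))"
    using littlewood_paley[OF p, where 'a="real^'n"] by blast
  let ?r = "min p 2 / p"
  have r: "?r > 0" using p by simp
  have main: "\<exists>s\<ge>0. Lpow p (\<lambda>x. \<Sum>k\<in>K. G k x) = ennreal s \<and> s powr ?r \<le> C0 ^ card I * (\<Sum>k\<in>K. \<gamma> k powr ?r)"
    if "finite I" "finite K" "\<And>k i. k \<in> K \<Longrightarrow> k i \<le> N \<and> band (axis i 1) (k i) (G k)" "\<And>k. k \<in> K \<Longrightarrow> \<gamma> k \<ge> 0 \<and> Lpow p (G k) = ennreal (\<gamma> k)"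
      "\<And>k l i. k \<in> K \<Longrightarrow> l \<in> K \<Longrightarrow> i \<notin> I \<Longrightarrow> k i = l i" for I :: "'n set" and K :: "('n \<Rightarrow> nat) set" and N and G :: "('n \<Rightarrow> nat) \<Rightarrow> real^'n \<Rightarrow> complex" and \<gamma>
    using that
  proof (induction I arbitrary: K rule: finite_induct)
    case empty
    show ?case
    proof (cases "K = {}")
      case True
      then show ?thesis using p by (intro exI[of _ 0]) (simp add: Lpow_def)
    next
      case False
      then obtain k where k: "k \<in> K" by blast
      have "K = {k}" using k empty(4)[OF _ k] by (auto simp: fun_eq_iff)
      then show ?thesis using empty(3)[OF k] by (intro exI[of _ "\<gamma> k"]) simp
    qed
  next
    case (insert i I)
    let ?K = "\<lambda>n. {k \<in> K. k i = n}"
    let ?P = "\<lambda>n s. s \<ge> 0 \<and> Lpow p (\<lambda>x. \<Sum>k\<in>?K n. G k x) = ennreal s \<and> s powr ?r \<le> C0 ^ card I * (\<Sum>k\<in>?K n. \<gamma> k powr ?r)"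
    have "\<exists>s. ?P n s" for n
    proof (rule insert.IH)
      show "finite (?K n)" using insert.prems(1) by simp
      show "k i \<le> N \<and> band (axis i 1) (k i) (G k)" if "k \<in> ?K n" for k i using insert.prems(2) that by blast
      show "\<gamma> k \<ge> 0 \<and> Lpow p (G k) = ennreal (\<gamma> k)" if "k \<in> ?K n" for k using insert.prems(3) that by blast
      show "k j = l j" if "k \<in> ?K n" "l \<in> ?K n" "j \<notin> I" for k l j
        using insert.prems(4)[of k l j] that by (cases "j = i") auto
    qed
    then have "\<forall>n. \<exists>s. ?P n s" by (rule allI)
    from choice[OF this] obtain s where P: "\<forall>n. ?P n (s n)" by (rule exE)
    have s: "s n \<ge> 0" "Lpow p (\<lambda>x. \<Sum>k\<in>?K n. G k x) = ennreal (s n)" "s n powr ?r \<le> C0 ^ card I * (\<Sum>k\<in>?K n. \<gamma> k powr ?r)" for n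
      using spec[OF P, of n] by simp_all
    have b: "band (axis i 1) n (\<lambda>x. \<Sum>k\<in>?K n. G k x)" for n
      using insert.prems(1,2) by (intro band_sum) auto
    have "\<forall>n\<le>N. band (axis i 1) n (\<lambda>x. \<Sum>k\<in>?K n. G k x) \<and> s n \<ge> 0 \<and> Lpow p (\<lambda>x. \<Sum>k\<in>?K n. G k x) = ennreal (s n)"
      using b s(1,2) by simp
    from LP[OF this]
    obtain \<sigma> where \<sigma>: "\<sigma> \<ge> 0" "Lpow p (\<lambda>x. \<Sum>n\<le>N. \<Sum>k\<in>?K n. G k x) = ennreal \<sigma>" "\<sigma> powr ?r \<le> C0 * (\<Sum>n\<le>N. s n powr ?r)" by blast
    have grp: "(\<Sum>n\<le>N. \<Sum>k\<in>?K n. h k) = (\<Sum>k\<in>K. h k)" for h :: "('n \<Rightarrow> nat) \<Rightarrow> 'z::comm_monoid_add"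
      using insert.prems(1,2) by (intro sum.group) auto
    have "(\<Sum>n\<le>N. s n powr ?r) \<le> (\<Sum>n\<le>N. C0 ^ card I * (\<Sum>k\<in>?K n. \<gamma> k powr ?r))" by (intro sum_mono s(3))
    also have "\<dots> = C0 ^ card I * (\<Sum>k\<in>K. \<gamma> k powr ?r)" unfolding sum_distrib_left[symmetric] grp ..
    finally have "C0 * (\<Sum>n\<le>N. s n powr ?r) \<le> C0 * (C0 ^ card I * (\<Sum>k\<in>K. \<gamma> k powr ?r))" using C0 by (intro mult_left_mono)
    then have "\<sigma> powr ?r \<le> C0 ^ card (insert i I) * (\<Sum>k\<in>K. \<gamma> k powr ?r)" using \<sigma>(3) insert.hyps by (simp add: mult.assoc)
    then show ?case using \<sigma> unfolding grp by (intro exI[of _ \<sigma>]) auto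
  qed
  show ?thesis
  proof (rule exI[of _ "C0 ^ CARD('n)"], intro conjI allI impI)
    show "C0 ^ CARD('n) \<ge> 0" using C0 by simp
    fix K :: "('n \<Rightarrow> nat) set" and N and G :: "('n \<Rightarrow> nat) \<Rightarrow> real^'n \<Rightarrow> complex" and \<gamma>
    assume "finite K \<and> (\<forall>k\<in>K. \<forall>i. k i \<le> N \<and> band (axis i 1) (k i) (G k)) \<and> (\<forall>k\<in>K. \<gamma> k \<ge> 0 \<and> Lpow p (G k) = ennreal (\<gamma> k))"
    then show "\<exists>s\<ge>0. Lpow p (\<lambda>x. \<Sum>k\<in>K. G k x) = ennreal s \<and> s powr ?r \<le> C0 ^ CARD('n) * (\<Sum>k\<in>K. \<gamma> k powr ?r)"
      by (intro main[of UNIV K N G \<gamma>]) auto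
  qed
qed

section \<open>Reassembling an isotropic piece from mixed pieces\<close>

lemma (in mixed_gen) mixed_piece1_sum: "(\<Sum>m\<le>J. mixed_piece1 \<phi>0 m s) = \<phi>0 (s / 2 ^ J)"
proof (induction J)
  case (Suc J)
  have "2 * s / 2 ^ Suc J = s / 2 ^ J" by simp
  then show ?case using Suc by (simp add: mixed_piece1_def)
qed (simp add: mixed_piece1_def)

definition box_set :: "nat \<Rightarrow> ('n::finite \<Rightarrow> nat) set" where "box_set J = {k. \<forall>i. k i \<le> J}"

lemma box_set_PiE: "box_set J = Pi\<^sub>E UNIV (\<lambda>_. {..J})"
  by (auto simp: box_set_def PiE_def Pi_def)

lemma finite_box_set: "finite (box_set J :: ('n::finite \<Rightarrow> nat) set)"
  unfolding box_set_PiE by (intro finite_PiE) auto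

text \<open>The indices of those mixed pieces that meet the support of the \<open>j\<close>-th isotropic piece.\<close>
definition Kset :: "nat \<Rightarrow> ('n::finite \<Rightarrow> nat) set" where
  "Kset j = {k. (\<forall>i. k i \<le> Suc j) \<and> (\<exists>i. j \<le> Suc (k i))}"

lemma Kset_subset: "Kset j \<subseteq> box_set (Suc j)" by (auto simp: Kset_def box_set_def)
lemma finite_Kset: "finite (Kset j)" by (rule finite_subset[OF Kset_subset finite_box_set])

context gens
begin

lemma iso_piece_support:
  assumes "iso_piece \<psi>0 j \<xi> \<noteq> 0" shows "\<bar>\<xi> $ i\<bar> \<le> 3/2 * 2 ^ j"
proof (rule ccontr)
  assume *: "\<not> \<bar>\<xi> $ i\<bar> \<le> 3/2 * 2 ^ j"
  have 1: "\<psi>0 ((1 / 2 ^ j) *\<^sub>R \<xi>) = 0" by (rule psi_zero[of _ i]) (use * in \<open>simp add: abs_mult field_simps\<close>)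
  have 2: "\<psi>0 ((2 / 2 ^ j) *\<^sub>R \<xi>) = 0"
  proof (rule psi_zero[of _ i])
    have "3/2 * 2 ^ j \<le> 2 * \<bar>\<xi> $ i\<bar>" using * by simp
    then show "3/2 \<le> \<bar>((2 / 2 ^ j) *\<^sub>R \<xi>) $ i\<bar>" by (simp add: abs_mult field_simps)
  qed
  show False using assms 1 2 by (cases "j = 0") (auto simp: iso_piece_def)
qed

text \<open>On the support |xi_i| <= 3/2 * 2^j the mixed pieces with all indices up to j + 1 sum to
  1. Those with all indices at most j - 2 live where |xi_i| <= 2^j / 2, and there the isotropic
  piece vanishes.\<close>

lemma iso_resolution:
  "(\<Sum>k\<in>Kset j. mixed_piece \<phi>0 k \<xi> * iso_piece \<psi>0 j \<xi>) = iso_piece \<psi>0 j \<xi>"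
proof (cases "iso_piece \<psi>0 j \<xi> = 0")
  case False
  have 1: "(\<Sum>k\<in>box_set (Suc j). mixed_piece \<phi>0 k \<xi>) = 1"
  proof -
    have "(\<Sum>k\<in>box_set (Suc j). mixed_piece \<phi>0 k \<xi>) = (\<Prod>i\<in>UNIV. \<Sum>m\<le>Suc j. mixed_piece1 \<phi>0 m (\<xi> $ i))"
      unfolding mixed_piece_def box_set_PiE by (rule prod_sum_PiE[symmetric]) auto
    also have "\<dots> = (\<Prod>i\<in>UNIV. \<phi>0 (\<xi> $ i / 2 ^ Suc j))" unfolding mixed_piece1_sum ..
    also have "\<dots> = 1"
    proof (rule prod.neutral, intro ballI phi_one)
      fix i
      have "\<bar>\<xi> $ i\<bar> \<le> 2 * 2 ^ j" using iso_piece_support[OF False, of i] zero_less_power[of "2::real" j] by linarith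
      then show "\<bar>\<xi> $ i / 2 ^ Suc j\<bar> \<le> 1" by (simp add: abs_divide abs_mult)
    qed
    finally show ?thesis .
  qed
  have 2: "mixed_piece \<phi>0 k \<xi> = 0" if k: "k \<in> box_set (Suc j) - Kset j" for k
  proof (rule ccontr)
    assume nz: "mixed_piece \<phi>0 k \<xi> \<noteq> 0"
    have lt: "Suc (k i) < j" for i
    proof -
      have "\<not> (\<exists>i. j \<le> Suc (k i))" using k unfolding box_set_def Kset_def by blast
      then show ?thesis by (simp add: not_le)
    qed
    \<comment> \<open>Any coordinate serves as witness; \<open>undefined\<close> picks one.\<close>
    have j: "j \<noteq> 0" using lt[of undefined] by simp
    have c: "\<bar>\<xi> $ i\<bar> \<le> 2 ^ j / 2" for i
    proof -
      have "(2::real) ^ Suc (Suc (k i)) \<le> 2 ^ j" using lt[of i] by (intro power_increasing) auto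
      then show ?thesis using mixed_piece_support[OF nz, of i] zero_less_power[of "2::real" "k i"] by simp
    qed
    have "\<psi>0 ((2 / 2 ^ j) *\<^sub>R \<xi>) = 1" by (rule psi_one) (use c in \<open>simp add: abs_mult field_simps\<close>)
    moreover have "\<psi>0 ((1 / 2 ^ j) *\<^sub>R \<xi>) = 1"
    proof (rule psi_one)
      fix i
      have "\<bar>\<xi> $ i\<bar> \<le> 2 ^ j" using c[of i] zero_less_power[of "2::real" j] by linarith
      then show "\<bar>((1 / 2 ^ j) *\<^sub>R \<xi>) $ i\<bar> \<le> 1" by (simp add: abs_mult field_simps)
    qed
    ultimately show False using False j by (simp add: iso_piece_def)
  qed
  have "(\<Sum>k\<in>Kset j. mixed_piece \<phi>0 k \<xi>) = (\<Sum>k\<in>box_set (Suc j). mixed_piece \<phi>0 k \<xi>)"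
    by (rule sum.mono_neutral_left[OF finite_box_set Kset_subset]) (use 2 in blast)
  then show ?thesis using 1 by (simp add: sum_distrib_right[symmetric])
qed simp

lemma iso_represents:
  assumes f: "tempered f" and g: "\<And>k. k \<in> Kset j \<Longrightarrow> represents (fourier_mult (mixed_piece \<phi>0 k) f) (g k)"
    and B: "\<And>k. k \<in> Kset j \<Longrightarrow> \<exists>B. \<forall>y. cva j k (g k) y \<le> ennreal B"
  shows "represents (fourier_mult (iso_piece \<psi>0 j) f) (\<lambda>x. \<Sum>k\<in>Kset j. cv j k (g k) x)"
  unfolding represents_def
proof (intro conjI ballI)
  show "(\<lambda>x. \<Sum>k\<in>Kset j. cv j k (g k) x) \<in> borel_measurable lborel"
    using represents_borel[OF g] by (auto intro!: borel_measurable_sum cv_borel)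
  fix \<phi> :: "real^'n \<Rightarrow> complex" assume \<phi>: "\<phi> \<in> schwartz"
  let ?h = "\<lambda>k \<xi>. complex_of_real (mixed_piece \<phi>0 k \<xi>) * (complex_of_real (iso_piece \<psi>0 j \<xi>) * iFT \<phi> \<xi>)"
  have rep: "integrable lborel (\<lambda>y. cv j k (g k) y * \<phi> y)" "f (FT (?h k)) = (LINT y|lborel. cv j k (g k) y * \<phi> y)" if k: "k \<in> Kset j" for k
  proof -
    obtain b where "\<And>y. cva j k (g k) y \<le> ennreal b" using B[OF k] by blast
    from cv_represents[OF f g[OF k] this \<phi>] show "integrable lborel (\<lambda>y. cv j k (g k) y * \<phi> y)" "f (FT (?h k)) = (LINT y|lborel. cv j k (g k) y * \<phi> y)" by auto
  qed
  have isch: "(\<lambda>\<xi>. complex_of_real (iso_piece \<psi>0 j \<xi>) * iFT \<phi> \<xi>) \<in> schwartz"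
  proof (rule slow_mult_schwartz[OF _ iFT_schwartz[OF \<phi>]], rule slow_compact)
    show "smooth_fun (\<lambda>\<xi>. complex_of_real (iso_piece \<psi>0 j \<xi>))"
      by (intro pderivs_linear(2)[OF bounded_linear_of_real] smooth_iso_piece)
    show "complex_of_real (iso_piece \<psi>0 j x) = 0" if nx: "norm x > (\<Sum>i\<in>(UNIV::'n set). 3/2 * 2 ^ j)" for x
    proof (rule ccontr)
      assume "complex_of_real (iso_piece \<psi>0 j x) \<noteq> 0"
      then have nz: "iso_piece \<psi>0 j x \<noteq> 0" by simp
      obtain i where "\<bar>x $ i\<bar> > 3/2 * 2 ^ j" using coord_gt_if_norm_gt[OF nx] by blast
      then show False using iso_piece_support[OF nz, of i] by simp
    qed
  qed
  have hs: "?h k \<in> schwartz" for k by (rule mixed_schwartz_mult[OF isch])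
  have "(\<lambda>\<xi>. complex_of_real (iso_piece \<psi>0 j \<xi>) * iFT \<phi> \<xi>) = (\<lambda>\<xi>. \<Sum>k\<in>Kset j. ?h k \<xi>)"
  proof
    fix \<xi>
    have "(\<Sum>k\<in>Kset j. ?h k \<xi>) = complex_of_real (\<Sum>k\<in>Kset j. mixed_piece \<phi>0 k \<xi> * iso_piece \<psi>0 j \<xi>) * iFT \<phi> \<xi>"
      by (simp add: sum_distrib_right mult.assoc)
    then show "complex_of_real (iso_piece \<psi>0 j \<xi>) * iFT \<phi> \<xi> = (\<Sum>k\<in>Kset j. ?h k \<xi>)" unfolding iso_resolution by simp
  qed
  then have "fourier_mult (iso_piece \<psi>0 j) f \<phi> = f (\<lambda>x. \<Sum>k\<in>Kset j. FT (?h k) x)"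
    unfolding fourier_mult_def using FT_sum[of "Kset j" ?h] hs by simp
  also have "\<dots> = (\<Sum>k\<in>Kset j. f (FT (?h k)))"
    by (rule tempered_sum[OF f finite_Kset]) (intro FT_schwartz hs)
  also have "\<dots> = (\<Sum>k\<in>Kset j. (LINT y|lborel. cv j k (g k) y * \<phi> y))" by (intro sum.cong refl rep)
  also have "\<dots> = (LINT y|lborel. (\<Sum>k\<in>Kset j. cv j k (g k) y) * \<phi> y)"
    unfolding sum_distrib_right by (rule Bochner_Integration.integral_sum[symmetric]) (rule rep(1))
  finally show "fourier_mult (iso_piece \<psi>0 j) f \<phi> = (LINT y|lborel. (\<Sum>k\<in>Kset j. cv j k (g k) y) * \<phi> y)" .
  show "integrable lborel (\<lambda>x. (\<Sum>k\<in>Kset j. cv j k (g k) x) * \<phi> x)"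
    unfolding sum_distrib_right by (intro Bochner_Integration.integrable_sum rep(1))
qed

end

section \<open>Sufficiency\<close>

lemma epow_ennreal: "x \<ge> 0 \<Longrightarrow> epow (ennreal x) r = ennreal (x powr r)"
  by (simp add: epow_def)

lemma epow_mono: "x \<le> y \<Longrightarrow> r \<ge> 0 \<Longrightarrow> epow x r \<le> epow y r"
  by (auto simp: epow_def top_unique enn2real_mono less_top intro!: ennreal_leI powr_mono2)

lemma lq_qnorm_ge:
  assumes q: "q > 0" shows "a k \<le> lq_qnorm q a"
proof (cases "q = \<infinity>")
  case True then show ?thesis by (simp add: lq_qnorm_def SUP_upper)
next
  case False
  let ?Q = "enn2real q"
  have Q: "?Q > 0" using q False by (simp add: enn2real_positive_iff less_top)
  have "epow (a k) ?Q \<le> (\<integral>\<^sup>+ k. epow (a k) ?Q \<partial>count_space UNIV)"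
    by (rule nn_integral_ge_point) simp
  then have "epow (epow (a k) ?Q) (1 / ?Q) \<le> lq_qnorm q a"
    unfolding lq_qnorm_def using False Q by (simp add: epow_mono)
  moreover have "epow (epow (a k) ?Q) (1 / ?Q) = a k"
  proof (cases "a k = \<infinity>")
    case False
    then obtain x where "x \<ge> 0" "a k = ennreal x" by (metis ennreal_cases infinity_ennreal_def)
    then show ?thesis using Q by (simp add: epow_ennreal powr_powr)
  qed (simp add: epow_def)
  ultimately show ?thesis by simp
qed

text \<open>Membership of \<open>k\<close> in \<open>Kset j\<close> forces the largest index of
  \<open>k\<close> to differ from \<open>j\<close> by at most 1.\<close>

lemma Kset_multiplicity: "card {j. k \<in> Kset j} \<le> 3" "finite {j. (k::'n::finite \<Rightarrow> nat) \<in> Kset j}"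
proof -
  define M where "M = Max (range k)"
  have M: "k i \<le> M" for i by (simp add: M_def)
  have "M \<in> range k" unfolding M_def by (rule Max_in) auto
  then obtain i where i: "M = k i" by (rule rangeE)
  have sub: "{j. k \<in> Kset j} \<subseteq> {M - 1..M + 1}"
  proof
    fix j assume "j \<in> {j. k \<in> Kset j}"
    then have a: "k i \<le> Suc j" and "\<exists>l. j \<le> Suc (k l)" by (auto simp: Kset_def)
    then obtain l where "j \<le> Suc (k l)" by blast
    then show "j \<in> {M - 1..M + 1}" using M[of l] a i by simp
  qed
  show "finite {j. k \<in> Kset j}" by (rule finite_subset[OF sub]) simp
  have "card {j. k \<in> Kset j} \<le> card {M - 1..M + 1}" by (rule card_mono[OF _ sub]) simp
  then show "card {j. k \<in> Kset j} \<le> 3" by simp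
qed

lemma Kset_double_sum:
  fixes H :: "('n::finite \<Rightarrow> nat) \<Rightarrow> ennreal"
  shows "(\<integral>\<^sup>+ j. (\<Sum>k\<in>Kset j. H k) \<partial>count_space UNIV) \<le> 3 * (\<integral>\<^sup>+ k. H k \<partial>count_space UNIV)"
proof -
  have 1: "(\<Sum>k\<in>Kset j. H k) = (\<integral>\<^sup>+ k. H k * indicator (Kset j) k \<partial>count_space UNIV)" for j
  proof -
    have "(\<integral>\<^sup>+ k. H k * indicator (Kset j) k \<partial>count_space UNIV) = (\<integral>\<^sup>+ k. H k \<partial>count_space (Kset j))"
      by (simp add: nn_integral_count_space_indicator)
    then show ?thesis using nn_integral_count_space_finite[OF finite_Kset[of j], of H] by simp
  qed
  have "(\<integral>\<^sup>+ j. (\<Sum>k\<in>Kset j. H k) \<partial>count_space UNIV) = (\<Sum>j. \<integral>\<^sup>+ k. H k * indicator (Kset j) k \<partial>count_space UNIV)"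
    unfolding 1 by (rule nn_integral_count_space_nat)
  also have "\<dots> = (\<integral>\<^sup>+ k. (\<Sum>j. H k * indicator (Kset j) k) \<partial>count_space UNIV)" by (rule nn_integral_suminf[symmetric]) simp
  also have "\<dots> \<le> (\<integral>\<^sup>+ k. 3 * H k \<partial>count_space UNIV)"
  proof (rule nn_integral_mono)
    fix k :: "'n \<Rightarrow> nat"
    have "(\<Sum>j. H k * indicator (Kset j) k) = H k * (\<Sum>j. indicator {j. k \<in> Kset j} j)"
      by (subst ennreal_suminf_cmult[symmetric]) (auto intro!: suminf_cong simp: indicator_def)
    also have "(\<Sum>j. indicator {j. k \<in> Kset j} j) = (\<integral>\<^sup>+ j. indicator {j. k \<in> Kset j} j \<partial>count_space UNIV)"
      by (rule nn_integral_count_space_nat[symmetric])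
    also have "\<dots> = of_nat (card {j. k \<in> Kset j})" using Kset_multiplicity(2)[of k] by simp
    also have "H k * of_nat (card {j. k \<in> Kset j}) \<le> H k * 3"
    proof (rule mult_left_mono)
      have "of_nat (card {j. k \<in> Kset j}) \<le> (of_nat 3 :: ennreal)" using Kset_multiplicity(1)[of k] by (simp only: of_nat_le_iff)
      then show "of_nat (card {j. k \<in> Kset j}) \<le> (3 :: ennreal)" by simp
    qed simp
    finally show "(\<Sum>j. H k * indicator (Kset j) k) \<le> 3 * H k" by (simp add: mult.commute)
  qed
  also have "\<dots> = 3 * (\<integral>\<^sup>+ k. H k \<partial>count_space UNIV)" by (rule nn_integral_cmult) simp
  finally show ?thesis .
qed

lemma sum_UN_le:
  fixes g :: "'b \<Rightarrow> real"
  assumes "finite I" "\<And>i. i \<in> I \<Longrightarrow> finite (A i)" "\<And>x. x \<in> (\<Union>i\<in>I. A i) \<Longrightarrow> g x \<ge> 0"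
  shows "sum g (\<Union>i\<in>I. A i) \<le> (\<Sum>i\<in>I. sum g (A i))"
proof -
  have e: "(\<Union>i\<in>I. A i) = snd ` Sigma I A" by force
  have "sum g (snd ` Sigma I A) \<le> sum (g \<circ> snd) (Sigma I A)"
    by (rule sum_image_le) (use assms(1,2) in \<open>auto intro!: assms(3)\<close>)
  also have "\<dots> = (\<Sum>i\<in>I. sum g (A i))"
    using assms by (subst sum.Sigma) (auto simp: case_prod_beta comp_def)
  finally show ?thesis unfolding e .
qed

text \<open>Some index is within 1 of j and contributes at most 3 x^j / x with x = 2^(-\<tau>); the
  other indices run through geometric series. The union over the distinguished coordinate
  \<open>i0\<close> costs a factor d.\<close>

lemma Kset_weight_sum:
  fixes \<tau> :: real
  assumes t: "\<tau> > 0"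
  shows "\<exists>C\<ge>0. \<forall>j. (\<Sum>k\<in>(Kset j :: ('n::finite \<Rightarrow> nat) set). 2 powr (- (\<tau> * real (\<Sum>i\<in>UNIV. k i)))) \<le> C * 2 powr (- (\<tau> * real j))"
proof -
  define x where "x = (2::real) powr (- \<tau>)"
  have x: "0 < x" "x < 1" using t powr_less_mono[of "-\<tau>" 0 2] by (auto simp: x_def)
  have xp: "2 powr (- (\<tau> * real m)) = x ^ m" for m by (simp add: x_def powr_realpow[symmetric] powr_powr)
  let ?S = "1 / (1 - x)"
  have S1: "?S \<ge> 1" using x by simp
  have geo: "(\<Sum>m\<le>J. x ^ m) \<le> ?S" for J
  proof -
    have "(\<Sum>m\<le>J. x ^ m) = (1 - x ^ Suc J) / (1 - x)" using x by (simp add: sum_gp_basic field_simps)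
    also have "\<dots> \<le> ?S" using x by (intro divide_right_mono) auto
    finally show ?thesis .
  qed
  let ?B = "\<lambda>j i0 i. if i = i0 then {m. m \<le> Suc j \<and> j \<le> Suc m} else {..Suc j}"
  have fB: "finite (?B j i0 i)" for j i0 i by (auto intro: finite_subset[of _ "{..Suc j}"])
  have one: "(\<Sum>m\<in>{m. m \<le> Suc j \<and> j \<le> Suc m}. x ^ m) \<le> 3 / x * x ^ j" for j
  proof -
    have "(\<Sum>m\<in>{m. m \<le> Suc j \<and> j \<le> Suc m}. x ^ m) \<le> (\<Sum>m\<in>{m. m \<le> Suc j \<and> j \<le> Suc m}. x ^ j / x)"
    proof (rule sum_mono)
      fix m assume "m \<in> {m. m \<le> Suc j \<and> j \<le> Suc m}"
      then have "x ^ Suc m \<le> x ^ j" using x by (intro power_decreasing) auto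
      then show "x ^ m \<le> x ^ j / x" using x by (simp add: field_simps)
    qed
    also have "\<dots> = real (card {m. m \<le> Suc j \<and> j \<le> Suc m}) * (x ^ j / x)" by simp
    also have "\<dots> \<le> 3 * (x ^ j / x)"
    proof (rule mult_right_mono)
      have "card {m. m \<le> Suc j \<and> j \<le> Suc m} \<le> card {j - 1..j + 1}" by (rule card_mono) auto
      also have "\<dots> \<le> 3" by simp
      finally show "real (card {m. m \<le> Suc j \<and> j \<le> Suc m}) \<le> 3" by simp
    qed (use x in auto)
    finally show ?thesis by simp
  qed
  let ?C = "real CARD('n) * (3 / x * ?S ^ CARD('n))"
  have "(\<Sum>k\<in>(Kset j :: ('n \<Rightarrow> nat) set). 2 powr (- (\<tau> * real (\<Sum>i\<in>UNIV. k i)))) \<le> ?C * 2 powr (- (\<tau> * real j))" for j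
  proof -
    have w: "2 powr (- (\<tau> * real (\<Sum>i\<in>UNIV. k i))) = (\<Prod>i\<in>UNIV. x ^ k i)" for k :: "'n \<Rightarrow> nat"
      unfolding xp power_sum ..
    have sub: "(Kset j :: ('n \<Rightarrow> nat) set) \<subseteq> (\<Union>i0\<in>UNIV. Pi\<^sub>E UNIV (?B j i0))"
      by (auto simp: Kset_def PiE_def Pi_def split: if_splits)
    have "(\<Sum>k\<in>(Kset j :: ('n \<Rightarrow> nat) set). \<Prod>i\<in>UNIV. x ^ k i) \<le> (\<Sum>k\<in>(\<Union>i0\<in>(UNIV::'n set). Pi\<^sub>E UNIV (?B j i0)). \<Prod>i\<in>UNIV. x ^ k i)"
      using x by (intro sum_mono2[OF _ sub]) (auto intro!: finite_PiE fB prod_nonneg)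
    also have "\<dots> \<le> (\<Sum>i0\<in>(UNIV::'n set). \<Sum>k\<in>Pi\<^sub>E UNIV (?B j i0). \<Prod>i\<in>UNIV. x ^ k i)"
      using x by (intro sum_UN_le) (auto intro!: finite_PiE fB prod_nonneg)
    also have "\<dots> = (\<Sum>i0\<in>(UNIV::'n set). \<Prod>i\<in>UNIV. \<Sum>m\<in>?B j i0 i. x ^ m)"
      by (intro sum.cong refl prod_sum_PiE[symmetric] fB) auto
    also have "\<dots> \<le> (\<Sum>i0\<in>(UNIV::'n set). 3 / x * ?S ^ CARD('n) * x ^ j)"
    proof (rule sum_mono)
      fix i0 :: 'n
      have "(\<Prod>i\<in>UNIV. \<Sum>m\<in>?B j i0 i. x ^ m) = (\<Sum>m\<in>?B j i0 i0. x ^ m) * (\<Prod>i\<in>UNIV - {i0}. \<Sum>m\<in>?B j i0 i. x ^ m)"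
        by (rule prod.remove) auto
      also have "\<dots> \<le> (3 / x * x ^ j) * (\<Prod>i\<in>UNIV - {i0}. ?S)"
        using one[of j] geo[of "Suc j"] x S1 by (intro mult_mono prod_mono prod_nonneg conjI) (auto intro!: sum_nonneg simp del: sum.atMost_Suc)
      also have "\<dots> \<le> (3 / x * x ^ j) * ?S ^ CARD('n)"
      proof (rule mult_left_mono)
        show "(\<Prod>i\<in>UNIV - {i0}. ?S) \<le> ?S ^ CARD('n)" using S1 by (simp only: prod_constant) (intro power_increasing card_mono, auto)
      qed (use x in auto)
      finally show "(\<Prod>i\<in>UNIV. \<Sum>m\<in>?B j i0 i. x ^ m) \<le> 3 / x * ?S ^ CARD('n) * x ^ j" by (simp only: mult.assoc mult.commute[of "x ^ j"])
    qed
    also have "\<dots> = ?C * x ^ j" by simp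
    finally show ?thesis unfolding w xp[of j] .
  qed
  moreover have "?C \<ge> 0" using x by simp
  ultimately show ?thesis by blast
qed

section \<open>From control of single pieces to the embedding\<close>

context gens
begin

text \<open>One isotropic piece is controlled by the mixed pieces it meets, added up in \<open>\<ell>_r\<close>. The embedding
  follows for \<open>t = 0\<close>, \<open>q \<le> r\<close>, and for every \<open>q\<close> if \<open>t > 0\<close>, where the weights are summable over \<open>Kset j\<close>.\<close>
definition piece_ctrl :: "ennreal \<Rightarrow> real \<Rightarrow> bool" where
  "piece_ctrl p r \<longleftrightarrow> r > 0 \<and> (\<exists>C\<ge>0. \<forall>j f a. tempered f \<longrightarrow>
     (\<forall>k\<in>Kset j. a k \<ge> 0 \<and> dist_Lp p (fourier_mult (mixed_piece \<phi>0 k) f) = ennreal (a k)) \<longrightarrow>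
     (\<exists>D\<ge>0. dist_Lp p (fourier_mult (iso_piece \<psi>0 j) f) \<le> ennreal D \<and> D powr r \<le> C * (\<Sum>k\<in>Kset j. a k powr r)))"

text \<open>Only a bound for the supremum of the weighted norms enters, which every l_q norm
  provides. The weights leave a sum over \<open>Kset j\<close> of size 2^(-t r j), and its r-th root
  cancels the isotropic weight.\<close>

lemma ctrl_weighted:
  assumes c: "piece_ctrl p r" and t: "t > 0"
  shows "\<exists>C\<ge>0. \<forall>j f a \<beta>. tempered f \<longrightarrow> (\<forall>k\<in>Kset j. a k \<ge> 0 \<and> dist_Lp p (fourier_mult (mixed_piece \<phi>0 k) f) = ennreal (a k)) \<longrightarrow>
     \<beta> \<ge> 0 \<longrightarrow> (\<forall>k\<in>Kset j. 2 powr (real (\<Sum>i\<in>UNIV. k i) * t) * a k \<le> \<beta>) \<longrightarrow>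
     ennreal (2 powr (real j * t)) * dist_Lp p (fourier_mult (iso_piece \<psi>0 j) f) \<le> ennreal (C * \<beta>)"
proof -
  obtain C where r: "r > 0" and C: "C \<ge> 0" "\<And>j f a. tempered f \<Longrightarrow> (\<forall>k\<in>Kset j. a k \<ge> 0 \<and> dist_Lp p (fourier_mult (mixed_piece \<phi>0 k) f) = ennreal (a k)) \<Longrightarrow>
     (\<exists>D\<ge>0. dist_Lp p (fourier_mult (iso_piece \<psi>0 j) f) \<le> ennreal D \<and> D powr r \<le> C * (\<Sum>k\<in>Kset j. a k powr r))"
    using c unfolding piece_ctrl_def by blast
  obtain W where W: "W \<ge> 0" "\<And>j. (\<Sum>k\<in>(Kset j :: ('n \<Rightarrow> nat) set). 2 powr (- (t * r * real (\<Sum>i\<in>UNIV. k i)))) \<le> W * 2 powr (- (t * r * real j))"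
    using Kset_weight_sum[of "t * r", where 'n='n] t r by auto
  let ?C = "(C * W) powr (1 / r)"
  have "ennreal (2 powr (real j * t)) * dist_Lp p (fourier_mult (iso_piece \<psi>0 j) f) \<le> ennreal (?C * \<beta>)"
    if f: "tempered f" and a: "\<forall>k\<in>Kset j. a k \<ge> 0 \<and> dist_Lp p (fourier_mult (mixed_piece \<phi>0 k) f) = ennreal (a k)"
      and b: "\<beta> \<ge> 0" "\<forall>k\<in>Kset j. 2 powr (real (\<Sum>i\<in>UNIV. k i) * t) * a k \<le> \<beta>" for j f a \<beta>
  proof -
    obtain D where D: "D \<ge> 0" "dist_Lp p (fourier_mult (iso_piece \<psi>0 j) f) \<le> ennreal D" "D powr r \<le> C * (\<Sum>k\<in>Kset j. a k powr r)" using C(2)[OF f a] by blast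
    have "(\<Sum>k\<in>Kset j. a k powr r) \<le> (\<Sum>k\<in>(Kset j :: ('n \<Rightarrow> nat) set). 2 powr (- (t * r * real (\<Sum>i\<in>UNIV. k i))) * \<beta> powr r)"
    proof (rule sum_mono)
      fix k :: "'n \<Rightarrow> nat" assume k: "k \<in> Kset j"
      let ?s = "real (\<Sum>i\<in>UNIV. k i)"
      have "a k \<le> 2 powr (- (?s * t)) * \<beta>"
        using mult_left_mono[OF bspec[OF b(2) k], of "2 powr (- (?s * t))"] by (simp add: mult.assoc[symmetric] powr_add[symmetric])
      then have "a k powr r \<le> (2 powr (- (?s * t)) * \<beta>) powr r" using a k r by (intro powr_mono2) auto
      also have "\<dots> = 2 powr (- (t * r * ?s)) * \<beta> powr r" by (simp add: powr_mult powr_powr mult_ac)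
      finally show "a k powr r \<le> 2 powr (- (t * r * ?s)) * \<beta> powr r" .
    qed
    also have "\<dots> = (\<Sum>k\<in>(Kset j :: ('n \<Rightarrow> nat) set). 2 powr (- (t * r * real (\<Sum>i\<in>UNIV. k i)))) * \<beta> powr r" by (rule sum_distrib_right[symmetric])
    also have "\<dots> \<le> W * 2 powr (- (t * r * real j)) * \<beta> powr r" by (intro mult_right_mono W) auto
    finally have "D powr r \<le> C * (W * 2 powr (- (t * r * real j)) * \<beta> powr r)" using D(3) mult_left_mono[OF _ C(1)] order_trans by blast
    then have "(D powr r) powr (1 / r) \<le> (C * (W * 2 powr (- (t * r * real j)) * \<beta> powr r)) powr (1 / r)" using r by (intro powr_mono2) auto
    also have "\<dots> = ?C * (2 powr (- (real j * t)) * \<beta>)" using r b(1) by (simp add: powr_mult powr_powr mult_ac)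
    finally have "D \<le> ?C * (2 powr (- (real j * t)) * \<beta>)" using D(1) r by (simp add: powr_powr)
    then have "2 powr (real j * t) * D \<le> 2 powr (real j * t) * (?C * (2 powr (- (real j * t)) * \<beta>))" by (intro mult_left_mono) auto
    also have "\<dots> = ?C * \<beta>" by (simp add: powr_minus field_simps)
    finally have "ennreal (2 powr (real j * t) * D) \<le> ennreal (?C * \<beta>)" by (rule ennreal_leI)
    moreover have "ennreal (2 powr (real j * t)) * dist_Lp p (fourier_mult (iso_piece \<psi>0 j) f) \<le> ennreal (2 powr (real j * t) * D)"
      using D(2) by (subst ennreal_mult') (auto intro: mult_left_mono)
    ultimately show ?thesis by simp
  qed
  moreover have "?C \<ge> 0" by simp
  ultimately show ?thesis by blast
qed

text \<open>For finite q each isotropic term is bounded by the l_q sum over \<open>Kset j\<close>: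
  through \<open>ctrl_weighted\<close> if t > 0, through the inclusion of l_q in l_r if t = 0.
  Summing over j then counts every k at most three times.\<close>

lemma embeds_of_ctrl:
  assumes c: "piece_ctrl p r" and q: "q > 0" and tq: "t > 0 \<or> t = 0 \<and> q \<le> ennreal r"
  shows "mixed_embeds \<phi>0 \<psi>0 t p q"
proof -
  let ?b = "\<lambda>f (k::'n\<Rightarrow>nat). ennreal (2 powr (real (\<Sum>i\<in>UNIV. k i) * t)) * dist_Lp p (fourier_mult (mixed_piece \<phi>0 k) f)"
  let ?d = "\<lambda>f j. ennreal (2 powr (real j * t)) * dist_Lp p (fourier_mult (iso_piece \<psi>0 j) f)"
  have fin: "\<exists>a. \<forall>k. a k \<ge> 0 \<and> dist_Lp p (fourier_mult (mixed_piece \<phi>0 k) f) = ennreal (a k)"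
    if f: "f \<in> mixed_besov_space \<phi>0 t p q" for f :: "(real^'n \<Rightarrow> complex) \<Rightarrow> complex"
  proof -
    have "\<exists>a\<ge>0. dist_Lp p (fourier_mult (mixed_piece \<phi>0 k) f) = ennreal a" for k
    proof -
      have "?b f k \<le> mixed_besov_qnorm \<phi>0 t p q f" unfolding mixed_besov_qnorm_def by (rule lq_qnorm_ge[OF q])
      also have "\<dots> < \<infinity>" using f by (simp add: mixed_besov_space_def)
      finally have "dist_Lp p (fourier_mult (mixed_piece \<phi>0 k) f) < \<infinity>" by (auto simp: ennreal_mult_less_top)
      then show ?thesis by (metis ennreal_cases infinity_ennreal_def less_irrefl)
    qed
    then show ?thesis by metis
  qed
  have "\<exists>C::real. \<forall>f\<in>mixed_besov_space \<phi>0 t p q. besov_qnorm \<psi>0 t p q f \<le> ennreal C * mixed_besov_qnorm \<phi>0 t p q f"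
  proof (cases "q = \<infinity>")
    case True
    then have t: "t > 0" using tq by (auto simp: top_unique)
    obtain C where C: "C \<ge> 0" "\<And>j f a \<beta>. tempered f \<Longrightarrow> (\<forall>k\<in>Kset j. a k \<ge> 0 \<and> dist_Lp p (fourier_mult (mixed_piece \<phi>0 k) f) = ennreal (a k)) \<Longrightarrow>
     \<beta> \<ge> 0 \<Longrightarrow> (\<forall>k\<in>Kset j. 2 powr (real (\<Sum>i\<in>UNIV. k i) * t) * a k \<le> \<beta>) \<Longrightarrow> ?d f j \<le> ennreal (C * \<beta>)" using ctrl_weighted[OF c t] by blast
    show ?thesis
    proof (intro exI[of _ C] ballI)
      fix f :: "(real^'n \<Rightarrow> complex) \<Rightarrow> complex" assume f: "f \<in> mixed_besov_space \<phi>0 t p q"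
      have tf: "tempered f" and lt: "mixed_besov_qnorm \<phi>0 t p q f < \<infinity>" using f by (auto simp: mixed_besov_space_def)
      obtain a where a: "\<forall>k. a k \<ge> 0 \<and> dist_Lp p (fourier_mult (mixed_piece \<phi>0 k) f) = ennreal (a k)" using fin[OF f] by blast
      obtain \<beta> where \<beta>: "\<beta> \<ge> 0" "mixed_besov_qnorm \<phi>0 t p q f = ennreal \<beta>" using lt by (metis ennreal_cases infinity_ennreal_def less_irrefl)
      have "2 powr (real (\<Sum>i\<in>UNIV. k i) * t) * a k \<le> \<beta>" for k
      proof -
        have "?b f k \<le> ennreal \<beta>" unfolding \<beta>(2)[symmetric] mixed_besov_qnorm_def by (rule lq_qnorm_ge[OF q])
        then show ?thesis using a \<beta>(1) by (simp add: ennreal_mult'[symmetric])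
      qed
      then have "?d f j \<le> ennreal (C * \<beta>)" for j using a \<beta>(1) by (intro C(2)[OF tf, of j a \<beta>]) auto
      then have "besov_qnorm \<psi>0 t p q f \<le> ennreal (C * \<beta>)" unfolding besov_qnorm_def lq_qnorm_def using True by (auto intro: SUP_least)
      then show "besov_qnorm \<psi>0 t p q f \<le> ennreal C * mixed_besov_qnorm \<phi>0 t p q f" unfolding \<beta>(2) using C(1) by (simp add: ennreal_mult')
    qed
  next
    case False
    let ?Q = "enn2real q"
    have Q: "?Q > 0" using q False by (simp add: enn2real_positive_iff less_top)
    have "\<exists>C\<ge>0. \<forall>j f a. tempered f \<longrightarrow> (\<forall>k\<in>Kset j. a k \<ge> 0 \<and> dist_Lp p (fourier_mult (mixed_piece \<phi>0 k) f) = ennreal (a k)) \<longrightarrow>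
      epow (?d f j) ?Q \<le> ennreal C * (\<Sum>k\<in>Kset j. ennreal ((2 powr (real (\<Sum>i\<in>UNIV. k i) * t) * a k) powr ?Q))"
      using tq
    proof
      assume t: "t > 0"
      obtain C where C: "C \<ge> 0" "\<And>j f a \<beta>. tempered f \<Longrightarrow> (\<forall>k\<in>Kset j. a k \<ge> 0 \<and> dist_Lp p (fourier_mult (mixed_piece \<phi>0 k) f) = ennreal (a k)) \<Longrightarrow>
       \<beta> \<ge> 0 \<Longrightarrow> (\<forall>k\<in>Kset j. 2 powr (real (\<Sum>i\<in>UNIV. k i) * t) * a k \<le> \<beta>) \<Longrightarrow> ?d f j \<le> ennreal (C * \<beta>)" using ctrl_weighted[OF c t] by blast
      show ?thesis
      proof (intro exI[of _ "C powr ?Q"] conjI allI impI)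
        fix j f and a :: "('n \<Rightarrow> nat) \<Rightarrow> real" assume f: "tempered f" and a: "\<forall>k\<in>Kset j. a k \<ge> 0 \<and> dist_Lp p (fourier_mult (mixed_piece \<phi>0 k) f) = ennreal (a k)"
        let ?x = "\<lambda>k::'n\<Rightarrow>nat. 2 powr (real (\<Sum>i\<in>UNIV. k i) * t) * a k"
        \<comment> \<open>\<open>?S powr (1 / ?Q)\<close> dominates every single term and serves as
          \<open>\<beta>\<close> in the supremum bound.\<close>
        let ?S = "\<Sum>k\<in>Kset j. ?x k powr ?Q"
        have S0: "?S \<ge> 0" by (intro sum_nonneg) auto
        have "?x k \<le> ?S powr (1 / ?Q)" if k: "k \<in> Kset j" for k
        proof -
          have "?x k powr ?Q \<le> ?S" using k finite_Kset by (intro member_le_sum) auto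
          then have "(?x k powr ?Q) powr (1 / ?Q) \<le> ?S powr (1 / ?Q)" using Q by (intro powr_mono2) auto
          then show ?thesis using Q a k by (simp add: powr_powr)
        qed
        then have "?d f j \<le> ennreal (C * ?S powr (1 / ?Q))" using f a S0 by (intro C(2)[of f j a]) auto
        then have "epow (?d f j) ?Q \<le> epow (ennreal (C * ?S powr (1 / ?Q))) ?Q" using Q by (intro epow_mono) auto
        also have "\<dots> = ennreal (C powr ?Q * ?S)" using C(1) Q S0 by (simp add: epow_ennreal powr_mult powr_powr)
        also have "\<dots> = ennreal (C powr ?Q) * (\<Sum>k\<in>Kset j. ennreal (?x k powr ?Q))" by (simp add: ennreal_mult' sum_ennreal)
        finally show "epow (?d f j) ?Q \<le> ennreal (C powr ?Q) * (\<Sum>k\<in>Kset j. ennreal (?x k powr ?Q))" .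
      qed simp
    next
      assume t0: "t = 0 \<and> q \<le> ennreal r"
      obtain C where r: "r > 0" and C: "C \<ge> 0" "\<And>j f a. tempered f \<Longrightarrow> (\<forall>k\<in>Kset j. a k \<ge> 0 \<and> dist_Lp p (fourier_mult (mixed_piece \<phi>0 k) f) = ennreal (a k)) \<Longrightarrow>
         (\<exists>D\<ge>0. dist_Lp p (fourier_mult (iso_piece \<psi>0 j) f) \<le> ennreal D \<and> D powr r \<le> C * (\<Sum>k\<in>Kset j. a k powr r))"
        using c unfolding piece_ctrl_def by blast
      have qr: "?Q \<le> r" using t0 r by (metis enn2real_ennreal enn2real_mono ennreal_less_top less_imp_le)
      show ?thesis
      proof (intro exI[of _ "C powr (?Q / r)"] conjI allI impI)
        fix j f and a :: "('n \<Rightarrow> nat) \<Rightarrow> real" assume f: "tempered f" and a: "\<forall>k\<in>Kset j. a k \<ge> 0 \<and> dist_Lp p (fourier_mult (mixed_piece \<phi>0 k) f) = ennreal (a k)"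
        obtain D where D: "D \<ge> 0" "dist_Lp p (fourier_mult (iso_piece \<psi>0 j) f) \<le> ennreal D" "D powr r \<le> C * (\<Sum>k\<in>Kset j. a k powr r)" using C(2)[OF f a] by blast
        have "D powr ?Q = (D powr r) powr (?Q / r)" using r by (simp add: powr_powr)
        also have "\<dots> \<le> (C * (\<Sum>k\<in>Kset j. a k powr r)) powr (?Q / r)" using D(3) Q r by (intro powr_mono2) auto
        also have "\<dots> = C powr (?Q / r) * (\<Sum>k\<in>Kset j. a k powr r) powr (?Q / r)" by (rule powr_mult)
        \<comment> \<open>Subadditivity of the power Q / r <= 1, which is the inclusion of l_q in
          l_r.\<close>
        also have "\<dots> \<le> C powr (?Q / r) * (\<Sum>k\<in>Kset j. (a k powr r) powr (?Q / r))"
          using Q r qr by (intro mult_left_mono powr_sum_le_subadd finite_Kset) auto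
        also have "(\<Sum>k\<in>Kset j. (a k powr r) powr (?Q / r)) = (\<Sum>k\<in>Kset j. a k powr ?Q)" using r by (simp add: powr_powr)
        finally have le: "D powr ?Q \<le> C powr (?Q / r) * (\<Sum>k\<in>Kset j. a k powr ?Q)" .
        have "epow (?d f j) ?Q \<le> epow (ennreal D) ?Q" using D(2) t0 Q by (intro epow_mono) auto
        also have "\<dots> \<le> ennreal (C powr (?Q / r) * (\<Sum>k\<in>Kset j. a k powr ?Q))" using le D(1) by (simp add: epow_ennreal ennreal_leI)
        also have "\<dots> = ennreal (C powr (?Q / r)) * (\<Sum>k\<in>Kset j. ennreal (a k powr ?Q))" by (simp add: ennreal_mult' sum_ennreal)
        finally show "epow (?d f j) ?Q \<le> ennreal (C powr (?Q / r)) * (\<Sum>k\<in>Kset j. ennreal ((2 powr (real (\<Sum>i\<in>UNIV. k i) * t) * a k) powr ?Q))"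
          using t0 by simp
      qed simp
    qed
    then obtain C where C: "C \<ge> 0" "\<And>j f a. tempered f \<Longrightarrow> (\<forall>k\<in>Kset j. a k \<ge> 0 \<and> dist_Lp p (fourier_mult (mixed_piece \<phi>0 k) f) = ennreal (a k)) \<Longrightarrow>
      epow (?d f j) ?Q \<le> ennreal C * (\<Sum>k\<in>Kset j. ennreal ((2 powr (real (\<Sum>i\<in>UNIV. k i) * t) * a k) powr ?Q))" by blast
    show ?thesis
    proof (intro exI[of _ "(3 * C) powr (1 / ?Q)"] ballI)
      fix f :: "(real^'n \<Rightarrow> complex) \<Rightarrow> complex" assume f: "f \<in> mixed_besov_space \<phi>0 t p q"
      have tf: "tempered f" and lt: "mixed_besov_qnorm \<phi>0 t p q f < \<infinity>" using f by (auto simp: mixed_besov_space_def)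
      obtain a where a: "\<forall>k. a k \<ge> 0 \<and> dist_Lp p (fourier_mult (mixed_piece \<phi>0 k) f) = ennreal (a k)" using fin[OF f] by blast
      let ?H = "\<lambda>k::'n\<Rightarrow>nat. ennreal ((2 powr (real (\<Sum>i\<in>UNIV. k i) * t) * a k) powr ?Q)"
      let ?X = "\<integral>\<^sup>+ k. ?H k \<partial>count_space UNIV"
      have Hb: "epow (?b f k) ?Q = ?H k" for k using a by (simp add: ennreal_mult'[symmetric] epow_ennreal)
      have m: "mixed_besov_qnorm \<phi>0 t p q f = epow ?X (1 / ?Q)"
        unfolding mixed_besov_qnorm_def lq_qnorm_def Hb using False by simp
      have "?X \<noteq> \<infinity>" using lt unfolding m by (auto simp: epow_def)
      then obtain x where x: "x \<ge> 0" "?X = ennreal x" by (cases ?X rule: ennreal_cases) auto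
      have "(\<integral>\<^sup>+ j. epow (?d f j) ?Q \<partial>count_space UNIV) \<le> (\<integral>\<^sup>+ j. ennreal C * (\<Sum>k\<in>Kset j. ?H k) \<partial>count_space UNIV)"
        using a by (intro nn_integral_mono C(2)[of f _ a] tf) auto
      also have "\<dots> = ennreal C * (\<integral>\<^sup>+ j. (\<Sum>k\<in>Kset j. ?H k) \<partial>count_space UNIV)" by (rule nn_integral_cmult) simp
      also have "\<dots> \<le> ennreal C * (3 * ?X)" by (intro mult_left_mono Kset_double_sum) simp
      also have "\<dots> = ennreal (3 * C * x)" unfolding x(2) using C(1) x(1) by (simp add: ennreal_mult' mult_ac)
      finally have "besov_qnorm \<psi>0 t p q f \<le> epow (ennreal (3 * C * x)) (1 / ?Q)"
        unfolding besov_qnorm_def lq_qnorm_def using False Q by (simp add: epow_mono)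
      also have "\<dots> = ennreal ((3 * C) powr (1 / ?Q)) * mixed_besov_qnorm \<phi>0 t p q f"
        unfolding m x(2) using C(1) x(1) by (subst (1 2) epow_ennreal) (auto simp: powr_mult ennreal_mult')
      finally show "besov_qnorm \<psi>0 t p q f \<le> ennreal ((3 * C) powr (1 / ?Q)) * mixed_besov_qnorm \<phi>0 t p q f" .
    qed
  qed
  then obtain C :: real where C: "\<And>f. f \<in> mixed_besov_space \<phi>0 t p q \<Longrightarrow> besov_qnorm \<psi>0 t p q f \<le> ennreal C * mixed_besov_qnorm \<phi>0 t p q f" by blast
  have "f \<in> besov_space \<psi>0 t p q" if f: "f \<in> mixed_besov_space \<phi>0 t p q" for f :: "(real^'n \<Rightarrow> complex) \<Rightarrow> complex"
  proof -
    have "ennreal C * mixed_besov_qnorm \<phi>0 t p q f < \<infinity>" using f by (auto simp: mixed_besov_space_def ennreal_mult_less_top)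
    then show ?thesis using C[OF f] f by (auto simp: mixed_besov_space_def besov_space_def)
  qed
  then show ?thesis unfolding mixed_embeds_def using C by blast
qed

end

section \<open>Norms of representing functions and control of one isotropic piece\<close>

lemma dist_Lp_finite:
  assumes "dist_Lp p T = ennreal a" obtains g where "represents T g"
proof (cases "{g. represents T g} = {}")
  case True
  \<comment> \<open>The infimum over the empty set is infinite.\<close>
  then show ?thesis using assms by (simp add: dist_Lp_def)
next
  case False
  then show ?thesis using that by blast
qed

lemma Lp_qnorm_Lpow:
  "p \<noteq> \<infinity> \<Longrightarrow> Lp_qnorm p g = epow (Lpow (enn2real p) g) (1 / enn2real p)"
  by (simp add: Lp_qnorm_def Lpow_def)

lemma epow_root_eq:
  assumes "epow x (1 / P) = ennreal a" "P > 0" "a \<ge> 0" shows "x = ennreal (a powr P)"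
proof (cases x rule: ennreal_cases)
  case (real y)
  then have "y powr (1 / P) = a" using assms by (simp add: epow_ennreal)
  then have "a powr P = y" using real assms(2) by (auto simp: powr_powr)
  then show ?thesis using real by simp
next
  case top
  then show ?thesis using assms by (simp add: epow_def)
qed

text \<open>The infimum defining the essential supremum is attained, since countably many null sets
  can be joined.\<close>

lemma Lp_qnorm_top_AE:
  assumes "Lp_qnorm \<infinity> g = ennreal a" "a \<ge> 0"
  shows "AE x in lborel. norm (g x) \<le> a"
proof -
  have "AE x in lborel. ennreal (norm (g x)) \<le> ennreal (a + 1 / Suc n)" for n
  proof -
    have "Inf {C. AE x in lborel. ennreal (norm (g x)) \<le> C} < ennreal (a + 1 / Suc n)"
      using assms unfolding Lp_qnorm_def by (simp add: ennreal_less_iff)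
    then obtain c where "AE x in lborel. ennreal (norm (g x)) \<le> c" "c < ennreal (a + 1 / Suc n)" unfolding Inf_less_iff by auto
    then show ?thesis by (elim AE_mp) (auto intro: AE_I2)
  qed
  then have "AE x in lborel. \<forall>n. ennreal (norm (g x)) \<le> ennreal (a + 1 / Suc n)" by (simp add: AE_all_countable)
  then show ?thesis
  proof (rule AE_mp, intro AE_I2 impI)
    fix x assume *: "\<forall>n. ennreal (norm (g x)) \<le> ennreal (a + 1 / Suc n)"
    have "norm (g x) \<le> a + 1 / real (Suc n)" for n
      using spec[OF *, of n] assms(2) by (subst (asm) ennreal_le_iff) (simp_all)
    then have "(\<lambda>n. a + 1 / real (Suc n)) \<longlonglongrightarrow> a \<Longrightarrow> norm (g x) \<le> a" by (intro LIMSEQ_le_const) auto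
    moreover have "(\<lambda>n. a + 1 / real (Suc n)) \<longlonglongrightarrow> a + 0" by (intro tendsto_intros LIMSEQ_Suc[OF lim_1_over_n])
    ultimately show "norm (g x) \<le> a" by simp
  qed
qed

context gens
begin

lemma cv_Lpow:
  assumes p: "p > 0"
  shows "\<exists>C\<ge>0. \<forall>j k f g. (\<forall>i. k i \<le> Suc j) \<longrightarrow> tempered f \<longrightarrow> represents (fourier_mult (mixed_piece \<phi>0 k) f) g \<longrightarrow> Lpow p g < \<infinity> \<longrightarrow>
    (\<exists>B. \<forall>y. cva j k g y \<le> ennreal B) \<and> Lpow p (cv j k g) \<le> ennreal C * Lpow p g"
proof (cases "p < 1")
  case True
  obtain C where C: "C \<ge> 0" "\<And>j k f g. (\<forall>i. k i \<le> Suc j) \<Longrightarrow> tempered f \<Longrightarrow> represents (fourier_mult (mixed_piece \<phi>0 k) f) g \<Longrightarrow> Lpow p g < \<infinity> \<Longrightarrow> Lpow p (cv j k g) \<le> ennreal C * Lpow p g"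
    using cv_Lpow_lt1[OF p True] by blast
  show ?thesis
    by (rule exI[of _ C], intro conjI allI impI C(1)) (blast intro: cva_bounded_lt1[OF _ _ p True] C(2))+
next
  case False
  then have p1: "p \<ge> 1" by simp
  obtain C where C: "C \<ge> 0" "\<And>j k g. (\<forall>i. k i \<le> Suc j) \<Longrightarrow> g \<in> borel_measurable borel \<Longrightarrow> Lpow p g < \<infinity> \<Longrightarrow> Lpow p (cv j k g) \<le> ennreal C * Lpow p g"
    using cv_Lpow_ge1[OF p1] by blast
  show ?thesis
    by (rule exI[of _ C], intro conjI allI impI C(1)) (blast intro: cva_bounded_ge1[OF _ p1] C(2) represents_borel)+
qed

text \<open>For p <= 1 subadditivity of the p-th power settles the sum pointwise; for p > 1 the
  spectral localisation of the summands feeds the Littlewood--Paley estimate.\<close>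

lemma band_sum_Lpow:
  assumes p: "p > 0"
  shows "\<exists>C\<ge>0. \<forall>j g \<gamma>. (\<forall>k\<in>Kset j. g k \<in> borel_measurable borel \<and> (\<exists>B. \<forall>y. cva j k (g k) y \<le> ennreal B) \<and> \<gamma> k \<ge> 0 \<and> Lpow p (cv j k (g k)) = ennreal (\<gamma> k)) \<longrightarrow>
    (\<exists>s\<ge>0. Lpow p (\<lambda>x. \<Sum>k\<in>Kset j. cv j k (g k) x) = ennreal s \<and> s powr (min p 2 / p) \<le> C * (\<Sum>k\<in>Kset j. \<gamma> k powr (min p 2 / p)))"
proof (cases "p \<le> 1")
  case True
  show ?thesis
  proof (rule exI[of _ 1], intro conjI allI impI)
    fix j g and \<gamma> :: "('n \<Rightarrow> nat) \<Rightarrow> real"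
    assume a: "\<forall>k\<in>Kset j. g k \<in> borel_measurable borel \<and> (\<exists>B. \<forall>y. cva j k (g k) y \<le> ennreal B) \<and> \<gamma> k \<ge> 0 \<and> Lpow p (cv j k (g k)) = ennreal (\<gamma> k)"
    have m [measurable]: "g k \<in> borel_measurable borel" if "k \<in> Kset j" for k using a that by blast
    have "Lpow p (\<lambda>x. \<Sum>k\<in>Kset j. cv j k (g k) x) \<le> (\<integral>\<^sup>+x. (\<Sum>k\<in>Kset j. ennreal (norm (cv j k (g k) x) powr p)) \<partial>lborel)"
      unfolding Lpow_def
    proof (rule nn_integral_mono)
      fix x
      have "norm (\<Sum>k\<in>Kset j. cv j k (g k) x) powr p \<le> (\<Sum>k\<in>Kset j. norm (cv j k (g k) x)) powr p"
        using p by (intro powr_mono2 norm_sum) auto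
      also have "\<dots> \<le> (\<Sum>k\<in>Kset j. norm (cv j k (g k) x) powr p)" using p True by (intro powr_sum_le_subadd finite_Kset) auto
      finally show "ennreal (norm (\<Sum>k\<in>Kset j. cv j k (g k) x) powr p) \<le> (\<Sum>k\<in>Kset j. ennreal (norm (cv j k (g k) x) powr p))"
        by (simp add: sum_ennreal ennreal_leI)
    qed
    also have "\<dots> = (\<Sum>k\<in>Kset j. Lpow p (cv j k (g k)))" unfolding Lpow_def
      by (rule nn_integral_sum) (use m in measurable)
    also have "\<dots> = (\<Sum>k\<in>Kset j. ennreal (\<gamma> k))" using a by (intro sum.cong) auto
    also have "\<dots> = ennreal (\<Sum>k\<in>Kset j. \<gamma> k)" using a by (intro sum_ennreal) auto
    finally have le: "Lpow p (\<lambda>x. \<Sum>k\<in>Kset j. cv j k (g k) x) \<le> ennreal (\<Sum>k\<in>Kset j. \<gamma> k)" .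
    obtain s where s: "s \<ge> 0" "Lpow p (\<lambda>x. \<Sum>k\<in>Kset j. cv j k (g k) x) = ennreal s"
      using le by (cases "Lpow p (\<lambda>x. \<Sum>k\<in>Kset j. cv j k (g k) x)" rule: ennreal_cases) (auto simp: top_unique)
    have "s \<le> (\<Sum>k\<in>Kset j. \<gamma> k)" using le s a by (simp add: sum_nonneg)
    moreover have "min p 2 / p = 1" using p True by simp
    moreover have "(\<Sum>k\<in>Kset j. \<gamma> k powr 1) = (\<Sum>k\<in>Kset j. \<gamma> k)" using a by (intro sum.cong) auto
    ultimately show "\<exists>s\<ge>0. Lpow p (\<lambda>x. \<Sum>k\<in>Kset j. cv j k (g k) x) = ennreal s \<and> s powr (min p 2 / p) \<le> 1 * (\<Sum>k\<in>Kset j. \<gamma> k powr (min p 2 / p))"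
      using s by (intro exI[of _ s]) simp
  qed simp
next
  case False
  then have p1: "p > 1" by simp
  obtain \<Lambda> A where sk: "smoothing_kernel lam \<Lambda> A" using lam_kernel by blast
  interpret sk: smoothing_kernel lam \<Lambda> A by (rule sk)
  obtain C where C: "C \<ge> 0" "\<And>(K::('n \<Rightarrow> nat) set) N (G::('n \<Rightarrow> nat) \<Rightarrow> real^'n \<Rightarrow> complex) \<gamma>.
    finite K \<and> (\<forall>k\<in>K. \<forall>i. k i \<le> N \<and> sk.band (axis i 1) (k i) (G k)) \<and> (\<forall>k\<in>K. \<gamma> k \<ge> 0 \<and> Lpow p (G k) = ennreal (\<gamma> k)) \<Longrightarrow>
    (\<exists>s\<ge>0. Lpow p (\<lambda>x. \<Sum>k\<in>K. G k x) = ennreal s \<and> s powr (min p 2 / p) \<le> C * (\<Sum>k\<in>K. \<gamma> k powr (min p 2 / p)))"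
    using sk.littlewood_paley_all_directions[OF p1, where 'n='n] by blast
  show ?thesis
  proof (rule exI[of _ C], intro conjI allI impI C(1))
    fix j g and \<gamma> :: "('n \<Rightarrow> nat) \<Rightarrow> real"
    assume a: "\<forall>k\<in>Kset j. g k \<in> borel_measurable borel \<and> (\<exists>B. \<forall>y. cva j k (g k) y \<le> ennreal B) \<and> \<gamma> k \<ge> 0 \<and> Lpow p (cv j k (g k)) = ennreal (\<gamma> k)"
    show "\<exists>s\<ge>0. Lpow p (\<lambda>x. \<Sum>k\<in>Kset j. cv j k (g k) x) = ennreal s \<and> s powr (min p 2 / p) \<le> C * (\<Sum>k\<in>Kset j. \<gamma> k powr (min p 2 / p))"
    proof (rule C(2)[of _ "Suc j"], intro conjI ballI allI finite_Kset)
      fix k :: "'n \<Rightarrow> nat" and i assume k: "k \<in> Kset j"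
      show "k i \<le> Suc j" using k by (simp add: Kset_def)
      obtain B where "\<And>y. cva j k (g k) y \<le> ennreal B" using a k by blast
      then show "sk.band (axis i 1) (k i) (cv j k (g k))" using a k by (intro cv_band[OF sk]) auto
    qed (use a in auto)
  qed
qed

lemma piece_ctrl_finite:
  assumes p: "0 < p" "p < \<infinity>"
  shows "piece_ctrl p (min (enn2real p) 2)"
proof -
  let ?P = "enn2real p"
  let ?r = "min ?P 2"
  have P: "?P > 0" using p by (simp add: enn2real_positive_iff)
  have pinf: "p \<noteq> \<infinity>" using p by simp
  obtain C where C: "C \<ge> 0" "\<And>j k f g. (\<forall>i. k i \<le> Suc j) \<Longrightarrow> tempered f \<Longrightarrow> represents (fourier_mult (mixed_piece \<phi>0 k) f) g \<Longrightarrow> Lpow ?P g < \<infinity> \<Longrightarrow>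
    (\<exists>B. \<forall>y. cva j k g y \<le> ennreal B) \<and> Lpow ?P (cv j k g) \<le> ennreal C * Lpow ?P g"
    using cv_Lpow[OF P] by blast
  obtain C' where C': "C' \<ge> 0" "\<And>j g \<gamma>. (\<forall>k\<in>Kset j. g k \<in> borel_measurable borel \<and> (\<exists>B. \<forall>y. cva j k (g k) y \<le> ennreal B) \<and> \<gamma> k \<ge> 0 \<and> Lpow ?P (cv j k (g k)) = ennreal (\<gamma> k)) \<Longrightarrow>
    (\<exists>s\<ge>0. Lpow ?P (\<lambda>x. \<Sum>k\<in>Kset j. cv j k (g k) x) = ennreal s \<and> s powr (?r / ?P) \<le> C' * (\<Sum>k\<in>Kset j. \<gamma> k powr (?r / ?P)))"
    using band_sum_Lpow[OF P] by blast
  show ?thesis unfolding piece_ctrl_def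
  proof (rule conjI, goal_cases)
    case 2 show ?case
  proof (rule exI[of _ "C' * C powr (?r / ?P)"], intro conjI allI impI)
    fix j f and a :: "('n \<Rightarrow> nat) \<Rightarrow> real"
    assume f: "tempered f" and a: "\<forall>k\<in>Kset j. a k \<ge> 0 \<and> dist_Lp p (fourier_mult (mixed_piece \<phi>0 k) f) = ennreal (a k)"
    have "\<exists>g. represents (fourier_mult (mixed_piece \<phi>0 k) f) g" if k: "k \<in> Kset j" for k
      using a k dist_Lp_finite[of p _ "a k"] by blast
    then obtain g where g: "\<And>k. k \<in> Kset j \<Longrightarrow> represents (fourier_mult (mixed_piece \<phi>0 k) f) (g k)" by metis
    have gL: "Lpow ?P (g k) = ennreal (a k powr ?P)" if k: "k \<in> Kset j" for k
    proof (rule epow_root_eq[OF _ P])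
      show "epow (Lpow ?P (g k)) (1 / ?P) = ennreal (a k)" using a k dist_Lp_eq[OF g[OF k], of p] by (simp add: Lp_qnorm_Lpow[OF pinf])
      show "a k \<ge> 0" using a k by blast
    qed
    have c: "\<exists>B. \<forall>y. cva j k (g k) y \<le> ennreal B" "Lpow ?P (cv j k (g k)) \<le> ennreal C * Lpow ?P (g k)" if k: "k \<in> Kset j" for k
      using C(2)[OF _ f g[OF k], of j] k gL[OF k] by (auto simp: Kset_def)
    define \<gamma> where "\<gamma> k = enn2real (Lpow ?P (cv j k (g k)))" for k
    have cl: "Lpow ?P (cv j k (g k)) \<le> ennreal (C * a k powr ?P)" if k: "k \<in> Kset j" for k
      using c(2)[OF k] C(1) by (simp add: gL[OF k] ennreal_mult')
    have \<gamma>: "\<gamma> k \<ge> 0" "Lpow ?P (cv j k (g k)) = ennreal (\<gamma> k)" "\<gamma> k \<le> C * a k powr ?P" if k: "k \<in> Kset j" for k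
    proof -
      show "\<gamma> k \<ge> 0" by (simp add: \<gamma>_def)
      show e: "Lpow ?P (cv j k (g k)) = ennreal (\<gamma> k)" unfolding \<gamma>_def
        using cl[OF k] by (intro ennreal_enn2real[symmetric]) (metis ennreal_less_top infinity_ennreal_def order_le_less_trans)
      show "\<gamma> k \<le> C * a k powr ?P" using cl[OF k] C(1) by (simp add: e)
    qed
    have "\<forall>k\<in>Kset j. g k \<in> borel_measurable borel \<and> (\<exists>B. \<forall>y. cva j k (g k) y \<le> ennreal B) \<and> \<gamma> k \<ge> 0 \<and> Lpow ?P (cv j k (g k)) = ennreal (\<gamma> k)"
      using c(1) \<gamma>(1,2) represents_borel[OF g] by blast
    from C'(2)[OF this] obtain s where s: "s \<ge> 0" "Lpow ?P (\<lambda>x. \<Sum>k\<in>Kset j. cv j k (g k) x) = ennreal s" "s powr (?r / ?P) \<le> C' * (\<Sum>k\<in>Kset j. \<gamma> k powr (?r / ?P))" by blast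
    have rep: "represents (fourier_mult (iso_piece \<psi>0 j) f) (\<lambda>x. \<Sum>k\<in>Kset j. cv j k (g k) x)"
      by (rule iso_represents[OF f g c(1)])
    have d: "dist_Lp p (fourier_mult (iso_piece \<psi>0 j) f) = ennreal (s powr (1 / ?P))"
      unfolding dist_Lp_eq[OF rep] Lp_qnorm_Lpow[OF pinf] s(2) using s(1) by (simp add: epow_ennreal)
    have "(\<Sum>k\<in>Kset j. \<gamma> k powr (?r / ?P)) \<le> (\<Sum>k\<in>Kset j. C powr (?r / ?P) * a k powr ?r)"
    proof (rule sum_mono)
      fix k :: "'n \<Rightarrow> nat" assume k: "k \<in> Kset j"
      have "\<gamma> k powr (?r / ?P) \<le> (C * a k powr ?P) powr (?r / ?P)" using \<gamma>[OF k] P by (intro powr_mono2) auto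
      also have "\<dots> = C powr (?r / ?P) * a k powr ?r" using P by (simp add: powr_mult powr_powr)
      finally show "\<gamma> k powr (?r / ?P) \<le> C powr (?r / ?P) * a k powr ?r" .
    qed
    then have "(s powr (1 / ?P)) powr ?r \<le> C' * (\<Sum>k\<in>Kset j. C powr (?r / ?P) * a k powr ?r)"
      using s(3) mult_left_mono[OF _ C'(1)] order_trans by (simp add: powr_powr) blast
    then have "(s powr (1 / ?P)) powr ?r \<le> C' * C powr (?r / ?P) * (\<Sum>k\<in>Kset j. a k powr ?r)" by (simp add: sum_distrib_left mult.assoc)
    then show "\<exists>D\<ge>0. dist_Lp p (fourier_mult (iso_piece \<psi>0 j) f) \<le> ennreal D \<and> D powr ?r \<le> C' * C powr (?r / ?P) * (\<Sum>k\<in>Kset j. a k powr ?r)"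
      using d by (intro exI[of _ "s powr (1 / ?P)"]) simp
  qed (use C'(1) in auto)
  qed (use P in auto)
qed

text \<open>The kernels are uniformly bounded in L_1, so the triangle inequality gives the exponent
  1.\<close>

lemma piece_ctrl_top: "piece_ctrl \<infinity> 1"
proof -
  obtain W where W: "W \<ge> 0" "\<And>j k. (\<forall>i. k i \<le> Suc j) \<Longrightarrow> (\<integral>\<^sup>+x. ennreal (norm (ker j k x)) \<partial>lborel) \<le> ennreal W" using ker_L1 by blast
  show ?thesis unfolding piece_ctrl_def
  proof (rule conjI, goal_cases)
    case 2 show ?case
  proof (rule exI[of _ W], intro conjI allI impI W(1))
    fix j f and a :: "('n \<Rightarrow> nat) \<Rightarrow> real"
    assume f: "tempered f" and a: "\<forall>k\<in>Kset j. a k \<ge> 0 \<and> dist_Lp \<infinity> (fourier_mult (mixed_piece \<phi>0 k) f) = ennreal (a k)"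
    have "\<exists>g. represents (fourier_mult (mixed_piece \<phi>0 k) f) g" if k: "k \<in> Kset j" for k
      using a k dist_Lp_finite[of \<infinity> _ "a k"] by blast
    then obtain g where g: "\<And>k. k \<in> Kset j \<Longrightarrow> represents (fourier_mult (mixed_piece \<phi>0 k) f) (g k)" by metis
    have cb: "cva j k (g k) y \<le> ennreal (W * a k)" if k: "k \<in> Kset j" for k y
    proof -
      have gk: "AE x in lborel. norm (g k x) \<le> a k"
        using a k dist_Lp_eq[OF g[OF k], of \<infinity>] by (intro Lp_qnorm_top_AE) auto
      have a0: "a k \<ge> 0" using a k by blast
      have [measurable]: "ker j k \<in> borel_measurable borel" by (rule schwartz_borel[OF ker_schwartz])
      have "cva j k (g k) y \<le> (\<integral>\<^sup>+x. ennreal (a k) * ennreal (norm (ker j k (y - x))) \<partial>lborel)" unfolding cva_def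
        by (rule nn_integral_mono_AE, rule AE_mp[OF gk], rule AE_I2) (auto simp: a0 ennreal_mult'[symmetric] mult.commute intro!: ennreal_leI mult_right_mono)
      also have "\<dots> = ennreal (a k) * (\<integral>\<^sup>+x. ennreal (norm (ker j k (y - x))) \<partial>lborel)" by (rule nn_integral_cmult) measurable
      also have "(\<integral>\<^sup>+x. ennreal (norm (ker j k (y - x))) \<partial>lborel) = (\<integral>\<^sup>+x. ennreal (norm (ker j k x)) \<partial>lborel)"
        using nn_integral_lborel_shift(2)[of "\<lambda>x. ennreal (norm (ker j k x))" y] by simp
      also have "ennreal (a k) * \<dots> \<le> ennreal (a k) * ennreal W" using k by (intro mult_left_mono W(2)) (auto simp: Kset_def)
      finally show ?thesis using a0 W(1) by (simp add: ennreal_mult' mult.commute)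
    qed
    have nb: "norm (cv j k (g k) x) \<le> W * a k" if k: "k \<in> Kset j" for k x
      using cv_bounded[OF represents_borel[OF g[OF k]] cb[OF k], of x] a k W(1) by simp
    have rep: "represents (fourier_mult (iso_piece \<psi>0 j) f) (\<lambda>x. \<Sum>k\<in>Kset j. cv j k (g k) x)"
      using cb by (intro iso_represents[OF f g]) auto
    have "norm (\<Sum>k\<in>Kset j. cv j k (g k) x) \<le> W * (\<Sum>k\<in>Kset j. a k)" for x
      unfolding sum_distrib_left using nb by (intro sum_norm_le) auto
    then have "Lp_qnorm \<infinity> (\<lambda>x. \<Sum>k\<in>Kset j. cv j k (g k) x) \<le> ennreal (W * (\<Sum>k\<in>Kset j. a k))"
      unfolding Lp_qnorm_def by (auto intro!: Inf_lower AE_I2 ennreal_leI)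
    moreover have "W * (\<Sum>k\<in>Kset j. a k) \<ge> 0" using W(1) a by (intro mult_nonneg_nonneg sum_nonneg) auto
    moreover have "(\<Sum>k\<in>Kset j. a k powr 1) = (\<Sum>k\<in>Kset j. a k)" using a by (intro sum.cong) auto
    ultimately show "\<exists>D\<ge>0. dist_Lp \<infinity> (fourier_mult (iso_piece \<psi>0 j) f) \<le> ennreal D \<and> D powr 1 \<le> W * (\<Sum>k\<in>Kset j. a k powr 1)"
      unfolding dist_Lp_eq[OF rep] by (intro exI[of _ "W * (\<Sum>k\<in>Kset j. a k)"]) simp
  qed
  qed simp
qed

theorem embeds_sufficient:
  assumes p: "0 < p" and q: "0 < q"
    and c: "t > 0 \<or> (t = 0 \<and> p < \<infinity> \<and> q \<le> min p 2) \<or> (t = 0 \<and> p = \<infinity> \<and> q \<le> 1)"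
  shows "mixed_embeds \<phi>0 \<psi>0 t p q"
proof (cases "p = \<infinity>")
  case True
  then show ?thesis using embeds_of_ctrl[OF piece_ctrl_top q, of t] c by auto
next
  case False
  then have pf: "p < \<infinity>" by (simp add: less_top)
  have "ennreal (min (enn2real p) 2) = min p 2"
    using pf by (cases p rule: ennreal_cases) (auto simp: min_def ennreal_le_iff simp flip: ennreal_numeral)
  then show ?thesis using embeds_of_ctrl[OF piece_ctrl_finite[OF p pf] q, of t] c False by auto
qed

end

section \<open>Necessity\<close>

lemma integral_FT_swap:
  fixes f g :: "real^'n::finite \<Rightarrow> complex"
  assumes f: "integrable lborel f" and g: "integrable lborel g"
  shows "(LINT x|lborel. FT f x * g x) = (LINT x|lborel. f x * FT g x)"
proof -
  have [measurable]: "f \<in> borel_measurable borel" "g \<in> borel_measurable borel" using f g by auto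
  have "(LINT x|lborel. FT f x * g x) = (LINT x|lborel. LINT y|lborel. f y * (cis (- (y \<bullet> x)) * g x))"
    unfolding FT_def
    by (subst integral_mult_left_zero[symmetric]) (simp only: mult.commute[of "cis _" "f _"] mult.assoc)
  also have "\<dots> = (LINT y|lborel. LINT x|lborel. f y * (cis (- (y \<bullet> x)) * g x))"
    by (rule lborel_pair.Fubini_integral, rule integrable_pair_prod[OF f g]) (measurable, simp add: norm_mult)
  also have "\<dots> = (LINT x|lborel. f x * FT g x)"
    unfolding FT_def by (simp only: integral_mult_right_zero inner_commute)
  finally show ?thesis .
qed

lemma integral_iFT_swap:
  fixes f g :: "real^'n::finite \<Rightarrow> complex"
  assumes f: "f \<in> schwartz" and g: "g \<in> schwartz"
  shows "(LINT x|lborel. iFT f x * g x) = (LINT x|lborel. f x * iFT g x)"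
proof -
  have "(LINT x|lborel. FT (iFT f) x * iFT g x) = (LINT x|lborel. iFT f x * FT (iFT g) x)"
    by (intro integral_FT_swap schwartz_integrable iFT_schwartz f g)
  then show ?thesis by (simp add: FT_iFT f g)
qed

lemma tempered_integral:
  fixes u :: "real^'n::finite \<Rightarrow> complex"
  assumes u: "u \<in> schwartz"
  shows "tempered (\<lambda>\<phi>. LINT x|lborel. u x * \<phi> x)"
proof -
  have i: "integrable lborel (\<lambda>x. u x * \<phi> x)" if "\<phi> \<in> schwartz" for \<phi>
    by (intro schwartz_integrable slow_mult_schwartz schwartz_slow u that)
  have ui: "integrable lborel (\<lambda>x. norm (u x))" using schwartz_integrable[OF u] by simp
  have "norm (LINT x|lborel. u x * \<phi> x) \<le> (LINT x|lborel. norm (u x)) * (\<Sum>k\<le>0. \<Sum>is\<in>{is. length is \<le> 0}. schwartz_seminorm k is \<phi>)"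
    if \<phi>: "\<phi> \<in> schwartz" for \<phi>
  proof -
    have b: "norm (\<phi> x) \<le> schwartz_seminorm 0 [] \<phi>" for x
    proof -
      have "bdd_above (range (\<lambda>x. (1 + norm x) ^ 0 * norm (pderivs [] \<phi> x)))" using conjunct2[OF \<phi>[unfolded schwartz_def mem_Collect_eq]] by (elim allE)
      from cSUP_upper[OF UNIV_I this, of x] show ?thesis by (simp add: schwartz_seminorm_def)
    qed
    have "norm (LINT x|lborel. u x * \<phi> x) \<le> (LINT x|lborel. norm (u x * \<phi> x))" by (rule integral_norm_bound)
    also have "\<dots> \<le> (LINT x|lborel. norm (u x) * schwartz_seminorm 0 [] \<phi>)"
      using ui integrable_norm[OF i[OF \<phi>]] b by (intro integral_mono) (auto simp: norm_mult intro!: mult_left_mono)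
    finally show ?thesis by simp
  qed
  then show ?thesis unfolding tempered_def
  proof (intro conjI ballI allI exI[of _ "LINT x|lborel. norm (u x)"] exI[of _ 0])
    show "(LINT x|lborel. u x * (\<phi> x + \<psi> x)) = (LINT x|lborel. u x * \<phi> x) + (LINT x|lborel. u x * \<psi> x)"
      if "\<phi> \<in> schwartz" "\<psi> \<in> schwartz" for \<phi> \<psi>
      using i[OF that(1)] i[OF that(2)] by (simp add: distrib_left)
    show "(LINT x|lborel. u x * (c * \<phi> x)) = c * (LINT x|lborel. u x * \<phi> x)" for c \<phi>
      by (simp only: integral_mult_right_zero mult.left_commute[of "u _" c])
  qed
qed

text \<open>Allows test distributions to be prescribed by their transforms, on which a multiplier
  acts by plain multiplication.\<close>

lemma fourier_mult_represents:
  fixes B B' :: "real^'n::finite \<Rightarrow> complex"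
  assumes B: "B \<in> schwartz" and B': "B' \<in> schwartz" and e: "\<And>\<xi>. complex_of_real (m \<xi>) * B \<xi> = B' \<xi>"
    and m: "\<And>\<phi>. \<phi> \<in> schwartz \<Longrightarrow> (\<lambda>\<xi>. complex_of_real (m \<xi>) * \<phi> \<xi>) \<in> schwartz"
  shows "represents (fourier_mult m (\<lambda>\<phi>. LINT x|lborel. iFT B x * \<phi> x)) (iFT B')"
  unfolding represents_def
proof (intro conjI ballI)
  have s: "iFT B' \<in> schwartz" by (rule iFT_schwartz[OF B'])
  show "iFT B' \<in> borel_measurable lborel" using schwartz_borel[OF s] by simp
  fix \<phi> :: "real^'n \<Rightarrow> complex" assume \<phi>: "\<phi> \<in> schwartz"
  show "integrable lborel (\<lambda>x. iFT B' x * \<phi> x)" by (intro schwartz_integrable slow_mult_schwartz schwartz_slow s \<phi>)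
  let ?h = "\<lambda>\<xi>. complex_of_real (m \<xi>) * iFT \<phi> \<xi>"
  have "fourier_mult m (\<lambda>\<phi>. LINT x|lborel. iFT B x * \<phi> x) \<phi> = (LINT x|lborel. iFT B x * FT ?h x)" by (simp add: fourier_mult_def)
  also have "\<dots> = (LINT x|lborel. FT (iFT B) x * ?h x)"
    by (intro integral_FT_swap[symmetric] schwartz_integrable iFT_schwartz B m \<phi>)
  also have "\<dots> = (LINT x|lborel. B' x * iFT \<phi> x)" unfolding FT_iFT[OF B] e[symmetric] by (simp only: mult.assoc mult.left_commute)
  also have "\<dots> = (LINT x|lborel. iFT B' x * \<phi> x)" by (rule integral_iFT_swap[OF B' \<phi>, symmetric])
  finally show "fourier_mult m (\<lambda>\<phi>. LINT x|lborel. iFT B x * \<phi> x) \<phi> = (LINT x|lborel. iFT B' x * \<phi> x)" .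
qed

lemma schwartz_Lpow_finite:
  fixes \<phi> :: "real^'n::finite \<Rightarrow> complex"
  assumes \<phi>: "\<phi> \<in> schwartz" and p: "p > 0"
  shows "Lpow p \<phi> < \<infinity>"
proof -
  obtain L :: nat where L: "real L \<ge> 2 * CARD('n) / p" using real_arch_simple by blast
  then have Lp: "real L * p \<ge> real (2 * CARD('n))" using p by (simp add: field_simps)
  obtain C where C: "C \<ge> 0" "\<And>x. norm (\<phi> x) \<le> C / (1 + norm x) ^ L" using schwartz_bound[OF \<phi>, of "[]" L] by auto
  let ?h = "\<lambda>x::real^'n. 1 / (1 + norm x) ^ (2 * CARD('n))"
  have hi: "integrable lborel (\<lambda>x. C powr p * ?h x)" by (rule integrable_mult_right) (use integrable_norm_decay[where 'a="real^'n"] in simp)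
  have "norm (\<phi> x) powr p \<le> C powr p * ?h x" for x
  proof -
    let ?N = "1 + norm x"
    have N: "?N \<ge> 1" "?N > 0" by (auto simp: add_pos_nonneg)
    have "norm (\<phi> x) powr p \<le> (C / ?N ^ L) powr p" using C(2)[of x] p by (intro powr_mono2) auto
    also have "\<dots> = C powr p * (1 / ?N powr (real L * p))"
      using powr_realpow[OF N(2), of L] by (simp add: powr_divide powr_powr[symmetric])
    also have "\<dots> \<le> C powr p * ?h x"
    proof (rule mult_left_mono)
      have "?N powr real (2 * CARD('n)) \<le> ?N powr (real L * p)" using N Lp by (intro powr_mono) auto
      then have "?N ^ (2 * CARD('n)) \<le> ?N powr (real L * p)" by (subst (asm) powr_realpow[OF N(2)])
      then show "1 / ?N powr (real L * p) \<le> ?h x" using N by (intro divide_left_mono) auto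
    qed simp
    finally show ?thesis .
  qed
  then have "Lpow p \<phi> \<le> (\<integral>\<^sup>+x. ennreal (C powr p * ?h x) \<partial>lborel)" unfolding Lpow_def by (intro nn_integral_mono ennreal_leI)
  also have "\<dots> = ennreal (LINT x|lborel. C powr p * ?h x)" by (rule nn_integral_eq_integral[OF hi]) auto
  finally show ?thesis by (metis ennreal_less_top infinity_ennreal_def order_le_less_trans)
qed

lemma schwartz_translate: "\<phi> \<in> schwartz \<Longrightarrow> (\<lambda>x::real^'m::finite. \<phi> (x - y)) \<in> schwartz"
  using schwartz_diag_affine[of \<phi> "\<lambda>_. 1" "-y"] by (simp add: diag_affine_def)

context gens
begin

lemma iso_schwartz_mult:
  assumes "\<phi> \<in> schwartz" shows "(\<lambda>\<xi>. complex_of_real (iso_piece \<psi>0 j \<xi>) * \<phi> \<xi>) \<in> schwartz"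
proof (rule slow_mult_schwartz[OF _ assms], rule slow_compact)
  show "smooth_fun (\<lambda>\<xi>::real^'n. complex_of_real (iso_piece \<psi>0 j \<xi>))"
    by (intro pderivs_linear(2)[OF bounded_linear_of_real] smooth_iso_piece)
  show "complex_of_real (iso_piece \<psi>0 j x) = 0" if "norm x > (\<Sum>i\<in>(UNIV::'n set). 3/2 * 2 ^ j)" for x
    using coord_gt_if_norm_gt[OF that] iso_piece_support[of j x] by (metis linorder_not_less of_real_0)
qed

text \<open>The factor 8 confines the support to radius 3/16. This is below 1/8 * 2^m >= 1/4, the
  distance for m >= 1 from 7/8 * 2^m to both 3/4 * 2^m and 2^m.\<close>

definition bump :: "real^'n \<Rightarrow> complex" where
  "bump \<xi> = complex_of_real (\<Prod>i\<in>UNIV. \<phi>0 (8 * \<xi> $ i))"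

lemma bump_support: "bump \<xi> \<noteq> 0 \<Longrightarrow> \<bar>\<xi> $ i\<bar> \<le> 3/16"
  using phi_zero[of "8 * \<xi> $ i"] unfolding bump_def by (force simp: abs_mult)

lemma bump_schwartz: "bump \<in> schwartz"
proof (rule schwartz_compact)
  show "smooth_fun bump" unfolding bump_def[abs_def]
    by (intro pderivs_linear(2)[OF bounded_linear_of_real] smooth_fun_prod smooth_phi_coord) auto
  show "bump x = 0" if "norm x > (\<Sum>i\<in>(UNIV::'n set). 3/16)" for x
    using coord_gt_if_norm_gt[OF that] bump_support[of x] by (metis linorder_not_less)
qed

definition env :: "real^'n \<Rightarrow> complex" where "env = iFT bump"

lemma env_schwartz: "env \<in> schwartz" unfolding env_def by (rule iFT_schwartz[OF bump_schwartz])

lemma env_borel [measurable]: "env \<in> borel_measurable borel" by (rule schwartz_borel[OF env_schwartz])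

lemma env_continuous: "continuous_on UNIV env" by (intro smooth_fun_continuous0 schwartz_smooth env_schwartz)

lemma env_nonzero: "\<exists>x. env x \<noteq> 0"
proof (rule ccontr)
  assume "\<nexists>x. env x \<noteq> 0"
  then have "env = (\<lambda>x. 0)" by auto
  then have "bump = (\<lambda>x. 0)" using FT_iFT[OF bump_schwartz] by (simp add: env_def FT_zero)
  moreover have "bump 0 = 1" by (simp add: bump_def phi_one)
  ultimately show False by (metis zero_neq_one)
qed

text \<open>With the factor 7/8, the cube of radius 3/16 about the frequency meets the support of only one
  mixed piece, and that piece equals 1 on the cube.\<close>
definition freq :: "('n \<Rightarrow> nat) \<Rightarrow> real^'n" where "freq \<kappa> = (\<chi> i. 7/8 * 2 ^ \<kappa> i)"

definition packet :: "('n \<Rightarrow> nat) \<Rightarrow> real^'n \<Rightarrow> real^'n \<Rightarrow> complex" where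
  "packet \<kappa> z x = cis (x \<bullet> freq \<kappa>) * env (x - z)"

text \<open>The phase is chosen so that moving the centre \<open>z\<close> shifts the envelope but
  not the carrier wave.\<close>

definition packet_hat :: "('n \<Rightarrow> nat) \<Rightarrow> real^'n \<Rightarrow> real^'n \<Rightarrow> complex" where
  "packet_hat \<kappa> z \<xi> = cis ((freq \<kappa> - \<xi>) \<bullet> z) * bump (\<xi> - freq \<kappa>)"

lemma packet_hat_schwartz: "packet_hat \<kappa> z \<in> schwartz"
proof -
  have "(\<lambda>\<xi>. cis (freq \<kappa> \<bullet> z) * (cis (\<xi> \<bullet> (- z)) * bump (\<xi> - freq \<kappa>))) \<in> schwartz"
    by (intro schwartz_cmult slow_mult_schwartz[OF slow_cis] schwartz_translate bump_schwartz)
  then show ?thesis unfolding packet_hat_def[abs_def] by (simp add: mult.assoc[symmetric] cis_mult inner_diff_left)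
qed

lemma iFT_packet_hat: "iFT (packet_hat \<kappa> z) = packet \<kappa> z"
proof
  fix x
  have [measurable]: "bump \<in> borel_measurable borel" by (rule schwartz_borel[OF bump_schwartz])
  have "(LINT \<xi>|lborel. cis (x \<bullet> \<xi>) * packet_hat \<kappa> z \<xi>) = (LINT \<xi>|lborel. cis (x \<bullet> (freq \<kappa> + \<xi>)) * packet_hat \<kappa> z (freq \<kappa> + \<xi>))"
    unfolding packet_hat_def by (rule lborel_shift(1)[symmetric]) measurable
  also have "\<dots> = (LINT \<xi>|lborel. cis (x \<bullet> freq \<kappa>) * (cis ((x - z) \<bullet> \<xi>) * bump \<xi>))"
  proof (rule Bochner_Integration.integral_cong[OF refl])
    fix \<xi>
    have "cis (x \<bullet> (freq \<kappa> + \<xi>)) * cis ((freq \<kappa> - (freq \<kappa> + \<xi>)) \<bullet> z) = cis (x \<bullet> freq \<kappa>) * cis ((x - z) \<bullet> \<xi>)"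
      by (simp add: cis_mult inner_diff_left inner_add_right inner_commute[of z] add_diff_eq)
    then show "cis (x \<bullet> (freq \<kappa> + \<xi>)) * packet_hat \<kappa> z (freq \<kappa> + \<xi>) = cis (x \<bullet> freq \<kappa>) * (cis ((x - z) \<bullet> \<xi>) * bump \<xi>)"
      unfolding packet_hat_def by (simp only: mult.assoc[symmetric] add_diff_cancel_left')
  qed
  also have "\<dots> = cis (x \<bullet> freq \<kappa>) * (LINT \<xi>|lborel. cis ((x - z) \<bullet> \<xi>) * bump \<xi>)" by (rule integral_mult_right_zero)
  finally show "iFT (packet_hat \<kappa> z) x = packet \<kappa> z x" unfolding iFT_def packet_def env_def by (simp add: mult.left_commute)
qed

lemma packet_hat_support:
  assumes "packet_hat \<kappa> z \<xi> \<noteq> 0" "\<And>i. 1 \<le> \<kappa> i"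
  shows "3/4 * 2 ^ \<kappa> i < \<xi> $ i" "\<xi> $ i \<le> 2 ^ \<kappa> i"
proof -
  have "bump (\<xi> - freq \<kappa>) \<noteq> 0" using assms(1) by (auto simp: packet_hat_def)
  from bump_support[OF this, of i] have "\<bar>\<xi> $ i - 7/8 * 2 ^ \<kappa> i\<bar> \<le> 3/16" by (simp add: freq_def)
  moreover have "(2::real) ^ 1 \<le> 2 ^ \<kappa> i" by (rule power_increasing) (use assms(2) in auto)
  ultimately have "3/4 * 2 ^ \<kappa> i < \<xi> $ i \<and> \<xi> $ i \<le> 2 ^ \<kappa> i" unfolding abs_le_iff power_one_right by linarith
  then show "3/4 * 2 ^ \<kappa> i < \<xi> $ i" "\<xi> $ i \<le> 2 ^ \<kappa> i" by auto
qed

text \<open>Above 3/4 * 2^m the term \<open>\<phi>0 (2 * s / 2 ^ m)\<close> has already vanished,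
  and up to 2^m the term \<open>\<phi>0 (s / 2 ^ m)\<close> is still 1. All other pieces are then 0
  because the pieces telescope.\<close>

lemma mixed_piece1_band:
  assumes s: "3/4 * 2 ^ m < s" "s \<le> 2 ^ m" and m: "1 \<le> m"
  shows "mixed_piece1 \<phi>0 k s = (if k = m then 1 else 0)"
proof -
  have s0: "s > 0" using s(1) zero_less_power[of "2::real" m] by linarith
  consider "k = m" | "k > m" | "k < m" "k \<ge> 1" | "k = 0" "m \<noteq> 0" using m by linarith
  then show ?thesis
  proof cases
    case 1
    have "\<phi>0 (s / 2 ^ m) = 1" by (rule phi_one) (use s s0 in \<open>simp add: field_simps\<close>)
    moreover have "\<phi>0 (2 * s / 2 ^ m) = 0" by (rule phi_zero) (use s s0 in \<open>simp add: field_simps\<close>)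
    ultimately show ?thesis using 1 m by (simp add: mixed_piece1_def)
  next
    case 2
    then have "(2::real) ^ Suc m \<le> 2 ^ k" by (intro power_increasing) auto
    then have le: "2 * s \<le> 2 ^ k" using s by simp
    have "\<phi>0 (s / 2 ^ k) = 1" by (rule phi_one) (use le s0 in \<open>simp add: field_simps\<close>)
    moreover have "\<phi>0 (2 * s / 2 ^ k) = 1" by (rule phi_one) (use le s0 in \<open>simp add: field_simps\<close>)
    ultimately show ?thesis using 2 by (simp add: mixed_piece1_def)
  next
    case 3
    then have "(2::real) ^ Suc k \<le> 2 ^ m" by (intro power_increasing) auto
    then have le: "3/2 * 2 ^ k < s" using s by simp
    have "\<phi>0 (s / 2 ^ k) = 0" by (rule phi_zero) (use le s0 in \<open>simp add: field_simps\<close>)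
    moreover have "\<phi>0 (2 * s / 2 ^ k) = 0" by (rule phi_zero) (use le s0 in \<open>simp add: field_simps\<close>)
    ultimately show ?thesis using 3 by (simp add: mixed_piece1_def)
  next
    case 4
    \<comment> \<open>Here m >= 1 enters: it puts s beyond 3/2, outside the support of
      \<open>\<phi>0\<close>.\<close>
    have "(2::real) ^ 1 \<le> 2 ^ m" by (rule power_increasing) (use m in auto)
    then have "\<phi>0 s = 0" using s s0 by (intro phi_zero) simp
    then show ?thesis using 4 by (simp add: mixed_piece1_def)
  qed
qed

lemma mixed_piece_packet_hat:
  assumes "\<And>i. 1 \<le> \<kappa> i"
  shows "complex_of_real (mixed_piece \<phi>0 k \<xi>) * packet_hat \<kappa> z \<xi> = (if k = \<kappa> then packet_hat \<kappa> z \<xi> else 0)"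
proof (cases "packet_hat \<kappa> z \<xi> = 0")
  case False
  have "mixed_piece1 \<phi>0 (k i) (\<xi> $ i) = (if k i = \<kappa> i then 1 else 0)" for i
    using mixed_piece1_band[OF packet_hat_support[OF False assms]] assms by simp
  then have e: "mixed_piece \<phi>0 k \<xi> = (\<Prod>i\<in>UNIV. if k i = \<kappa> i then 1 else 0)" by (simp add: mixed_piece_def)
  show ?thesis
  proof (cases "k = \<kappa>")
    case False
    then obtain i where "k i \<noteq> \<kappa> i" by blast
    then have "mixed_piece \<phi>0 k \<xi> = 0" unfolding e by (intro prod_zero) auto
    then show ?thesis using False by simp
  next
    case True
    then show ?thesis unfolding e by simp
  qed
qed simp

lemma iso_piece_packet_hat:
  assumes \<kappa>: "\<And>i. 1 \<le> \<kappa> i" "\<And>i. \<kappa> i \<le> J" "\<kappa> i0 = J"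
  shows "complex_of_real (iso_piece \<psi>0 J \<xi>) * packet_hat \<kappa> z \<xi> = packet_hat \<kappa> z \<xi>"
proof (cases "packet_hat \<kappa> z \<xi> = 0")
  case False
  have J: "J \<noteq> 0" using \<kappa>(1)[of i0] \<kappa>(3) by auto
  have "\<psi>0 ((1 / 2 ^ J) *\<^sub>R \<xi>) = 1"
  proof (rule psi_one)
    fix i
    have "(2::real) ^ \<kappa> i \<le> 2 ^ J" using \<kappa>(2) by (intro power_increasing) auto
    then have "\<xi> $ i \<le> 2 ^ J" "0 < \<xi> $ i" using packet_hat_support[OF False \<kappa>(1), of i] zero_less_power[of "2::real" "\<kappa> i"] by linarith+
    then show "\<bar>((1 / 2 ^ J) *\<^sub>R \<xi>) $ i\<bar> \<le> 1" by simp
  qed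
  moreover have "\<psi>0 ((2 / 2 ^ J) *\<^sub>R \<xi>) = 0"
  proof (rule psi_zero[of _ i0])
    have "3/4 * 2 ^ J < \<xi> $ i0" using packet_hat_support(1)[OF False \<kappa>(1), of i0] \<kappa>(3) by simp
    then have "3/2 \<le> (2 / 2 ^ J) * \<xi> $ i0" by (simp add: field_simps)
    then show "3/2 \<le> \<bar>((2 / 2 ^ J) *\<^sub>R \<xi>) $ i0\<bar>" using abs_ge_self[of "((2 / 2 ^ J) *\<^sub>R \<xi>) $ i0"] by (simp only: vector_scaleR_component real_scaleR_def)
  qed
  ultimately show ?thesis using J by (simp add: iso_piece_def)
qed simp

end

lemma Lp_qnorm_zero: "Lp_qnorm p (\<lambda>x. 0) = 0"
proof (cases "p = \<infinity>")
  case True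
  have "Inf {C. AE x in (lborel::(real^'n::finite) measure). ennreal 0 \<le> C} \<le> 0" by (rule Inf_lower) simp
  then show ?thesis using True by (simp add: Lp_qnorm_def)
qed (simp add: Lp_qnorm_def epow_def)

lemma Lp_qnorm_norm_cong: "(\<And>x. norm (f x) = norm (g x)) \<Longrightarrow> Lp_qnorm p f = Lp_qnorm p g"
  by (simp add: Lp_qnorm_def)

lemma not_power_growth:
  fixes \<alpha> \<beta> \<delta> C :: real
  assumes "\<delta> > 0" "\<beta> < \<alpha>" and le: "\<And>N::nat. N \<ge> 1 \<Longrightarrow> \<delta> * real N powr \<alpha> \<le> C * real N powr \<beta>"
  shows False
proof -
  let ?g = "\<alpha> - \<beta>" and ?M = "\<bar>C\<bar> / \<delta> + 1"
  have M: "?M > 0" using assms(1) by (simp add: add_nonneg_pos)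
  obtain N :: nat where N: "real N \<ge> max 1 (?M powr (1 / ?g))" using real_arch_simple by blast
  then have N1: "N \<ge> 1" and N2: "?M powr (1 / ?g) \<le> real N" by auto
  have "(?M powr (1 / ?g)) powr ?g \<le> real N powr ?g" using N2 assms(2) by (intro powr_mono2) auto
  then have "?M \<le> real N powr ?g" using M assms(2) by (simp add: powr_powr)
  also have "\<dots> = real N powr \<alpha> / real N powr \<beta>" by (rule powr_diff)
  also have "\<dots> \<le> \<bar>C\<bar> / \<delta>"
  proof -
    have "real N powr \<beta> > 0" using N1 by simp
    moreover have "\<delta> * real N powr \<alpha> \<le> \<bar>C\<bar> * real N powr \<beta>" using le[OF N1] by (rule order_trans) (intro mult_right_mono, auto)
    ultimately show ?thesis using assms(1) by (simp add: field_simps)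
  qed
  finally show False by simp
qed

text \<open>The reciprocal \<open>1/q\<close>, including \<open>1/\<infinity> = 0\<close>.\<close>
definition qinv :: "ennreal \<Rightarrow> real" where "qinv q = (if q = \<infinity> then 0 else 1 / enn2real q)"

text \<open>For q = \<infinity> the factor is \<open>real (card K) powr 0\<close>, which is 1 only
  for nonempty \<open>K\<close>.\<close>

lemma lq_qnorm_le:
  assumes q: "q > 0" and K: "finite K" "K \<noteq> {}" and M: "M \<ge> 0"
    and b: "\<And>k. k \<in> K \<Longrightarrow> b k \<le> ennreal M" "\<And>k. k \<notin> K \<Longrightarrow> b k = 0"
  shows "lq_qnorm q b \<le> ennreal (M * real (card K) powr qinv q)"
proof (cases "q = \<infinity>")
  case True
  have "card K > 0" using K by (simp add: card_gt_0_iff)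
  moreover have "b k \<le> ennreal M" for k using b[of k] by (cases "k \<in> K") auto
  ultimately show ?thesis using True by (auto simp: lq_qnorm_def qinv_def intro!: SUP_least)
next
  case False
  let ?Q = "enn2real q"
  have Q: "?Q > 0" using q False by (simp add: enn2real_positive_iff less_top)
  have "(\<integral>\<^sup>+ k. epow (b k) ?Q \<partial>count_space UNIV) \<le> (\<integral>\<^sup>+ k. ennreal (M powr ?Q) * indicator K k \<partial>count_space UNIV)"
  proof (rule nn_integral_mono)
    fix k
    show "epow (b k) ?Q \<le> ennreal (M powr ?Q) * indicator K k"
    proof (cases "k \<in> K")
      case True
      then show ?thesis using epow_mono[OF b(1)[OF True], of ?Q] Q M by (simp add: epow_ennreal)
    qed (simp add: b epow_def)
  qed
  also have "\<dots> = ennreal (M powr ?Q) * of_nat (card K)" using K by (subst nn_integral_cmult) auto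
  also have "\<dots> = ennreal (M powr ?Q * real (card K))" by (simp add: ennreal_mult' ennreal_of_nat_eq_real_of_nat)
  finally have "lq_qnorm q b \<le> epow (ennreal (M powr ?Q * real (card K))) (1 / ?Q)"
    unfolding lq_qnorm_def using False Q by (simp add: epow_mono)
  also have "\<dots> = ennreal (M * real (card K) powr qinv q)"
    using M Q False by (subst epow_ennreal) (auto simp: powr_mult powr_powr qinv_def)
  finally show ?thesis .
qed

lemma qinv_less:
  assumes q: "q > ennreal s" and s: "s > 0" shows "qinv q < 1 / s"
proof (cases "q = \<infinity>")
  case False
  then obtain Q where Q: "Q \<ge> 0" "q = ennreal Q" by (cases q rule: ennreal_cases) auto
  then have "Q > s" using q s by (simp add: ennreal_less_iff)
  then show ?thesis using Q s by (simp add: qinv_def frac_less2)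
qed (use s in \<open>simp add: qinv_def\<close>)

section \<open>Sums of wave packets and their norms\<close>

context gens
begin

definition wave :: "('n \<Rightarrow> nat) set \<Rightarrow> (('n \<Rightarrow> nat) \<Rightarrow> complex) \<Rightarrow> (('n \<Rightarrow> nat) \<Rightarrow> real^'n) \<Rightarrow> real^'n \<Rightarrow> complex" where
  "wave K c z x = (\<Sum>\<kappa>\<in>K. c \<kappa> * packet \<kappa> (z \<kappa>) x)"

definition wave_hat :: "('n \<Rightarrow> nat) set \<Rightarrow> (('n \<Rightarrow> nat) \<Rightarrow> complex) \<Rightarrow> (('n \<Rightarrow> nat) \<Rightarrow> real^'n) \<Rightarrow> real^'n \<Rightarrow> complex" where
  "wave_hat K c z \<xi> = (\<Sum>\<kappa>\<in>K. c \<kappa> * packet_hat \<kappa> (z \<kappa>) \<xi>)"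

lemma wave_hat_schwartz: "finite K \<Longrightarrow> wave_hat K c z \<in> schwartz"
  unfolding wave_hat_def[abs_def] by (intro schwartz_sum schwartz_cmult packet_hat_schwartz)

lemma iFT_wave_hat: assumes "finite K" shows "iFT (wave_hat K c z) = wave K c z"
proof
  fix x
  have i: "integrable lborel (\<lambda>\<xi>. c \<kappa> * (cis (x \<bullet> \<xi>) * packet_hat \<kappa> (z \<kappa>) \<xi>))" for \<kappa>
    by (intro integrable_mult_right integrable_cis_mult schwartz_integrable packet_hat_schwartz)
  have "(LINT \<xi>|lborel. cis (x \<bullet> \<xi>) * wave_hat K c z \<xi>) = (\<Sum>\<kappa>\<in>K. c \<kappa> * (LINT \<xi>|lborel. cis (x \<bullet> \<xi>) * packet_hat \<kappa> (z \<kappa>) \<xi>))"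
    unfolding wave_hat_def sum_distrib_left mult.left_commute[of "cis _"]
    by (subst Bochner_Integration.integral_sum[OF i]) (simp only: integral_mult_right_zero)
  then show "iFT (wave_hat K c z) x = wave K c z x"
    unfolding wave_def iFT_packet_hat[symmetric] unfolding iFT_def by (simp add: sum_distrib_left mult.left_commute)
qed

lemma wave_borel [measurable]: "finite K \<Longrightarrow> wave K c z \<in> borel_measurable borel"
  unfolding iFT_wave_hat[symmetric] by (intro schwartz_borel iFT_schwartz wave_hat_schwartz)

lemma wave_continuous: "finite K \<Longrightarrow> continuous_on UNIV (wave K c z)"
  unfolding iFT_wave_hat[symmetric] by (intro smooth_fun_continuous0 schwartz_smooth iFT_schwartz wave_hat_schwartz)

lemma wave_mixed:
  assumes K: "finite K" "\<And>\<kappa> i. \<kappa> \<in> K \<Longrightarrow> 1 \<le> \<kappa> i"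
  shows "represents (fourier_mult (mixed_piece \<phi>0 k) (\<lambda>\<phi>. LINT x|lborel. wave K c z x * \<phi> x)) (wave (K \<inter> {k}) c z)"
proof -
  have fin: "finite (K \<inter> {k})" by simp
  have "represents (fourier_mult (mixed_piece \<phi>0 k) (\<lambda>\<phi>. LINT x|lborel. iFT (wave_hat K c z) x * \<phi> x)) (iFT (wave_hat (K \<inter> {k}) c z))"
  proof (rule fourier_mult_represents[OF wave_hat_schwartz[OF K(1)] wave_hat_schwartz[OF fin] _ mixed_schwartz_mult])
    fix \<xi>
    have "complex_of_real (mixed_piece \<phi>0 k \<xi>) * wave_hat K c z \<xi> = (\<Sum>\<kappa>\<in>K. c \<kappa> * (complex_of_real (mixed_piece \<phi>0 k \<xi>) * packet_hat \<kappa> (z \<kappa>) \<xi>))"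
      unfolding wave_hat_def sum_distrib_left by (simp only: mult.left_commute)
    also have "\<dots> = (\<Sum>\<kappa>\<in>K. if \<kappa> \<in> {k} then c \<kappa> * packet_hat \<kappa> (z \<kappa>) \<xi> else 0)"
    proof (rule sum.cong[OF refl])
      fix \<kappa> assume "\<kappa> \<in> K"
      then have "\<And>i. 1 \<le> \<kappa> i" by (rule K(2))
      from mixed_piece_packet_hat[of \<kappa> k \<xi> "z \<kappa>", OF this]
      show "c \<kappa> * (complex_of_real (mixed_piece \<phi>0 k \<xi>) * packet_hat \<kappa> (z \<kappa>) \<xi>) = (if \<kappa> \<in> {k} then c \<kappa> * packet_hat \<kappa> (z \<kappa>) \<xi> else 0)"
        by simp
    qed
    also have "\<dots> = wave_hat (K \<inter> {k}) c z \<xi>" unfolding wave_hat_def by (rule sum.inter_restrict[OF K(1), symmetric])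
    finally show "complex_of_real (mixed_piece \<phi>0 k \<xi>) * wave_hat K c z \<xi> = wave_hat (K \<inter> {k}) c z \<xi>" .
  qed
  then show ?thesis by (simp only: iFT_wave_hat[OF K(1)] iFT_wave_hat[OF fin])
qed

lemma wave_iso:
  assumes K: "finite K" "\<And>\<kappa>. \<kappa> \<in> K \<Longrightarrow> (\<forall>i. 1 \<le> \<kappa> i \<and> \<kappa> i \<le> J) \<and> (\<exists>i. \<kappa> i = J)"
  shows "represents (fourier_mult (iso_piece \<psi>0 J) (\<lambda>\<phi>. LINT x|lborel. wave K c z x * \<phi> x)) (wave K c z)"
proof -
  have "represents (fourier_mult (iso_piece \<psi>0 J) (\<lambda>\<phi>. LINT x|lborel. iFT (wave_hat K c z) x * \<phi> x)) (iFT (wave_hat K c z))"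
  proof (rule fourier_mult_represents[OF wave_hat_schwartz[OF K(1)] wave_hat_schwartz[OF K(1)] _ iso_schwartz_mult])
    fix \<xi>
    have "complex_of_real (iso_piece \<psi>0 J \<xi>) * packet_hat \<kappa> (z \<kappa>) \<xi> = packet_hat \<kappa> (z \<kappa>) \<xi>" if "\<kappa> \<in> K" for \<kappa>
      using K(2)[OF that] iso_piece_packet_hat[of \<kappa> J] by blast
    then show "complex_of_real (iso_piece \<psi>0 J \<xi>) * wave_hat K c z \<xi> = wave_hat K c z \<xi>"
      unfolding wave_hat_def sum_distrib_left mult.left_commute[of "complex_of_real _"] by (intro sum.cong) auto
  qed
  then show ?thesis by (simp only: iFT_wave_hat[OF K(1)])
qed

lemma norm_packet: "norm (packet \<kappa> z x) = norm (env (x - z))" by (simp add: packet_def norm_mult)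

lemma env_Lp_finite: "p > 0 \<Longrightarrow> \<exists>h\<ge>0. \<forall>\<kappa> z c. norm c = 1 \<longrightarrow> Lp_qnorm p (\<lambda>x. c * packet \<kappa> z x) \<le> ennreal h"
proof (cases "p = \<infinity>")
  case True
  obtain h where h: "h \<ge> 0" "\<And>x. norm (env x) \<le> h" using schwartz_bound[OF env_schwartz, of "[]" 0] by auto
  show ?thesis using True h by (intro exI[of _ h]) (auto simp: Lp_qnorm_def norm_mult norm_packet intro!: Inf_lower AE_I2 ennreal_leI)
next
  case False
  assume "p > 0"
  then have P: "enn2real p > 0" using False by (simp add: enn2real_positive_iff less_top)
  obtain h where h: "h \<ge> 0" "Lpow (enn2real p) env = ennreal h"
    using schwartz_Lpow_finite[OF env_schwartz P] by (cases "Lpow (enn2real p) env" rule: ennreal_cases) auto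
  have "Lp_qnorm p (\<lambda>x. c * packet \<kappa> z x) \<le> ennreal (h powr (1 / enn2real p))" if "norm c = 1" for c \<kappa> z
  proof -
    have "Lpow (enn2real p) (\<lambda>x. c * packet \<kappa> z x) = Lpow (enn2real p) (\<lambda>x. env (x - z))" by (simp add: Lpow_def norm_mult norm_packet that)
    also have "\<dots> = Lpow (enn2real p) env"
      using nn_integral_lborel_shift(3)[of "\<lambda>x. ennreal (norm (env x) powr enn2real p)" z] by (simp add: Lpow_def)
    finally show ?thesis using False h by (simp add: Lp_qnorm_Lpow epow_ennreal)
  qed
  then show ?thesis by (intro exI[of _ "h powr (1 / enn2real p)"]) simp
qed

text \<open>Each mixed piece of the wave is a single packet, of norm at most \<open>h\<close>
  wherever it sits and whatever its unimodular coefficient, while the isotropic piece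
  \<open>J\<close> is the whole wave. \<open>S\<close> bounds the mixed weights, so the mixed norm
  of N packets is at most S h N^(1/q).\<close>

lemma wave_estimate:
  assumes e: "mixed_embeds \<phi>0 \<psi>0 t p q" and p: "p > 0" and q: "q > 0"
  shows "\<exists>C\<ge>0. \<forall>J K c z S. finite K \<longrightarrow> K \<noteq> {} \<longrightarrow> S \<ge> 0 \<longrightarrow>
    (\<forall>\<kappa>\<in>K. (\<forall>i. 1 \<le> \<kappa> i \<and> \<kappa> i \<le> J) \<and> (\<exists>i. \<kappa> i = J) \<and> norm (c \<kappa>) = 1 \<and> 2 powr (real (\<Sum>i\<in>UNIV. \<kappa> i) * t) \<le> S) \<longrightarrow>
    ennreal (2 powr (real J * t)) * Lp_qnorm p (wave K c z) \<le> ennreal (C * S * real (card K) powr qinv q)"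
proof -
  obtain C :: real where C: "\<And>f :: (real^'n \<Rightarrow> complex) \<Rightarrow> complex. f \<in> mixed_besov_space \<phi>0 t p q \<Longrightarrow> besov_qnorm \<psi>0 t p q f \<le> ennreal C * mixed_besov_qnorm \<phi>0 t p q f"
    using e unfolding mixed_embeds_def by blast
  obtain h where h: "h \<ge> 0" "\<And>\<kappa> z c. norm c = 1 \<Longrightarrow> Lp_qnorm p (\<lambda>x. c * packet \<kappa> z x) \<le> ennreal h" using env_Lp_finite[OF p] by blast
  have "ennreal (2 powr (real J * t)) * Lp_qnorm p (wave K c z) \<le> ennreal (max C 0 * h * S * real (card K) powr qinv q)"
    if K: "finite K" "K \<noteq> {}" and S: "S \<ge> 0"
      and k: "\<forall>\<kappa>\<in>K. (\<forall>i. 1 \<le> \<kappa> i \<and> \<kappa> i \<le> J) \<and> (\<exists>i. \<kappa> i = J) \<and> norm (c \<kappa>) = 1 \<and> 2 powr (real (\<Sum>i\<in>UNIV. \<kappa> i) * t) \<le> S" for J K c z S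
  proof -
    let ?f = "\<lambda>\<phi>. LINT x|lborel. wave K c z x * \<phi> x"
    have tf: "tempered ?f" unfolding iFT_wave_hat[OF K(1), symmetric] by (intro tempered_integral iFT_schwartz wave_hat_schwartz K)
    have d: "dist_Lp p (fourier_mult (mixed_piece \<phi>0 k) ?f) = Lp_qnorm p (wave (K \<inter> {k}) c z)" for k
      by (rule dist_Lp_eq[OF wave_mixed[OF K(1)]]) (use k in blast)
    have m: "mixed_besov_qnorm \<phi>0 t p q ?f \<le> ennreal (S * h * real (card K) powr qinv q)"
      unfolding mixed_besov_qnorm_def
    proof (rule lq_qnorm_le[OF q K])
      fix \<kappa> assume \<kappa>: "\<kappa> \<in> K"
      then have "wave (K \<inter> {\<kappa>}) c z = (\<lambda>x. c \<kappa> * packet \<kappa> (z \<kappa>) x)" by (simp add: wave_def[abs_def])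
      then have "dist_Lp p (fourier_mult (mixed_piece \<phi>0 \<kappa>) ?f) \<le> ennreal h" unfolding d using k \<kappa> h(2) by simp
      moreover have "ennreal (2 powr (real (\<Sum>i\<in>UNIV. \<kappa> i) * t)) \<le> ennreal S" using k \<kappa> by (intro ennreal_leI) blast
      ultimately show "ennreal (2 powr (real (\<Sum>i\<in>UNIV. \<kappa> i) * t)) * dist_Lp p (fourier_mult (mixed_piece \<phi>0 \<kappa>) ?f) \<le> ennreal (S * h)"
        using S h(1) by (simp add: ennreal_mult' mult_mono)
    next
      fix k assume "k \<notin> K"
      then have "wave (K \<inter> {k}) c z = (\<lambda>x. 0)" by (simp add: wave_def[abs_def])
      then show "ennreal (2 powr (real (\<Sum>i\<in>UNIV. k i) * t)) * dist_Lp p (fourier_mult (mixed_piece \<phi>0 k) ?f) = 0" unfolding d by (simp add: Lp_qnorm_zero)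
    qed (use S h in simp)
    then have fm: "?f \<in> mixed_besov_space \<phi>0 t p q" unfolding mixed_besov_space_def using tf
      by (simp add: order_le_less_trans[OF _ ennreal_less_top])
    have "dist_Lp p (fourier_mult (iso_piece \<psi>0 J) ?f) = Lp_qnorm p (wave K c z)"
      by (rule dist_Lp_eq[OF wave_iso[OF K(1)]]) (use k in blast)
    then have "ennreal (2 powr (real J * t)) * Lp_qnorm p (wave K c z) \<le> besov_qnorm \<psi>0 t p q ?f"
      unfolding besov_qnorm_def using lq_qnorm_ge[OF q, of "\<lambda>j. ennreal (2 powr (real j * t)) * dist_Lp p (fourier_mult (iso_piece \<psi>0 j) ?f)" J] by simp
    also have "\<dots> \<le> ennreal C * mixed_besov_qnorm \<phi>0 t p q ?f" by (rule C[OF fm])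
    also have "\<dots> \<le> ennreal (max C 0) * ennreal (S * h * real (card K) powr qinv q)" by (intro mult_mono m ennreal_leI) auto
    also have "\<dots> = ennreal (max C 0 * (S * h * real (card K) powr qinv q))" by (rule ennreal_mult'[symmetric]) simp
    also have "max C 0 * (S * h * real (card K) powr qinv q) = max C 0 * h * S * real (card K) powr qinv q" by simp
    finally show ?thesis .
  qed
  moreover have "max C 0 * h \<ge> 0" using h(1) by simp
  ultimately show ?thesis by blast
qed

lemma env_Lp_pos:
  assumes p: "p > 0" shows "Lp_qnorm p env > 0"
proof (rule ccontr)
  assume "\<not> Lp_qnorm p env > 0"
  then have z: "Lp_qnorm p env = 0" by simp
  have "AE x in lborel. env x = 0"
  proof (cases "p = \<infinity>")
    case True
    then show ?thesis using Lp_qnorm_top_AE[of env 0] z by simp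
  next
    case False
    then have P: "enn2real p > 0" using p by (simp add: enn2real_positive_iff less_top)
    have "Lpow (enn2real p) env = ennreal (0 powr enn2real p)" by (rule epow_root_eq[OF _ P]) (use z False in \<open>simp_all add: Lp_qnorm_Lpow\<close>)
    then have "(\<integral>\<^sup>+x. ennreal (norm (env x) powr enn2real p) \<partial>lborel) = 0" by (simp add: Lpow_def)
    then have "AE x in lborel. ennreal (norm (env x) powr enn2real p) = 0" by (subst (asm) nn_integral_0_iff_AE) auto
    then show ?thesis by (rule AE_mp) (auto intro!: AE_I2)
  qed
  then have "env = (\<lambda>x. 0)" by (intro AE_eq_continuous env_continuous) auto
  then show False using env_nonzero by simp
qed

text \<open>For the index (J, ..., J) the mixed weight is 2^(d J t), at most 2^(2 J t) as t < 0 and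
  d >= 2, whereas the isotropic weight is 2^(J t). The embedding would bound a fixed positive number
  by C 2^(J t), which tends to 0.\<close>

lemma embeds_imp_nonneg:
  assumes e: "mixed_embeds \<phi>0 \<psi>0 t p q" and p: "p > 0" and q: "q > 0" and n: "CARD('n) \<ge> 2"
  shows "t \<ge> 0"
proof (rule ccontr)
  assume "\<not> t \<ge> 0"
  then have t: "t < 0" by simp
  obtain C where C: "C \<ge> 0" "\<And>J K c z S. finite K \<Longrightarrow> K \<noteq> {} \<Longrightarrow> S \<ge> 0 \<Longrightarrow>
    (\<forall>\<kappa>\<in>K. (\<forall>i. 1 \<le> \<kappa> i \<and> \<kappa> i \<le> J) \<and> (\<exists>i. \<kappa> i = J) \<and> norm (c \<kappa>) = 1 \<and> 2 powr (real (\<Sum>i\<in>UNIV. \<kappa> i) * t) \<le> S) \<Longrightarrow>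
    ennreal (2 powr (real J * t)) * Lp_qnorm p (wave K c z) \<le> ennreal (C * S * real (card K) powr qinv q)"
    using wave_estimate[OF e p q] by blast
  have "Lp_qnorm p env \<noteq> 0" using env_Lp_pos[OF p] by simp
  then obtain h where h: "h > 0" "ennreal h \<le> Lp_qnorm p env"
  proof (cases "Lp_qnorm p env" rule: ennreal_cases)
    case (real r)
    then show ?thesis using that[of r] \<open>Lp_qnorm p env \<noteq> 0\<close> by (cases "r = 0") auto
  qed (use that[of 1] in auto)
  have bd: "h \<le> C * 2 powr (real J * t)" if J: "J \<ge> 1" for J :: nat
  proof -
    let ?\<kappa> = "\<lambda>_::'n. J"
    have w: "Lp_qnorm p (wave {?\<kappa>} (\<lambda>_. 1) (\<lambda>_. 0)) = Lp_qnorm p env"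
      by (rule Lp_qnorm_norm_cong) (simp add: wave_def norm_packet)
    have "ennreal (2 powr (real J * t) * h) \<le> ennreal (2 powr (real J * t)) * Lp_qnorm p env"
      using h(2) by (subst ennreal_mult') (auto intro: mult_left_mono)
    also have "\<dots> \<le> ennreal (C * 2 powr (real (\<Sum>i\<in>(UNIV::'n set). J) * t) * real (card {?\<kappa>}) powr qinv q)"
      unfolding w[symmetric] using J by (intro C(2)) auto
    finally have "2 powr (real J * t) * h \<le> C * 2 powr (real CARD('n) * real J * t)" using C(1) by simp
    also have "\<dots> \<le> C * 2 powr (2 * real J * t)"
    proof (intro mult_left_mono powr_mono C(1))
      have "2 * real J \<le> real CARD('n) * real J" using n by (intro mult_right_mono) auto
      then show "real CARD('n) * real J * t \<le> 2 * real J * t" by (rule mult_right_mono_neg) (use t in simp)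
    qed simp
    also have "\<dots> = 2 powr (real J * t) * (C * 2 powr (real J * t))" by (simp add: powr_add[symmetric] mult_ac)
    finally show ?thesis by simp
  qed
  have "(\<lambda>J. C * (2 powr t) ^ J) \<longlonglongrightarrow> C * 0"
    using t powr_less_mono[of t 0 2] by (intro tendsto_intros LIMSEQ_power_zero) simp
  moreover have "(2 powr t) ^ J = 2 powr (real J * t)" for J by (simp add: powr_realpow[symmetric] powr_powr mult.commute)
  ultimately have "(\<lambda>J. C * 2 powr (real J * t)) \<longlonglongrightarrow> 0" by simp
  then have "h \<le> 0" using bd by (intro LIMSEQ_le_const) (auto intro!: exI[of _ 1])
  then show False using h(1) by simp
qed

text \<open>Here d >= 2 yields arbitrarily many mixed pieces in one isotropic piece: one index is
  fixed at N + 1, and the others share a common value l = 1, ..., N. \<open>K\<close> is chosen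
  before \<open>c\<close> and \<open>z\<close>, which leaves coefficients and centres free for the
  three tests.\<close>

lemma wave_estimate_zero:
  assumes e: "mixed_embeds \<phi>0 \<psi>0 0 p q" and p: "p > 0" and q: "q > 0" and n: "CARD('n) \<ge> 2"
  shows "\<exists>C\<ge>0. \<forall>N\<ge>1. \<exists>K. finite K \<and> card K = N \<and> (\<forall>c z. (\<forall>\<kappa>\<in>K. norm (c \<kappa>) = 1) \<longrightarrow> Lp_qnorm p (wave K c z) \<le> ennreal (C * real N powr qinv q))"
proof -
  obtain C where C: "C \<ge> 0" "\<And>J K c z S. finite K \<Longrightarrow> K \<noteq> {} \<Longrightarrow> S \<ge> 0 \<Longrightarrow>
    (\<forall>\<kappa>\<in>K. (\<forall>i. 1 \<le> \<kappa> i \<and> \<kappa> i \<le> J) \<and> (\<exists>i. \<kappa> i = J) \<and> norm (c \<kappa>) = 1 \<and> 2 powr (real (\<Sum>i\<in>UNIV. \<kappa> i) * 0) \<le> S) \<Longrightarrow>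
    ennreal (2 powr (real J * 0)) * Lp_qnorm p (wave K c z) \<le> ennreal (C * S * real (card K) powr qinv q)"
    using wave_estimate[OF e p q] by blast
  obtain i0 :: 'n where True by simp
  have "UNIV \<noteq> {i0}" using n by (metis card_1_singleton_iff One_nat_def Suc_1 not_less_eq_eq order_refl)
  then obtain i1 where i1: "i1 \<noteq> i0" by blast
  show ?thesis
  proof (rule exI[of _ C], intro conjI C(1) allI impI)
    fix N :: nat assume N: "N \<ge> 1"
    let ?\<kappa> = "\<lambda>l i. if i = i0 then Suc N else l"
    have inj: "inj_on ?\<kappa> {1..N}"
    proof (rule inj_onI)
      fix a b assume "?\<kappa> a = ?\<kappa> b"
      from fun_cong[OF this, of i1] show "a = b" using i1 by simp
    qed
    have card: "card (?\<kappa> ` {1..N}) = N" using card_image[OF inj] by simp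
    show "\<exists>K. finite K \<and> card K = N \<and> (\<forall>c z. (\<forall>\<kappa>\<in>K. norm (c \<kappa>) = 1) \<longrightarrow> Lp_qnorm p (wave K c z) \<le> ennreal (C * real N powr qinv q))"
    proof (rule exI[of _ "?\<kappa> ` {1..N}"], intro conjI card allI impI)
      fix c :: "('n \<Rightarrow> nat) \<Rightarrow> complex" and z assume c: "\<forall>\<kappa>\<in>?\<kappa> ` {1..N}. norm (c \<kappa>) = 1"
      have "ennreal (2 powr (real (Suc N) * 0)) * Lp_qnorm p (wave (?\<kappa> ` {1..N}) c z) \<le> ennreal (C * 1 * real (card (?\<kappa> ` {1..N})) powr qinv q)"
      proof (rule C(2))
        show "\<forall>\<kappa>\<in>?\<kappa> ` {1..N}. (\<forall>i. 1 \<le> \<kappa> i \<and> \<kappa> i \<le> Suc N) \<and> (\<exists>i. \<kappa> i = Suc N) \<and> norm (c \<kappa>) = 1 \<and> 2 powr (real (\<Sum>i\<in>UNIV. \<kappa> i) * 0) \<le> 1"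
          using c by auto
      qed (use N in auto)
      then show "Lp_qnorm p (wave (?\<kappa> ` {1..N}) c z) \<le> ennreal (C * real N powr qinv q)" unfolding card by simp
    qed simp
  qed
qed

end

text \<open>Signs are coded by the set \<open>A\<close> of positive ones. Each new summand is
  averaged out by the parallelogram law; \<open>w\<close> carries the part of the sum whose signs
  are already fixed.\<close>

lemma sign_second_moment:
  fixes a :: "'k \<Rightarrow> complex"
  assumes "finite K"
  shows "(\<Sum>A\<in>Pow K. (norm (w + (\<Sum>\<kappa>\<in>K. (if \<kappa> \<in> A then 1 else - 1) * a \<kappa>)))\<^sup>2) = 2 ^ card K * ((norm w)\<^sup>2 + (\<Sum>\<kappa>\<in>K. (norm (a \<kappa>))\<^sup>2))"
  using assms
proof (induction arbitrary: w rule: finite_induct)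
  case (insert k K)
  let ?S = "\<lambda>K A. \<Sum>\<kappa>\<in>K. (if \<kappa> \<in> A then 1 else - 1) * a \<kappa>"
  let ?f = "\<lambda>A. (norm (w + ?S (insert k K) A))\<^sup>2"
  have 1: "?f A = (norm ((w - a k) + ?S K A))\<^sup>2" if "A \<in> Pow K" for A
    using that insert.hyps by (auto simp: algebra_simps)
  have 2: "?f (insert k A) = (norm ((w + a k) + ?S K A))\<^sup>2" if "A \<in> Pow K" for A
  proof -
    have "?S K (insert k A) = ?S K A" using insert.hyps by (intro sum.cong) auto
    then show ?thesis using insert.hyps by (simp add: add.assoc)
  qed
  have inj: "inj_on (insert k) (Pow K)" using insert.hyps by (auto simp: inj_on_def)
  have "(\<Sum>A\<in>Pow (insert k K). ?f A) = (\<Sum>A\<in>Pow K. ?f A) + (\<Sum>A\<in>insert k ` Pow K. ?f A)"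
    unfolding Pow_insert using insert.hyps by (intro sum.union_disjoint) auto
  also have "(\<Sum>A\<in>insert k ` Pow K. ?f A) = (\<Sum>A\<in>Pow K. ?f (insert k A))" by (subst sum.reindex[OF inj]) simp
  also have "(\<Sum>A\<in>Pow K. ?f A) = 2 ^ card K * ((norm (w - a k))\<^sup>2 + (\<Sum>\<kappa>\<in>K. (norm (a \<kappa>))\<^sup>2))"
    unfolding insert.IH[symmetric] by (rule sum.cong[OF refl 1])
  also have "(\<Sum>A\<in>Pow K. ?f (insert k A)) = 2 ^ card K * ((norm (w + a k))\<^sup>2 + (\<Sum>\<kappa>\<in>K. (norm (a \<kappa>))\<^sup>2))"
    unfolding insert.IH[symmetric] by (rule sum.cong[OF refl 2])
  finally have "(\<Sum>A\<in>Pow (insert k K). ?f A) = 2 ^ card K * ((norm (w - a k))\<^sup>2 + (norm (w + a k))\<^sup>2 + 2 * (\<Sum>\<kappa>\<in>K. (norm (a \<kappa>))\<^sup>2))"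
    by (simp add: algebra_simps)
  also have "(norm (w - a k))\<^sup>2 + (norm (w + a k))\<^sup>2 = 2 * (norm w)\<^sup>2 + 2 * (norm (a k))\<^sup>2"
    unfolding cmod_power2 by (simp add: power2_eq_square algebra_simps)
  finally show ?case using insert.hyps by (simp add: algebra_simps)
qed simp

text \<open>Truncation at level \<open>s\<close>: a square above \<open>s\<close> is paid for by the
  P-th power. Summing this inequality turns second moments into lower bounds for P-th
  moments.\<close>

lemma square_le_powr:
  fixes y s P :: real
  assumes y: "y \<ge> 0" and s: "s > 0" and P: "P \<ge> 2"
  shows "y\<^sup>2 \<le> s + y powr P * s powr (1 - P / 2)"
proof (cases "y\<^sup>2 \<le> s")
  case True
  then show ?thesis by (simp add: add_increasing2)
next
  case False
  then have y2: "y\<^sup>2 > s" by simp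
  then have yp: "y > 0" using s y by (cases "y = 0") auto
  have "y\<^sup>2 = y powr 2" using yp by simp
  then have e: "(y\<^sup>2) powr (P / 2) = y powr P" by (simp only: powr_powr) simp
  have "y\<^sup>2 = (y\<^sup>2) powr (P / 2) * (y\<^sup>2) powr (1 - P / 2)" using y2 s by (simp add: powr_add[symmetric])
  also have "\<dots> \<le> (y\<^sup>2) powr (P / 2) * s powr (1 - P / 2)" using y2 s P by (intro mult_left_mono powr_mono2') auto
  finally have "y\<^sup>2 \<le> y powr P * s powr (1 - P / 2)" unfolding e .
  then show ?thesis using s by simp
qed

text \<open>Lower Khinchin inequality for P >= 2. The truncation level is half the mean square, so
  half of the second moment remains after the small values are discarded.\<close>

lemma sign_moment_ge:
  fixes a :: "'k \<Rightarrow> complex"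
  assumes K: "finite K" "K \<noteq> {}" and a: "\<And>\<kappa>. \<kappa> \<in> K \<Longrightarrow> norm (a \<kappa>) = 1" and P: "P \<ge> 2"
  shows "2 ^ card K * (real (card K) / 2) powr (P / 2) \<le> (\<Sum>A\<in>Pow K. norm (\<Sum>\<kappa>\<in>K. (if \<kappa> \<in> A then 1 else - 1) * a \<kappa>) powr P)"
proof -
  let ?s = "real (card K) / 2" and ?y = "\<lambda>A. norm (\<Sum>\<kappa>\<in>K. (if \<kappa> \<in> A then 1 else - 1) * a \<kappa>)"
  have s: "?s > 0" using K by (simp add: card_gt_0_iff)
  have "2 ^ card K * real (card K) = (\<Sum>A\<in>Pow K. (?y A)\<^sup>2)"
    using sign_second_moment[OF K(1), of 0 a] a by simp
  also have "\<dots> \<le> (\<Sum>A\<in>Pow K. ?s + ?y A powr P * ?s powr (1 - P / 2))" by (intro sum_mono square_le_powr s P) simp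
  also have "\<dots> = 2 ^ card K * ?s + (\<Sum>A\<in>Pow K. ?y A powr P) * ?s powr (1 - P / 2)"
    using K(1) by (simp add: sum.distrib card_Pow sum_distrib_right)
  finally have "2 ^ card K * ?s \<le> (\<Sum>A\<in>Pow K. ?y A powr P) * ?s powr (1 - P / 2)" by simp
  from mult_right_mono[OF this, of "?s powr (P / 2 - 1)"]
  have "2 ^ card K * (?s * ?s powr (P / 2 - 1)) \<le> (\<Sum>A\<in>Pow K. ?y A powr P) * (?s powr (1 - P / 2) * ?s powr (P / 2 - 1))" by (simp only: mult.assoc powr_ge_zero)
  moreover have "?s powr (1 - P / 2) * ?s powr (P / 2 - 1) = 1" using s by (simp add: powr_add[symmetric])
  moreover have "?s * ?s powr (P / 2 - 1) = ?s powr (P / 2)" using s powr_mult_base[of ?s "P / 2 - 1"] by simp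
  ultimately show ?thesis by simp
qed

text \<open>For a continuous function the exceptional null set is empty, since the bound holds on a
  closed set of full measure.\<close>

lemma Lp_qnorm_top_continuous:
  fixes u :: "real^'m::finite \<Rightarrow> complex"
  assumes u: "continuous_on UNIV u" and le: "Lp_qnorm \<infinity> u \<le> ennreal M" and M: "M \<ge> 0"
  shows "norm (u x) \<le> M"
proof -
  obtain a where a: "a \<ge> 0" "Lp_qnorm \<infinity> u = ennreal a" "a \<le> M"
    using le M by (cases "Lp_qnorm \<infinity> u" rule: ennreal_cases) (auto simp: top_unique)
  have "closed {x. norm (u x) \<le> a}" using u by (intro closed_Collect_le continuous_intros) auto
  moreover have "AE x\<in>UNIV in lebesgue. x \<in> {x. norm (u x) \<le> a}"
    using Lp_qnorm_top_AE[OF a(2,1)] by (intro AE_completion) auto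
  ultimately have "x \<in> {x. norm (u x) \<le> a}" using mem_closed_if_AE_lebesgue_open[of UNIV "{x. norm (u x) \<le> a}" x] by auto
  then show ?thesis using a(3) by simp
qed

lemma Lpow_le_of_Lp_qnorm:
  assumes p: "p > 0" "p \<noteq> \<infinity>" and le: "Lp_qnorm p u \<le> ennreal M" and M: "M \<ge> 0"
  shows "Lpow (enn2real p) u \<le> ennreal (M powr enn2real p)"
proof -
  have P: "enn2real p > 0" using p by (simp add: enn2real_positive_iff less_top)
  obtain a where a: "a \<ge> 0" "Lp_qnorm p u = ennreal a" "a \<le> M"
    using le M by (cases "Lp_qnorm p u" rule: ennreal_cases) (auto simp: top_unique)
  have "Lpow (enn2real p) u = ennreal (a powr enn2real p)"
    by (rule epow_root_eq[OF _ P a(1)]) (use a(2) p in \<open>simp add: Lp_qnorm_Lpow\<close>)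
  then show ?thesis using a P by (auto intro!: ennreal_leI powr_mono2)
qed

section \<open>Tests that force the conditions on q\<close>

context gens
begin

lemma embeds_top_imp:
  assumes e: "mixed_embeds \<phi>0 \<psi>0 0 \<infinity> q" and q: "q > 0" and n: "CARD('n) \<ge> 2"
  shows "q \<le> 1"
proof (rule ccontr)
  assume "\<not> q \<le> 1"
  then have q1: "qinv q < 1" using qinv_less[of 1 q] by simp
  obtain C where C: "C \<ge> 0" "\<And>N. N \<ge> 1 \<Longrightarrow> \<exists>K. finite K \<and> card K = N \<and> (\<forall>c z. (\<forall>\<kappa>\<in>K. norm (c \<kappa>) = 1) \<longrightarrow> Lp_qnorm \<infinity> (wave K c z) \<le> ennreal (C * real N powr qinv q))"
    using wave_estimate_zero[OF e _ q n] by auto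
  obtain x0 where x0: "env x0 \<noteq> 0" using env_nonzero by blast
  have "norm (env x0) * real N powr 1 \<le> C * real N powr qinv q" if N: "N \<ge> 1" for N
  proof -
    \<comment> \<open>The coefficients undo the carrier phases at \<open>x0\<close>, so that all
      packets add up there.\<close>
    let ?c = "\<lambda>\<kappa>. cis (- (x0 \<bullet> freq \<kappa>))"
    obtain K where K: "finite K" "card K = N" "\<And>c z. (\<forall>\<kappa>\<in>K. norm (c \<kappa>) = 1) \<Longrightarrow> Lp_qnorm \<infinity> (wave K c z) \<le> ennreal (C * real N powr qinv q)"
      using C(2)[OF N] by blast
    have "norm (wave K ?c (\<lambda>_. 0) x0) \<le> C * real N powr qinv q"
      by (intro Lp_qnorm_top_continuous wave_continuous K) (use C(1) in auto)
    moreover have "wave K ?c (\<lambda>_. 0) x0 = of_nat N * env x0"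
      using K(2) by (simp add: wave_def packet_def mult.assoc[symmetric] cis_mult)
    ultimately show ?thesis by (simp add: norm_mult mult.commute)
  qed
  then show False using not_power_growth[of "norm (env x0)" "qinv q" 1 C] x0 q1 by simp
qed

text \<open>All packets share the centre 0, so the envelope factors out and the sign average acts on
  the unimodular carriers at each point.\<close>

lemma wave_signs_Lpow:
  assumes K: "finite K" "K \<noteq> {}" and P: "P \<ge> 2"
  shows "ennreal (2 ^ card K * (real (card K) / 2) powr (P / 2)) * Lpow P env
    \<le> (\<Sum>A\<in>Pow K. Lpow P (wave K (\<lambda>\<kappa>. if \<kappa> \<in> A then 1 else - 1) (\<lambda>_. 0)))"
proof -
  let ?c = "\<lambda>A (\<kappa>::'n \<Rightarrow> nat). if \<kappa> \<in> A then 1 else - 1 :: complex"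
  let ?b = "2 ^ card K * (real (card K) / 2) powr (P / 2)"
  have "ennreal ?b * Lpow P env = (\<integral>\<^sup>+x. ennreal ?b * ennreal (norm (env x) powr P) \<partial>lborel)"
    unfolding Lpow_def by (rule nn_integral_cmult[symmetric]) measurable
  also have "\<dots> \<le> (\<integral>\<^sup>+x. (\<Sum>A\<in>Pow K. ennreal (norm (wave K (?c A) (\<lambda>_. 0) x) powr P)) \<partial>lborel)"
  proof (rule nn_integral_mono)
    fix x
    have w: "wave K (?c A) (\<lambda>_. 0) x = (\<Sum>\<kappa>\<in>K. ?c A \<kappa> * cis (x \<bullet> freq \<kappa>)) * env x" for A
      unfolding wave_def packet_def sum_distrib_right by (simp add: mult.assoc)
    have "?b * norm (env x) powr P \<le> (\<Sum>A\<in>Pow K. norm (\<Sum>\<kappa>\<in>K. ?c A \<kappa> * cis (x \<bullet> freq \<kappa>)) powr P) * norm (env x) powr P"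
      by (intro mult_right_mono sign_moment_ge K P) auto
    also have "\<dots> = (\<Sum>A\<in>Pow K. norm (wave K (?c A) (\<lambda>_. 0) x) powr P)"
      unfolding sum_distrib_right by (rule sum.cong[OF refl]) (simp only: w norm_mult powr_mult)
    finally show "ennreal ?b * ennreal (norm (env x) powr P) \<le> (\<Sum>A\<in>Pow K. ennreal (norm (wave K (?c A) (\<lambda>_. 0) x) powr P))"
      by (simp add: ennreal_mult'[symmetric] sum_ennreal ennreal_leI)
  qed
  also have "\<dots> = (\<Sum>A\<in>Pow K. Lpow P (wave K (?c A) (\<lambda>_. 0)))" unfolding Lpow_def using K(1)
    by (intro nn_integral_sum) measurable
  finally show ?thesis .
qed

lemma embeds_imp_le_2:
  assumes e: "mixed_embeds \<phi>0 \<psi>0 0 p q" and p: "2 \<le> p" "p \<noteq> \<infinity>" and q: "q > 0" and n: "CARD('n) \<ge> 2"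
  shows "q \<le> 2"
proof (rule ccontr)
  assume "\<not> q \<le> 2"
  then have q2: "qinv q < 1 / 2" using qinv_less[of 2 q] by simp
  let ?P = "enn2real p"
  have P: "?P \<ge> 2" using p by (metis enn2real_mono enn2real_numeral infinity_ennreal_def less_top)
  have p0: "p > 0" using p(1) by (rule order_less_le_trans[rotated]) simp
  obtain C where C: "C \<ge> 0" "\<And>N. N \<ge> 1 \<Longrightarrow> \<exists>K. finite K \<and> card K = N \<and> (\<forall>c z. (\<forall>\<kappa>\<in>K. norm (c \<kappa>) = 1) \<longrightarrow> Lp_qnorm p (wave K c z) \<le> ennreal (C * real N powr qinv q))"
    using wave_estimate_zero[OF e p0 q n] by auto
  obtain h where h: "h \<ge> 0" "Lpow ?P env = ennreal h"
    using schwartz_Lpow_finite[OF env_schwartz, of ?P] P by (cases "Lpow ?P env" rule: ennreal_cases) auto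
  have "h \<noteq> 0" using env_Lp_pos[OF p0] h p(2) by (auto simp: Lp_qnorm_Lpow epow_def)
  then have h0: "h > 0" using h(1) by simp
  have "(h * (1 / 2) powr (?P / 2)) * real N powr (?P / 2) \<le> C powr ?P * real N powr (qinv q * ?P)" if N: "N \<ge> 1" for N
  proof -
    obtain K where K: "finite K" "card K = N" "\<And>c z. (\<forall>\<kappa>\<in>K. norm (c \<kappa>) = 1) \<Longrightarrow> Lp_qnorm p (wave K c z) \<le> ennreal (C * real N powr qinv q)"
      using C(2)[OF N] by blast
    have K0: "K \<noteq> {}" using K(2) N by auto
    let ?M = "(C * real N powr qinv q) powr ?P"
    have "ennreal (2 ^ N * (real N / 2) powr (?P / 2) * h) = ennreal (2 ^ N * (real N / 2) powr (?P / 2)) * Lpow ?P env"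
      unfolding h(2) by (rule ennreal_mult') simp
    also have "\<dots> \<le> (\<Sum>A\<in>Pow K. Lpow ?P (wave K (\<lambda>\<kappa>. if \<kappa> \<in> A then 1 else - 1) (\<lambda>_. 0)))"
      using wave_signs_Lpow[OF K(1) K0 P] unfolding K(2) .
    also have "\<dots> \<le> (\<Sum>A\<in>Pow K. ennreal ?M)"
      by (intro sum_mono Lpow_le_of_Lp_qnorm[OF p0 p(2)] K(3)) (use C(1) in auto)
    also have "\<dots> = ennreal (\<Sum>A\<in>Pow K. ?M)" by (rule sum_ennreal) simp
    also have "(\<Sum>A\<in>Pow K. ?M) = 2 ^ N * ?M" using K(1,2) by (simp add: card_Pow)
    finally have "2 ^ N * ((real N / 2) powr (?P / 2) * h) \<le> 2 ^ N * ?M" by (simp add: mult.assoc)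
    then have "(real N / 2) powr (?P / 2) * h \<le> ?M" by simp
    moreover have "(real N / 2) powr (?P / 2) = (1 / 2) powr (?P / 2) * real N powr (?P / 2)" by (simp add: powr_mult[symmetric])
    moreover have "?M = C powr ?P * real N powr (qinv q * ?P)" by (simp add: powr_mult powr_powr)
    ultimately show ?thesis by (simp add: mult_ac)
  qed
  moreover have "qinv q * ?P < ?P / 2" using q2 P by (simp add: field_simps)
  moreover have "h * (1 / 2) powr (?P / 2) > 0" using h0 by simp
  ultimately show False using not_power_growth by blast
qed

text \<open>With centres far apart, one packet dominates near each translate of \<open>x0\<close>
  and the others together are small; the disjoint balls contribute equally.\<close>

lemma wave_translates_Lpow:
  assumes P: "P > 0"
  shows "\<exists>a>0. \<forall>K. finite K \<longrightarrow> (\<exists>z. ennreal (a * real (card K)) \<le> Lpow P (wave K (\<lambda>_. 1) z))"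
proof -
  obtain x0 where x0: "env x0 \<noteq> 0" using env_nonzero by blast
  define \<delta> where "\<delta> = norm (env x0)"
  have \<delta>: "\<delta> > 0" using x0 by (simp add: \<delta>_def)
  have "isCont env x0" using env_continuous by (simp add: continuous_on_eq_continuous_at)
  then obtain r0 where r0: "r0 > 0" "\<And>y. dist y x0 < r0 \<Longrightarrow> dist (env y) (env x0) < \<delta> / 2"
    unfolding continuous_at_eps_delta using \<delta> by (meson half_gt_zero)
  define r where "r = min r0 1"
  have r: "r > 0" "r \<le> 1" using r0(1) by (auto simp: r_def)
  have near: "norm (env y) \<ge> \<delta> / 2" if "dist y x0 < r" for y
  proof -
    have "norm (env x0) - norm (env y) \<le> norm (env y - env x0)" by (metis norm_minus_commute norm_triangle_ineq2)
    then show ?thesis using r0(2)[of y] that by (simp add: r_def dist_norm \<delta>_def)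
  qed
  obtain A where A: "A \<ge> 0" "\<And>y. norm (env y) \<le> A / (1 + norm y)" using schwartz_bound[OF env_schwartz, of "[]" 1] by auto
  define V where "V = unit_ball_vol (real DIM(real^'n)) * r ^ DIM(real^'n)"
  have V: "V > 0" using r by (simp add: V_def)
  have vol: "emeasure lborel (ball x r) = ennreal V" for x :: "real^'n" unfolding V_def using emeasure_ball[of r x] r by simp
  let ?a = "(\<delta> / 4) powr P * V"
  have "\<exists>z. ennreal (?a * real (card K)) \<le> Lpow P (wave K (\<lambda>_. 1) z)" if K: "finite K" for K
  proof -
    let ?N = "real (card K)"
    \<comment> \<open>At distance R - |x0| - 1 the envelope is at most \<delta> / (4 N), so the
      tails together stay below \<delta> / 4, half of the lower bound \<delta> / 2 for the near
      packet. The summand 3 keeps the balls disjoint.\<close>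
    define R where "R = norm x0 + 3 + 4 * ?N * A / \<delta>"
    \<comment> \<open>\<open>to_nat\<close> enumerates the indices injectively, so the centres lie
      on a line at mutual distance at least \<open>R\<close>.\<close>
    define z where "z \<kappa> = (R * real (to_nat \<kappa>)) *\<^sub>R (axis undefined 1 :: real^'n)" for \<kappa> :: "'n \<Rightarrow> nat"
    have NA: "4 * ?N * A / \<delta> \<ge> 0" using A(1) \<delta> by simp
    then have R: "R \<ge> 3" by (simp add: R_def)
    have sep: "norm (z \<kappa> - z \<kappa>') \<ge> R" if "\<kappa> \<noteq> \<kappa>'" for \<kappa> \<kappa>'
    proof -
      have "to_nat \<kappa> \<noteq> to_nat \<kappa>'" using that by simp
      then have "\<bar>real (to_nat \<kappa>) - real (to_nat \<kappa>')\<bar> \<ge> 1" by linarith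
      then have "R * 1 \<le> R * \<bar>real (to_nat \<kappa>) - real (to_nat \<kappa>')\<bar>" using R by (intro mult_left_mono) auto
      moreover have "norm (z \<kappa> - z \<kappa>') = R * \<bar>real (to_nat \<kappa>) - real (to_nat \<kappa>')\<bar>"
        unfolding z_def scaleR_diff_left[symmetric] using R by (simp add: abs_mult flip: right_diff_distrib)
      ultimately show ?thesis by simp
    qed
    let ?b = "\<lambda>\<kappa>. ball (x0 + z \<kappa>) r"
    have off: "norm (x - z \<kappa>') \<ge> R - norm x0 - 1" if x: "x \<in> ?b \<kappa>" and ne: "\<kappa> \<noteq> \<kappa>'" for x \<kappa> \<kappa>'
    proof -
      have "norm (x - z \<kappa>) \<le> norm x0 + 1"
      proof -
        have "norm (x - z \<kappa>) \<le> norm x0 + norm (x - (x0 + z \<kappa>))" using norm_triangle_ineq[of x0 "x - (x0 + z \<kappa>)"] by simp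
        also have "norm (x - (x0 + z \<kappa>)) \<le> 1" using x r by (simp add: dist_norm norm_minus_commute)
        finally show ?thesis by simp
      qed
      moreover have "norm (z \<kappa> - z \<kappa>') \<le> norm (x - z \<kappa>') + norm (x - z \<kappa>)"
        using norm_triangle_ineq4[of "x - z \<kappa>'" "x - z \<kappa>"] by simp
      ultimately show ?thesis using sep[OF ne] by simp
    qed
    have low: "norm (wave K (\<lambda>_. 1) z x) \<ge> \<delta> / 4" if \<kappa>: "\<kappa> \<in> K" and x: "x \<in> ?b \<kappa>" for \<kappa> x
    proof -
      have N: "?N > 0" using K \<kappa> by (simp add: card_gt_0_iff) blast
      have "norm (packet \<kappa>' (z \<kappa>') x) \<le> \<delta> / (4 * ?N)" if k: "\<kappa>' \<in> K - {\<kappa>}" for \<kappa>'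
      proof -
        have "4 * ?N * A / \<delta> \<le> 1 + norm (x - z \<kappa>')" using off[OF x, of \<kappa>'] k by (auto simp: R_def)
        then have "A \<le> \<delta> / (4 * ?N) * (1 + norm (x - z \<kappa>'))" using \<delta> N by (simp add: field_simps)
        then have "A / (1 + norm (x - z \<kappa>')) \<le> \<delta> / (4 * ?N)" by (subst pos_divide_le_eq) (auto simp: add_pos_nonneg)
        then show ?thesis unfolding norm_packet using A(2)[of "x - z \<kappa>'"] by simp
      qed
      then have "norm (\<Sum>\<kappa>'\<in>K - {\<kappa>}. packet \<kappa>' (z \<kappa>') x) \<le> real (card (K - {\<kappa>})) * (\<delta> / (4 * ?N))" by (rule sum_norm_bound)
      also have "\<dots> \<le> ?N * (\<delta> / (4 * ?N))" using \<delta> N K by (intro mult_right_mono) (auto intro: card_mono)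
      also have "\<dots> = \<delta> / 4" using N by simp
      finally have s: "norm (\<Sum>\<kappa>'\<in>K - {\<kappa>}. packet \<kappa>' (z \<kappa>') x) \<le> \<delta> / 4" .
      have m: "norm (packet \<kappa> (z \<kappa>) x) \<ge> \<delta> / 2" unfolding norm_packet
        by (rule near) (use x in \<open>simp add: dist_norm norm_minus_commute algebra_simps\<close>)
      have "wave K (\<lambda>_. 1) z x = packet \<kappa> (z \<kappa>) x + (\<Sum>\<kappa>'\<in>K - {\<kappa>}. packet \<kappa>' (z \<kappa>') x)"
        unfolding wave_def using sum.remove[OF K \<kappa>, of "\<lambda>\<kappa>. packet \<kappa> (z \<kappa>) x"] by simp
      then show ?thesis using norm_diff_ineq[of "packet \<kappa> (z \<kappa>) x" "\<Sum>\<kappa>'\<in>K - {\<kappa>}. packet \<kappa>' (z \<kappa>') x"] s m by simp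
    qed
    have disj: "\<kappa> = \<kappa>'" if "x \<in> ?b \<kappa>" "x \<in> ?b \<kappa>'" for x \<kappa> \<kappa>'
    proof (rule ccontr)
      assume "\<kappa> \<noteq> \<kappa>'"
      then have "R \<le> norm (z \<kappa> - z \<kappa>')" by (rule sep)
      also have "\<dots> = dist (x0 + z \<kappa>) (x0 + z \<kappa>')" by (simp add: dist_norm)
      also have "\<dots> \<le> dist (x0 + z \<kappa>) x + dist (x0 + z \<kappa>') x" by (rule dist_triangle2)
      also have "\<dots> < 2" using that r by simp
      finally show False using R by simp
    qed
    have pt: "(\<Sum>\<kappa>\<in>K. ennreal ((\<delta> / 4) powr P) * indicator (?b \<kappa>) x) \<le> ennreal (norm (wave K (\<lambda>_. 1) z x) powr P)" for x
    proof (cases "\<exists>\<kappa>\<in>K. x \<in> ?b \<kappa>")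
      case True
      then obtain \<kappa> where \<kappa>: "\<kappa> \<in> K" "x \<in> ?b \<kappa>" by blast
      have "(\<Sum>\<kappa>'\<in>K. ennreal ((\<delta> / 4) powr P) * indicator (?b \<kappa>') x) = (\<Sum>\<kappa>'\<in>K. if \<kappa>' = \<kappa> then ennreal ((\<delta> / 4) powr P) else 0)"
      proof (rule sum.cong[OF refl])
        fix \<kappa>'
        show "ennreal ((\<delta> / 4) powr P) * indicator (?b \<kappa>') x = (if \<kappa>' = \<kappa> then ennreal ((\<delta> / 4) powr P) else 0)"
          using disj[OF \<kappa>(2), of \<kappa>'] \<kappa>(2) by (cases "x \<in> ?b \<kappa>'") (auto simp del: mem_ball)
      qed
      also have "\<dots> = ennreal ((\<delta> / 4) powr P)" using K \<kappa>(1) by simp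
      also have "\<dots> \<le> ennreal (norm (wave K (\<lambda>_. 1) z x) powr P)"
        using low[OF \<kappa>] \<delta> P by (intro ennreal_leI powr_mono2) auto
      finally show ?thesis .
    next
      case False
      then have "(\<Sum>\<kappa>\<in>K. ennreal ((\<delta> / 4) powr P) * indicator (?b \<kappa>) x) = 0" by (intro sum.neutral) (auto simp: indicator_def)
      then show ?thesis by simp
    qed
    let ?f = "\<lambda>\<kappa> x. ennreal ((\<delta> / 4) powr P) * indicator (?b \<kappa>) x"
    have fm: "?f \<kappa> \<in> borel_measurable lborel" for \<kappa>
      by (intro borel_measurable_times_ennreal borel_measurable_const borel_measurable_indicator) simp
    have fi: "(\<integral>\<^sup>+x. ?f \<kappa> x \<partial>lborel) = ennreal ?a" for \<kappa>
    proof -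
      have "(\<integral>\<^sup>+x. ?f \<kappa> x \<partial>lborel) = ennreal ((\<delta> / 4) powr P) * emeasure lborel (?b \<kappa>)" by (rule nn_integral_cmult_indicator) simp
      then show ?thesis unfolding vol by (simp add: ennreal_mult')
    qed
    have "(\<integral>\<^sup>+x. (\<Sum>\<kappa>\<in>K. ?f \<kappa> x) \<partial>lborel) = (\<Sum>\<kappa>\<in>K. \<integral>\<^sup>+x. ?f \<kappa> x \<partial>lborel)"
      by (rule nn_integral_sum[OF fm])
    then have "ennreal (?a * ?N) = (\<integral>\<^sup>+x. (\<Sum>\<kappa>\<in>K. ?f \<kappa> x) \<partial>lborel)"
      unfolding fi using V by (simp add: ennreal_mult' ennreal_of_nat_eq_real_of_nat mult.commute)
    moreover have "(\<integral>\<^sup>+x. (\<Sum>\<kappa>\<in>K. ?f \<kappa> x) \<partial>lborel) \<le> Lpow P (wave K (\<lambda>_. 1) z)" unfolding Lpow_def by (rule nn_integral_mono) (rule pt)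
    ultimately have "ennreal (?a * ?N) \<le> Lpow P (wave K (\<lambda>_. 1) z)" by simp
    then show ?thesis by (rule exI[of _ z])
  qed
  moreover have "?a > 0" using V \<delta> by simp
  ultimately show ?thesis by blast
qed

lemma embeds_imp_le_p:
  assumes e: "mixed_embeds \<phi>0 \<psi>0 0 p q" and p: "p > 0" "p \<noteq> \<infinity>" and q: "q > 0" and n: "CARD('n) \<ge> 2"
  shows "q \<le> p"
proof (rule ccontr)
  let ?P = "enn2real p"
  have P: "?P > 0" using p by (simp add: enn2real_positive_iff less_top)
  assume "\<not> q \<le> p"
  then have "ennreal ?P < q" using p by (simp add: less_top)
  then have qp: "qinv q < 1 / ?P" using qinv_less P by blast
  obtain C where C: "C \<ge> 0" "\<And>N. N \<ge> 1 \<Longrightarrow> \<exists>K. finite K \<and> card K = N \<and> (\<forall>c z. (\<forall>\<kappa>\<in>K. norm (c \<kappa>) = 1) \<longrightarrow> Lp_qnorm p (wave K c z) \<le> ennreal (C * real N powr qinv q))"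
    using wave_estimate_zero[OF e p(1) q n] by auto
  obtain a where a: "a > 0" "\<And>K. finite K \<Longrightarrow> \<exists>z. ennreal (a * real (card K)) \<le> Lpow ?P (wave K (\<lambda>_. 1) z)" using wave_translates_Lpow[OF P] by blast
  have "a * real N powr 1 \<le> C powr ?P * real N powr (qinv q * ?P)" if N: "N \<ge> 1" for N
  proof -
    obtain K where K: "finite K" "card K = N" "\<And>c z. (\<forall>\<kappa>\<in>K. norm (c \<kappa>) = 1) \<Longrightarrow> Lp_qnorm p (wave K c z) \<le> ennreal (C * real N powr qinv q)"
      using C(2)[OF N] by blast
    obtain z where "ennreal (a * real (card K)) \<le> Lpow ?P (wave K (\<lambda>_. 1) z)" using a(2)[OF K(1)] by blast
    also have "\<dots> \<le> ennreal ((C * real N powr qinv q) powr ?P)"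
      by (intro Lpow_le_of_Lp_qnorm[OF p] K(3)) (use C(1) in auto)
    finally show ?thesis using K(2) by (simp add: powr_mult powr_powr)
  qed
  moreover have "qinv q * ?P < 1" using qp P by (simp add: field_simps)
  ultimately show False using not_power_growth[OF a(1)] by blast
qed

theorem embeds_necessary:
  assumes e: "mixed_embeds \<phi>0 \<psi>0 t p q" and p: "p > 0" and q: "q > 0" and n: "CARD('n) \<ge> 2"
  shows "t > 0 \<or> (t = 0 \<and> p < \<infinity> \<and> q \<le> min p 2) \<or> (t = 0 \<and> p = \<infinity> \<and> q \<le> 1)"
proof (cases "t > 0")
  case False
  then have t: "t = 0" using embeds_imp_nonneg[OF e p q n] by simp
  have e0: "mixed_embeds \<phi>0 \<psi>0 0 p q" using e t by simp
  show ?thesis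
  proof (cases "p = \<infinity>")
    case True
    then show ?thesis using embeds_top_imp[of q] e0 q n t by simp
  next
    case False
    have "q \<le> p" by (rule embeds_imp_le_p[OF e0 p False q n])
    moreover have "q \<le> 2"
    proof (cases "2 \<le> p")
      case True
      then show ?thesis using embeds_imp_le_2[OF e0 _ False q n] by blast
    next
      case False
      then show ?thesis using \<open>q \<le> p\<close> by simp
    qed
    ultimately show ?thesis using t False by (simp add: less_top)
  qed
qed simp

end

theorem theorem3p1:
  fixes \<phi>0 :: "real \<Rightarrow> real" and \<psi>0 :: "real^'n::finite \<Rightarrow> real"
    and t :: real and p q :: ennreal
  assumes "CARD('n) \<ge> 2"
    and "0 < p" and "0 < q"
    and "mixed_generator \<phi>0" and "iso_generator \<psi>0"
  shows "mixed_embeds \<phi>0 \<psi>0 t p q \<longleftrightarrow>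
           (t > 0 \<or> (t = 0 \<and> p < \<infinity> \<and> q \<le> min p 2) \<or> (t = 0 \<and> p = \<infinity> \<and> q \<le> 1))"
proof -
  interpret gens \<phi>0 \<psi>0 by unfold_locales (use assms in auto)
  show ?thesis using embeds_necessary[of t p q] embeds_sufficient[of p q t] assms by blast
qed

end
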